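(* Let $k,m\ge1$ and let $\lambda\subseteq[k]\times[m]$ be a Young diagram with $|\lambda|=d$ boxes. (1) The smooth part $\Omega^{\mathrm{sm}}_\lambda$ of the Schubert variety $\Omega_\lambda\subseteq G(k,m)$ is cohomogeneous. (2) The Schubert zonoid $K_\lambda\subseteq\Lambda^d(\mathbb R^k\otimes\mathbb R^m)$ equals $$K_\lambda=\frac{\mathrm{vol}(\Omega_\lambda)}{\mathrm{vol}(G(k,m))}\;K(h\cdot v_\lambda),$$ with the random variable $h\cdot v_\lambda\in\Lambda^d(\mathbb R^k\otimes\mathbb R^m)$ defined by a uniformly random $h\in\mathrm O(k)\times\mathrm O(m)$. (3) The Schubert span $V_\lambda$ is the linear span of the $\mathrm O(k)\times\mathrm O(m)$-orbit of $v_\lambda$.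
   Context: Let $n=k+m$. $G(k,m)=G/H$, $G=\mathrm O(n)$, $H=\mathrm O(k)\times\mathrm O(m)$, is the Grassmannian of $k$-dimensional subspaces $L$ of $\mathbb R^n$, with base point $\mathbf o=\mathbb R^k$ and an $\mathrm O(n)$-invariant Riemannian metric; $T_LG(k,m)=\mathrm{Hom}(L,L^\perp)\simeq L\otimes L^\perp$, and $V=T^*_{\mathbf o}G(k,m)\simeq\mathbb R^k\otimes\mathbb R^m$ with the standard inner product and tensor action of $H$. $\Lambda^dV$ has the induced inner product and $H$-action. A Young diagram $\lambda\subseteq[k]\times[m]$ (partition $\lambda_1\ge\dots\ge\lambda_k\ge0$, $\lambda_1\le m$) is identified with its set of boxes $(i,j)$, $j\le\lambda_i$. An outer corner is a box $(i,j)$ with $j=\lambda_i$ and $\lambda_{i+1}<\lambda_i$; denote the outer corners by $(p_1,q_1),\ldots,(p_r,q_r)$. Fix a complete flag $0\subset V_1\subset\dots\subset V_n=\mathbb R^n$, $\dim V_i=i$. The Schubert variety is $\Omega_\lambda=\{L\in G(k,m)\mid\forall(i,j)\in\lambda:\dim(L\cap V_{m-j+i})\ge i\}$; its smooth part is $\Omega^{\mathrm{sm}}_\lambda=\{L\mid\forall i=1,\dots,r:\dim(L\cap V_{m-q_i+p_i})=p_i\}$, of codimension $|\lambda|$; $\mathrm{vol}(\Omega_\lambda)=\mathrm{vol}(\Omega_\lambda^{\mathrm{sm}})$. $v_\lambda:=\bigwedge_{(i,j)\in\lambda}e_i\otimes f_j\in\Lambda^d(\mathbb R^k\otimes\mathbb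 R^m)$, where $e_1,\dots,e_k$ and $f_1,\dots,f_m$ are orthonormal bases of $\mathbb R^k$ and $\mathbb R^m$ (well defined up to sign and the $H$-action). A submanifold $Y\subseteq G/H$ is cohomogeneous if for all $y_1,y_2\in Y$ there is $g\in G$ with $gy_1=y_2$ and $g\,N_{y_1}Y=N_{y_2}Y$, $N_yY$ being the conormal space at $y$. For an integrable random vector $\xi\in\Lambda^dV$, $K(\xi)$ is the zonoid (convex body) with support function $u\mapsto\frac12\mathbb E|\langle u,\xi\rangle|$. Fix a measurable $\tau:G(k,m)\to G$ with $\tau(y)y=\mathbf o$. For $y\in\Omega_\lambda^{\mathrm{sm}}$ let $\pm\nu_{\Omega_\lambda}(y)$ be the unit simple vector in $\Lambda^dT^*_yG(k,m)$ representing the conormal space. The Schubert zonoid is $K_\lambda=K(\Omega_\lambda):=\frac{\mathrm{vol}(\Omega_\lambda)}{\mathrm{vol}(G(k,m))}K(\xi)$ with $\xi=\varepsilon\,\nu_{h\tau(y)\Omega_\lambda}(\mathbf o)\in\Lambda^dV$, $(h,y,\varepsilon)\in H\times\Omega^{\mathrm{sm}}_\lambda\times\{\pm1\}$ uniformly random; it does not depend on $\tau$ or the flag. The Schubert span $V_\lambda$ is the linear span of $K_\lambda$ in $\Lambda^d(\mathbb R^k\otimes\mathbb R^m)$. *)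

theory Defs
  imports "HOL-Probability.Probability"
begin

text \<open>
  \<open>\<real>\<^sup>n\<close> is \<open>real ^ ('k + 'm)\<close>, with \<open>\<real>\<^sup>k\<close> the \<open>Inl\<close>-coordinates and \<open>\<real>\<^sup>m\<close> the
  \<open>Inr\<close>-coordinates; \<open>\<real>\<^sup>k \<otimes> \<real>\<^sup>m\<close> is \<open>real ^ ('k \<times> 'm)\<close>.
\<close>


section \<open>Exterior algebra of a coordinate space\<close>

text \<open>
  The exterior algebra of \<open>real ^ 'i\<close> is \<open>real ^ ('i set)\<close>: the coordinate at \<open>S\<close> belongs to the
  basis vector \<open>e\<^sub>S\<close>, the wedge product of the standard basis vectors indexed by \<open>S\<close>, taken in a
  fixed order of \<open>'i\<close>. The degree \<open>d\<close> part is spanned by the \<open>e\<^sub>S\<close> with \<open>card S = d\<close>. The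
  \<open>e\<^sub>S\<close> are orthonormal, so the inner product is the induced one, and by Cauchy-Binet
  \<open>wedge v \<bullet> wedge w\<close> is the determinant of the matrix of all \<open>v\<^sub>i \<bullet> w\<^sub>j\<close>.
\<close>

definition index_list :: "'i::finite list" where
  "index_list = (SOME xs. distinct xs \<and> set xs = UNIV)"

definition enum_set :: "'i::finite set \<Rightarrow> 'i list" where
  "enum_set S = filter (\<lambda>i. i \<in> S) index_list"

definition wedge :: "(real ^ 'i) list \<Rightarrow> real ^ ('i::finite set)" where
  "wedge ws = (\<chi> S. if card S = length ws
     then \<Sum>p | p permutes {..<length ws}.
            of_int (sign p) * (\<Prod>a<length ws. (ws ! a) $ (enum_set S ! p a))
     else 0)"

text \<open>The linear map induced by a linear map \<open>f\<close>: it sends \<open>e\<^sub>S\<close> to the wedge product of the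
  vectors \<open>f e\<^sub>i\<close>, \<open>i \<in> S\<close>.\<close>

definition ext_map ::
  "(real ^ 'i \<Rightarrow> real ^ 'i) \<Rightarrow> real ^ ('i::finite set) \<Rightarrow> real ^ ('i set)" where
  "ext_map f u = (\<Sum>S\<in>UNIV. (u $ S) *\<^sub>R wedge (map (\<lambda>i. f (axis i 1)) (enum_set S)))"

text \<open>The unit simple vector representing the subspace \<open>N\<close>; it is determined up to sign, and the
  choice of sign made here is arbitrary.\<close>

definition unit_simple :: "(real ^ 'i) set \<Rightarrow> real ^ ('i::finite set)" where
  "unit_simple N = (SOME v. norm v = 1 \<and> (\<exists>ws. v = wedge ws \<and> span (set ws) = N))"


section \<open>Zonoids\<close>

definition support_fun :: "'a::euclidean_space set \<Rightarrow> 'a \<Rightarrow> real" where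
  "support_fun K u = (SUP x\<in>K. u \<bullet> x)"

definition convex_body :: "'a::euclidean_space set \<Rightarrow> bool" where
  "convex_body K \<longleftrightarrow> K \<noteq> {} \<and> compact K \<and> convex K"

definition zonoid :: "'w measure \<Rightarrow> ('w \<Rightarrow> 'a::euclidean_space) \<Rightarrow> 'a set" where
  "zonoid M \<xi> = (THE K. convex_body K \<and>
     (\<forall>u. support_fun K u = 1/2 * (\<integral>\<omega>. \<bar>u \<bullet> \<xi> \<omega>\<bar> \<partial>M)))"


section \<open>Hausdorff measure\<close>

text \<open>
  The factor makes the \<open>D\<close>-dimensional Hausdorff measure agree with the Riemannian volume on
  \<open>D\<close>-dimensional submanifolds of a Euclidean space. Empty sets in a cover have to be discounted
  because \<open>0 ^ 0 = 1\<close>; for \<open>D = 0\<close> one gets the counting measure.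
\<close>

definition hausdorff_outer :: "nat \<Rightarrow> 'a::metric_space set \<Rightarrow> ennreal" where
  "hausdorff_outer D A =
     (SUP \<delta>\<in>{0<..}.
        INF C\<in>{C :: nat \<Rightarrow> 'a set.
                 A \<subseteq> (\<Union>i. C i) \<and> (\<forall>i. bounded (C i) \<and> diameter (C i) \<le> \<delta>)}.
          \<Sum>i. if C i = {} then 0
               else ennreal (unit_ball_vol (real D) * (diameter (C i) / 2) ^ D))"


section \<open>The Grassmannian\<close>

text \<open>The parameters of \<open>G(k, m)\<close> are implicit in the types: \<open>k = CARD('k)\<close> and
  \<open>m = CARD('m)\<close>.\<close>

definition grassmannian :: "(real ^ ('k::finite + 'm::finite)) set set" where
  "grassmannian = {L. subspace L \<and> dim L = CARD('k)}"

definition base_point :: "(real ^ ('k::finite + 'm::finite)) set" where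
  "base_point = {x. \<forall>j. x $ Inr j = 0}"

definition act :: "real ^ 'n ^ 'n \<Rightarrow> (real ^ 'n::finite) set \<Rightarrow> (real ^ 'n) set" where
  "act g L = (\<lambda>x. g *v x) ` L"

definition proj_matrix :: "(real ^ 'n::finite) set \<Rightarrow> real ^ 'n ^ 'n" where
  "proj_matrix L = matrix (closest_point L)"

text \<open>
  \<open>Hom(L, L\<^sup>\<bottom>)\<close>, as matrices that vanish on \<open>L\<^sup>\<bottom>\<close>. It is the tangent space of the
  Grassmannian at \<open>L\<close>, and is identified with the cotangent space by the inner product. The
  orthogonal group acts on (co)tangent vectors by conjugation.
\<close>

definition hom_perp :: "(real ^ 'n::finite) set \<Rightarrow> (real ^ 'n ^ 'n) set" where
  "hom_perp L = {X. (\<forall>x\<in>L. X *v x \<in> orthogonal_comp L) \<and> (\<forall>x\<in>orthogonal_comp L. X *v x = 0)}"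

text \<open>Velocities of curves in \<open>Y\<close>. If a curve of subspaces has velocity \<open>X\<close> in \<open>Hom(L, L\<^sup>\<bottom>)\<close>,
  then the orthogonal projections onto these subspaces have velocity \<open>X + X\<^sup>T\<close>.\<close>

definition tangent_space :: "(real ^ 'n::finite) set set \<Rightarrow> (real ^ 'n) set \<Rightarrow> (real ^ 'n ^ 'n) set"
  where
  "tangent_space Y L = {X \<in> hom_perp L. \<exists>\<gamma> \<epsilon>. \<epsilon> > 0 \<and> \<gamma> 0 = L \<and> (\<forall>t::real. \<bar>t\<bar> < \<epsilon> \<longrightarrow> \<gamma> t \<in> Y) \<and>
     ((\<lambda>t. proj_matrix (\<gamma> t)) has_vector_derivative (X + transpose X)) (at 0)}"

definition conormal_space :: "(real ^ 'n::finite) set set \<Rightarrow> (real ^ 'n) set \<Rightarrow> (real ^ 'n ^ 'n) set"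
  where
  "conormal_space Y L = {X \<in> hom_perp L. \<forall>Z \<in> tangent_space Y L. X \<bullet> Z = 0}"

text \<open>
  The velocity \<open>X + X\<^sup>T\<close> has norm \<open>sqrt 2\<close> times the norm of \<open>X\<close>. So this is an isometric
  embedding for the invariant Riemannian metric given by the standard inner products of the
  spaces \<open>Hom(L, L\<^sup>\<bottom>)\<close>.
\<close>

definition gr_embed :: "(real ^ 'n::finite) set \<Rightarrow> real ^ 'n ^ 'n" where
  "gr_embed L = (1 / sqrt 2) *\<^sub>R proj_matrix L"

definition gr_borel :: "(real ^ ('k::finite + 'm::finite)) set measure" where
  "gr_borel = vimage_algebra grassmannian gr_embed borel"

text \<open>On a \<open>D\<close>-dimensional submanifold of the Grassmannian this is its Riemannian volume, since
  \<open>gr_embed\<close> is isometric.\<close>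

definition gr_volume :: "nat \<Rightarrow> (real ^ ('k::finite + 'm::finite)) set measure" where
  "gr_volume D = measure_of grassmannian (sets gr_borel) (\<lambda>A. hausdorff_outer D (gr_embed ` A))"

text \<open>\<open>C\<^sup>\<infinity>\<close> on an open set: \<open>f\<close> belongs to a family of differentiable functions that is closed
  under directional derivatives.\<close>

definition smooth_on :: "'a::euclidean_space set \<Rightarrow> ('a \<Rightarrow> 'b::euclidean_space) \<Rightarrow> bool" where
  "smooth_on U f \<longleftrightarrow> (\<exists>F. f \<in> F \<and>
     (\<forall>g\<in>F. \<exists>g'. (\<forall>x\<in>U. (g has_derivative g' x) (at x)) \<and> (\<forall>v. (\<lambda>x. g' x v) \<in> F)))"

text \<open>Embedded \<open>D\<close>-dimensional submanifolds, by local parametrizations \<open>\<phi>\<close>. The parameter domain is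
  the open subset \<open>U \<inter> S\<close> of a \<open>D\<close>-dimensional linear subspace \<open>S\<close>, since \<open>D\<close> is not a type.\<close>

definition submanifold :: "nat \<Rightarrow> (real ^ 'n::finite) set set \<Rightarrow> bool" where
  "submanifold D Y \<longleftrightarrow> (\<forall>y\<in>Y. \<exists>U S \<phi> \<psi>.
     open U \<and> subspace S \<and> dim S = D \<and>
     smooth_on U (\<phi> :: real ^ 'n ^ 'n \<Rightarrow> real ^ 'n ^ 'n) \<and>
     (\<forall>x \<in> U \<inter> S. inj_on (frechet_derivative \<phi> (at x)) S) \<and>
     homeomorphism (U \<inter> S) (\<phi> ` (U \<inter> S)) \<phi> \<psi> \<and>
     openin (top_of_set (gr_embed ` Y)) (\<phi> ` (U \<inter> S)) \<and>
     gr_embed y \<in> \<phi> ` (U \<inter> S))"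

definition cohomogeneous :: "(real ^ ('k::finite + 'm::finite)) set set \<Rightarrow> bool" where
  "cohomogeneous Y \<longleftrightarrow> Y \<subseteq> grassmannian \<and> (\<exists>D. submanifold D Y) \<and>
     (\<forall>y1\<in>Y. \<forall>y2\<in>Y. \<exists>g. orthogonal_matrix g \<and> act g y1 = y2 \<and>
        (\<lambda>X. g ** X ** transpose g) ` conormal_space Y y1 = conormal_space Y y2)"


section \<open>The stabilizer \<open>H\<close> of the base point and its representations\<close>

definition stab :: "((real ^ 'k ^ 'k) \<times> (real ^ 'm ^ 'm)) set" where
  "stab = {(A, B). orthogonal_matrix A \<and> orthogonal_matrix B}"

definition stab_mult ::
  "(real ^ 'k ^ 'k) \<times> (real ^ 'm ^ 'm) \<Rightarrow> (real ^ 'k ^ 'k) \<times> (real ^ 'm ^ 'm) \<Rightarrow>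
   (real ^ 'k ^ 'k) \<times> (real ^ 'm ^ 'm)" where
  "stab_mult g h = (fst g ** fst h, snd g ** snd h)"

definition block_matrix ::
  "(real ^ 'k ^ 'k) \<times> (real ^ 'm ^ 'm) \<Rightarrow> real ^ ('k + 'm) ^ ('k::finite + 'm::finite)" where
  "block_matrix h = (\<chi> r c. case (r, c) of
       (Inl i, Inl j) \<Rightarrow> fst h $ i $ j
     | (Inr i, Inr j) \<Rightarrow> snd h $ i $ j
     | _ \<Rightarrow> 0)"

text \<open>The Haar probability measure of \<open>O(k) \<times> O(m)\<close>, characterized by bi-invariance (it is unique).\<close>

definition uniform_stab :: "((real ^ 'k ^ 'k) \<times> (real ^ 'm ^ 'm)) measure \<Rightarrow> bool" where
  "uniform_stab P \<longleftrightarrow> prob_space P \<and> sets P = sets (restrict_space borel stab) \<and>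
     (\<forall>h\<in>stab. distr P P (\<lambda>x. stab_mult h x) = P \<and> distr P P (\<lambda>x. stab_mult x h) = P)"

definition tensor :: "real ^ 'k \<Rightarrow> real ^ 'm \<Rightarrow> real ^ ('k::finite \<times> 'm::finite)" where
  "tensor x y = (\<chi> p. x $ fst p * y $ snd p)"

definition tensor_act ::
  "(real ^ 'k ^ 'k) \<times> (real ^ 'm ^ 'm) \<Rightarrow> real ^ ('k \<times> 'm) \<Rightarrow> real ^ ('k::finite \<times> 'm::finite)" where
  "tensor_act h v = (\<chi> p. \<Sum>q\<in>UNIV. fst h $ fst p $ fst q * snd h $ snd p $ snd q * v $ q)"

definition ext_act ::
  "(real ^ 'k ^ 'k) \<times> (real ^ 'm ^ 'm) \<Rightarrow>
   real ^ ('k \<times> 'm) set \<Rightarrow> real ^ ('k::finite \<times> 'm::finite) set" where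
  "ext_act h = ext_map (tensor_act h)"

text \<open>The isomorphism from \<open>Hom(\<real>\<^sup>k, \<real>\<^sup>m)\<close>, the cotangent space at the base point, to
  \<open>\<real>\<^sup>k \<otimes> \<real>\<^sup>m\<close>.\<close>

definition hom_to_tensor ::
  "real ^ ('k + 'm) ^ ('k + 'm) \<Rightarrow> real ^ ('k::finite \<times> 'm::finite)" where
  "hom_to_tensor X = (\<chi> p. X $ Inr (snd p) $ Inl (fst p))"


section \<open>Young diagrams and Schubert varieties\<close>

text \<open>A partition with at most \<open>k\<close> parts is a function on the positive naturals that vanishes beyond
  \<open>k\<close>; its value at \<open>0\<close> is irrelevant.\<close>

definition young_diagram :: "nat \<Rightarrow> nat \<Rightarrow> (nat \<Rightarrow> nat) \<Rightarrow> bool" where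
  "young_diagram k m l \<longleftrightarrow>
     (\<forall>i\<in>{1..k}. l i \<le> m) \<and> (\<forall>i\<ge>1. l (Suc i) \<le> l i) \<and> (\<forall>i>k. l i = 0)"

definition boxes :: "nat \<Rightarrow> (nat \<Rightarrow> nat) \<Rightarrow> (nat \<times> nat) set" where
  "boxes k l = {(i, j). 1 \<le> i \<and> i \<le> k \<and> 1 \<le> j \<and> j \<le> l i}"

definition outer_corners :: "nat \<Rightarrow> (nat \<Rightarrow> nat) \<Rightarrow> (nat \<times> nat) set" where
  "outer_corners k l = {(i, j) \<in> boxes k l. j = l i \<and> l (Suc i) < l i}"

definition box_list :: "nat \<Rightarrow> (nat \<Rightarrow> nat) \<Rightarrow> (nat \<times> nat) list" where
  "box_list k l = [(i, j). i \<leftarrow> [1..<Suc k], j \<leftarrow> [1..<Suc (l i)]]"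

definition complete_flag :: "(nat \<Rightarrow> (real ^ 'n::finite) set) \<Rightarrow> bool" where
  "complete_flag V \<longleftrightarrow> (\<forall>i\<le>CARD('n). subspace (V i) \<and> dim (V i) = i) \<and>
     (\<forall>i<CARD('n). V i \<subseteq> V (Suc i))"

definition schubert ::
  "(nat \<Rightarrow> (real ^ ('k::finite + 'm::finite)) set) \<Rightarrow> (nat \<Rightarrow> nat) \<Rightarrow> (real ^ ('k + 'm)) set set" where
  "schubert V l = {L \<in> grassmannian.
     \<forall>(i, j) \<in> boxes CARD('k) l. dim (L \<inter> V (CARD('m) - j + i)) \<ge> i}"

definition schubert_smooth ::
  "(nat \<Rightarrow> (real ^ ('k::finite + 'm::finite)) set) \<Rightarrow> (nat \<Rightarrow> nat) \<Rightarrow> (real ^ ('k + 'm)) set set" where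
  "schubert_smooth V l = {L \<in> grassmannian.
     \<forall>(p, q) \<in> outer_corners CARD('k) l. dim (L \<inter> V (CARD('m) - q + p)) = p}"

text \<open>The order of the factors only affects the sign.\<close>

definition schubert_vector ::
  "(nat \<Rightarrow> real ^ 'k) \<Rightarrow> (nat \<Rightarrow> real ^ 'm) \<Rightarrow> (nat \<Rightarrow> nat) \<Rightarrow>
   real ^ ('k::finite \<times> 'm::finite) set" where
  "schubert_vector e f l = wedge (map (\<lambda>(i, j). tensor (e i) (f j)) (box_list CARD('k) l))"

definition orthonormal_basis :: "(nat \<Rightarrow> real ^ 'n::finite) \<Rightarrow> bool" where
  "orthonormal_basis e \<longleftrightarrow>
     (\<forall>i\<in>{1..CARD('n)}. \<forall>j\<in>{1..CARD('n)}. e i \<bullet> e j = (if i = j then 1 else 0))"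


section \<open>The Schubert zonoid\<close>

definition transporter ::
  "((real ^ ('k::finite + 'm::finite)) set \<Rightarrow> real ^ ('k + 'm) ^ ('k + 'm)) \<Rightarrow> bool" where
  "transporter \<tau> \<longleftrightarrow> \<tau> \<in> measurable gr_borel borel \<and>
     (\<forall>y\<in>grassmannian. orthogonal_matrix (\<tau> y) \<and> act (\<tau> y) y = base_point)"

definition vol_ratio ::
  "(nat \<Rightarrow> (real ^ ('k::finite + 'm::finite)) set) \<Rightarrow> (nat \<Rightarrow> nat) \<Rightarrow> real" where
  "vol_ratio V l =
     measure (gr_volume (CARD('k) * CARD('m) - card (boxes CARD('k) l))) (schubert V l) /
     measure (gr_volume (CARD('k) * CARD('m))) (grassmannian :: (real ^ ('k + 'm)) set set)"

definition schubert_space ::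
  "((real ^ 'k ^ 'k) \<times> (real ^ 'm ^ 'm)) measure \<Rightarrow>
   (nat \<Rightarrow> (real ^ ('k::finite + 'm::finite)) set) \<Rightarrow> (nat \<Rightarrow> nat) \<Rightarrow>
   (((real ^ 'k ^ 'k) \<times> (real ^ 'm ^ 'm)) \<times> (real ^ ('k + 'm)) set \<times> real) measure" where
  "schubert_space P V l =
     P \<Otimes>\<^sub>M (uniform_measure (gr_volume (CARD('k) * CARD('m) - card (boxes CARD('k) l)))
             (schubert_smooth V l)
          \<Otimes>\<^sub>M uniform_count_measure {-1, 1})"

text \<open>The sign chosen by \<open>unit_simple\<close> is arbitrary, but only \<open>\<bar>u \<bullet> \<xi>\<bar>\<close> enters the zonoid.\<close>

definition schubert_random_vector ::
  "((real ^ ('k::finite + 'm::finite)) set \<Rightarrow> real ^ ('k + 'm) ^ ('k + 'm)) \<Rightarrow>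
   (nat \<Rightarrow> (real ^ ('k + 'm)) set) \<Rightarrow> (nat \<Rightarrow> nat) \<Rightarrow>
   ((real ^ 'k ^ 'k) \<times> (real ^ 'm ^ 'm)) \<times> (real ^ ('k + 'm)) set \<times> real \<Rightarrow>
   real ^ ('k \<times> 'm) set" where
  "schubert_random_vector \<tau> V l = (\<lambda>(h, y, \<epsilon>).
     \<epsilon> *\<^sub>R unit_simple (hom_to_tensor `
       conormal_space (act (block_matrix h ** \<tau> y) ` schubert_smooth V l) base_point))"

definition schubert_zonoid ::
  "((real ^ 'k ^ 'k) \<times> (real ^ 'm ^ 'm)) measure \<Rightarrow>
   ((real ^ ('k::finite + 'm::finite)) set \<Rightarrow> real ^ ('k + 'm) ^ ('k + 'm)) \<Rightarrow>
   (nat \<Rightarrow> (real ^ ('k + 'm)) set) \<Rightarrow> (nat \<Rightarrow> nat) \<Rightarrow> (real ^ ('k \<times> 'm) set) set" where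
  "schubert_zonoid P \<tau> V l =
     (\<lambda>x. vol_ratio V l *\<^sub>R x) ` zonoid (schubert_space P V l) (schubert_random_vector \<tau> V l)"

end

theory Submission
  imports Defs
begin

text \<open>
  Write \<open>L\<close> in the smooth part as \<open>g \<real>\<^sup>k\<close> with an orthogonal \<open>g\<close> that is adapted to the flag: for every
  outer corner \<open>(p, q)\<close> the vectors \<open>g e\<^sub>1, \<dots>, g e\<^sub>p\<close> span the intersection of \<open>L\<close> with the corresponding
  flag space, and \<open>g f\<^sub>1, \<dots>, g f\<^sub>q\<close> are orthogonal to this flag space. Along a curve in the cell the
  flag conditions force the velocity \<open>X\<close> to satisfy \<open>g f\<^sub>j \<bullet> X g e\<^sub>i = 0\<close> for all boxes \<open>(i, j)\<close>, and
  explicit curves realize all other matrix entries. Hence the conormal space is spanned by the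
  \<open>g e\<^sub>i \<otimes> g f\<^sub>j\<close> for the boxes \<open>(i, j)\<close>. Two adapted matrices differ by an orthogonal matrix that
  carries one conormal space to the other, which gives cohomogeneity.

  At the base point an adapted matrix is a block matrix \<open>h\<close>, so the conormal vector is \<open>\<plusminus> h \<cdot> v\<close>
  with \<open>v\<close> the Schubert vector. For fixed \<open>y\<close> the random conormal vector is therefore \<open>\<plusminus> h h\<^sub>y \<cdot> v\<close> with
  \<open>h\<close> Haar distributed, and right invariance removes \<open>h\<^sub>y\<close>. Finally, \<open>u\<close> is orthogonal to the zonoid iff
  \<open>u \<bullet> h \<cdot> v\<close> vanishes almost everywhere, which by continuity and the full support of the Haar measure
  means that \<open>u\<close> is orthogonal to the orbit of \<open>v\<close>.
\<close>

section \<open>Wedge products\<close>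

text \<open>Two difficulties shape the proof. \<open>measure\<close> and
  \<open>uniform_measure\<close> degenerate when a volume is 0 or infinite, so the cell must have
  positive and the whole Schubert variety finite Hausdorff measure. Positivity comes from one
  Lipschitz inverse chart. Finiteness concerns the closed variety, beyond the charts of the cell; it
  is covered by Lipschitz images of finitely many cubes, by normalizing a basis of \<open>L\<close>
  at its largest coordinates. Secondly, adapted matrices are chosen pointwise and need not vary
  continuously with \<open>L\<close>. But they are cut out by closed conditions in a compact group,
  and passing to limits is enough both for the constraint on velocities and for the measurability of
  the conormal vector up to sign. The curves that realize the free directions need more than an
  orthogonal frame, since the flag is in general not a coordinate flag of such a frame; they use a
  second, oblique basis that agrees with the first on \<open>L\<close>. Equality of zonoids requires
  only equal integrals of \<open>\<bar>u \<bullet> \<xi>\<bar>\<close>; existence of the zonoid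
  enters for the span.\<close>

definition alt_sum :: "nat \<Rightarrow> (nat \<Rightarrow> nat \<Rightarrow> real) \<Rightarrow> real" where
  "alt_sum d m = (\<Sum>p | p permutes {..<d}. of_int (sign p) * (\<Prod>a<d. m a (p a)))"

lemma alt_sum_cong:
  assumes "\<And>a b. a < d \<Longrightarrow> b < d \<Longrightarrow> m a b = m' a b"
  shows "alt_sum d m = alt_sum d m'"
  unfolding alt_sum_def
proof (intro sum.cong refl)
  fix p assume "p \<in> {p. p permutes {..<d}}"
  then have "\<And>a. a < d \<Longrightarrow> p a < d" using permutes_in_image by fastforce
  then show "real_of_int (sign p) * (\<Prod>a<d. m a (p a)) = real_of_int (sign p) * (\<Prod>a<d. m' a (p a))"
    using assms by simp
qed

lemma permutes_permutation: "p permutes {..<d::nat} \<Longrightarrow> permutation p"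
  using permutation_permutes by blast

text \<open>\<open>alt_sum\<close> is the Leibniz determinant, with indices below \<open>d\<close>
  because the degree is not a type. Composing all permutations with \<open>q\<close> only reindexes
  the sum, and each sign changes by the factor \<open>sign q\<close>.\<close>

lemma alt_sum_col_perm:
  assumes q: "q permutes {..<d}"
  shows "alt_sum d (\<lambda>a b. m a (q b)) = of_int (sign q) * alt_sum d m"
proof -
  have "of_int (sign q) * alt_sum d m
      = (\<Sum>p | p permutes {..<d}. of_int (sign q) * (of_int (sign p) * (\<Prod>a<d. m a (p a))))"
    by (simp add: alt_sum_def sum_distrib_left)
  also have "\<dots> = (\<Sum>p | p permutes {..<d}.
      of_int (sign q) * (of_int (sign (q \<circ> p)) * (\<Prod>a<d. m a ((q \<circ> p) a))))"
    by (rule setum_permutations_compose_left[OF q])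
  also have "\<dots> = (\<Sum>p | p permutes {..<d}. of_int (sign p) * (\<Prod>a<d. m a (q (p a))))"
  proof (intro sum.cong refl)
    fix p assume "p \<in> {p. p permutes {..<d}}"
    then have "sign (q \<circ> p) = sign q * sign p"
      using q by (simp add: sign_compose permutes_permutation)
    then show "real_of_int (sign q) * (real_of_int (sign (q \<circ> p)) * (\<Prod>a<d. m a ((q \<circ> p) a)))
       = real_of_int (sign p) * (\<Prod>a<d. m a (q (p a)))"
      by (simp flip: mult.assoc of_int_mult)
  qed
  finally show ?thesis by (simp add: alt_sum_def)
qed

lemma alt_sum_transpose: "alt_sum d (\<lambda>a b. m b a) = alt_sum d m"
proof -
  have "alt_sum d (\<lambda>a b. m b a)
     = (\<Sum>p | p permutes {..<d}. of_int (sign (inv p)) * (\<Prod>a<d. m (inv p a) a))"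
    unfolding alt_sum_def by (rule sum_permutations_inverse)
  also have "\<dots> = alt_sum d m"
    unfolding alt_sum_def
  proof (intro sum.cong refl)
    fix p assume "p \<in> {p. p permutes {..<d}}"
    then have p: "p permutes {..<d}" by simp
    have "(\<Prod>a<d. m (inv p a) a) = (\<Prod>a<d. m (inv p (p a)) (p a))"
      by (rule prod.permute[OF p, unfolded comp_def])
    then show "real_of_int (sign (inv p)) * (\<Prod>a<d. m (inv p a) a)
       = real_of_int (sign p) * (\<Prod>a<d. m a (p a))"
      using p by (simp add: sign_inverse permutes_permutation permutes_inverses)
  qed
  finally show ?thesis .
qed

lemma alt_sum_row_perm:
  assumes q: "q permutes {..<d}"
  shows "alt_sum d (\<lambda>a b. m (q a) b) = of_int (sign q) * alt_sum d m"
  using alt_sum_col_perm[OF q, of "\<lambda>a b. m b a"] alt_sum_transpose[of d "\<lambda>a b. m (q a) b"]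
    alt_sum_transpose[of d m] by simp

text \<open>Swapping the two equal rows fixes the matrix but reverses the sign, so the sum equals
  its own negative.\<close>

lemma alt_sum_eq_rows:
  assumes "a < d" "b < d" "a \<noteq> b" "\<And>c. m a c = m b c"
  shows "alt_sum d m = 0"
proof -
  have q: "Transposition.transpose a b permutes {..<d}" using assms by (simp add: permutes_swap_id)
  have "(\<lambda>x c. m (Transposition.transpose a b x) c) = m"
    by (intro ext) (auto simp: Transposition.transpose_def assms(4))
  then have "alt_sum d m = - alt_sum d m"
    using alt_sum_row_perm[OF q, of m] assms(3) by (simp add: sign_swap_id)
  then show ?thesis by simp
qed

text \<open>Multilinearity in all rows at once: \<open>c a\<close> is the summand chosen in row
  \<open>a\<close>, so the terms are indexed by maps \<open>c\<close>. Cauchy-Binet and the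
  comparison of wedges within one span both start from this expansion.\<close>

lemma alt_sum_expand_rows:
  assumes I: "finite I" and m: "\<And>a b. a < d \<Longrightarrow> b < d \<Longrightarrow> m a b = (\<Sum>i\<in>I. w a i * y i b)"
  shows "alt_sum d m = (\<Sum>c\<in>{..<d} \<rightarrow>\<^sub>E I. (\<Prod>a<d. w a (c a)) * alt_sum d (\<lambda>a b. y (c a) b))"
proof -
  have "alt_sum d m = (\<Sum>p | p permutes {..<d}. of_int (sign p) *
      (\<Sum>c\<in>{..<d} \<rightarrow>\<^sub>E I. \<Prod>a<d. w a (c a) * y (c a) (p a)))"
    unfolding alt_sum_def
  proof (intro sum.cong refl)
    fix p assume "p \<in> {p. p permutes {..<d}}"
    then have p: "\<And>a. a < d \<Longrightarrow> p a < d" using permutes_in_image by fastforce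
    have "(\<Prod>a<d. m a (p a)) = (\<Prod>a<d. \<Sum>i\<in>I. w a i * y i (p a))"
      using p by (intro prod.cong refl) (simp add: m)
    also have "\<dots> = (\<Sum>c\<in>{..<d} \<rightarrow>\<^sub>E I. \<Prod>a<d. w a (c a) * y (c a) (p a))"
      using I by (subst prod_sum_PiE) auto
    finally show "real_of_int (sign p) * (\<Prod>a<d. m a (p a)) =
      real_of_int (sign p) * (\<Sum>c\<in>{..<d} \<rightarrow>\<^sub>E I. \<Prod>a<d. w a (c a) * y (c a) (p a))" by simp
  qed
  also have "\<dots> = (\<Sum>c\<in>{..<d} \<rightarrow>\<^sub>E I. (\<Prod>a<d. w a (c a)) * alt_sum d (\<lambda>a b. y (c a) b))"
    unfolding alt_sum_def sum_distrib_left
    by (subst sum.swap) (simp add: prod.distrib mult.left_commute)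
  finally show ?thesis .
qed

section \<open>Cauchy-Binet and unit simple vectors\<close>

lemma index_list: "distinct (index_list :: 'i::finite list)" "set (index_list :: 'i list) = UNIV"
proof -
  have "\<exists>xs :: 'i list. distinct xs \<and> set xs = UNIV"
    using finite_distinct_list[OF finite_class.finite_UNIV] by blast
  from someI_ex[OF this] show "distinct (index_list :: 'i list)" "set (index_list :: 'i list) = UNIV"
    unfolding index_list_def by auto
qed

lemma distinct_enum_set: "distinct (enum_set S)"
  and set_enum_set: "set (enum_set S) = S"
  and length_enum_set: "length (enum_set S) = card S"
proof -
  show 1: "distinct (enum_set S)" and 2: "set (enum_set S) = S"
    by (auto simp: enum_set_def index_list)
  show "length (enum_set S) = card S" using distinct_card[OF 1] 2 by simp
qed

lemma wedge_nth: "wedge ws $ S = (if card S = length ws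
    then alt_sum (length ws) (\<lambda>a b. (ws ! a) $ (enum_set S ! b)) else 0)"
  by (simp add: wedge_def alt_sum_def)

text \<open>An injective map of the indices onto \<open>S\<close> is an ordering of
  \<open>S\<close>, hence a permutation followed by the fixed ordering \<open>enum_set S\<close>.
  This turns sums over maps into sums over coordinates \<open>S\<close>.\<close>

lemma injective_maps_bij:
  fixes S :: "'i::finite set"
  assumes "card S = d"
  shows "bij_betw (\<lambda>p. restrict (\<lambda>a. enum_set S ! p a) {..<d}) {p. p permutes {..<d}}
    {c \<in> {..<d} \<rightarrow>\<^sub>E UNIV. inj_on c {..<d} \<and> c ` {..<d} = S}"
proof -
  let ?l = "enum_set S"
  have len: "length ?l = d" using assms by (simp add: length_enum_set)
  have ntheq: "?l ! a = ?l ! b \<longleftrightarrow> a = b" if "a < d" "b < d" for a b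
    using that len nth_eq_iff_index_eq[OF distinct_enum_set] by metis
  have nthS: "(!) ?l ` {..<d} = S"
    using set_enum_set[of S] len by (auto simp: set_conv_nth)
  let ?f = "\<lambda>p. restrict (\<lambda>a. ?l ! p a) {..<d}"
  show ?thesis
  proof (rule bij_betwI')
    fix p p' assume "p \<in> {p. p permutes {..<d}}" "p' \<in> {p. p permutes {..<d}}"
    then have p: "p permutes {..<d}" and p': "p' permutes {..<d}" by auto
    show "(?f p = ?f p') = (p = p')"
    proof
      assume eq: "?f p = ?f p'"
      show "p = p'"
      proof
        fix a show "p a = p' a"
        proof (cases "a < d")
          case True
          then have "?l ! p a = ?l ! p' a" using fun_cong[OF eq, of a] by simp
          then show ?thesis
            using ntheq True permutes_in_image[OF p, of a] permutes_in_image[OF p', of a] by simp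
        next
          case False
          then show ?thesis using permutes_not_in[OF p, of a] permutes_not_in[OF p', of a] by simp
        qed
      qed
    qed simp
  next
    fix p assume "p \<in> {p. p permutes {..<d}}"
    then have p: "p permutes {..<d}" by auto
    have "inj_on (\<lambda>a. ?l ! p a) {..<d}"
      using ntheq permutes_in_image[OF p] permutes_inj[OF p] by (auto simp: inj_on_def)
    moreover have "(\<lambda>a. ?l ! p a) ` {..<d} = S"
      using permutes_image[OF p] nthS by (metis image_image)
    ultimately show "?f p \<in> {c \<in> {..<d} \<rightarrow>\<^sub>E UNIV. inj_on c {..<d} \<and> c ` {..<d} = S}" by auto
  next
    fix c assume "c \<in> {c \<in> {..<d} \<rightarrow>\<^sub>E UNIV. inj_on c {..<d} \<and> c ` {..<d} = S}"
    then have c: "c \<in> {..<d} \<rightarrow>\<^sub>E UNIV" "inj_on c {..<d}" "c ` {..<d} = S" by auto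
    have "\<exists>b<d. ?l ! b = c a" if "a < d" for a
    proof -
      have "c a \<in> (!) ?l ` {..<d}" using nthS c(3) that by auto
      then show ?thesis by force
    qed
    then obtain r where r: "\<And>a. a < d \<Longrightarrow> r a < d \<and> ?l ! r a = c a" by metis
    define p where "p = (\<lambda>a. if a < d then r a else a)"
    have "inj_on p {..<d}"
    proof (rule inj_onI)
      fix a b assume ab: "a \<in> {..<d}" "b \<in> {..<d}" "p a = p b"
      then have "c a = c b" using r[of a] r[of b] by (simp add: p_def)
      then show "a = b" using ab c(2) by (simp add: inj_on_def)
    qed
    moreover have "p ` {..<d} \<subseteq> {..<d}" using r by (auto simp: p_def)
    ultimately have "bij_betw p {..<d} {..<d}"
      by (simp add: bij_betw_def endo_inj_surj)
    then have "p permutes {..<d}"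
      by (rule bij_imp_permutes) (simp add: p_def)
    moreover have "c = ?f p"
    proof
      fix a show "c a = ?f p a"
      proof (cases "a < d")
        case True
        then show ?thesis using r[OF True] by (simp add: p_def)
      next
        case False
        then show ?thesis using PiE_arb[OF c(1), of a] by simp
      qed
    qed
    ultimately show "\<exists>x\<in>{p. p permutes {..<d}}. c = ?f x" by auto
  qed
qed

text \<open>Only the injective maps contribute, and they are grouped by their image.\<close>

lemma sum_maps_alternating:
  fixes w :: "nat \<Rightarrow> 'i::finite \<Rightarrow> real" and y :: "'i \<Rightarrow> nat \<Rightarrow> real"
  shows "(\<Sum>c\<in>{..<d} \<rightarrow>\<^sub>E UNIV. (\<Prod>a<d. w a (c a)) * alt_sum d (\<lambda>a b. y (c a) b))
    = (\<Sum>S | card S = d. alt_sum d (\<lambda>a b. w a (enum_set S ! b)) *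
         alt_sum d (\<lambda>a b. y (enum_set S ! a) b))"
proof -
  let ?G = "\<lambda>c. (\<Prod>a<d. w a (c a)) * alt_sum d (\<lambda>a b. y (c a) b)"
  let ?X = "{..<d} \<rightarrow>\<^sub>E (UNIV :: 'i set)"
  let ?I = "{c \<in> ?X. inj_on c {..<d}}"
  have finX: "finite ?X" by (intro finite_PiE) auto
  have "?G c = 0" if "c \<in> ?X - ?I" for c
  proof -
    have "\<not> inj_on c {..<d}" using that by blast
    then obtain a b where "a < d" "b < d" "a \<noteq> b" "c a = c b" by (auto simp: inj_on_def)
    then have "alt_sum d (\<lambda>a b. y (c a) b) = 0" by (intro alt_sum_eq_rows[of a d b]) auto
    then show ?thesis by simp
  qed
  then have "sum ?G ?X = sum ?G ?I"
    using finX by (intro sum.mono_neutral_right) blast+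
  also have "\<dots> = (\<Sum>S | card S = d. sum ?G {c \<in> ?I. c ` {..<d} = S})"
  proof (rule sum.group[symmetric])
    show "finite ?I" using finX by simp
    show "(\<lambda>c. c ` {..<d}) ` ?I \<subseteq> {S. card S = d}"
      using card_image by fastforce
  qed simp
  also have "\<dots> = (\<Sum>S | card S = d. alt_sum d (\<lambda>a b. w a (enum_set S ! b)) *
         alt_sum d (\<lambda>a b. y (enum_set S ! a) b))"
  proof (intro sum.cong refl)
    fix S :: "'i set" assume "S \<in> {S. card S = d}"
    then have S: "card S = d" by simp
    have "sum ?G {c \<in> ?I. c ` {..<d} = S} = sum ?G {c \<in> ?X. inj_on c {..<d} \<and> c ` {..<d} = S}"
      by (rule arg_cong[where f = "sum ?G"]) auto
    also have "\<dots> = (\<Sum>p | p permutes {..<d}. ?G (restrict (\<lambda>a. enum_set S ! p a) {..<d}))"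
      by (rule sum.reindex_bij_betw[OF injective_maps_bij[OF S], symmetric])
    also have "\<dots> = (\<Sum>p | p permutes {..<d}. of_int (sign p) * (\<Prod>a<d. w a (enum_set S ! p a)) *
        alt_sum d (\<lambda>a b. y (enum_set S ! a) b))"
    proof (intro sum.cong refl)
      fix p assume "p \<in> {p. p permutes {..<d}}"
      then have p: "p permutes {..<d}" by simp
      have "alt_sum d (\<lambda>a b. y (restrict (\<lambda>a. enum_set S ! p a) {..<d} a) b)
         = alt_sum d (\<lambda>a b. y (enum_set S ! p a) b)"
        by (rule alt_sum_cong) simp
      also have "\<dots> = of_int (sign p) * alt_sum d (\<lambda>a b. y (enum_set S ! a) b)"
        using alt_sum_row_perm[OF p, of "\<lambda>a b. y (enum_set S ! a) b"] .
      finally show "?G (restrict (\<lambda>a. enum_set S ! p a) {..<d}) =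
        of_int (sign p) * (\<Prod>a<d. w a (enum_set S ! p a)) * alt_sum d (\<lambda>a b. y (enum_set S ! a) b)"
        by simp
    qed
    also have "\<dots> = alt_sum d (\<lambda>a b. w a (enum_set S ! b)) * alt_sum d (\<lambda>a b. y (enum_set S ! a) b)"
      by (simp add: alt_sum_def sum_distrib_right)
    finally show "sum ?G {c \<in> ?I. c ` {..<d} = S} = \<dots>" .
  qed
  finally show ?thesis .
qed

text \<open>Functoriality of the exterior power. Each \<open>f (ws ! a)\<close> is expanded in the
  vectors \<open>f (axis i 1)\<close>; after grouping by images, the coefficients are the
  coordinates of \<open>wedge ws\<close>, and the other factors are those of the wedges that define
  \<open>ext_map f\<close>.\<close>

lemma ext_map_wedge:
  fixes ws :: "(real ^ 'a::finite) list"
  assumes f: "linear f"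
  shows "ext_map f (wedge ws) = wedge (map f ws)"
proof (subst vec_eq_iff, rule allI)
  fix T
  let ?d = "length ws"
  show "ext_map f (wedge ws) $ T = wedge (map f ws) $ T"
  proof (cases "card T = ?d")
    case False
    have "ext_map f (wedge ws) $ T = (\<Sum>S\<in>(UNIV :: 'a set set). 0)"
      unfolding ext_map_def sum_component vector_scaleR_component
    proof (intro sum.cong refl)
      fix S
      show "wedge ws $ S *\<^sub>R wedge (map (\<lambda>i. f (axis i 1)) (enum_set S)) $ T = 0"
        using False by (auto simp: wedge_nth length_enum_set)
    qed
    then show ?thesis using False by (simp add: wedge_nth)
  next
    case True
    have fx: "f x $ t = (\<Sum>i\<in>UNIV. x $ i * f (axis i 1) $ t)" for x t
    proof -
      have "f x = f (\<Sum>i\<in>UNIV. x $ i *\<^sub>R axis i 1)"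
        using basis_expansion[of x] by (simp add: scalar_mult_eq_scaleR)
      also have "\<dots> = (\<Sum>i\<in>UNIV. x $ i *\<^sub>R f (axis i 1))"
        using f by (simp add: linear_sum linear_cmul)
      finally show ?thesis by (simp add: sum_component)
    qed
    have "wedge (map f ws) $ T = alt_sum ?d (\<lambda>a b. f (ws ! a) $ (enum_set T ! b))"
      unfolding wedge_nth using True by (auto intro!: alt_sum_cong)
    also have "\<dots> = (\<Sum>c\<in>{..<?d} \<rightarrow>\<^sub>E UNIV. (\<Prod>a<?d. ws ! a $ c a) *
        alt_sum ?d (\<lambda>a b. f (axis (c a) 1) $ (enum_set T ! b)))"
      by (rule alt_sum_expand_rows) (simp_all add: fx[symmetric])
    also have "\<dots> = (\<Sum>S | card S = ?d. alt_sum ?d (\<lambda>a b. ws ! a $ (enum_set S ! b)) *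
        alt_sum ?d (\<lambda>a b. f (axis (enum_set S ! a) 1) $ (enum_set T ! b)))"
      by (rule sum_maps_alternating)
    also have "\<dots> = (\<Sum>S | card S = ?d. wedge ws $ S *
        wedge (map (\<lambda>i. f (axis i 1)) (enum_set S)) $ T)"
    proof (intro sum.cong refl arg_cong2[where f = "(*)"])
      fix S :: "'a set" assume "S \<in> {S. card S = ?d}"
      then have S: "card S = ?d" by simp
      show "alt_sum ?d (\<lambda>a b. ws ! a $ (enum_set S ! b)) = wedge ws $ S"
        using S by (simp add: wedge_nth)
      show "alt_sum ?d (\<lambda>a b. f (axis (enum_set S ! a) 1) $ (enum_set T ! b)) =
          wedge (map (\<lambda>i. f (axis i 1)) (enum_set S)) $ T"
        using S True by (auto simp: wedge_nth length_enum_set intro!: alt_sum_cong)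
    qed
    also have "\<dots> = (\<Sum>S\<in>UNIV. wedge ws $ S * wedge (map (\<lambda>i. f (axis i 1)) (enum_set S)) $ T)"
      by (rule sum.mono_neutral_left) (auto simp: wedge_nth)
    also have "\<dots> = ext_map f (wedge ws) $ T"
      by (simp add: ext_map_def sum_component)
    finally show ?thesis by simp
  qed
qed

text \<open>Cauchy-Binet read backwards: with the second factor transposed, the sum over
  \<open>S\<close> regroups into a sum over all maps, which contracts to the Gram
  determinant.\<close>

lemma inner_wedge:
  assumes "length vs = length ws"
  shows "wedge vs \<bullet> wedge ws = alt_sum (length vs) (\<lambda>a b. vs ! a \<bullet> ws ! b)"
proof -
  let ?d = "length vs"
  have "wedge vs \<bullet> wedge ws = (\<Sum>S\<in>UNIV. wedge vs $ S * wedge ws $ S)"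
    by (simp add: inner_vec_def)
  also have "\<dots> = (\<Sum>S | card S = ?d. wedge vs $ S * wedge ws $ S)"
    by (rule sum.mono_neutral_right) (auto simp: wedge_nth)
  also have "\<dots> = (\<Sum>S | card S = ?d. alt_sum ?d (\<lambda>a b. vs ! a $ (enum_set S ! b)) *
        alt_sum ?d (\<lambda>a b. ws ! b $ (enum_set S ! a)))"
  proof (intro sum.cong refl arg_cong2[where f = "(*)"])
    fix S :: "'a set" assume "S \<in> {S. card S = ?d}"
    then have S: "card S = ?d" by simp
    show "wedge vs $ S = alt_sum ?d (\<lambda>a b. vs ! a $ (enum_set S ! b))"
      using S by (simp add: wedge_nth)
    show "wedge ws $ S = alt_sum ?d (\<lambda>a b. ws ! b $ (enum_set S ! a))"
      using S assms alt_sum_transpose[of ?d "\<lambda>a b. ws ! a $ (enum_set S ! b)"]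
      by (simp add: wedge_nth)
  qed
  also have "\<dots> = (\<Sum>c\<in>{..<?d} \<rightarrow>\<^sub>E UNIV. (\<Prod>a<?d. vs ! a $ c a) * alt_sum ?d (\<lambda>a b. ws ! b $ c a))"
    by (rule sum_maps_alternating[where y = "\<lambda>i b. ws ! b $ i", symmetric])
  also have "\<dots> = alt_sum ?d (\<lambda>a b. vs ! a \<bullet> ws ! b)"
    by (rule alt_sum_expand_rows[symmetric, where y = "\<lambda>i b. ws ! b $ i"])
      (simp_all add: inner_vec_def)
  finally show ?thesis .
qed

text \<open>Gram determinant of the identity matrix: a permutation that moves some index picks up a
  zero entry, so only \<open>id\<close> contributes.\<close>

lemma norm_wedge_orthonormal:
  assumes "\<And>a b. a < length ws \<Longrightarrow> b < length ws \<Longrightarrow> ws ! a \<bullet> ws ! b = (if a = b then 1 else 0)"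
  shows "norm (wedge ws) = 1"
proof -
  let ?d = "length ws"
  have "wedge ws \<bullet> wedge ws = alt_sum ?d (\<lambda>a b. if a = b then 1 else 0)"
    unfolding inner_wedge[OF refl] by (rule alt_sum_cong) (simp add: assms)
  also have "\<dots> = (\<Sum>p | p permutes {..<?d}. if p = id then 1 else 0)"
    unfolding alt_sum_def
  proof (intro sum.cong refl)
    fix p assume "p \<in> {p. p permutes {..<?d}}"
    then have p: "p permutes {..<?d}" by simp
    show "real_of_int (sign p) * (\<Prod>a<?d. if a = p a then 1 else 0) = (if p = id then 1 else 0)"
    proof (cases "p = id")
      case False
      then obtain a where a: "p a \<noteq> a" by (auto simp: fun_eq_iff)
      then have "a < ?d" using permutes_not_in[OF p] by fastforce
      then have "(\<Prod>a<?d. if a = p a then 1 else 0 :: real) = 0"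
        using a by (intro prod_zero bexI[of _ a]) auto
      then show ?thesis using False by simp
    qed simp
  qed
  also have "\<dots> = 1" by (simp add: permutes_id finite_permutations)
  finally show ?thesis by (simp add: norm_eq_sqrt_inner)
qed

text \<open>After expressing \<open>ws'\<close> through \<open>ws\<close> and expanding, every
  choice \<open>c\<close> with a repetition drops out. For equal lengths the remaining choices are
  permutations and contribute multiples of \<open>wedge ws\<close>, with factors independent of the
  coordinate; for a longer \<open>ws'\<close> the pigeonhole principle leaves nothing.\<close>

lemma wedge_in_span_list:
  assumes "set ws' \<subseteq> span (set ws)"
  shows "length ws' = length ws \<Longrightarrow> \<exists>c. wedge ws' = c *\<^sub>R wedge ws"
    and "length ws' > length ws \<Longrightarrow> wedge ws' = 0"
proof -
  let ?d = "length ws'"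
  let ?n = "length ws"
  have "\<exists>c. v = (\<Sum>i<?n. c i *\<^sub>R ws ! i)" if "v \<in> span (set ws)" for v
    using that
  proof (induction rule: span_induct_alt)
    case base
    show ?case by (rule exI[of _ "\<lambda>_. 0"]) simp
  next
    case (step r x y)
    then obtain c where c: "y = (\<Sum>i<?n. c i *\<^sub>R ws ! i)" by blast
    obtain j where j: "j < ?n" "x = ws ! j" using step(1) by (auto simp: in_set_conv_nth)
    have "r *\<^sub>R x + y = (\<Sum>i<?n. (if i = j then r else 0) *\<^sub>R ws ! i) + y"
      using j by (simp add: if_distrib[of "\<lambda>z. z *\<^sub>R _"] sum.delta cong: if_cong)
    also have "\<dots> = (\<Sum>i<?n. ((if i = j then r else 0) + c i) *\<^sub>R ws ! i)"
      by (simp add: c sum.distrib scaleR_add_left)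
    finally show ?case by (intro exI[of _ "\<lambda>i. (if i = j then r else 0) + c i"])
  qed
  then have "\<forall>a<?d. \<exists>c. ws' ! a = (\<Sum>i<?n. c i *\<^sub>R ws ! i)"
    using assms nth_mem by blast
  then obtain w where w: "\<And>a. a < ?d \<Longrightarrow> ws' ! a = (\<Sum>i<?n. w a i *\<^sub>R ws ! i)" by metis
  have exp: "alt_sum ?d (\<lambda>a b. ws' ! a $ t b) =
      (\<Sum>c\<in>{..<?d} \<rightarrow>\<^sub>E {..<?n}. (\<Prod>a<?d. w a (c a)) * alt_sum ?d (\<lambda>a b. ws ! c a $ t b))" for t
    by (rule alt_sum_expand_rows) (simp_all add: w sum_component)
  {
    assume len: "?d = ?n"
    have "\<exists>k. \<forall>t. alt_sum ?d (\<lambda>a b. ws ! c a $ t b) = k * alt_sum ?d (\<lambda>a b. ws ! a $ t b)"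
      if c: "c \<in> {..<?d} \<rightarrow>\<^sub>E {..<?n}" for c
    proof (cases "inj_on c {..<?d}")
      case False
      then obtain a b where "a < ?d" "b < ?d" "a \<noteq> b" "c a = c b" by (auto simp: inj_on_def)
      then have "alt_sum ?d (\<lambda>a b. ws ! c a $ t b) = 0" for t
        by (intro alt_sum_eq_rows[of a _ b]) auto
      then show ?thesis by (intro exI[of _ 0]) simp
    next
      case True
      define p where "p = (\<lambda>a. if a < ?d then c a else a)"
      have "inj_on p {..<?d}" using True by (auto simp: p_def inj_on_def)
      moreover have "p ` {..<?d} \<subseteq> {..<?d}" using c len by (auto simp: p_def)
      ultimately have "bij_betw p {..<?d} {..<?d}"
        by (simp add: bij_betw_def endo_inj_surj)
      then have p: "p permutes {..<?d}" by (rule bij_imp_permutes) (simp add: p_def)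
      have "alt_sum ?d (\<lambda>a b. ws ! c a $ t b) = of_int (sign p) * alt_sum ?d (\<lambda>a b. ws ! a $ t b)" for t
        unfolding alt_sum_row_perm[OF p, of "\<lambda>a b. ws ! a $ t b", symmetric]
        by (rule alt_sum_cong) (simp add: p_def)
      then show ?thesis by blast
    qed
    then obtain k where k: "\<And>c t. c \<in> {..<?d} \<rightarrow>\<^sub>E {..<?n} \<Longrightarrow>
       alt_sum ?d (\<lambda>a b. ws ! c a $ t b) = k c * alt_sum ?d (\<lambda>a b. ws ! a $ t b)" by metis
    have "wedge ws' = (\<Sum>c\<in>{..<?d} \<rightarrow>\<^sub>E {..<?n}. (\<Prod>a<?d. w a (c a)) * k c) *\<^sub>R wedge ws"
    proof (subst vec_eq_iff, rule allI)
      fix T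
      have "alt_sum ?d (\<lambda>a b. ws' ! a $ (enum_set T ! b)) =
        (\<Sum>c\<in>{..<?d} \<rightarrow>\<^sub>E {..<?n}. (\<Prod>a<?d. w a (c a)) * k c) *
          alt_sum ?d (\<lambda>a b. ws ! a $ (enum_set T ! b))"
        unfolding exp sum_distrib_right by (intro sum.cong refl) (simp only: k mult.assoc)
      then show "wedge ws' $ T =
        ((\<Sum>c\<in>{..<?d} \<rightarrow>\<^sub>E {..<?n}. (\<Prod>a<?d. w a (c a)) * k c) *\<^sub>R wedge ws) $ T"
        using len by (simp add: wedge_nth)
    qed
    then show "\<exists>c. wedge ws' = c *\<^sub>R wedge ws" by blast
  }
  {
    assume len: "?d > ?n"
    have "alt_sum ?d (\<lambda>a b. ws ! c a $ t b) = 0" if c: "c \<in> {..<?d} \<rightarrow>\<^sub>E {..<?n}" for c t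
    proof -
      have "card (c ` {..<?d}) \<le> card {..<?n}" using c by (intro card_mono) auto
      then have "\<not> inj_on c {..<?d}" using len card_image by fastforce
      then obtain a b where "a < ?d" "b < ?d" "a \<noteq> b" "c a = c b" by (auto simp: inj_on_def)
      then show ?thesis by (intro alt_sum_eq_rows[of a _ b]) auto
    qed
    then have "alt_sum ?d (\<lambda>a b. ws' ! a $ t b) = 0" for t
      unfolding exp by (intro sum.neutral ballI) simp
    then show "wedge ws' = 0" by (simp add: vec_eq_iff wedge_nth)
  }
qed

text \<open>The choice in \<open>unit_simple\<close> ranges over lists of any length. Neither list
  can be longer than the other, since the longer wedge would vanish, against its norm 1; then the
  wedges are proportional with a factor of modulus 1.\<close>

lemma unit_simple_span:
  fixes ws :: "(real ^ 'i::finite) list"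
  assumes on: "\<And>a b. a < length ws \<Longrightarrow> b < length ws \<Longrightarrow> ws ! a \<bullet> ws ! b = (if a = b then 1 else 0)"
    and N: "span (set ws) = N"
  shows "unit_simple N = wedge ws \<or> unit_simple N = - wedge ws"
proof -
  have n1: "norm (wedge ws) = 1" using norm_wedge_orthonormal on by blast
  have "\<exists>v. norm v = 1 \<and> (\<exists>ws. v = wedge ws \<and> span (set ws) = N)" using n1 N by blast
  from someI_ex[OF this] obtain us where us: "unit_simple N = wedge us" "span (set us) = N"
    "norm (wedge us) = 1"
    unfolding unit_simple_def by metis
  have "\<not> length us > length ws"
    using wedge_in_span_list(2)[of us ws] us N span_superset[of "set us"] by auto
  moreover have "\<not> length ws > length us"
    using wedge_in_span_list(2)[of ws us] us N n1 span_superset[of "set ws"] by auto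
  ultimately have "length us = length ws" by simp
  then obtain c where c: "wedge us = c *\<^sub>R wedge ws"
    using wedge_in_span_list(1)[of us ws] us N span_superset[of "set us"] by auto
  then have "\<bar>c\<bar> = 1" using us(3) n1 by simp
  then have "c = 1 \<or> c = -1" by linarith
  then show ?thesis using c us(1) by auto
qed

section \<open>Hausdorff measure\<close>

definition hgauge :: "nat \<Rightarrow> 'a::metric_space set \<Rightarrow> ennreal" where
  "hgauge D S = (if S = {} then 0 else ennreal (unit_ball_vol (real D) * (diameter S / 2) ^ D))"

definition hcovers :: "real \<Rightarrow> 'a::metric_space set \<Rightarrow> (nat \<Rightarrow> 'a set) set" where
  "hcovers \<delta> A = {C. A \<subseteq> (\<Union>i. C i) \<and> (\<forall>i. bounded (C i) \<and> diameter (C i) \<le> \<delta>)}"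

definition hpre :: "nat \<Rightarrow> real \<Rightarrow> 'a::metric_space set \<Rightarrow> ennreal" where
  "hpre D \<delta> A = (INF C\<in>hcovers \<delta> A. \<Sum>i. hgauge D (C i))"

lemma hausdorff_outer_hpre: "hausdorff_outer D A = (SUP \<delta>\<in>{0<..}. hpre D \<delta> A)"
  by (simp add: hausdorff_outer_def hpre_def hcovers_def hgauge_def)

lemma hpre_le: "0 < \<delta> \<Longrightarrow> hpre D \<delta> A \<le> hausdorff_outer D A"
  unfolding hausdorff_outer_hpre by (intro SUP_upper) auto

lemma hpre_le_sum: "C \<in> hcovers \<delta> A \<Longrightarrow> hpre D \<delta> A \<le> (\<Sum>i. hgauge D (C i))"
  unfolding hpre_def by (intro INF_lower)

lemma hpre_mono: "A \<subseteq> B \<Longrightarrow> hpre D \<delta> A \<le> hpre D \<delta> B"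
  unfolding hpre_def hcovers_def by (intro INF_superset_mono) auto

lemma hpre_antimono: "\<delta> \<le> \<delta>' \<Longrightarrow> hpre D \<delta>' A \<le> hpre D \<delta> A"
  unfolding hpre_def
  by (intro INF_superset_mono order_refl) (unfold hcovers_def, blast intro: order.trans)

lemma hausdorff_outer_mono: "A \<subseteq> B \<Longrightarrow> hausdorff_outer D A \<le> hausdorff_outer D B"
  unfolding hausdorff_outer_hpre by (intro SUP_mono) (auto intro: hpre_mono)

lemma hausdorff_outer_empty [simp]: "hausdorff_outer D {} = 0"
proof -
  have "hpre D \<delta> ({} :: 'a set) = 0" if "0 < \<delta>" for \<delta>
  proof -
    have "(\<lambda>_. {}) \<in> hcovers \<delta> ({} :: 'a set)" using that by (simp add: hcovers_def)
    from hpre_le_sum[OF this, of D] show ?thesis by (simp add: hgauge_def)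
  qed
  then show ?thesis unfolding hausdorff_outer_hpre by (simp add: SUP_constant)
qed

lemma hausdorff_outer_countably_subadditive:
  "hausdorff_outer D (\<Union>n. A n) \<le> (\<Sum>n. hausdorff_outer D (A (n::nat)))"
proof -
  have "hpre D \<delta> (\<Union>n. A n) \<le> (\<Sum>n. hausdorff_outer D (A n))" if \<delta>: "0 < \<delta>" for \<delta>
  proof (rule order_trans)
    show "hpre D \<delta> (\<Union>n. A n) \<le> (\<Sum>n. hpre D \<delta> (A n))"
    proof (rule ennreal_le_epsilon)
      fix e :: real assume "0 < e" "(\<Sum>n. hpre D \<delta> (A n)) < top"
      then have *: "\<And>n. hpre D \<delta> (A n) < hpre D \<delta> (A n) + e * (1/2)^Suc n"
        by (auto simp add: less_top dest!: ennreal_suminf_lessD)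
      have "\<exists>C\<in>hcovers \<delta> (A n). (\<Sum>i. hgauge D (C i)) \<le> hpre D \<delta> (A n) + e * (1/2)^Suc n" for n
        using *[of n] unfolding hpre_def INF_less_iff by (auto intro: less_imp_le)
      then obtain B where B: "\<And>n. B n \<in> hcovers \<delta> (A n)"
        and Ble: "\<And>n. (\<Sum>i. hgauge D (B n i)) \<le> hpre D \<delta> (A n) + e * (1/2)^(Suc n)" by metis
      \<comment> \<open>The covers of all \<open>A n\<close> are interleaved into one sequence
        through the pairing of naturals; their errors \<open>e / 2^(n+1)\<close> add up to
        \<open>e\<close>.\<close>
      define C where "C = case_prod B o prod_decode"
      have "C \<in> hcovers \<delta> (\<Union>n. A n)"
      proof -
        have "\<exists>i. x \<in> C i" if "x \<in> A n" for x n
        proof -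
          have "A n \<subseteq> (\<Union>i. B n i)" using B[of n] unfolding hcovers_def by blast
          then have "x \<in> (\<Union>i. B n i)" using that by (rule subsetD)
          then obtain j where "x \<in> B n j" by (rule UN_E)
          then show ?thesis by (intro exI[of _ "prod_encode (n, j)"]) (simp add: C_def)
        qed
        then have "(\<Union>n. A n) \<subseteq> (\<Union>i. C i)" by blast
        moreover have "bounded (C i) \<and> diameter (C i) \<le> \<delta>" for i
          using B[of "fst (prod_decode i)"] by (simp add: hcovers_def C_def case_prod_unfold)
        ultimately show ?thesis by (simp add: hcovers_def)
      qed
      then have "hpre D \<delta> (\<Union>n. A n) \<le> (\<Sum>i. hgauge D (C i))" by (rule hpre_le_sum)
      also have "\<dots> = (\<Sum>i. (\<lambda>p. hgauge D (case_prod B p)) (prod_decode i))"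
        by (simp add: C_def)
      also have "\<dots> = (\<Sum>n. \<Sum>i. hgauge D (B n i))"
        by (rule suminf_ennreal_2dimen) simp
      also have "\<dots> \<le> (\<Sum>n. hpre D \<delta> (A n) + e * (1/2) ^ Suc n)"
        by (intro suminf_le suminf_nonneg allI Ble) auto
      also have "... = (\<Sum>n. hpre D \<delta> (A n)) + (\<Sum>n. ennreal e * ennreal ((1/2) ^ Suc n))"
        using \<open>0 < e\<close> by (subst suminf_add[symmetric])
          (auto simp del: ennreal_suminf_cmult simp add: ennreal_mult[symmetric])
      also have "\<dots> = (\<Sum>n. hpre D \<delta> (A n)) + e"
        unfolding ennreal_suminf_cmult
        by (subst suminf_ennreal_eq[OF zero_le_power power_half_series]) auto
      finally show "hpre D \<delta> (\<Union>n. A n) \<le> (\<Sum>n. hpre D \<delta> (A n)) + e" .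
    qed
    show "(\<Sum>n. hpre D \<delta> (A n)) \<le> (\<Sum>n. hausdorff_outer D (A n))"
      by (intro suminf_le summableI hpre_le \<delta>)
  qed
  then show ?thesis unfolding hausdorff_outer_hpre[of D "\<Union>n. A n"] by (intro SUP_least) auto
qed

lemma hausdorff_outer_measure_space:
  "outer_measure_space (Pow (UNIV :: 'a::metric_space set)) (hausdorff_outer D)"
  unfolding outer_measure_space_def
proof (intro conjI)
  show "positive (Pow UNIV) (hausdorff_outer D)" by (simp add: positive_def)
  show "increasing (Pow (UNIV :: 'a set)) (hausdorff_outer D)"
    by (auto simp: increasing_def intro: hausdorff_outer_mono)
  show "countably_subadditive (Pow (UNIV :: 'a set)) (hausdorff_outer D)"
    using hausdorff_outer_countably_subadditive by (auto simp: countably_subadditive_def)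
qed

lemma hausdorff_outer_subadditive:
  "hausdorff_outer D (A \<union> B) \<le> hausdorff_outer D A + hausdorff_outer D (B :: 'a::metric_space set)"
proof -
  interpret algebra "UNIV :: 'a set" "Pow UNIV" by (rule algebra_Pow)
  have "positive (Pow (UNIV :: 'a set)) (hausdorff_outer D)"
    "countably_subadditive (Pow (UNIV :: 'a set)) (hausdorff_outer D)"
    using hausdorff_outer_measure_space by (auto simp: outer_measure_space_def)
  from countably_subadditive_subadditive[OF this]
  have sa: "subadditive (Pow UNIV) (hausdorff_outer D :: 'a set \<Rightarrow> ennreal)" .
  have "hausdorff_outer D (A \<union> (B - A)) \<le> hausdorff_outer D A + hausdorff_outer D (B - A)"
    using sa by (intro subadditiveD) auto
  also have "\<dots> \<le> hausdorff_outer D A + hausdorff_outer D B"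
    by (intro add_mono hausdorff_outer_mono) auto
  finally show ?thesis by simp
qed

text \<open>At scales below \<open>r\<close> no set of a cover can meet both \<open>A\<close> and
  \<open>B\<close>, so each cover splits into a cover of \<open>A\<close> and one of
  \<open>B\<close> without increasing the sum.\<close>

lemma hausdorff_outer_separated:
  fixes A B :: "'a::metric_space set"
  assumes r: "0 < r" and sep: "\<And>x y. x \<in> A \<Longrightarrow> y \<in> B \<Longrightarrow> r \<le> dist x y"
  shows "hausdorff_outer D A + hausdorff_outer D B \<le> hausdorff_outer D (A \<union> B)"
proof -
  let ?c = "hausdorff_outer D (A \<union> B)"
  have small: "hpre D \<delta> A + hpre D \<delta> B \<le> ?c" if \<delta>: "0 < \<delta>" "\<delta> < r" for \<delta>
  proof -
    have "hpre D \<delta> A + hpre D \<delta> B \<le> (\<Sum>i. hgauge D (C i))" if C: "C \<in> hcovers \<delta> (A \<union> B)" for C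
    proof -
      define C1 where "C1 i = (if C i \<inter> A = {} then {} else C i)" for i
      define C2 where "C2 i = (if C i \<inter> B = {} then {} else C i)" for i
      have cov: "A \<union> B \<subseteq> (\<Union>i. C i)" and bd: "\<And>i. bounded (C i)" "\<And>i. diameter (C i) \<le> \<delta>"
        using C by (auto simp: hcovers_def)
      have "A \<subseteq> (\<Union>i. C1 i)"
      proof
        fix x assume "x \<in> A"
        moreover from this obtain i where "x \<in> C i" using cov by blast
        ultimately have "x \<in> C1 i" by (auto simp: C1_def)
        then show "x \<in> (\<Union>i. C1 i)" by blast
      qed
      then have 1: "C1 \<in> hcovers \<delta> A"
        using bd \<delta> by (auto simp: hcovers_def C1_def)
      have "B \<subseteq> (\<Union>i. C2 i)"
      proof
        fix x assume "x \<in> B"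
        moreover from this obtain i where "x \<in> C i" using cov by blast
        ultimately have "x \<in> C2 i" by (auto simp: C2_def)
        then show "x \<in> (\<Union>i. C2 i)" by blast
      qed
      then have 2: "C2 \<in> hcovers \<delta> B"
        using bd \<delta> by (auto simp: hcovers_def C2_def)
      have disj: "C i \<inter> A = {} \<or> C i \<inter> B = {}" for i
      proof (rule ccontr)
        assume "\<not> ?thesis"
        then obtain x y where xy: "x \<in> C i" "x \<in> A" "y \<in> C i" "y \<in> B" by blast
        then have "dist x y \<le> diameter (C i)" using diameter_bounded_bound bd(1) by blast
        then show False using sep[OF xy(2,4)] bd(2)[of i] \<delta>(2) by linarith
      qed
      have "hpre D \<delta> A + hpre D \<delta> B \<le> (\<Sum>i. hgauge D (C1 i)) + (\<Sum>i. hgauge D (C2 i))"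
        by (intro add_mono hpre_le_sum 1 2)
      also have "\<dots> = (\<Sum>i. hgauge D (C1 i) + hgauge D (C2 i))"
        by (rule suminf_add) auto
      also have "\<dots> \<le> (\<Sum>i. hgauge D (C i))"
      proof (intro suminf_le summableI)
        fix i show "hgauge D (C1 i) + hgauge D (C2 i) \<le> hgauge D (C i)"
          using disj[of i] by (auto simp: C1_def C2_def hgauge_def)
      qed
      finally show ?thesis .
    qed
    then have "hpre D \<delta> A + hpre D \<delta> B \<le> hpre D \<delta> (A \<union> B)"
      unfolding hpre_def[of D \<delta> "A \<union> B"] by (intro INF_greatest)
    also have "\<dots> \<le> ?c" using \<delta> by (intro hpre_le)
    finally show ?thesis .
  qed
  \<comment> \<open>The two suprema run over independent scales; both premeasures are compared with
    those at one common smaller scale, chosen below \<open>r\<close>.\<close>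
  have all: "hpre D \<delta>1 A + hpre D \<delta>2 B \<le> ?c" if "0 < \<delta>1" "0 < \<delta>2" for \<delta>1 \<delta>2
  proof -
    define \<delta> where "\<delta> = min (min \<delta>1 \<delta>2) (r / 2)"
    have d: "0 < \<delta>" "\<delta> < r" "\<delta> \<le> \<delta>1" "\<delta> \<le> \<delta>2" using that r by (auto simp: \<delta>_def min_def)
    have "hpre D \<delta>1 A + hpre D \<delta>2 B \<le> hpre D \<delta> A + hpre D \<delta> B"
      using d by (intro add_mono hpre_antimono)
    also have "\<dots> \<le> ?c" using d by (intro small)
    finally show ?thesis .
  qed
  have "hausdorff_outer D A + hpre D \<delta>2 B \<le> ?c" if "0 < \<delta>2" for \<delta>2
    unfolding hausdorff_outer_hpre[of D A] using all that
    by (subst ennreal_SUP_add_left[symmetric]) (auto intro!: SUP_least)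
  then show ?thesis
    unfolding hausdorff_outer_hpre[of D B]
    by (subst add.commute, subst ennreal_SUP_add_left[symmetric]) (auto simp: add.commute intro!: SUP_least)
qed

text \<open>Caratheodory's criterion: the parts of \<open>E\<close> at distance at least \<open>1 / (n + 1)\<close> from \<open>T\<close>
  exhaust \<open>E - T\<close>, and the shells between them have summable measure because every second
  one is separated from the previous ones.\<close>

lemma hausdorff_outer_closed_split:
  fixes T E :: "'a::metric_space set"
  assumes T: "closed T"
  shows "hausdorff_outer D (E \<inter> T) + hausdorff_outer D (E - T) \<le> hausdorff_outer D E"
proof (cases "T = {} \<or> hausdorff_outer D E = \<infinity>")
  case True
  then show ?thesis by auto
next
  case False
  then have ne: "T \<noteq> {}" and fin: "hausdorff_outer D E \<noteq> \<infinity>" by auto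
  let ?H = "hausdorff_outer D :: 'a set \<Rightarrow> ennreal"
  define F where "F n = {x \<in> E. infdist x T \<ge> 1 / (real n + 1)}" for n :: nat
  define R where "R k = F (Suc k) - F k" for k
  have pos: "infdist x T > 0" if "x \<notin> T" for x
    using that in_closed_iff_infdist_zero[OF T ne, of x] infdist_nonneg[of x T] by linarith
  have Fmono: "F m \<subseteq> F n" if "m \<le> n" for m n
    using that by (auto simp: F_def elim!: order_trans[rotated] intro!: divide_left_mono)
  have FE: "F n \<subseteq> E - T" for n
    by (auto simp: F_def not_le dest: infdist_zero)
  have ex: "\<exists>n. x \<in> F n" if "x \<in> E - T" for x
  proof -
    have "0 < infdist x T" using that pos by blast
    from reals_Archimedean[OF this] obtain n where "inverse (real (Suc n)) < infdist x T" by blast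
    then show ?thesis using that by (intro exI[of _ n]) (auto simp: F_def field_simps)
  qed
  have split1: "?H (E \<inter> T) + ?H (F n) \<le> ?H E" for n
  proof -
    have "?H (E \<inter> T) + ?H (F n) \<le> ?H ((E \<inter> T) \<union> F n)"
    proof (rule hausdorff_outer_separated)
      show "0 < 1 / (real n + 1)" by simp
      fix x y assume "x \<in> E \<inter> T" "y \<in> F n"
      then show "1 / (real n + 1) \<le> dist x y"
        using infdist_le[of x T y] by (auto simp: F_def dist_commute)
    qed
    also have "\<dots> \<le> ?H E" using FE by (intro hausdorff_outer_mono) auto
    finally show ?thesis .
  qed
  \<comment> \<open>\<open>s\<close> selects the parity. Between two shells of the same parity lies
    a skipped one, so the \<open>n\<close>-th shell has distance at least
    \<open>1 / n - 1 / (n + 1)\<close> from the earlier ones.\<close>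
  have par: "(\<Sum>k<N. ?H (R (2 * k + s))) \<le> ?H (\<Union>k<N. R (2 * k + s))" for N s
  proof (induction N)
    case (Suc N)
    have "(\<Sum>k<Suc N. ?H (R (2 * k + s))) \<le> ?H (\<Union>k<N. R (2 * k + s)) + ?H (R (2 * N + s))"
      using Suc.IH by (simp add: add_mono)
    also have "\<dots> \<le> ?H ((\<Union>k<N. R (2 * k + s)) \<union> R (2 * N + s))"
    proof (rule hausdorff_outer_separated)
      let ?n = "real (2 * N + s)"
      \<comment> \<open>For \<open>N = 0\<close> the union is empty and \<open>1 / ?n\<close> may be
        a division by zero, so the gap is replaced by 1 there.\<close>
      have "1 / (?n + 1) < 1 / ?n" if "0 < N" using that by (intro divide_strict_left_mono) auto
      then show "0 < (if N = 0 then 1 else 1 / ?n - 1 / (?n + 1))" by simp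
      fix x y assume x: "x \<in> (\<Union>k<N. R (2 * k + s))" and y: "y \<in> R (2 * N + s)"
      from x obtain k where k: "k < N" "x \<in> R (2 * k + s)" by blast
      then have "x \<in> F (Suc (2 * k + s))" by (auto simp: R_def)
      moreover have "Suc (2 * k + s) \<le> 2 * N + s - 1" using k by simp
      ultimately have "x \<in> F (2 * N + s - 1)" using Fmono by blast
      then have "1 / ?n \<le> infdist x T" using k by (simp add: F_def of_nat_diff)
      moreover have "infdist y T < 1 / (?n + 1)" using y by (auto simp: R_def F_def)
      moreover have "infdist x T \<le> infdist y T + dist x y" by (rule infdist_triangle)
      ultimately show "(if N = 0 then 1 else 1 / ?n - 1 / (?n + 1)) \<le> dist x y" using k by simp
    qed
    also have "\<dots> = ?H (\<Union>k<Suc N. R (2 * k + s))" by (simp add: lessThan_Suc Un_commute)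
    finally show ?case .
  qed simp
  have par': "(\<Sum>k<N. ?H (R (2 * k + s))) \<le> ?H E" for N s
  proof (rule order_trans[OF par])
    show "?H (\<Union>k<N. R (2 * k + s)) \<le> ?H E"
      by (rule hausdorff_outer_mono) (auto simp: R_def F_def)
  qed
  have "(\<Sum>k<2 * N. ?H (R k)) = (\<Sum>k<N. ?H (R (2 * k + 0))) + (\<Sum>k<N. ?H (R (2 * k + 1)))" for N
    by (induction N) (simp_all add: algebra_simps)
  then have two: "(\<Sum>k<2 * N. ?H (R k)) \<le> 2 * ?H E" for N
    using add_mono[OF par'[where N = N and s = 0] par'[where N = N and s = 1]] by (simp add: mult_2)
  have "(\<Sum>k. ?H (R k)) \<le> 2 * ?H E"
    unfolding suminf_eq_SUP
  proof (rule SUP_least)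
    fix n :: nat
    have "(\<Sum>k<n. ?H (R k)) \<le> (\<Sum>k<2 * n. ?H (R k))" by (intro sum_mono2) auto
    then show "(\<Sum>k<n. ?H (R k)) \<le> 2 * ?H E" using two order_trans by blast
  qed
  then have sumfin: "(\<Sum>k. ?H (R k)) \<noteq> \<infinity>"
    using fin by (auto simp: top_unique ennreal_mult_eq_top_iff)
  have tail: "?H (E - T) \<le> ?H (F n) + (\<Sum>k. ?H (R (k + n)))" for n
  proof -
    have "E - T \<subseteq> F n \<union> (\<Union>k. R (k + n))"
    proof
      fix x assume x: "x \<in> E - T"
      show "x \<in> F n \<union> (\<Union>k. R (k + n))"
      proof (cases "x \<in> F n")
        case False
        define j where "j = (LEAST j. x \<in> F j)"
        have j: "x \<in> F j" using ex[OF x] unfolding j_def by (rule LeastI_ex)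
        have "n < j" using False j Fmono[of j n] by (metis not_le subsetD)
        then obtain i where i: "j = Suc (i + n)" by (metis add.commute less_imp_Suc_add)
        have "x \<notin> F (i + n)" using not_less_Least[of "i + n" "\<lambda>j. x \<in> F j"] i j_def by simp
        then have "x \<in> R (i + n)" using j i by (simp add: R_def)
        then show ?thesis by blast
      qed simp
    qed
    then have "?H (E - T) \<le> ?H (F n \<union> (\<Union>k. R (k + n)))" by (rule hausdorff_outer_mono)
    also have "\<dots> \<le> ?H (F n) + ?H (\<Union>k. R (k + n))" by (rule hausdorff_outer_subadditive)
    also have "\<dots> \<le> ?H (F n) + (\<Sum>k. ?H (R (k + n)))"
      by (intro add_left_mono hausdorff_outer_countably_subadditive)
    finally show ?thesis .
  qed
  have "?H (E \<inter> T) + ?H (E - T) \<le> ?H E + (\<Sum>k. ?H (R (k + n)))" for n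
  proof -
    have "?H (E \<inter> T) + ?H (E - T) \<le> ?H (E \<inter> T) + (?H (F n) + (\<Sum>k. ?H (R (k + n))))"
      by (intro add_left_mono tail)
    also have "\<dots> \<le> ?H E + (\<Sum>k. ?H (R (k + n)))"
      using add_right_mono[OF split1] by (simp add: add.assoc)
    finally show ?thesis .
  qed
  moreover have "(\<lambda>n. ?H E + (\<Sum>k. ?H (R (k + n)))) \<longlonglongrightarrow> ?H E + 0"
  proof -
    \<comment> \<open>Finiteness of the sum allows a passage to real terms, where the tails of a
      convergent series tend to 0.\<close>
    obtain g where g: "\<And>k. ?H (R k) = ennreal (g k)" "\<And>k. 0 \<le> g k"
    proof -
      have "?H (R k) \<noteq> top" for k
        using sumfin ennreal_suminf_lessD[of "\<lambda>k. ?H (R k)" top k] by (simp add: less_top)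
      then show ?thesis using that[of "\<lambda>k. enn2real (?H (R k))"] by (simp add: less_top)
    qed
    have gs: "summable g"
      using sumfin g by (intro summable_suminf_not_top) auto
    have "(\<lambda>n. \<Sum>k. g (k + n)) \<longlonglongrightarrow> 0" by (rule suminf_exist_split2[OF gs])
    then have "(\<lambda>n. ennreal (\<Sum>k. g (k + n))) \<longlonglongrightarrow> ennreal 0" by (rule tendsto_ennrealI)
    moreover have "(\<Sum>k. ?H (R (k + n))) = ennreal (\<Sum>k. g (k + n))" for n
      using gs g by (simp add: suminf_ennreal2 summable_iff_shift)
    ultimately show ?thesis by (intro tendsto_add) auto
  qed
  ultimately have "?H (E \<inter> T) + ?H (E - T) \<le> ?H E + 0"
    by (intro LIMSEQ_le_const[where X = "\<lambda>n. ?H E + (\<Sum>k. ?H (R (k + n)))"]) auto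
  then show ?thesis by simp
qed

text \<open>By Caratheodory's lemma the sets that split every \<open>E\<close> additively form a
  sigma-algebra on which the outer measure is additive. It contains the closed sets, hence all Borel
  sets.\<close>

lemma hausdorff_outer_countably_additive:
  "countably_additive (sets (borel :: 'a::metric_space measure)) (hausdorff_outer D)"
proof -
  interpret sigma_algebra "UNIV :: 'a set" "Pow UNIV" by (rule sigma_algebra_Pow)
  let ?L = "lambda_system UNIV (Pow (UNIV :: 'a set)) (hausdorff_outer D)"
  have ms: "measure_space UNIV ?L (hausdorff_outer D)"
    using caratheodory_lemma[OF hausdorff_outer_measure_space] .
  have "Collect closed \<subseteq> ?L"
  proof
    fix T :: "'a set" assume "T \<in> Collect closed"
    then have T: "closed T" by simp
    have "hausdorff_outer D (E \<inter> T) + hausdorff_outer D (E - T) = hausdorff_outer D E" for E :: "'a set"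
    proof (rule antisym)
      show "hausdorff_outer D (E \<inter> T) + hausdorff_outer D (E - T) \<le> hausdorff_outer D E"
        by (rule hausdorff_outer_closed_split[OF T])
      have "E = (E \<inter> T) \<union> (E - T)" by blast
      then show "hausdorff_outer D E \<le> hausdorff_outer D (E \<inter> T) + hausdorff_outer D (E - T)"
        using hausdorff_outer_subadditive[of D "E \<inter> T" "E - T"] by simp
    qed
    then show "T \<in> ?L" unfolding lambda_system_eq by blast
  qed
  then have "sets (borel :: 'a measure) \<subseteq> ?L"
    unfolding borel_eq_closed using ms
    by (simp add: measure_space_def sigma_algebra.sigma_sets_subset)
  then have sub: "sets (borel :: 'a measure) \<subseteq> ?L" .
  have ca: "countably_additive ?L (hausdorff_outer D)" using ms by (simp add: measure_space_def)
  show ?thesis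
  proof (rule countably_additiveI)
    fix A :: "nat \<Rightarrow> 'a set"
    assume "range A \<subseteq> sets borel" "disjoint_family A" "(\<Union>i. A i) \<in> sets borel"
    then have "range A \<subseteq> ?L" "disjoint_family A" "(\<Union>i. A i) \<in> ?L" using sub by blast+
    then show "(\<Sum>i. hausdorff_outer D (A i)) = hausdorff_outer D (\<Union>i. A i)"
      using ca unfolding countably_additive_def by blast
  qed
qed

text \<open>\<open>M * N ^ D\<close> sets of diameter at most \<open>c / N\<close> have total gauge
  at most \<open>M\<close> times the gauge for diameter \<open>c\<close>: the powers of
  \<open>N\<close> cancel, so one bound serves all scales.\<close>

lemma hausdorff_outer_finiteI:
  fixes A :: "'a::metric_space set"
  assumes c: "0 \<le> c"
    and cov: "\<And>N. 0 < N \<Longrightarrow> \<exists>F. finite F \<and> card F \<le> M * N ^ D \<and> A \<subseteq> \<Union>F \<and>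
        (\<forall>S\<in>F. bounded S \<and> diameter S \<le> c / real N)"
  shows "hausdorff_outer D A < \<infinity>"
proof -
  let ?K = "real M * (unit_ball_vol (real D) * (c / 2) ^ D)"
  have "hpre D \<delta> A \<le> ennreal ?K" if \<delta>: "0 < \<delta>" for \<delta>
  proof -
    obtain n where n: "c / \<delta> < real n" using reals_Archimedean2 by blast
    define N where "N = Suc n"
    have N: "0 < N" "c / real N \<le> \<delta>" using n \<delta> c by (auto simp: N_def field_simps)
    obtain F where F: "finite F" "card F \<le> M * N ^ D" "A \<subseteq> \<Union>F"
       "\<And>S. S \<in> F \<Longrightarrow> bounded S" "\<And>S. S \<in> F \<Longrightarrow> diameter S \<le> c / real N"
      using cov[OF N(1)] by blast
    obtain h where h: "bij_betw h {0..<card F} F" using ex_bij_betw_nat_finite[OF F(1)] by blast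
    define C where "C i = (if i < card F then h i else {})" for i
    have hF: "h i \<in> F" if "i < card F" for i using h that by (auto simp: bij_betw_def)
    have "\<Union>F \<subseteq> (\<Union>i. C i)"
    proof
      fix x assume "x \<in> \<Union>F"
      then obtain S where S: "S \<in> F" "x \<in> S" by blast
      then have "S \<in> h ` {0..<card F}" using h by (simp add: bij_betw_def)
      then obtain i where "i < card F" "h i = S" by auto
      then have "x \<in> C i" using S by (simp add: C_def)
      then show "x \<in> (\<Union>i. C i)" by blast
    qed
    moreover have "bounded (C i) \<and> diameter (C i) \<le> \<delta>" for i
      using F(4)[OF hF, of i] F(5)[OF hF, of i] N(2) \<delta> by (auto simp: C_def)
    ultimately have "C \<in> hcovers \<delta> A" using F(3) by (auto simp: hcovers_def)
    then have "hpre D \<delta> A \<le> (\<Sum>i. hgauge D (C i))" by (rule hpre_le_sum)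
    also have "\<dots> = (\<Sum>i<card F. hgauge D (C i))"
      by (rule suminf_finite) (auto simp: C_def hgauge_def)
    also have "\<dots> \<le> (\<Sum>i<card F. ennreal (unit_ball_vol (real D) * (c / real N / 2) ^ D))"
    proof (rule sum_mono)
      fix i assume "i \<in> {..<card F}"
      then have i: "i < card F" by simp
      show "hgauge D (C i) \<le> ennreal (unit_ball_vol (real D) * (c / real N / 2) ^ D)"
        using F(5)[OF hF[OF i]] i diameter_ge_0[OF F(4)[OF hF[OF i]]]
        by (auto simp: hgauge_def C_def intro!: ennreal_leI mult_left_mono power_mono)
    qed
    also have "\<dots> = ennreal (real (card F) * (unit_ball_vol (real D) * (c / real N / 2) ^ D))"
      using c by (simp add: ennreal_mult ennreal_of_nat_eq_real_of_nat)
    also have "\<dots> \<le> ennreal ?K"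
    proof (rule ennreal_leI)
      have "real (card F) * (unit_ball_vol (real D) * (c / real N / 2) ^ D)
         \<le> real (M * N ^ D) * (unit_ball_vol (real D) * (c / real N / 2) ^ D)"
        using F(2) c of_nat_mono[OF F(2), where 'a = real] by (intro mult_right_mono) auto
      also have "\<dots> = ?K" using N(1) by (simp add: power_divide field_simps)
      finally show "real (card F) * (unit_ball_vol (real D) * (c / real N / 2) ^ D) \<le> ?K" .
    qed
    finally show ?thesis .
  qed
  then have "hausdorff_outer D A \<le> ennreal ?K"
    unfolding hausdorff_outer_hpre by (intro SUP_least) auto
  then show ?thesis using ennreal_less_top order_le_less_trans by (metis infinity_ennreal_def)
qed

text \<open>Every set of a cover is mapped into a box that is thin in the directions \<open>B\<close> only; the
  boxes cover a cube of full dimension.\<close>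

lemma hausdorff_outer_posI:
  fixes A :: "'a::metric_space set" and f :: "'a \<Rightarrow> 'b::euclidean_space"
  assumes B: "B \<subseteq> Basis" "card B = D" and C: "0 < L" and r: "0 < r"
    and lip: "\<And>x y. x \<in> A \<Longrightarrow> y \<in> A \<Longrightarrow> norm (f x - f y) \<le> L * dist x y"
    and onto: "\<And>z. (\<And>b. b \<in> B \<Longrightarrow> \<bar>(z - z0) \<bullet> b\<bar> \<le> r) \<Longrightarrow> \<exists>x\<in>A. \<forall>b\<in>B. f x \<bullet> b = z \<bullet> b"
  shows "0 < hausdorff_outer D A"
proof -
  let ?N = "DIM('b)"
  let ?w = "unit_ball_vol (real D)"
  have fB: "finite B" using B(1) finite_Basis finite_subset by blast
  have w: "0 < ?w" by simp
  \<comment> \<open>The ratio between the volume \<open>(2 * L * d) ^ D * (2 * r) ^ (?N - D)\<close>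
    of a box and the gauge of a set of diameter \<open>d\<close>; the gauge uses
    \<open>d / 2\<close>, hence the factor 4.\<close>
  define \<kappa> where "\<kappa> = (4 * L) ^ D * (2 * r) ^ (?N - D) / ?w"
  have \<kappa>: "0 < \<kappa>" using w C r by (simp add: \<kappa>_def)
  have DN: "D \<le> ?N" using B card_mono[OF finite_Basis B(1)] by simp
  \<comment> \<open>A bound at the single scale 1 is enough, because the Hausdorff measure is the
    supremum over all scales.\<close>
  have "ennreal ((2 * r) ^ ?N / \<kappa>) \<le> (\<Sum>i. hgauge D (S i))" if S: "S \<in> hcovers 1 A" for S
  proof -
    define p where "p i = (SOME x. x \<in> S i \<inter> A)" for i
    have p: "p i \<in> S i" "p i \<in> A" if "S i \<inter> A \<noteq> {}" for i
    proof -
      have "\<exists>x. x \<in> S i \<inter> A" using that by blast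
      from someI_ex[OF this] show "p i \<in> S i" "p i \<in> A" by (auto simp: p_def)
    qed
    define e where "e b i = (if b \<in> B then L * diameter (S i) else r)" for b i
    define m where "m b i = (if b \<in> B then f (p i) \<bullet> b else z0 \<bullet> b)" for b i
    define lo where "lo i = (\<Sum>b\<in>Basis. (m b i - e b i) *\<^sub>R b)" for i
    define hi where "hi i = (\<Sum>b\<in>Basis. (m b i + e b i) *\<^sub>R b)" for i
    define Q where "Q i = (if S i \<inter> A = {} then {} else cbox (lo i) (hi i))" for i
    have bd: "bounded (S i)" for i using S by (simp add: hcovers_def)
    have d0: "0 \<le> diameter (S i)" for i using diameter_ge_0[OF bd] .
    have vol: "emeasure lborel (Q i) \<le> ennreal \<kappa> * hgauge D (S i)" for i
    proof (cases "S i \<inter> A = {}")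
      case False
      have "emeasure lborel (Q i) = ennreal (\<Prod>b\<in>Basis. (hi i - lo i) \<bullet> b)"
        unfolding Q_def using False d0 C r
        by (simp, intro emeasure_lborel_cbox) (auto simp: lo_def hi_def e_def)
      also have "(\<Prod>b\<in>Basis. (hi i - lo i) \<bullet> b) = (\<Prod>b\<in>Basis. 2 * e b i)"
        by (intro prod.cong refl) (auto simp: lo_def hi_def inner_diff_left)
      also have "\<dots> = (\<Prod>b\<in>B. 2 * e b i) * (\<Prod>b\<in>Basis - B. 2 * e b i)"
        using B(1) by (simp add: prod.subset_diff mult.commute)
      also have "(\<Prod>b\<in>B. 2 * e b i) = (2 * L * diameter (S i)) ^ D"
        using B(2) by (simp add: e_def mult.assoc)
      also have "(\<Prod>b\<in>Basis - B. 2 * e b i) = (2 * r) ^ (?N - D)"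
        using B fB by (simp add: e_def card_Diff_subset)
      also have "(2 * L * diameter (S i)) ^ D * (2 * r) ^ (?N - D)
          = (4 * L * (diameter (S i) / 2)) ^ D * (2 * r) ^ (?N - D)" by (simp add: mult.assoc)
      also have "\<dots> = \<kappa> * (?w * (diameter (S i) / 2) ^ D)"
        unfolding power_mult_distrib[of _ "diameter (S i) / 2"] using less_imp_neq[OF w] by (simp add: \<kappa>_def)
      also have "ennreal \<dots> = ennreal \<kappa> * hgauge D (S i)"
        using \<kappa> False by (simp add: hgauge_def ennreal_mult' less_imp_le) auto
      finally show ?thesis by simp
    qed (simp add: Q_def)
    let ?big = "cbox (\<Sum>b\<in>Basis. (z0 \<bullet> b - r) *\<^sub>R b) (\<Sum>b\<in>Basis. (z0 \<bullet> b + r) *\<^sub>R b)"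
    have cover: "?big \<subseteq> (\<Union>i. Q i)"
    proof
      fix z assume z: "z \<in> ?big"
      have zb: "\<bar>(z - z0) \<bullet> b\<bar> \<le> r" if "b \<in> Basis" for b
      proof -
        have "z0 \<bullet> b - r \<le> z \<bullet> b \<and> z \<bullet> b \<le> z0 \<bullet> b + r"
          using z that unfolding mem_box by (simp add: inner_sum_left_Basis)
        then show ?thesis by (auto simp: inner_diff_left abs_le_iff)
      qed
      then obtain x where x: "x \<in> A" "\<And>b. b \<in> B \<Longrightarrow> f x \<bullet> b = z \<bullet> b"
        using onto[of z] B(1) by blast
      obtain i where i: "x \<in> S i" using S x(1) by (auto simp: hcovers_def)
      then have ne: "S i \<inter> A \<noteq> {}" using x by blast
      have "norm (f x - f (p i)) \<le> L * dist x (p i)" using lip x(1) p(2)[OF ne] by blast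
      also have "\<dots> \<le> L * diameter (S i)"
        using C diameter_bounded_bound[OF bd i p(1)[OF ne]] by simp
      finally have n: "norm (f x - f (p i)) \<le> L * diameter (S i)" .
      have "\<bar>z \<bullet> b - m b i\<bar> \<le> e b i" if b: "b \<in> Basis" for b
      proof (cases "b \<in> B")
        case True
        then show ?thesis
          using Basis_le_norm[OF b, of "f x - f (p i)"] n x(2)[OF True]
          by (simp add: m_def e_def inner_diff_left)
      next
        case False
        then show ?thesis using zb[OF b] by (simp add: m_def e_def inner_diff_left)
      qed
      then have "lo i \<bullet> b \<le> z \<bullet> b \<and> z \<bullet> b \<le> hi i \<bullet> b" if "b \<in> Basis" for b
        using that by (force simp: lo_def hi_def abs_le_iff)
      then have "z \<in> Q i" using ne by (simp add: Q_def mem_box)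
      then show "z \<in> (\<Union>i. Q i)" by blast
    qed
    have "ennreal ((2 * r) ^ ?N) = emeasure lborel ?big"
      using r by (subst emeasure_lborel_cbox) (auto simp: inner_diff_left)
    also have "\<dots> \<le> emeasure lborel (\<Union>i. Q i)"
      using cover by (intro emeasure_mono sets.countable_UN) (auto simp: Q_def)
    also have "\<dots> \<le> (\<Sum>i. emeasure lborel (Q i))"
      by (intro emeasure_subadditive_countably) (auto simp: Q_def)
    also have "\<dots> \<le> (\<Sum>i. ennreal \<kappa> * hgauge D (S i))"
      by (intro suminf_le vol summableI)
    also have "\<dots> = ennreal \<kappa> * (\<Sum>i. hgauge D (S i))" by simp
    finally have "ennreal ((2 * r) ^ ?N) \<le> ennreal \<kappa> * (\<Sum>i. hgauge D (S i))" .
    then have "ennreal (1 / \<kappa>) * ennreal ((2 * r) ^ ?N) \<le> ennreal (1 / \<kappa>) * (ennreal \<kappa> * (\<Sum>i. hgauge D (S i)))"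
      by (rule mult_left_mono) simp
    then show ?thesis
      using \<kappa> r by (simp flip: mult.assoc ennreal_mult' add: less_imp_le)
  qed
  then have "ennreal ((2 * r) ^ ?N / \<kappa>) \<le> hpre D 1 A" unfolding hpre_def by (intro INF_greatest)
  moreover have "0 < ennreal ((2 * r) ^ ?N / \<kappa>)" using \<kappa> r by simp
  ultimately show ?thesis using hpre_le[of 1 D A] by (meson less_le_trans zero_less_one)
qed

section \<open>Matrices and orthogonal projections\<close>

declare transpose_matrix_vector [simp del]

lemma inner_matrix_vector: "(A *v x) \<bullet> y = x \<bullet> (transpose A *v (y :: real ^ 'm))" for A :: "real ^ 'n ^ 'm"
  by (metis dot_lmul_matrix vector_transpose_matrix)

lemma bounded_bilinear_matrix_mult:
  "bounded_bilinear ((**) :: real ^ 'n ^ 'm \<Rightarrow> real ^ 'p ^ 'n \<Rightarrow> real ^ 'p ^ 'm)"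
  unfolding bilinear_conv_bounded_bilinear[symmetric] bilinear_def
proof (intro conjI allI)
  show "linear ((**) A)" for A :: "real ^ 'n ^ 'm"
    by (rule linearI)
      (simp_all add: vec_eq_iff matrix_matrix_mult_def distrib_left sum.distrib sum_distrib_left mult.left_commute)
  show "linear (\<lambda>A. A ** B)" for B :: "real ^ 'p ^ 'n"
    by (rule linearI)
      (simp_all add: vec_eq_iff matrix_matrix_mult_def distrib_right sum.distrib sum_distrib_left mult.assoc)
qed

interpretation matmul: bounded_bilinear "(**) :: real ^ 'n ^ 'm \<Rightarrow> real ^ 'p ^ 'n \<Rightarrow> real ^ 'p ^ 'm"
  by (rule bounded_bilinear_matrix_mult)

lemma bounded_linear_transpose: "bounded_linear (transpose :: real ^ 'n ^ 'm \<Rightarrow> real ^ 'm ^ 'n)"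
  by (intro linear_conv_bounded_linear[THEN iffD1] linearI) (simp_all add: vec_eq_iff transpose_def)

lemma transpose_add: "transpose (A + B) = transpose A + transpose (B :: real ^ 'n ^ 'm)"
  and transpose_diff: "transpose (A - B) = transpose A - transpose (B :: real ^ 'n ^ 'm)"
  and transpose_scaleR: "transpose (c *\<^sub>R A) = c *\<^sub>R transpose (A :: real ^ 'n ^ 'm)"
  by (simp_all add: vec_eq_iff transpose_def)

lemma continuous_on_det: "continuous_on S (det :: real ^ 'n ^ 'n \<Rightarrow> real)"
  unfolding det_def by (intro continuous_intros)

lemma matrix_inv_mult:
  fixes A :: "real ^ 'n ^ 'n"
  assumes "invertible A"
  shows "A ** matrix_inv A = mat 1" "matrix_inv A ** A = mat 1"
  using assms unfolding invertible_def matrix_inv_def by (metis (mono_tags, lifting) someI_ex)+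

lemma matrix_inv_eqI:
  fixes A :: "real ^ 'n ^ 'n"
  assumes "A ** B = mat 1"
  shows "matrix_inv A = B" "invertible A"
proof -
  show i: "invertible A" using assms invertible_right_inverse by blast
  have "matrix_inv A = matrix_inv A ** (A ** B)" using assms by simp
  also have "\<dots> = B" by (simp add: matrix_mul_assoc matrix_inv_mult[OF i])
  finally show "matrix_inv A = B" .
qed

text \<open>Cramer's rule: the entries of the inverse are quotients of determinants, hence
  continuous where \<open>det\<close> does not vanish.\<close>

lemma continuous_on_matrix_inv: "continuous_on {A :: real ^ 'n ^ 'n. invertible A} matrix_inv"
proof -
  let ?M = "\<lambda>(A :: real ^ 'n ^ 'n) i j. (\<chi> r c. if c = i then axis j 1 $ r else A $ r $ c) :: real ^ 'n ^ 'n"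
  let ?f = "\<lambda>A :: real ^ 'n ^ 'n. (\<chi> i j. det (?M A i j) / det A) :: real ^ 'n ^ 'n"
  have cM: "continuous_on S (\<lambda>A. ?M A i j)" for S i j
  proof (intro continuous_on_vec_lambda)
    fix r c show "continuous_on S (\<lambda>A. if c = i then axis j 1 $ r else A $ r $ c)"
      by (cases "c = i") (auto intro!: continuous_intros)
  qed
  have "continuous_on {A :: real ^ 'n ^ 'n. invertible A} ?f"
  proof (intro continuous_on_vec_lambda continuous_on_divide)
    fix i j show "continuous_on {A :: real ^ 'n ^ 'n. invertible A} (\<lambda>A. det (?M A i j))"
      by (rule continuous_on_compose2[OF continuous_on_det[of UNIV] cM]) simp
  qed (auto simp: invertible_det_nz intro: continuous_on_det)
  moreover have "?f A = matrix_inv A" if "A \<in> {A. invertible A}" for A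
  proof -
    have d: "det A \<noteq> 0" using that invertible_det_nz by blast
    have "A *v (matrix_inv A *v axis j 1) = axis j 1" for j
      using that by (simp add: matrix_vector_mul_assoc matrix_inv_mult)
    then have "matrix_inv A *v axis j 1 = (\<chi> i. det (?M A i j) / det A)" for j
      using cramer[OF d] by blast
    then show ?thesis
      by (simp add: vec_eq_iff matrix_vector_mult_def axis_def if_distrib[of "(*) _"] cong: if_cong)
  qed
  ultimately show ?thesis
    using continuous_on_cong[OF refl, of "{A. invertible A}" ?f matrix_inv] by blast
qed

lemma open_invertible: "open {A :: real ^ 'n ^ 'n. invertible A}"
proof -
  have "{A :: real ^ 'n ^ 'n. invertible A} = det -` (- {0})" by (auto simp: invertible_det_nz)
  moreover have "open (det -` (- {0 :: real}) :: (real ^ 'n ^ 'n) set)"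
    by (intro open_vimage continuous_on_det) auto
  ultimately show ?thesis by simp
qed

lemma has_derivative_matrix_inv:
  fixes A :: "real ^ 'n ^ 'n"
  assumes A: "invertible A"
  shows "(matrix_inv has_derivative (\<lambda>h. - (matrix_inv A ** h ** matrix_inv A))) (at A)"
proof -
  let ?i = "matrix_inv :: real ^ 'n ^ 'n \<Rightarrow> real ^ 'n ^ 'n"
  obtain K where K: "0 < K" "\<And>(X :: real ^ 'n ^ 'n) (Y :: real ^ 'n ^ 'n). norm (X ** Y) \<le> norm X * norm Y * K"
    using matmul.pos_bounded by blast
  have "isCont ?i A"
    using continuous_on_matrix_inv A unfolding continuous_on_eq_continuous_at[OF open_invertible] by blast
  then have lim: "((\<lambda>B. norm (?i A - ?i B) * (norm (?i A) * K * K)) \<longlongrightarrow> norm (?i A - ?i A) * (norm (?i A) * K * K)) (at A)"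
    by (intro tendsto_intros) (simp add: isCont_def)
  obtain e where e: "0 < e" "\<And>B. dist B A < e \<Longrightarrow> invertible B"
    using open_invertible A unfolding open_dist by (auto simp: mem_Collect_eq)
  show ?thesis
  proof (rule has_derivativeI_sandwich[OF e(1)])
    show "bounded_linear (\<lambda>h. - (?i A ** h ** ?i A))"
      by (intro bounded_linear_minus bounded_linear_compose[OF matmul.bounded_linear_left] matmul.bounded_linear_right)
    show "((\<lambda>B. norm (?i A - ?i B) * (norm (?i A) * K * K)) \<longlongrightarrow> 0) (at A)" using lim by simp
    fix B assume B: "B \<noteq> A" "dist B A < e"
    then have iB: "invertible B" using e by blast
    \<comment> \<open>The remainder contains the two small factors \<open>?i A - ?i B\<close> and
      \<open>B - A\<close>. The first tends to 0 by continuity, so the remainder is of smaller order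
      than \<open>norm (B - A)\<close>.\<close>
    have "?i B - ?i A - - (?i A ** (B - A) ** ?i A) = (?i A - ?i B) ** ((B - A) ** ?i A)"
    proof -
      have "(?i A - ?i B) ** ((B - A) ** ?i A)
         = ?i A ** (B - A) ** ?i A - (?i B ** B) ** ?i A + ?i B ** (A ** ?i A)"
        by (simp add: matmul.diff_left matmul.diff_right matrix_mul_assoc)
      also have "\<dots> = ?i A ** (B - A) ** ?i A - ?i A + ?i B"
        using matrix_inv_mult[OF A] matrix_inv_mult[OF iB] by simp
      finally show ?thesis by simp
    qed
    also have "norm \<dots> \<le> norm (?i A - ?i B) * (norm (B - A) * norm (?i A) * K) * K"
      by (intro order.trans[OF K(2)] mult_right_mono mult_left_mono K(2)) (use K(1) in auto)
    finally show "norm (?i B - ?i A - - (?i A ** (B - A) ** ?i A)) / norm (B - A)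
        \<le> norm (?i A - ?i B) * (norm (?i A) * K * K)"
      using B(1) by (simp add: divide_simps mult_ac)
  qed
qed

lemma has_derivative_matrix_inv':
  fixes F :: "'a::real_normed_vector \<Rightarrow> real ^ 'n ^ 'n"
  assumes "(F has_derivative F') (at x)" "invertible (F x)"
  shows "((\<lambda>y. matrix_inv (F y)) has_derivative (\<lambda>h. - (matrix_inv (F x) ** F' h ** matrix_inv (F x)))) (at x)"
  using diff_chain_at[OF assms(1) has_derivative_matrix_inv[OF assms(2)]] by (simp add: o_def)

lemma invertible_iff_inj: "invertible A \<longleftrightarrow> inj ((*v) A)" for A :: "real ^ 'n ^ 'n"
  by (simp add: invertible_left_inverse matrix_left_invertible_injective)

lemma invertibleI_ker: "(\<And>x. A *v x = 0 \<Longrightarrow> x = 0) \<Longrightarrow> invertible A" for A :: "real ^ 'n ^ 'n"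
  unfolding invertible_left_inverse matrix_left_invertible_ker by simp

text \<open>The rank-one matrix \<open>y x^T\<close>. It is the tensor of \<open>x\<close> and
  \<open>y\<close> seen as a homomorphism from the line of \<open>x\<close> to the line of
  \<open>y\<close>, which explains the opposite order of the factors.\<close>

definition outer :: "real ^ 'm \<Rightarrow> real ^ 'n \<Rightarrow> real ^ 'n ^ 'm" where
  "outer y x = (\<chi> i j. y $ i * x $ j)"

lemma outer_mult_vec: "outer y x *v v = (x \<bullet> v) *\<^sub>R y"
  by (simp add: vec_eq_iff outer_def matrix_vector_mult_def inner_vec_def sum_distrib_left sum_distrib_right mult_ac)

lemma transpose_outer: "transpose (outer y x) = outer x y"
  by (simp add: vec_eq_iff outer_def transpose_def)

lemma matrix_mult_outer: "A ** outer y x = outer (A *v y) x"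
  by (simp add: vec_eq_iff outer_def matrix_vector_mult_def matrix_matrix_mult_def sum_distrib_left mult_ac)

lemma outer_matrix_mult: "outer y x ** A = outer y (transpose A *v x)"
  by (simp add: vec_eq_iff outer_def transpose_def matrix_vector_mult_def matrix_matrix_mult_def sum_distrib_left mult_ac)

lemma inner_outer: "X \<bullet> outer y x = y \<bullet> (X *v x)"
  by (simp add: outer_def inner_vec_def matrix_vector_mult_def sum_distrib_left mult_ac)

lemma inner_outer_outer: "outer y x \<bullet> outer y' x' = (y \<bullet> y') * (x \<bullet> x')"
  by (simp add: inner_outer outer_mult_vec inner_commute)

text \<open>Self-adjointness makes \<open>x - M *v x\<close> orthogonal to \<open>L\<close>, and
  Pythagoras identifies \<open>M *v x\<close> as the nearest point. This replaces the metric
  definition of \<open>proj_matrix\<close> by algebra.\<close>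

lemma proj_matrix_eqI:
  fixes M :: "real ^ 'n ^ 'n"
  assumes L: "subspace L" and "transpose M = M" and range: "\<And>x. M *v x \<in> L" and id: "\<And>x. x \<in> L \<Longrightarrow> M *v x = x"
  shows "proj_matrix L = M"
proof -
  have "closest_point L x = M *v x" for x
  proof (rule closest_point_unique[symmetric])
    show "convex L" "closed L" using L by (auto intro: subspace_imp_convex closed_subspace)
    show "M *v x \<in> L" by (rule range)
    show "\<forall>z\<in>L. dist x (M *v x) \<le> dist x z"
    proof
      fix z assume z: "z \<in> L"
      have zd: "M *v x - z \<in> L" using L range z by (simp add: subspace_diff)
      then have "(x - M *v x) \<bullet> (M *v x - z) = 0"
        using inner_matrix_vector[of M x "M *v x - z"] assms(2) id by (simp add: inner_diff_left)
      then have "norm (x - z) ^ 2 = norm (x - M *v x) ^ 2 + norm (M *v x - z) ^ 2"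
        using norm_add_Pythagorean[of "x - M *v x" "M *v x - z"] by (simp add: orthogonal_def)
      then have "norm (x - M *v x) ^ 2 \<le> norm (x - z) ^ 2" by simp
      then show "dist x (M *v x) \<le> dist x z" by (simp add: dist_norm power2_le_iff_abs_le)
    qed
  qed
  then have "closest_point L = (\<lambda>x. M *v x)" by blast
  then show ?thesis by (simp add: proj_matrix_def)
qed

lemma proj_matrix_properties:
  fixes L :: "(real ^ 'n) set"
  assumes L: "subspace L"
  shows transpose_proj_matrix: "transpose (proj_matrix L) = proj_matrix L"
    and proj_matrix_in: "proj_matrix L *v x \<in> L"
    and proj_matrix_id: "x \<in> L \<Longrightarrow> proj_matrix L *v x = x"
proof -
  obtain B where B: "B \<subseteq> L" "pairwise orthogonal B" "\<And>x. x \<in> B \<Longrightarrow> norm x = 1"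
      "independent B" "card B = dim L" "span B = L"
    using orthonormal_basis_subspace[OF L] by blast
  have fB: "finite B" using B(4) independent_imp_finite by blast
  define M where "M = (\<Sum>b\<in>B. outer b b)"
  have Mv: "M *v x = (\<Sum>b\<in>B. (b \<bullet> x) *\<^sub>R b)" for x
    unfolding M_def using fB
    by (induction B rule: finite_induct) (simp_all add: matrix_vector_mult_add_rdistrib outer_mult_vec)
  have t: "transpose M = M"
    unfolding M_def using fB
    by (induction B rule: finite_induct) (simp_all add: transpose_add transpose_outer, simp add: transpose_def vec_eq_iff)
  have r: "M *v x \<in> L" for x
    unfolding Mv using B(1) by (intro subspace_sum[OF L] subspace_scale[OF L]) auto
  have i: "M *v x = x" if "x \<in> L" for x
  proof -
    have "x \<in> span B" using that B(6) by simp
    then show ?thesis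
    proof (induction rule: span_induct)
      show "subspace (Collect (\<lambda>x. M *v x = x))"
        by (auto simp: subspace_def matrix_vector_right_distrib matrix_vector_mult_scaleR)
      fix c assume c: "c \<in> B"
      have "M *v c = (\<Sum>b\<in>B. if b = c then c else 0)"
        unfolding Mv using c B(2,3)
        by (intro sum.cong refl) (auto simp: pairwise_def orthogonal_def norm_eq_1)
      then show "M *v c = c" using c fB by simp
    qed
  qed
  have "proj_matrix L = M" by (rule proj_matrix_eqI[OF L t r i])
  then show "transpose (proj_matrix L) = proj_matrix L" "proj_matrix L *v x \<in> L"
    using t r by auto
  show "proj_matrix L *v x = x" if "x \<in> L"
    using \<open>proj_matrix L = M\<close> i that by auto
qed

lemma proj_matrix_idem:
  assumes "subspace L" shows "proj_matrix L ** proj_matrix L = proj_matrix L"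
  using proj_matrix_in[OF assms] proj_matrix_id[OF assms]
  by (simp add: matrix_eq flip: matrix_vector_mul_assoc)

lemma proj_matrix_range: "subspace L \<Longrightarrow> x \<in> L \<longleftrightarrow> proj_matrix L *v x = x"
  using proj_matrix_in proj_matrix_id by metis

lemma proj_matrix_inj: "subspace L \<Longrightarrow> subspace L' \<Longrightarrow> proj_matrix L = proj_matrix L' \<Longrightarrow> L = L'"
  using proj_matrix_range[of L] proj_matrix_range[of L'] by (intro set_eqI) simp

lemma proj_matrix_orthogonal:
  assumes "subspace L" "\<And>z. z \<in> L \<Longrightarrow> x \<bullet> z = 0"
  shows "proj_matrix L *v x = 0"
proof -
  have "(proj_matrix L *v x) \<bullet> (proj_matrix L *v x) = x \<bullet> (proj_matrix L *v (proj_matrix L *v x))"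
    using inner_matrix_vector[of "proj_matrix L" x] transpose_proj_matrix[OF assms(1)] by simp
  also have "\<dots> = 0" using assms(2) proj_matrix_in[OF assms(1)] by blast
  finally show ?thesis by simp
qed

lemma proj_matrix_compl:
  assumes "subspace L" "z \<in> L"
  shows "(x - proj_matrix L *v x) \<bullet> z = 0"
  using inner_matrix_vector[of "proj_matrix L" x z] assms
  by (simp add: inner_diff_left transpose_proj_matrix proj_matrix_id)

lemma subspace_act: "subspace L \<Longrightarrow> subspace (act g L)"
  unfolding act_def by (intro linear_subspace_image) auto

lemma dim_act:
  assumes "invertible g" shows "dim (act g L) = dim (L :: (real ^ 'n) set)"
proof -
  have "inj ((*v) g)" using assms by (simp add: invertible_iff_inj)
  then show ?thesis unfolding act_def by (intro dim_image_eq) (auto intro: inj_on_subset)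
qed

lemma act_act: "act g (act h L) = act (g ** h) L"
  by (auto simp: act_def image_image matrix_vector_mul_assoc)

lemma act_mat_1 [simp]: "act (mat 1) L = L"
  by (simp add: act_def)

lemma act_mono: "L \<subseteq> L' \<Longrightarrow> act g L \<subseteq> act g L'"
  by (auto simp: act_def)

lemma act_Int: "invertible g \<Longrightarrow> act g (L \<inter> M) = act g L \<inter> act g (M :: (real ^ 'n) set)"
  unfolding act_def by (intro image_Int) (simp add: invertible_iff_inj)

lemma orthogonal_matrix_invertible: "orthogonal_matrix g \<Longrightarrow> invertible (g :: real ^ 'n ^ 'n)"
  by (auto simp: orthogonal_matrix_def invertible_def)

lemma orthogonal_matrix_inner: "orthogonal_matrix g \<Longrightarrow> (g *v x) \<bullet> (g *v y) = x \<bullet> (y :: real ^ 'n)"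
  by (simp add: inner_matrix_vector matrix_vector_mul_assoc orthogonal_matrix)

lemma orthogonal_matrix_mult_transpose:
  "orthogonal_matrix g \<Longrightarrow> transpose g ** g = mat 1" "orthogonal_matrix g \<Longrightarrow> g ** transpose g = mat 1"
  by (auto simp: orthogonal_matrix_def)

lemma proj_matrix_act:
  assumes "orthogonal_matrix g" "subspace L"
  shows "proj_matrix (act g L) = g ** proj_matrix L ** transpose g"
proof (rule proj_matrix_eqI)
  show "subspace (act g L)" using assms by (rule_tac subspace_act)
  show "transpose (g ** proj_matrix L ** transpose g) = g ** proj_matrix L ** transpose g"
    using assms by (simp add: matrix_transpose_mul transpose_proj_matrix matrix_mul_assoc)
  show "g ** proj_matrix L ** transpose g *v x \<in> act g L" for x
    using proj_matrix_in[OF assms(2)] by (auto simp: act_def simp flip: matrix_vector_mul_assoc)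
  fix x assume "x \<in> act g L"
  then obtain z where z: "z \<in> L" "x = g *v z" by (auto simp: act_def)
  have "g ** proj_matrix L ** transpose g *v x = g *v (proj_matrix L *v (transpose g ** g *v z))"
    by (simp add: z matrix_vector_mul_assoc matrix_mul_assoc)
  then show "g ** proj_matrix L ** transpose g *v x = x"
    using z assms by (simp add: orthogonal_matrix proj_matrix_id)
qed

text \<open>\<open>gram P A\<close> is the Gram matrix of \<open>A\<close> on the range of the projection \<open>P\<close>, extended by the
  identity on the orthogonal complement, and \<open>range_proj P A\<close> is the normal equation
  \<open>A (A\<^sup>T A)\<^sup>-\<^sup>1 A\<^sup>T\<close> for the projection onto the image of that range.\<close>

definition gram :: "real ^ 'n ^ 'n \<Rightarrow> real ^ 'n ^ 'n \<Rightarrow> real ^ 'n ^ 'n" where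
  "gram P A = P ** transpose A ** A ** P + (mat 1 - P)"

definition range_proj :: "real ^ 'n ^ 'n \<Rightarrow> real ^ 'n ^ 'n \<Rightarrow> real ^ 'n ^ 'n" where
  "range_proj P A = A ** P ** matrix_inv (gram P A) ** P ** transpose A"

text \<open>Positive definiteness: pairing the image of \<open>x\<close> with \<open>x\<close> gives
  the sum of the squared norms of \<open>A P x\<close> and \<open>x - P x\<close>. If both vanish,
  \<open>x\<close> lies in \<open>L\<close> and is killed by \<open>A\<close>.\<close>

lemma invertible_gram:
  fixes L :: "(real ^ 'n) set"
  assumes L: "subspace L" and inj: "\<And>x. x \<in> L \<Longrightarrow> A *v x = 0 \<Longrightarrow> x = 0"
  shows "invertible (gram (proj_matrix L) A)"
proof -
  let ?P = "proj_matrix L"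
  have "x = 0" if "gram ?P A *v x = 0" for x
  proof -
    have d: "?P *v (x - ?P *v x) = 0"
      using L by (simp add: matrix_vector_mult_diff_distrib matrix_vector_mul_assoc proj_matrix_idem)
    have "0 = (gram ?P A *v x) \<bullet> x" using that by simp
    also have "\<dots> = (?P *v (transpose A *v (A *v (?P *v x)))) \<bullet> x + (x - ?P *v x) \<bullet> x"
      by (simp add: gram_def matrix_vector_mult_add_rdistrib inner_add_left matrix_vector_mult_diff_rdistrib
          flip: matrix_vector_mul_assoc)
    also have "(?P *v (transpose A *v (A *v (?P *v x)))) \<bullet> x = (A *v (?P *v x)) \<bullet> (A *v (?P *v x))"
      using L by (simp add: inner_matrix_vector transpose_proj_matrix)
    also have "(x - ?P *v x) \<bullet> x = (x - ?P *v x) \<bullet> (x - ?P *v x)"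
      using proj_matrix_compl[OF L proj_matrix_in[OF L], of x x] by (simp add: inner_diff_right)
    finally have e: "(A *v (?P *v x)) \<bullet> (A *v (?P *v x)) + (x - ?P *v x) \<bullet> (x - ?P *v x) = 0" by simp
    then have "(A *v (?P *v x)) \<bullet> (A *v (?P *v x)) = 0" "(x - ?P *v x) \<bullet> (x - ?P *v x) = 0"
      using inner_ge_zero[of "A *v (?P *v x)"] inner_ge_zero[of "x - ?P *v x"] by linarith+
    then show "x = 0" using inj[OF proj_matrix_in[OF L], of x] by simp
  qed
  then show ?thesis by (rule invertibleI_ker)
qed

text \<open>On the range of \<open>P\<close> the Gram matrix acts as \<open>P A^T A P\<close>, so
  its inverse cancels in \<open>range_proj P A ** A ** P\<close> and leaves \<open>A ** P\<close>.
  The formula is rational in \<open>A\<close>; velocities, smoothness and Lipschitz bounds of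
  projections are read off from it.\<close>

lemma range_proj:
  fixes L :: "(real ^ 'n) set"
  assumes L: "subspace L" and inj: "\<And>x. x \<in> L \<Longrightarrow> A *v x = 0 \<Longrightarrow> x = 0"
  shows "proj_matrix (act A L) = range_proj (proj_matrix L) A"
proof -
  let ?P = "proj_matrix L"
  let ?N = "gram ?P A"
  have N: "invertible ?N" by (rule invertible_gram[OF assms])
  have PP: "?P ** ?P = ?P" using L by (rule proj_matrix_idem)
  have tP: "transpose ?P = ?P" using L by (rule transpose_proj_matrix)
  have tN: "transpose ?N = ?N"
    by (simp add: gram_def transpose_add transpose_diff matrix_transpose_mul tP matrix_mul_assoc transpose_mat)
  have NP: "?N ** ?P = ?P ** transpose A ** A ** ?P"
    by (simp add: gram_def matmul.add_left matmul.diff_left PP flip: matrix_mul_assoc)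
  have "transpose (matrix_inv ?N) = matrix_inv ?N"
  proof (rule matrix_inv_eqI(1)[symmetric])
    have "transpose (matrix_inv ?N ** ?N) = mat 1"
      using matrix_inv_mult[OF N] by (simp add: transpose_mat)
    then show "?N ** transpose (matrix_inv ?N) = mat 1" by (simp add: matrix_transpose_mul tN)
  qed
  then have "transpose (range_proj ?P A) = range_proj ?P A"
    by (simp add: range_proj_def matrix_transpose_mul tP matrix_mul_assoc)
  moreover have "range_proj ?P A *v x \<in> act A L" for x
    unfolding range_proj_def act_def
    using proj_matrix_in[OF L] by (auto simp flip: matrix_vector_mul_assoc)
  moreover have "range_proj ?P A *v y = y" if y: "y \<in> act A L" for y
  proof -
    obtain x where x: "x \<in> L" "y = A *v x" using y by (auto simp: act_def)
    have "range_proj ?P A ** A ** ?P = A ** ?P ** (matrix_inv ?N ** (?P ** transpose A ** A ** ?P))"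
      by (simp add: range_proj_def matrix_mul_assoc)
    also have "\<dots> = A ** ?P"
      unfolding NP[symmetric] matrix_mul_assoc[of "matrix_inv ?N"] matrix_inv_mult[OF N]
      by (simp add: PP flip: matrix_mul_assoc)
    finally have "range_proj ?P A ** A ** ?P *v x = A ** ?P *v x" by simp
    then show ?thesis using x L by (simp add: proj_matrix_id flip: matrix_vector_mul_assoc)
  qed
  ultimately show ?thesis by (intro proj_matrix_eqI subspace_act L)
qed

section \<open>Frames adapted to a flag\<close>

declare One_nat_def [simp del]

lemma orthonormal_family_independent:
  fixes b :: "'i \<Rightarrow> 'a::euclidean_space"
  assumes on: "\<And>i j. i \<in> I \<Longrightarrow> j \<in> I \<Longrightarrow> b i \<bullet> b j = (if i = j then 1 else 0)"
  shows "inj_on b I" "independent (b ` I)"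
proof -
  show inj: "inj_on b I"
  proof (rule inj_onI)
    fix i j assume ij: "i \<in> I" "j \<in> I" "b i = b j"
    then show "i = j" using on[of i i] on[of i j] by (simp split: if_splits)
  qed
  have "pairwise orthogonal (b ` I)"
    using on by (auto simp: pairwise_def orthogonal_def)
  moreover have "0 \<notin> b ` I" using on by force
  ultimately show "independent (b ` I)" by (rule pairwise_orthogonal_independent)
qed

lemma dim_span_orthonormal_family:
  fixes b :: "'i \<Rightarrow> 'a::euclidean_space"
  assumes "\<And>i j. i \<in> I \<Longrightarrow> j \<in> I \<Longrightarrow> b i \<bullet> b j = (if i = j then 1 else 0)"
  shows "dim (span (b ` I)) = card I"
  using orthonormal_family_independent[OF assms] by (simp add: dim_eq_card_independent card_image)

lemma orthonormal_family_expand: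
  fixes b :: "'i \<Rightarrow> 'a::euclidean_space"
  assumes on: "\<And>i j. i \<in> I \<Longrightarrow> j \<in> I \<Longrightarrow> b i \<bullet> b j = (if i = j then 1 else 0)"
    and I: "finite I" "card I = DIM('a)"
  shows "x = (\<Sum>i\<in>I. (b i \<bullet> x) *\<^sub>R b i)"
proof -
  have "dim (span (b ` I)) = DIM('a)" using dim_span_orthonormal_family[OF on] I by simp
  then have "x \<in> span (b ` I)" using dim_eq_full[of "span (b ` I)"] by (simp add: span_span)
  then show ?thesis
  proof (induction rule: span_induct)
    show "subspace (Collect (\<lambda>x. x = (\<Sum>i\<in>I. (b i \<bullet> x) *\<^sub>R b i)))"
    proof (auto simp: subspace_def inner_add_right scaleR_add_left sum.distrib)
      fix c x assume "x = (\<Sum>i\<in>I. (b i \<bullet> x) *\<^sub>R b i)"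
      then have "c *\<^sub>R x = c *\<^sub>R (\<Sum>i\<in>I. (b i \<bullet> x) *\<^sub>R b i)" by simp
      then show "c *\<^sub>R x = (\<Sum>i\<in>I. (c * (b i \<bullet> x)) *\<^sub>R b i)" by (simp add: scaleR_sum_right)
    qed
    fix c assume "c \<in> b ` I"
    then obtain j where j: "j \<in> I" "c = b j" by blast
    have "(\<Sum>i\<in>I. (b i \<bullet> c) *\<^sub>R b i) = (\<Sum>i\<in>I. if i = j then b j else 0)"
      using on j by (intro sum.cong) auto
    then show "c = (\<Sum>i\<in>I. (b i \<bullet> c) *\<^sub>R b i)" using j I by simp
  qed
qed

lemma orthonormal_family_subspace:
  fixes b :: "'i \<Rightarrow> 'a::euclidean_space"
  assumes on: "\<And>i j. i \<in> I \<Longrightarrow> j \<in> I \<Longrightarrow> b i \<bullet> b j = (if i = j then 1 else 0)"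
    and I: "finite I" "card I = DIM('a)" and J: "J \<subseteq> I"
  shows "{x. \<forall>i\<in>I - J. b i \<bullet> x = 0} = span (b ` J)"
    and "dim {x. \<forall>i\<in>I - J. b i \<bullet> x = 0} = card J"
proof -
  show eq: "{x. \<forall>i\<in>I - J. b i \<bullet> x = 0} = span (b ` J)"
  proof
    show "{x. \<forall>i\<in>I - J. b i \<bullet> x = 0} \<subseteq> span (b ` J)"
    proof
      fix x assume x: "x \<in> {x. \<forall>i\<in>I - J. b i \<bullet> x = 0}"
      have "x = (\<Sum>i\<in>I. (b i \<bullet> x) *\<^sub>R b i)" by (rule orthonormal_family_expand[OF on I])
      also have "\<dots> = (\<Sum>i\<in>J. (b i \<bullet> x) *\<^sub>R b i)"
        using x I J by (intro sum.mono_neutral_right) auto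
      also have "\<dots> \<in> span (b ` J)" by (intro span_sum span_scale span_base) auto
      finally show "x \<in> span (b ` J)" .
    qed
    have "subspace {x. \<forall>i\<in>I - J. b i \<bullet> x = 0}"
      by (auto simp: subspace_def inner_add_right)
    moreover have "b ` J \<subseteq> {x. \<forall>i\<in>I - J. b i \<bullet> x = 0}" using J on by auto
    ultimately show "span (b ` J) \<subseteq> {x. \<forall>i\<in>I - J. b i \<bullet> x = 0}" by (simp add: span_minimal)
  qed
  have "dim (span (b ` J)) = card J"
    by (rule dim_span_orthonormal_family) (rule on; use J in blast)
  then show "dim {x. \<forall>i\<in>I - J. b i \<bullet> x = 0} = card J" using eq by simp
qed

lemma unit_vector_orthogonal:
  fixes S T :: "'a::euclidean_space set"
  assumes "subspace S" "subspace T" "S \<subseteq> T" "dim S < dim T"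
  obtains x where "x \<in> T" "norm x = 1" "\<And>z. z \<in> S \<Longrightarrow> x \<bullet> z = 0"
proof -
  let ?W = "{y \<in> T. \<forall>x\<in>S. orthogonal x y}"
  have "dim ?W > 0" using dim_subspace_orthogonal_to_vectors[OF assms(1-3)] assms(4) by simp
  then have "\<not> ?W \<subseteq> {0}" using dim_eq_0[of ?W] by linarith
  then obtain y where y: "y \<in> ?W" "y \<noteq> 0" by blast
  show ?thesis
  proof (rule that[of "y /\<^sub>R norm y"])
    show "y /\<^sub>R norm y \<in> T" using y assms(2) by (simp add: subspace_scale)
    show "norm (y /\<^sub>R norm y) = 1" using y by simp
    show "(y /\<^sub>R norm y) \<bullet> z = 0" if "z \<in> S" for z
      using y that by (auto simp: orthogonal_def inner_commute)
  qed
qed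

lemma flag_props:
  fixes V :: "nat \<Rightarrow> (real ^ 'n) set"
  assumes "complete_flag V"
  shows flag_subspace: "a \<le> CARD('n) \<Longrightarrow> subspace (V a)"
    and flag_dim: "a \<le> CARD('n) \<Longrightarrow> dim (V a) = a"
    and flag_mono: "a \<le> b \<Longrightarrow> b \<le> CARD('n) \<Longrightarrow> V a \<subseteq> V b"
    and flag_top: "V CARD('n) = UNIV"
proof -
  show s: "a \<le> CARD('n) \<Longrightarrow> subspace (V a)" and d: "a \<le> CARD('n) \<Longrightarrow> dim (V a) = a" for a
    using assms by (auto simp: complete_flag_def)
  show "V a \<subseteq> V b" if "a \<le> b" "b \<le> CARD('n)"
    using that
  proof (induction rule: dec_induct)
    case (step n)
    have "V n \<subseteq> V (Suc n)" using assms step by (simp add: complete_flag_def)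
    then show ?case using step by auto
  qed simp
  show "V CARD('n) = UNIV"
  proof -
    have "dim (V CARD('n)) = DIM(real ^ 'n)" using d[of "CARD('n)"] by simp
    then have "span (V CARD('n)) = UNIV" by (simp only: dim_eq_full)
    then show ?thesis using s[of "CARD('n)"] by (metis span_eq_iff order_refl)
  qed
qed

definition ssum :: "'a::real_vector set \<Rightarrow> 'a set \<Rightarrow> 'a set" where
  "ssum S T = {x + y | x y. x \<in> S \<and> y \<in> T}"

lemma ssum_simps:
  fixes S T :: "'a::euclidean_space set"
  assumes "subspace S" "subspace T"
  shows subspace_ssum: "subspace (ssum S T)" and dim_ssum: "dim (ssum S T) + dim (S \<inter> T) = dim S + dim T"
    and ssum_left: "S \<subseteq> ssum S T" and ssum_right: "T \<subseteq> ssum S T"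
proof -
  show "subspace (ssum S T)" unfolding ssum_def using assms by (rule subspace_sums)
  show "dim (ssum S T) + dim (S \<inter> T) = dim S + dim T" unfolding ssum_def using assms by (rule dim_sums_Int)
  show "S \<subseteq> ssum S T"
    using subspace_0[OF assms(2)] by (force simp: ssum_def)
  show "T \<subseteq> ssum S T"
    using subspace_0[OF assms(1)] by (force simp: ssum_def)
qed

text \<open>\<open>J\<close> consists of the steps of the flag at which the intersection with \<open>L\<close> grows.\<close>

lemma flag_frame:
  fixes V :: "nat \<Rightarrow> (real ^ 'n) set"
  assumes V: "complete_flag V" and L: "subspace L"
  obtains u J where
    "\<And>i j. i \<in> {1..CARD('n)} \<Longrightarrow> j \<in> {1..CARD('n)} \<Longrightarrow> u i \<bullet> u j = (if i = j then 1 else 0)"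
    "J \<subseteq> {1..CARD('n)}"
    "\<And>a. a \<le> CARD('n) \<Longrightarrow> dim (L \<inter> V a) = card (J \<inter> {1..a})"
    "\<And>i. i \<in> J \<Longrightarrow> u i \<in> L \<inter> V i"
    "\<And>i z. i \<in> {1..CARD('n)} - J \<Longrightarrow> z \<in> L \<Longrightarrow> u i \<bullet> z = 0"
    "\<And>i a z. i \<in> {1..CARD('n)} - J \<Longrightarrow> a < i \<Longrightarrow> z \<in> V a \<Longrightarrow> u i \<bullet> z = 0"
proof -
  let ?n = "CARD('n)"
  define J where "J = {i \<in> {1..?n}. dim (L \<inter> V (i - 1)) < dim (L \<inter> V i)}"
  have sI: "subspace (L \<inter> V a)" if "a \<le> ?n" for a using flag_subspace[OF V that] L by (simp add: subspace_inter)
  have sS: "subspace (ssum L (V a))" if "a \<le> ?n" for a using flag_subspace[OF V that] L by (rule_tac subspace_ssum)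
  have dS: "dim (ssum L (V a)) + dim (L \<inter> V a) = dim L + a" if "a \<le> ?n" for a
    using dim_ssum[OF L flag_subspace[OF V that]] flag_dim[OF V that] by simp
  have mI: "L \<inter> V a \<subseteq> L \<inter> V b" if "a \<le> b" "b \<le> ?n" for a b using flag_mono[OF V that] by blast
  have mS: "ssum L (V a) \<subseteq> ssum L (V b)" if "a \<le> b" "b \<le> ?n" for a b
    using flag_mono[OF V that] by (auto simp: ssum_def)
  have step: "dim (L \<inter> V i) \<le> dim (L \<inter> V (i - 1)) + 1" if "i \<in> {1..?n}" for i
  proof -
    have i: "i \<le> ?n" "i - 1 \<le> ?n" "1 \<le> i" using that by auto
    show ?thesis
      using dS[OF i(1)] dS[OF i(2)] dim_subset[OF mS[of "i - 1" i]] i by linarith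
  qed
  \<comment> \<open>By the dimension formula exactly one of \<open>L \<inter> V i\<close> and
    \<open>L + V i\<close> grows at step \<open>i\<close>. The new unit vector is taken in the one
    that grows, orthogonal to its predecessor. So it is orthogonal to all earlier vectors and,
    outside \<open>J\<close>, to all of \<open>L\<close>.\<close>
  have ex: "\<exists>x. norm x = 1 \<and> (if i \<in> J then x \<in> L \<inter> V i \<and> (\<forall>z\<in>L \<inter> V (i - 1). x \<bullet> z = 0)
      else x \<in> ssum L (V i) \<and> (\<forall>z\<in>ssum L (V (i - 1)). x \<bullet> z = 0))" if i: "i \<in> {1..?n}" for i
  proof (cases "i \<in> J")
    case True
    then have "dim (L \<inter> V (i - 1)) < dim (L \<inter> V i)" by (simp add: J_def)
    moreover have "i - 1 \<le> ?n" "i \<le> ?n" "i - 1 \<le> i" using i by auto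
    ultimately obtain x where "x \<in> L \<inter> V i" "norm x = 1" "\<And>z. z \<in> L \<inter> V (i - 1) \<Longrightarrow> x \<bullet> z = 0"
      using unit_vector_orthogonal[OF sI sI mI, of "i - 1" i] by blast
    then show ?thesis using True by auto
  next
    case False
    then have "dim (L \<inter> V (i - 1)) = dim (L \<inter> V i)"
      using i dim_subset[OF mI[of "i - 1" i]] by (auto simp: J_def)
    then have "dim (ssum L (V (i - 1))) < dim (ssum L (V i))"
    proof -
      have i': "i \<le> ?n" "i - 1 \<le> ?n" "1 \<le> i" using i by auto
      show ?thesis
        using dS[OF i'(1)] dS[OF i'(2)] i'(3) \<open>dim (L \<inter> V (i - 1)) = dim (L \<inter> V i)\<close> by linarith
    qed
    moreover have "i - 1 \<le> ?n" "i \<le> ?n" "i - 1 \<le> i" using i by auto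
    ultimately obtain x where "x \<in> ssum L (V i)" "norm x = 1" "\<And>z. z \<in> ssum L (V (i - 1)) \<Longrightarrow> x \<bullet> z = 0"
      using unit_vector_orthogonal[OF sS sS mS, of "i - 1" i] by blast
    then show ?thesis using False by auto
  qed
  define u where "u i = (SOME x. norm x = 1 \<and> (if i \<in> J then x \<in> L \<inter> V i \<and> (\<forall>z\<in>L \<inter> V (i - 1). x \<bullet> z = 0)
      else x \<in> ssum L (V i) \<and> (\<forall>z\<in>ssum L (V (i - 1)). x \<bullet> z = 0)))" for i
  have u: "norm (u i) = 1 \<and> (if i \<in> J then u i \<in> L \<inter> V i \<and> (\<forall>z\<in>L \<inter> V (i - 1). u i \<bullet> z = 0)
      else u i \<in> ssum L (V i) \<and> (\<forall>z\<in>ssum L (V (i - 1)). u i \<bullet> z = 0))" if i: "i \<in> {1..?n}" for i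
    using someI_ex[OF ex[OF i]] unfolding u_def .
  have uJ: "u i \<in> L \<inter> V i" "z \<in> L \<inter> V (i - 1) \<Longrightarrow> u i \<bullet> z = 0" if "i \<in> J" for i z
    using u[of i] that by (auto simp: J_def)
  have uC: "u i \<in> ssum L (V i)" "z \<in> ssum L (V (i - 1)) \<Longrightarrow> u i \<bullet> z = 0" if "i \<in> {1..?n} - J" for i z
    using u[of i] that by auto
  have uCL: "u i \<bullet> z = 0" if "i \<in> {1..?n} - J" "z \<in> L" for i z
  proof -
    have "i - 1 \<le> ?n" using that by auto
    then show ?thesis
      using uC(2)[OF that(1)] ssum_left[OF L flag_subspace[OF V, of "i - 1"]] that(2) by blast
  qed
  have uCV: "u i \<bullet> z = 0" if "i \<in> {1..?n} - J" "a < i" "z \<in> V a" for i a z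
  proof -
    have "i - 1 \<le> ?n" "a \<le> i - 1" using that by auto
    then show ?thesis
      using uC(2)[OF that(1)] ssum_right[OF L flag_subspace[OF V, of "i - 1"]] that(3)
        flag_mono[OF V, of a "i - 1"] by blast
  qed
  have lt: "u j \<bullet> u i = 0" if "i \<in> {1..?n}" "j \<in> {1..?n}" "i < j" for i j
  proof (cases "j \<in> J"; cases "i \<in> J")
    assume "j \<in> J" "i \<in> J"
    moreover have "i \<le> j - 1" "j - 1 \<le> ?n" using that by auto
    ultimately show ?thesis using uJ(1)[of i] uJ(2)[of j "u i"] mI[of i "j - 1"] by blast
  next
    assume "j \<in> J" "i \<notin> J"
    then show ?thesis using uJ(1)[of j] uCL[of i "u j"] that by (auto simp: inner_commute)
  next
    assume "j \<notin> J" "i \<in> J"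
    then show ?thesis using uJ(1)[of i] uCL[of j "u i"] that by auto
  next
    assume "j \<notin> J" "i \<notin> J"
    moreover have "i \<le> j - 1" "j - 1 \<le> ?n" using that by auto
    ultimately show ?thesis using uC(1)[of i] uC(2)[of j "u i"] mS[of i "j - 1"] that by blast
  qed
  show ?thesis
  proof (rule that[of u J])
    fix i j assume ij: "i \<in> {1..?n}" "j \<in> {1..?n}"
    show "u i \<bullet> u j = (if i = j then 1 else 0)"
      using lt[of i j] lt[of j i] u[of i] ij by (cases i j rule: linorder_cases) (auto simp: inner_commute norm_eq_1)
  next
    show "J \<subseteq> {1..?n}" by (auto simp: J_def)
    show "dim (L \<inter> V a) = card (J \<inter> {1..a})" if "a \<le> ?n" for a
      using that
    proof (induction a)
      case 0
      have "V 0 \<subseteq> {0}" using flag_dim[OF V, of 0] dim_eq_0[of "V 0"] by simp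
      then have "dim (L \<inter> V 0) = 0" unfolding dim_eq_0 by blast
      then show ?case by simp
    next
      case (Suc a)
      have i: "Suc a \<in> {1..?n}" using Suc.prems by simp
      show ?case
      proof (cases "Suc a \<in> J")
        case True
        then have "J \<inter> {1..Suc a} = insert (Suc a) (J \<inter> {1..a})" by auto
        then show ?thesis using True Suc step[OF i] by (simp add: J_def)
      next
        case False
        then have "J \<inter> {1..Suc a} = J \<inter> {1..a}" using le_Suc_eq by auto
        moreover have "dim (L \<inter> V (Suc a)) = dim (L \<inter> V a)"
          using False i dim_subset[OF mI[of a "Suc a"]] Suc.prems by (auto simp: J_def)
        ultimately show ?thesis using Suc by simp
      qed
    qed
  qed (use uJ(1) uCL uCV in blast)+
qed

lemma rank_less:
  fixes J :: "nat set"
  assumes "j \<in> J" "i < j" "0 < j"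
  shows "card (J \<inter> {1..i}) < card (J \<inter> {1..j})"
proof (rule psubset_card_mono)
  have "j \<in> J \<inter> {1..j}" "j \<notin> J \<inter> {1..i}" using assms by auto
  moreover have "J \<inter> {1..i} \<subseteq> J \<inter> {1..j}" using assms by auto
  ultimately show "J \<inter> {1..i} \<subset> J \<inter> {1..j}" by blast
qed simp

lemma rank_bij:
  fixes J :: "nat set"
  assumes "J \<subseteq> {1..n}"
  shows "bij_betw (\<lambda>i. card (J \<inter> {1..i})) J {1..card J}"
proof -
  have fJ: "finite J" using assms finite_subset by blast
  have mono: "card (J \<inter> {1..i}) < card (J \<inter> {1..j})" if "j \<in> J" "i < j" for i j
    using that assms by (intro rank_less) auto
  have inj: "inj_on (\<lambda>i. card (J \<inter> {1..i})) J"
    by (rule inj_onI) (metis mono linorder_neqE_nat less_irrefl)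
  moreover have "(\<lambda>i. card (J \<inter> {1..i})) ` J \<subseteq> {1..card J}"
  proof
    fix r assume "r \<in> (\<lambda>i. card (J \<inter> {1..i})) ` J"
    then obtain i where i: "i \<in> J" "r = card (J \<inter> {1..i})" by blast
    have "i \<in> J \<inter> {1..i}" using i assms by auto
    then have "r \<noteq> 0" using i(2) fJ by auto
    moreover have "r \<le> card J" unfolding i(2) using fJ by (intro card_mono) auto
    ultimately show "r \<in> {1..card J}" by auto
  qed
  moreover have "card ((\<lambda>i. card (J \<inter> {1..i})) ` J) = card {1..card J}" using inj by (simp add: card_image)
  ultimately show ?thesis by (simp add: bij_betw_def card_subset_eq)
qed

text \<open>The increasing enumeration of \<open>J\<close>, as the inverse of the counting function.
  Comparisons with a bound \<open>a\<close> are expressed by counts, because in the application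
  these counts are given by dimensions of intersections with the flag.\<close>

lemma rank_enumeration:
  fixes J :: "nat set"
  assumes J: "J \<subseteq> {1..n}"
  obtains r where "bij_betw r {1..card J} J" "\<And>s. s \<in> {1..card J} \<Longrightarrow> card (J \<inter> {1..r s}) = s"
    "\<And>s a. s \<in> {1..card J} \<Longrightarrow> s \<le> card (J \<inter> {1..a}) \<Longrightarrow> r s \<le> a"
    "\<And>s a. s \<in> {1..card J} \<Longrightarrow> card (J \<inter> {1..a}) < s \<Longrightarrow> a < r s"
proof -
  define r where "r = inv_into J (\<lambda>i. card (J \<inter> {1..i}))"
  have fJ: "finite J" using assms finite_subset by blast
  have b: "bij_betw r {1..card J} J" unfolding r_def by (rule bij_betw_inv_into[OF rank_bij[OF J]])
  have c: "card (J \<inter> {1..r s}) = s" if "s \<in> {1..card J}" for s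
    unfolding r_def using bij_betw_inv_into_right[OF rank_bij[OF J] that] .
  show ?thesis
  proof (rule that[OF b c])
    fix s a assume s: "s \<in> {1..card J}"
    have rJ: "r s \<in> J" using b s by (auto simp: bij_betw_def)
    show "r s \<le> a" if "s \<le> card (J \<inter> {1..a})"
    proof (rule ccontr)
      assume "\<not> r s \<le> a"
      then have "card (J \<inter> {1..a}) < card (J \<inter> {1..r s})"
        using rJ J by (intro rank_less) auto
      then show False using c[OF s] that by simp
    qed
    show "a < r s" if "card (J \<inter> {1..a}) < s"
    proof (rule ccontr)
      assume "\<not> a < r s"
      then have "card (J \<inter> {1..r s}) \<le> card (J \<inter> {1..a})" using fJ by (intro card_mono) auto
      then show False using c[OF s] that by simp
    qed
  qed auto
qed

text \<open>Orthonormal bases of the two coordinate spaces, indexed by naturals so that a box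
  \<open>(i, j)\<close> names a pair of vectors. Two instances occur: arbitrary bases for the
  Schubert vector, and coordinate axes for the volume bound, which works with elements of
  \<open>Basis\<close>.\<close>

locale grass_frame =
  fixes E F :: "nat \<Rightarrow> real ^ ('k::finite + 'm::finite)"
  assumes EE: "i \<in> {1..CARD('k)} \<Longrightarrow> i' \<in> {1..CARD('k)} \<Longrightarrow> E i \<bullet> E i' = (if i = i' then 1 else 0)"
    and FF: "j \<in> {1..CARD('m)} \<Longrightarrow> j' \<in> {1..CARD('m)} \<Longrightarrow> F j \<bullet> F j' = (if j = j' then 1 else 0)"
    and EF: "i \<in> {1..CARD('k)} \<Longrightarrow> j \<in> {1..CARD('m)} \<Longrightarrow> E i \<bullet> F j = 0"
    and E_base: "i \<in> {1..CARD('k)} \<Longrightarrow> E i \<in> base_point"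
begin

lemma frame_on: "s \<in> ({1..CARD('k)} <+> {1..CARD('m)}) \<Longrightarrow> t \<in> ({1..CARD('k)} <+> {1..CARD('m)}) \<Longrightarrow> case_sum E F s \<bullet> case_sum E F t = (if s = t then 1 else 0)"
  by (cases s; cases t) (auto simp: EE FF EF inner_commute[of "F _" "E _"] simp del: One_nat_def)

lemma card_frame_ix: "finite ({1..CARD('k)} <+> {1..CARD('m)})" "card ({1..CARD('k)} <+> {1..CARD('m)}) = DIM(real ^ ('k + 'm))"
  by (auto simp: card_Plus)

lemma sum_frame_ix: "(\<Sum>s\<in>({1..CARD('k)} <+> {1..CARD('m)}). h s) = (\<Sum>i=1..CARD('k). h (Inl i)) + (\<Sum>j=1..CARD('m). h (Inr j))"
  by (simp add: sum.Plus)

lemma frame_expand: "x = (\<Sum>i=1..CARD('k). (E i \<bullet> x) *\<^sub>R E i) + (\<Sum>j=1..CARD('m). (F j \<bullet> x) *\<^sub>R F j)"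
  using orthonormal_family_expand[OF frame_on card_frame_ix, of x] by (simp add: sum_frame_ix del: One_nat_def)

lemma subspace_base: "subspace (base_point :: (real ^ ('k + 'm)) set)"
  by (auto simp: base_point_def subspace_def)

lemma dim_base: "dim (base_point :: (real ^ ('k + 'm)) set) = CARD('k)"
proof -
  let ?d = "(\<lambda>i. axis (Inl i) 1) ` (UNIV :: 'k set) :: (real ^ ('k + 'm)) set"
  have "base_point = {x :: real ^ ('k + 'm). \<forall>i\<in>Basis. i \<notin> ?d \<longrightarrow> x \<bullet> i = 0}"
  proof (intro set_eqI iffI)
    fix x :: "real ^ ('k + 'm)" assume x: "x \<in> base_point"
    have "x \<bullet> i = 0" if "i \<in> Basis" "i \<notin> ?d" for i
    proof -
      from that(1) obtain s where s: "i = axis s 1" unfolding Basis_vec_def by auto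
      with that(2) obtain j where "s = Inr j" by (cases s) auto
      then show ?thesis using x s by (simp add: base_point_def inner_axis)
    qed
    then show "x \<in> {x. \<forall>i\<in>Basis. i \<notin> ?d \<longrightarrow> x \<bullet> i = 0}" by simp
  next
    fix x :: "real ^ ('k + 'm)" assume x: "x \<in> {x. \<forall>i\<in>Basis. i \<notin> ?d \<longrightarrow> x \<bullet> i = 0}"
    have "x $ Inr j = 0" for j
    proof -
      have "axis (Inr j) 1 \<in> (Basis :: (real ^ ('k + 'm)) set)" by (simp add: axis_in_Basis_iff)
      moreover have "axis (Inr j) 1 \<notin> ?d" by (auto simp: axis_eq_axis)
      ultimately have "x \<bullet> axis (Inr j) 1 = 0" using x by blast
      then show ?thesis by (simp add: inner_axis)
    qed
    then show "x \<in> base_point" by (simp add: base_point_def)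
  qed
  moreover have "?d \<subseteq> Basis" by (auto simp: axis_in_Basis_iff)
  moreover have "card ?d = CARD('k)"
    by (intro card_image) (auto simp: inj_on_def axis_eq_axis)
  ultimately show ?thesis using dim_substandard[of ?d] by simp
qed

lemma base_span: "base_point = span (E ` {1..CARD('k)})"
proof (rule subspace_dim_equal[symmetric])
  show "span (E ` {1..CARD('k)}) \<subseteq> base_point"
    using E_base subspace_base by (intro span_minimal) auto
  have "dim (span (E ` {1..CARD('k)})) = card {1..CARD('k)}"
    using EE by (rule dim_span_orthonormal_family)
  then show "dim (base_point :: (real ^ ('k + 'm)) set) \<le> dim (span (E ` {1..CARD('k)}))"
    by (simp add: dim_base del: dim_span)
qed (simp_all add: subspace_base)

lemma F_base: "j \<in> {1..CARD('m)} \<Longrightarrow> x \<in> base_point \<Longrightarrow> F j \<bullet> x = 0"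
proof -
  assume j: "j \<in> {1..CARD('m)}" and "x \<in> base_point"
  then have "x \<in> span (E ` {1..CARD('k)})" using base_span by simp
  then show "F j \<bullet> x = 0"
  proof (induction rule: span_induct)
    show "subspace (Collect (\<lambda>x. F j \<bullet> x = 0))" by (auto simp: subspace_def inner_add_right)
  qed (use EF j in \<open>auto simp: inner_commute\<close>)
qed

lemma base_iff: "x \<in> base_point \<longleftrightarrow> (\<forall>j\<in>{1..CARD('m)}. F j \<bullet> x = 0)"
proof
  assume "\<forall>j\<in>{1..CARD('m)}. F j \<bullet> x = 0"
  then have "x = (\<Sum>i=1..CARD('k). (E i \<bullet> x) *\<^sub>R E i)" using frame_expand[of x] by simp
  also have "\<dots> \<in> base_point" by (intro subspace_sum subspace_scale subspace_base E_base)
  finally show "x \<in> base_point" .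
qed (use F_base in auto)

lemma matrix_of_frame:
  fixes E' F' :: "nat \<Rightarrow> real ^ ('k + 'm)"
  obtains A where "\<And>i. i \<in> {1..CARD('k)} \<Longrightarrow> A *v E i = E' i" "\<And>j. j \<in> {1..CARD('m)} \<Longrightarrow> A *v F j = F' j"
    "\<And>x. A *v x = (\<Sum>i=1..CARD('k). (E i \<bullet> x) *\<^sub>R E' i) + (\<Sum>j=1..CARD('m). (F j \<bullet> x) *\<^sub>R F' j)"
proof -
  let ?f = "\<lambda>x. (\<Sum>i=1..CARD('k). (E i \<bullet> x) *\<^sub>R E' i) + (\<Sum>j=1..CARD('m). (F j \<bullet> x) *\<^sub>R F' j)"
  have "linear ?f"
    by (rule linearI)
      (simp_all add: inner_add_right scaleR_add_left sum.distrib algebra_simps scaleR_sum_right)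
  then have A: "matrix ?f *v x = ?f x" for x by (rule matrix_works[OF linear_matrix_vector_mul_eq[THEN iffD2]])
  show ?thesis
  proof (rule that[of "matrix ?f", OF _ _ A])
    fix i assume i: "i \<in> {1..CARD('k)}"
    have "?f (E i) = (\<Sum>i'=1..CARD('k). if i' = i then E' i else 0) + 0"
      using i by (intro arg_cong2[where f = "(+)"] sum.cong sum.neutral) (auto simp: EE EF inner_commute)
    then show "matrix ?f *v E i = E' i" using i unfolding A by (simp add: sum.delta)
  next
    fix j assume j: "j \<in> {1..CARD('m)}"
    have "?f (F j) = 0 + (\<Sum>j'=1..CARD('m). if j' = j then F' j else 0)"
      using j by (intro arg_cong2[where f = "(+)"] sum.cong sum.neutral) (auto simp: FF EF)
    then show "matrix ?f *v F j = F' j" using j unfolding A by (simp add: sum.delta)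
  qed
qed

lemma matrix_eq_frame:
  assumes "\<And>i. i \<in> {1..CARD('k)} \<Longrightarrow> A *v E i = B *v E i" "\<And>j. j \<in> {1..CARD('m)} \<Longrightarrow> A *v F j = B *v F j"
  shows "A = (B :: real ^ ('k + 'm) ^ 'p)"
proof -
  have "A *v x = B *v x" for x
    by (subst (1 2) frame_expand[of x])
      (simp add: matrix_vector_right_distrib linear_sum[OF matrix_vector_mul_linear] matrix_vector_mult_scaleR assms)
  then show ?thesis by (simp add: matrix_eq)
qed

lemma orthogonal_of_frame:
  fixes g :: "real ^ ('k + 'm) ^ ('k + 'm)"
  assumes "\<And>s t. s \<in> ({1..CARD('k)} <+> {1..CARD('m)}) \<Longrightarrow> t \<in> ({1..CARD('k)} <+> {1..CARD('m)}) \<Longrightarrow>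
      (g *v case_sum E F s) \<bullet> (g *v case_sum E F t) = (if s = t then 1 else 0)"
  shows "orthogonal_matrix g"
proof -
  have *: "transpose g ** g *v case_sum E F s = case_sum E F s" if s: "s \<in> ({1..CARD('k)} <+> {1..CARD('m)})" for s
  proof -
    have "transpose g ** g *v case_sum E F s
      = (\<Sum>t\<in>({1..CARD('k)} <+> {1..CARD('m)}). (case_sum E F t \<bullet> (transpose g ** g *v case_sum E F s)) *\<^sub>R case_sum E F t)"
      by (rule orthonormal_family_expand[OF frame_on card_frame_ix])
    also have "\<dots> = (\<Sum>t\<in>({1..CARD('k)} <+> {1..CARD('m)}). if t = s then case_sum E F s else 0)"
      using assms s by (intro sum.cong refl) (auto simp: inner_matrix_vector matrix_vector_mul_assoc simp del: sum.case)
    also have "\<dots> = case_sum E F s" using s by (simp add: card_frame_ix)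
    finally show ?thesis .
  qed
  have "transpose g ** g = mat 1"
  proof (rule matrix_eq_frame)
    show "transpose g ** g *v E i = mat 1 *v E i" if "i \<in> {1..CARD('k)}" for i
      using *[OF InlI[OF that]] by simp
    show "transpose g ** g *v F j = mat 1 *v F j" if "j \<in> {1..CARD('m)}" for j
      using *[OF InrI[OF that]] by simp
  qed
  then show ?thesis by (simp add: orthogonal_matrix)
qed

end

context grass_frame begin

lemma matrix_frame_sum: "A *v (\<Sum>i\<in>I. c i *\<^sub>R b i) = (\<Sum>i\<in>I. c i *\<^sub>R (A *v (b i :: real ^ 'p)))"
  by (simp add: linear_sum[OF matrix_vector_mul_linear] matrix_vector_mult_scaleR)

lemma act_base_eqI:
  assumes g: "invertible g" and L: "L \<in> grassmannian"
    and E: "\<And>i. i \<in> {1..CARD('k)} \<Longrightarrow> g *v E i \<in> L"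
  shows "act g base_point = L"
proof (rule subspace_dim_equal)
  have L': "subspace L" "dim L = CARD('k)" using L by (auto simp: grassmannian_def)
  show "subspace (act g base_point)" by (intro subspace_act subspace_base)
  show "subspace L" by fact
  show "dim L \<le> dim (act g base_point)" using dim_act[OF g] dim_base L' by simp
  show "act g base_point \<subseteq> L"
  proof
    fix y assume "y \<in> act g base_point"
    then obtain x where x: "x \<in> base_point" "y = g *v x" by (auto simp: act_def)
    have "x = (\<Sum>i=1..CARD('k). (E i \<bullet> x) *\<^sub>R E i)" using frame_expand[of x] base_iff x by simp
    from arg_cong[OF this, of "(*v) g"]
    have "y = (\<Sum>i=1..CARD('k). (E i \<bullet> x) *\<^sub>R (g *v E i))"
      by (simp only: x(2) matrix_frame_sum)
    also have "\<dots> \<in> L" by (intro subspace_sum subspace_scale L' E)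
    finally show "y \<in> L" .
  qed
qed

lemma act_base_grassmannian: "invertible g \<Longrightarrow> act g base_point \<in> (grassmannian :: (real ^ ('k + 'm)) set set)"
  by (simp add: grassmannian_def subspace_act subspace_base dim_act dim_base)

text \<open>\<open>gF\<close> runs through the steps of the flag outside \<open>J\<close> in decreasing order.\<close>

lemma adapted_orthogonal:
  fixes V :: "nat \<Rightarrow> (real ^ ('k + 'm)) set"
  assumes V: "complete_flag V" and L: "L \<in> grassmannian"
  obtains g where "orthogonal_matrix g" "act g base_point = L"
    "\<And>a i. a \<le> CARD('k + 'm) \<Longrightarrow> i \<in> {1..dim (L \<inter> V a)} \<Longrightarrow> g *v E i \<in> V a"
    "\<And>a j x. a \<le> CARD('k + 'm) \<Longrightarrow> j \<in> {1..CARD('m) + dim (L \<inter> V a) - a} \<Longrightarrow> x \<in> V a \<Longrightarrow> (g *v F j) \<bullet> x = 0"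
proof -
  let ?n = "CARD('k + 'm)" and ?k = "CARD('k)" and ?m = "CARD('m)"
  have L': "subspace L" "dim L = ?k" using L by (auto simp: grassmannian_def)
  obtain u J where u: "\<And>i j. i \<in> {1..?n} \<Longrightarrow> j \<in> {1..?n} \<Longrightarrow> u i \<bullet> u j = (if i = j then 1 else 0)"
    and J: "J \<subseteq> {1..?n}"
    and dJ: "\<And>a. a \<le> ?n \<Longrightarrow> dim (L \<inter> V a) = card (J \<inter> {1..a})"
    and uJ: "\<And>i. i \<in> J \<Longrightarrow> u i \<in> L \<inter> V i"
    and uL: "\<And>i z. i \<in> {1..?n} - J \<Longrightarrow> z \<in> L \<Longrightarrow> u i \<bullet> z = 0"
    and uV: "\<And>i a z. i \<in> {1..?n} - J \<Longrightarrow> a < i \<Longrightarrow> z \<in> V a \<Longrightarrow> u i \<bullet> z = 0"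
    using flag_frame[OF V L'(1)] by blast
  define C where "C = {1..?n} - J"
  have CJ: "C \<subseteq> {1..?n}" by (auto simp: C_def)
  have "card (J \<inter> {1..?n}) = ?k" using dJ[of ?n] flag_top[OF V] L' by simp
  then have cJ: "card J = ?k" using J by (simp add: Int_absorb2)
  have cC: "card C = ?m" unfolding C_def using card_Diff_subset[OF finite_subset[OF J] J] cJ by simp
  obtain r where r: "bij_betw r {1..?k} J"
    and rle: "\<And>s a. s \<in> {1..?k} \<Longrightarrow> s \<le> card (J \<inter> {1..a}) \<Longrightarrow> r s \<le> a"
    by (rule rank_enumeration[OF J, unfolded cJ]) (rule that)
  obtain r' where r': "bij_betw r' {1..?m} C"
    and rgt: "\<And>s a. s \<in> {1..?m} \<Longrightarrow> card (C \<inter> {1..a}) < s \<Longrightarrow> a < r' s"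
    by (rule rank_enumeration[OF CJ, unfolded cC]) (rule that)
  have rJ: "r i \<in> J" if "i \<in> {1..?k}" for i using r that by (auto simp: bij_betw_def)
  have rC: "r' (?m + 1 - j) \<in> C" if "j \<in> {1..?m}" for j
  proof -
    have "?m + 1 - j \<in> {1..?m}" using that by auto
    then show ?thesis using r' by (auto simp: bij_betw_def)
  qed
  have rinj: "r i = r i' \<longleftrightarrow> i = i'" if "i \<in> {1..?k}" "i' \<in> {1..?k}" for i i'
    using inj_on_eq_iff[OF bij_betw_imp_inj_on[OF r]] that by blast
  have rinj': "r' (?m + 1 - j) = r' (?m + 1 - j') \<longleftrightarrow> j = j'" if "j \<in> {1..?m}" "j' \<in> {1..?m}" for j j'
  proof -
    have "?m + 1 - j \<in> {1..?m}" "?m + 1 - j' \<in> {1..?m}" using that by auto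
    then have "r' (?m + 1 - j) = r' (?m + 1 - j') \<longleftrightarrow> ?m + 1 - j = ?m + 1 - j'"
      using inj_on_eq_iff[OF bij_betw_imp_inj_on[OF r']] by blast
    then show ?thesis using that by auto
  qed
  obtain g where gE: "\<And>i. i \<in> {1..?k} \<Longrightarrow> g *v E i = u (r i)"
    and gF: "\<And>j. j \<in> {1..?m} \<Longrightarrow> g *v F j = u (r' (?m + 1 - j))"
    by (rule matrix_of_frame[of "\<lambda>i. u (r i)" "\<lambda>j. u (r' (?m + 1 - j))"]) (rule that)
  have og: "orthogonal_matrix g"
  proof (rule orthogonal_of_frame)
    fix s t assume s: "s \<in> {1..?k} <+> {1..?m}" and t: "t \<in> {1..?k} <+> {1..?m}"
    have ne: "r i \<noteq> r' (?m + 1 - j)" if "i \<in> {1..?k}" "j \<in> {1..?m}" for i j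
      using rJ[OF that(1)] rC[OF that(2)] by (auto simp: C_def)
    have *: "r i \<in> {1..?n}" if "i \<in> {1..?k}" for i using rJ[OF that] J by blast
    have **: "r' (?m + 1 - j) \<in> {1..?n}" if "j \<in> {1..?m}" for j using rC[OF that] CJ by blast
    show "(g *v case_sum E F s) \<bullet> (g *v case_sum E F t) = (if s = t then 1 else 0)"
      using s t
      by (elim PlusE) (simp_all add: gE gF u[OF * *] u[OF * **] u[OF ** *] u[OF ** **] rinj rinj' ne ne[symmetric]
          del: atLeastAtMost_iff)
  qed
  have act: "act g base_point = L"
    using rJ uJ by (intro act_base_eqI orthogonal_matrix_invertible og L) (auto simp: gE)
  show ?thesis
  proof (rule that[OF og act])
    fix a i assume a: "a \<le> ?n" and i: "i \<in> {1..dim (L \<inter> V a)}"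
    have "dim (L \<inter> V a) \<le> ?k" using dim_subset[of "L \<inter> V a" L] L' by simp
    then have i': "i \<in> {1..?k}" using i by auto
    have "r i \<le> a" using i dJ[OF a] by (intro rle i') simp
    then show "g *v E i \<in> V a"
      using gE[OF i'] uJ[OF rJ[OF i']] flag_mono[OF V _ a, of "r i"] by auto
  next
    fix a j x assume a: "a \<le> ?n" and j: "j \<in> {1..?m + dim (L \<inter> V a) - a}" and x: "x \<in> V a"
    have "{1..a} = (J \<inter> {1..a}) \<union> (C \<inter> {1..a})" using a by (auto simp: C_def)
    moreover have "card ((J \<inter> {1..a}) \<union> (C \<inter> {1..a})) = card (J \<inter> {1..a}) + card (C \<inter> {1..a})"
      by (rule card_Un_disjoint) (auto simp: C_def)
    ultimately have c: "a = dim (L \<inter> V a) + card (C \<inter> {1..a})" using dJ[OF a] by (metis card_atLeastAtMost diff_Suc_1 One_nat_def)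
    have j': "j \<in> {1..?m}" using j c by auto
    \<comment> \<open>\<open>a\<close> is the dimension of the intersection plus the number of steps
      outside \<open>J\<close> up to \<open>a\<close>. So the range of \<open>j\<close> says exactly
      that \<open>?m + 1 - j\<close> exceeds the latter number.\<close>
    have "a < r' (?m + 1 - j)" using j c by (intro rgt) auto
    then show "(g *v F j) \<bullet> x = 0"
      using gF[OF j'] uV[OF _ _ x] rC[OF j'] by (auto simp: C_def)
  qed
qed

text \<open>Given by equations; for \<open>p \<le> CARD('k)\<close> and
  \<open>q \<le> CARD('m)\<close> it is spanned by the \<open>E i\<close> with
  \<open>i \<le> p\<close> and the \<open>F j\<close> with \<open>j > q\<close>. At a corner
  \<open>(p, q)\<close> it is the model of the flag space \<open>V (CARD('m) - q + p)\<close>, which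
  has the same dimension.\<close>

definition coord_sub :: "nat \<Rightarrow> nat \<Rightarrow> (real ^ ('k + 'm)) set" where
  "coord_sub p q = {v. (\<forall>i\<in>{p<..CARD('k)}. E i \<bullet> v = 0) \<and> (\<forall>j\<in>{1..q}. F j \<bullet> v = 0)}"

lemma coord_sub:
  assumes "p \<le> CARD('k)" "q \<le> CARD('m)"
  shows subspace_coord_sub: "subspace (coord_sub p q)" and dim_coord_sub: "dim (coord_sub p q) = p + (CARD('m) - q)"
proof -
  show "subspace (coord_sub p q)" by (auto simp: coord_sub_def subspace_def inner_add_right)
  let ?J = "{1..p} <+> {q<..CARD('m)}"
  have "coord_sub p q = {x. \<forall>s\<in>({1..CARD('k)} <+> {1..CARD('m)}) - ?J. case_sum E F s \<bullet> x = 0}"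
  proof -
    have "({1..CARD('k)} <+> {1..CARD('m)}) - ?J = {p<..CARD('k)} <+> {1..q}"
    proof (rule set_eqI)
      have l: "Inl x \<in> A <+> B \<longleftrightarrow> x \<in> A" and r: "Inr y \<in> A <+> B \<longleftrightarrow> y \<in> B"
        for x y :: nat and A B by auto
      show "s \<in> ({1..CARD('k)} <+> {1..CARD('m)}) - ?J \<longleftrightarrow> s \<in> {p<..CARD('k)} <+> {1..q}" for s
        using assms by (cases s) (auto simp: l r)
    qed
    moreover have "(\<forall>s\<in>A <+> B. P s) \<longleftrightarrow> (\<forall>i\<in>A. P (Inl i)) \<and> (\<forall>j\<in>B. P (Inr j))"
      for A B :: "nat set" and P by blast
    ultimately show ?thesis by (simp add: coord_sub_def)
  qed
  moreover have "?J \<subseteq> {1..CARD('k)} <+> {1..CARD('m)}" using assms by auto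
  ultimately have "dim (coord_sub p q) = card ?J"
    using orthonormal_family_subspace(2)[OF frame_on card_frame_ix] by simp
  then show "dim (coord_sub p q) = p + (CARD('m) - q)" by (simp add: card_Plus)
qed

text \<open>The last bound says that \<open>L + V a\<close> fits into the whole space; it makes
  \<open>CARD('m) + dim (L \<inter> V a) - a\<close> a subtraction without truncation.\<close>

lemma flag_dim_bounds:
  fixes V :: "nat \<Rightarrow> (real ^ ('k + 'm)) set"
  assumes V: "complete_flag V" and L: "L \<in> grassmannian" and a: "a \<le> CARD('k + 'm)"
  shows "dim (L \<inter> V a) \<le> CARD('k)" "dim (L \<inter> V a) \<le> a" "a \<le> CARD('m) + dim (L \<inter> V a)"
proof -
  have L': "subspace L" "dim L = CARD('k)" using L by (auto simp: grassmannian_def)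
  show "dim (L \<inter> V a) \<le> CARD('k)" using dim_subset[of "L \<inter> V a" L] L' by simp
  show "dim (L \<inter> V a) \<le> a" using dim_subset[of "L \<inter> V a" "V a"] flag_dim[OF V a] by simp
  have "dim (ssum L (V a)) \<le> CARD('k + 'm)" using dim_subset_UNIV[of "ssum L (V a)"] by simp
  then show "a \<le> CARD('m) + dim (L \<inter> V a)"
    using dim_ssum[OF L'(1) flag_subspace[OF V a]] L' flag_dim[OF V a] by simp
qed

text \<open>Here the flag itself becomes a coordinate flag, at the price that the complement spanned by
  the \<open>A F\<close> is no longer orthogonal to \<open>L\<close>.\<close>

lemma adapted_basis:
  fixes V :: "nat \<Rightarrow> (real ^ ('k + 'm)) set"
  assumes V: "complete_flag V" and L: "L \<in> grassmannian"
  obtains g A where "orthogonal_matrix g" "act g base_point = L"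
    "\<And>a i. a \<le> CARD('k + 'm) \<Longrightarrow> i \<in> {1..dim (L \<inter> V a)} \<Longrightarrow> g *v E i \<in> V a"
    "\<And>a j x. a \<le> CARD('k + 'm) \<Longrightarrow> j \<in> {1..CARD('m) + dim (L \<inter> V a) - a} \<Longrightarrow> x \<in> V a \<Longrightarrow> (g *v F j) \<bullet> x = 0"
    "invertible A" "\<And>i. i \<in> {1..CARD('k)} \<Longrightarrow> A *v E i = g *v E i"
    "\<And>j. j \<in> {1..CARD('m)} \<Longrightarrow> A *v F j - g *v F j \<in> L"
    "\<And>a. a \<le> CARD('k + 'm) \<Longrightarrow> act A (coord_sub (dim (L \<inter> V a)) (CARD('m) + dim (L \<inter> V a) - a)) = V a"
proof -
  let ?n = "CARD('k + 'm)" and ?k = "CARD('k)" and ?m = "CARD('m)"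
  let ?q = "\<lambda>a. ?m + dim (L \<inter> V a) - a"
  have L': "subspace L" "dim L = ?k" using L by (auto simp: grassmannian_def)
  obtain g where og: "orthogonal_matrix g" and act: "act g base_point = L"
    and gE: "\<And>a i. a \<le> ?n \<Longrightarrow> i \<in> {1..dim (L \<inter> V a)} \<Longrightarrow> g *v E i \<in> V a"
    and gF: "\<And>a j x. a \<le> ?n \<Longrightarrow> j \<in> {1..?q a} \<Longrightarrow> x \<in> V a \<Longrightarrow> (g *v F j) \<bullet> x = 0"
    by (rule adapted_orthogonal[OF V L]) (rule that)
  have gFL: "(g *v F j) \<bullet> x = 0" if j: "j \<in> {1..?m}" and x: "x \<in> L" for j x
    using x F_base[OF j] orthogonal_matrix_inner[OF og] unfolding act[symmetric] by (auto simp: act_def)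
  have gEL: "g *v E i \<in> L" if "i \<in> {1..?k}" for i
    unfolding act[symmetric] using E_base[OF that] by (auto simp: act_def)
  note bd = flag_dim_bounds[OF V L]
  \<comment> \<open>By a dimension count \<open>L + V a\<close> is the whole orthogonal complement
    of the first \<open>?q a\<close> vectors \<open>g *v F j\<close>. The later ones therefore lie
    in it, and a correction by an element of \<open>L\<close> moves them into
    \<open>V a\<close>.\<close>
  have exw: "\<exists>w\<in>V a. w - g *v F j \<in> L" if a: "a \<le> ?n" and j: "j \<in> {1..?m}" "?q a < j" for a j
  proof -
    have q: "?q a \<le> ?m" using bd(2)[OF a] by simp
    have "ssum L (V a) = act g (coord_sub ?k (?q a))"
    proof (rule subspace_dim_equal)
      show "subspace (ssum L (V a))" by (intro subspace_ssum L' flag_subspace[OF V a])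
      show "subspace (act g (coord_sub ?k (?q a)))" by (intro subspace_act subspace_coord_sub q order_refl)
      show "dim (act g (coord_sub ?k (?q a))) \<le> dim (ssum L (V a))"
        using dim_act[OF orthogonal_matrix_invertible[OF og]] dim_coord_sub[OF order_refl q]
          dim_ssum[OF L'(1) flag_subspace[OF V a]] flag_dim[OF V a] L' bd[OF a] by simp
      show "ssum L (V a) \<subseteq> act g (coord_sub ?k (?q a))"
      proof
        fix x assume x: "x \<in> ssum L (V a)"
        have "(g *v F i) \<bullet> x = 0" if i: "i \<in> {1..?q a}" for i
          using x gF[OF a i] gFL[of i] i q by (auto simp: ssum_def inner_add_right)
        then have "transpose g *v x \<in> coord_sub ?k (?q a)"
          by (auto simp: coord_sub_def inner_matrix_vector)
        moreover have "x = g *v (transpose g *v x)"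
          using og by (simp add: matrix_vector_mul_assoc orthogonal_matrix_def)
        ultimately show "x \<in> act g (coord_sub ?k (?q a))" unfolding act_def by blast
      qed
    qed
    moreover have "F j \<in> coord_sub ?k (?q a)"
      using j q by (auto simp: coord_sub_def FF)
    ultimately have "g *v F j \<in> ssum L (V a)" by (auto simp: act_def)
    then obtain x y where "x \<in> L" "y \<in> V a" "g *v F j = x + y" by (auto simp: ssum_def)
    then show ?thesis using subspace_neg[OF L'(1)] by (intro bexI[of _ y]) auto
  qed
  \<comment> \<open>The correction is made in the smallest possible flag space; by monotonicity it
    then serves every \<open>a\<close> with \<open>?q a < j\<close>.\<close>
  define la where "la j = (LEAST a. a \<le> ?n \<and> ?q a < j)" for j
  have la: "la j \<le> ?n \<and> ?q (la j) < j" if "j \<in> {1..?m}" for j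
    unfolding la_def
  proof (rule LeastI[of _ ?n])
    show "?n \<le> ?n \<and> ?q ?n < j" using that flag_top[OF V] L' by simp
  qed
  define w where "w j = (SOME w. w \<in> V (la j) \<and> w - g *v F j \<in> L)" for j
  have w: "w j \<in> V (la j)" "w j - g *v F j \<in> L" if "j \<in> {1..?m}" for j
  proof -
    have "\<exists>x. x \<in> V (la j) \<and> x - g *v F j \<in> L" using exw[of "la j" j] la[OF that] that by blast
    from someI_ex[OF this] show "w j \<in> V (la j)" "w j - g *v F j \<in> L" by (auto simp: w_def)
  qed
  obtain A where AE: "\<And>i. i \<in> {1..?k} \<Longrightarrow> A *v E i = g *v E i" and AF: "\<And>j. j \<in> {1..?m} \<Longrightarrow> A *v F j = w j"
    and Ax: "\<And>x. A *v x = (\<Sum>i=1..?k. (E i \<bullet> x) *\<^sub>R (g *v E i)) + (\<Sum>j=1..?m. (F j \<bullet> x) *\<^sub>R w j)"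
    by (rule matrix_of_frame[of "\<lambda>i. g *v E i" w]) (rule that)
  \<comment> \<open>The corrections lie in \<open>L\<close>, so the \<open>w j\<close> are still
    dual to the \<open>g *v F j\<close>. Together with the \<open>g *v E i\<close> in
    \<open>L\<close> this makes \<open>A\<close> injective.\<close>
  have gFw: "(g *v F j) \<bullet> w j' = (if j = j' then 1 else 0)" if "j \<in> {1..?m}" "j' \<in> {1..?m}" for j j'
    using gFL[OF that(1) w(2)[OF that(2)]] FF[OF that] orthogonal_matrix_inner[OF og, of "F j" "F j'"]
    by (simp add: inner_diff_right)
  have inv: "invertible A"
  proof (rule invertibleI_ker)
    fix x assume 0: "A *v x = 0"
    have F0: "F j \<bullet> x = 0" if j: "j \<in> {1..?m}" for j
    proof -
      have "0 = (g *v F j) \<bullet> (A *v x)" by (simp add: 0)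
      also have "\<dots> = (\<Sum>i=1..?k. (E i \<bullet> x) * ((g *v F j) \<bullet> (g *v E i))) + (\<Sum>j'=1..?m. (F j' \<bullet> x) * ((g *v F j) \<bullet> w j'))"
        by (simp add: Ax inner_add_right inner_sum_right)
      also have "\<dots> = 0 + (\<Sum>j'=1..?m. if j' = j then F j \<bullet> x else 0)"
        using j gFL[OF j gEL] gFw by (intro arg_cong2[where f = "(+)"] sum.cong sum.neutral) auto
      finally show ?thesis using j by simp
    qed
    then have "x = (\<Sum>i=1..?k. (E i \<bullet> x) *\<^sub>R E i)" using frame_expand[of x] by simp
    from arg_cong[OF this, of "(*v) g"]
    have "g *v x = (\<Sum>i=1..?k. (E i \<bullet> x) *\<^sub>R (g *v E i))"
      by (simp only: matrix_frame_sum)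
    also have "\<dots> = A *v x" by (simp add: Ax F0)
    finally have "g *v x = 0" using 0 by simp
    then have "transpose g *v (g *v x) = 0" by simp
    then show "x = 0" using og by (simp add: matrix_vector_mul_assoc orthogonal_matrix)
  qed
  show ?thesis
  proof (rule that[OF og act gE gF inv AE])
    show "A *v F j - g *v F j \<in> L" if "j \<in> {1..?m}" for j using w(2)[OF that] AF[OF that] by simp
    fix a assume a: "a \<le> ?n"
    let ?p = "dim (L \<inter> V a)"
    have q: "?q a \<le> ?m" using bd(2)[OF a] by simp
    show "act A (coord_sub ?p (?q a)) = V a"
    proof (rule subspace_dim_equal)
      show "subspace (act A (coord_sub ?p (?q a)))" by (intro subspace_act subspace_coord_sub q bd(1)[OF a])
      show "subspace (V a)" by (rule flag_subspace[OF V a])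
      show "dim (V a) \<le> dim (act A (coord_sub ?p (?q a)))"
        using dim_act[OF inv] dim_coord_sub[OF bd(1)[OF a] q] flag_dim[OF V a] bd[OF a] by simp
      show "act A (coord_sub ?p (?q a)) \<subseteq> V a"
      proof
        fix y assume "y \<in> act A (coord_sub ?p (?q a))"
        then obtain v where v: "v \<in> coord_sub ?p (?q a)" "y = A *v v" by (auto simp: act_def)
        have "(E i \<bullet> v) *\<^sub>R (g *v E i) \<in> V a" if i: "i \<in> {1..?k}" for i
        proof (cases "i \<le> ?p")
          case True
          then show ?thesis using gE[OF a, of i] i by (intro subspace_scale flag_subspace[OF V a]) auto
        next
          case False
          then show ?thesis using v(1) i subspace_0[OF flag_subspace[OF V a]] by (auto simp: coord_sub_def)
        qed
        moreover have "(F j \<bullet> v) *\<^sub>R w j \<in> V a" if j: "j \<in> {1..?m}" for j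
        proof (cases "?q a < j")
          case True
          then have "la j \<le> a" unfolding la_def using a by (intro Least_le) simp
          then show ?thesis
            using w(1)[OF j] flag_mono[OF V _ a] by (intro subspace_scale flag_subspace[OF V a]) auto
        next
          case False
          then show ?thesis using v(1) j subspace_0[OF flag_subspace[OF V a]] by (auto simp: coord_sub_def)
        qed
        ultimately show "y \<in> V a"
          unfolding v(2) Ax by (intro subspace_add subspace_sum flag_subspace[OF V a])
      qed
    qed
  qed
qed

text \<open>With \<open>CARD('m)\<close> as second index no \<open>F j\<close> remains, and the
  model space is spanned by the first \<open>E i\<close>. Their images lie in the intersection and
  are as many as its dimension.\<close>

lemma adapted_span:
  assumes g: "orthogonal_matrix g" "act g base_point = L" and L: "L \<in> grassmannian" and W: "subspace W"
    and E: "\<And>i. i \<in> {1..dim (L \<inter> W)} \<Longrightarrow> g *v E i \<in> W"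
  shows "act g (coord_sub (dim (L \<inter> W)) CARD('m)) = L \<inter> W"
proof -
  let ?p = "dim (L \<inter> W)"
  have L': "subspace L" "dim L = CARD('k)" using L by (auto simp: grassmannian_def)
  have p: "?p \<le> CARD('k)" using dim_subset[of "L \<inter> W" L] L' by simp
  have gEL: "g *v E i \<in> L" if "i \<in> {1..CARD('k)}" for i
    unfolding g(2)[symmetric] using E_base[OF that] by (auto simp: act_def)
  have gi: "invertible g" using g(1) by (rule orthogonal_matrix_invertible)
  show ?thesis
  proof (rule subspace_dim_equal)
    show "subspace (act g (coord_sub ?p CARD('m)))" by (intro subspace_act subspace_coord_sub p order_refl)
    show LW: "subspace (L \<inter> W)" using L' W by (simp add: subspace_inter)
    show "dim (L \<inter> W) \<le> dim (act g (coord_sub ?p CARD('m)))"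
      using dim_act[OF gi] dim_coord_sub[OF p order_refl] by simp
    show "act g (coord_sub ?p CARD('m)) \<subseteq> L \<inter> W"
    proof
      fix y assume "y \<in> act g (coord_sub ?p CARD('m))"
      then obtain v where v: "v \<in> coord_sub ?p CARD('m)" "y = g *v v" by (auto simp: act_def)
      have "v = (\<Sum>i=1..CARD('k). (E i \<bullet> v) *\<^sub>R E i)" using frame_expand[of v] v by (simp add: coord_sub_def)
      from arg_cong[OF this, of "(*v) g"]
      have "y = (\<Sum>i=1..CARD('k). (E i \<bullet> v) *\<^sub>R (g *v E i))"
        by (simp only: v(2) matrix_frame_sum)
      also have "\<dots> \<in> L \<inter> W"
      proof (intro subspace_sum LW)
        fix i assume i: "i \<in> {1..CARD('k)}"
        show "(E i \<bullet> v) *\<^sub>R (g *v E i) \<in> L \<inter> W"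
        proof (cases "i \<le> ?p")
          case True
          then show ?thesis using E[of i] gEL[OF i] i by (intro subspace_scale LW) auto
        next
          case False
          then show ?thesis using v(1) i subspace_0[OF LW] by (auto simp: coord_sub_def)
        qed
      qed
      finally show "y \<in> L \<inter> W" .
    qed
  qed
qed

end

section \<open>Tangent and conormal spaces of Schubert cells\<close>

lemma bounded_bilinear_matrix_vector_mult:
  "bounded_bilinear ((*v) :: real ^ 'n ^ 'm \<Rightarrow> real ^ 'n \<Rightarrow> real ^ 'm)"
  unfolding bilinear_conv_bounded_bilinear[symmetric] bilinear_def
proof (intro conjI allI)
  show "linear (\<lambda>A. A *v x)" for x :: "real ^ 'n"
    by (rule linearI) (simp_all add: matrix_vector_mult_add_rdistrib scaleR_matrix_vector_assoc)
qed (rule matrix_vector_mul_linear)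

lemmas tendsto_matrix_vector_mult = bounded_bilinear.tendsto[OF bounded_bilinear_matrix_vector_mult]

lemma tendsto_transpose: "(f \<longlongrightarrow> A) G \<Longrightarrow> ((\<lambda>x. transpose (f x :: real ^ 'n ^ 'm)) \<longlongrightarrow> transpose A) G"
  by (rule bounded_linear.tendsto[OF bounded_linear_transpose])

lemma compact_orthogonal_matrices: "compact {g :: real ^ 'n ^ 'n. orthogonal_matrix g}"
proof -
  have "norm g \<le> sqrt CARD('n)" if "orthogonal_matrix g" for g :: "real ^ 'n ^ 'n"
  proof -
    have "norm (g $ i) = 1" for i
      using that unfolding orthogonal_matrix_orthonormal_rows by (simp add: row_def)
    then show ?thesis by (simp add: norm_vec_def L2_set_def)
  qed
  then have "bounded {g :: real ^ 'n ^ 'n. orthogonal_matrix g}" unfolding bounded_iff by blast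
  moreover have "closed {g :: real ^ 'n ^ 'n. transpose g ** g = mat 1}"
    by (intro closed_Collect_eq bounded_bilinear.continuous_on[OF bounded_bilinear_matrix_mult]
        bounded_linear.continuous_on[OF bounded_linear_transpose] continuous_intros)
  ultimately show ?thesis unfolding orthogonal_matrix compact_eq_bounded_closed by simp
qed

text \<open>The off-diagonal part of the velocity of the projections depends only on the map that \<open>W\<close>
  induces from \<open>L\<close> to the orthogonal complement.\<close>

lemma proj_matrix_curve:
  fixes L :: "(real ^ 'n) set" and W :: "real ^ 'n ^ 'n"
  assumes L: "subspace L"
  defines "P \<equiv> proj_matrix L"
  defines "X \<equiv> (mat 1 - P) ** W ** P"
  shows "((\<lambda>t. proj_matrix (act (mat 1 + t *\<^sub>R W) L)) has_vector_derivative (X + transpose X)) (at 0)"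
    and "\<forall>\<^sub>F t in at (0 :: real). invertible (mat 1 + t *\<^sub>R W)"
proof -
  let ?A = "\<lambda>t :: real. mat 1 + t *\<^sub>R W"
  have PP: "P ** P = P" and tP: "transpose P = P"
    using L by (simp_all add: P_def proj_matrix_idem transpose_proj_matrix)
  \<comment> \<open>At \<open>t = 0\<close> the Gram matrix is the identity, so the derivative of
    its inverse is minus its own derivative.\<close>
  have N0: "gram P (mat 1) = mat 1"
    by (simp add: gram_def transpose_mat PP)
  have Ad: "(?A has_derivative (\<lambda>t. t *\<^sub>R W)) (at 0)"
    by (auto intro!: derivative_eq_intros)
  have tAd: "((\<lambda>t. transpose (?A t)) has_derivative (\<lambda>t. transpose (t *\<^sub>R W))) (at 0)"
    by (rule bounded_linear.has_derivative[OF bounded_linear_transpose Ad])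
  note md = bounded_bilinear.FDERIV[OF bounded_bilinear_matrix_mult]
  have Nd: "((\<lambda>t. gram P (?A t)) has_derivative (\<lambda>t. t *\<^sub>R (P ** (transpose W + W) ** P))) (at 0)"
    unfolding gram_def
    by (rule has_derivative_eq_rhs, rule has_derivative_add_const, rule md, rule md, rule md,
        rule has_derivative_const, rule tAd, rule Ad, rule has_derivative_const)
      (simp add: fun_eq_iff transpose_mat transpose_scaleR matmul.add_left matmul.add_right
        matmul.scaleR_left matmul.scaleR_right matmul.zero_left matmul.zero_right scaleR_add_right)

  have invd: "((\<lambda>t. matrix_inv (gram P (?A t))) has_derivative
      (\<lambda>t. - (t *\<^sub>R (P ** (transpose W + W) ** P)))) (at 0)"
  proof -
    have "invertible (gram P (?A 0))" using N0 by (simp add: invertible_def)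
    from has_derivative_matrix_inv'[OF Nd this] show ?thesis
      using N0 matrix_inv_eqI(1)[of "mat 1 :: real ^ 'n ^ 'n" "mat 1"] by simp
  qed
  \<comment> \<open>The product rule gives \<open>W P + P W^T - P (W + W^T) P\<close>, and this is
    \<open>X + X^T\<close>.\<close>
  have rd: "((\<lambda>t. range_proj P (?A t)) has_derivative (\<lambda>t. t *\<^sub>R (X + transpose X))) (at 0)"
    unfolding range_proj_def
  proof (rule has_derivative_eq_rhs, rule md, rule md, rule md, rule md, rule Ad, rule has_derivative_const,
      rule invd, rule has_derivative_const, rule tAd)
    have i1: "matrix_inv (mat 1 :: real ^ 'n ^ 'n) = mat 1" by (rule matrix_inv_eqI) simp
    have tX: "transpose X = P ** transpose W ** (mat 1 - P)"
      by (simp add: X_def matrix_transpose_mul transpose_diff transpose_mat tP matrix_mul_assoc)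
    have X: "X = W ** P - P ** W ** P"
      by (simp add: X_def matmul.diff_left)
    have tX': "transpose X = P ** transpose W - P ** transpose W ** P"
      unfolding tX by (simp add: matmul.diff_right)
    have a1: "P ** P ** M = P ** M" "M ** P ** P = M ** P" for M :: "real ^ 'n ^ 'n"
      by (simp_all add: PP flip: matrix_mul_assoc)
    show "(\<lambda>h. (?A 0 ** P ** matrix_inv (gram P (?A 0)) ** P) ** transpose (h *\<^sub>R W)
        + (?A 0 ** P ** matrix_inv (gram P (?A 0)) ** 0
        + (?A 0 ** P ** - (h *\<^sub>R (P ** (transpose W + W) ** P)) + (?A 0 ** 0 + h *\<^sub>R W ** P)
            ** matrix_inv (gram P (?A 0))) ** P) ** transpose (?A 0)) = (\<lambda>h. h *\<^sub>R (X + transpose X))"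
      unfolding tX' unfolding X
      by (simp add: fun_eq_iff N0 i1 transpose_mat transpose_scaleR matmul.add_left matmul.add_right
        matmul.minus_right matmul.minus_left matmul.diff_right matmul.diff_left
        matmul.scaleR_left matmul.scaleR_right matmul.zero_left matmul.zero_right matrix_mul_assoc PP a1
        algebra_simps)
  qed
  have "continuous_on UNIV ?A" by (intro continuous_intros)
  then have "open (?A -` {A. invertible A})" using open_invertible by (rule_tac open_vimage)
  moreover have "0 \<in> ?A -` {A. invertible A}" by (simp add: invertible_def)
  ultimately have ev: "\<forall>\<^sub>F t in nhds 0. invertible (?A t)"
    unfolding eventually_nhds by (intro exI[of _ "?A -` {A. invertible A}"]) auto
  then show "\<forall>\<^sub>F t in at 0. invertible (?A t)" by (simp add: eventually_at_filter eventually_mono)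
  have evr: "\<forall>\<^sub>F t in nhds 0. proj_matrix (act (?A t) L) = range_proj P (?A t)"
    using ev
  proof eventually_elim
    case (elim t)
    show ?case unfolding P_def
    proof (rule range_proj[OF L])
      show "x = 0" if "?A t *v x = 0" for x
        using matrix_inv_mult(2)[OF elim] that
        by (metis matrix_vector_mul_assoc matrix_vector_mul_lid matrix_vector_mult_0_right)
    qed
  qed
  have pd: "((\<lambda>t. proj_matrix (act (?A t) L)) has_derivative (\<lambda>t. t *\<^sub>R (X + transpose X))) (at 0)"
  proof (intro has_derivative_transform_eventually[OF rd])
    show "range_proj P (?A 0) = proj_matrix (act (?A 0) L)"
      using eventually_nhds_x_imp_x[OF evr] by simp
    show "\<forall>\<^sub>F t in at 0. range_proj P (?A t) = proj_matrix (act (?A t) L)"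
      using evr by (simp add: eventually_at_filter eventually_mono)
  qed simp
  then show "((\<lambda>t. proj_matrix (act (?A t) L)) has_vector_derivative (X + transpose X)) (at 0)"
    by (simp add: has_vector_derivative_def)
qed

text \<open>Stated for sequences, because frames along a curve converge only after passing to a
  subsequence.\<close>

lemma has_vector_derivative_quotient_tendsto:
  fixes f :: "real \<Rightarrow> 'a::real_normed_vector"
  assumes f: "(f has_vector_derivative f') (at 0)" and t: "t \<longlonglongrightarrow> 0" "\<And>n. t n \<noteq> 0"
  shows "(\<lambda>n. (1 / t n) *\<^sub>R (f (t n) - f 0)) \<longlonglongrightarrow> f'"
proof -
  have "(\<lambda>h. norm (f h - f 0 - h *\<^sub>R f') / norm h) \<midarrow>0\<rightarrow> 0"
    using f by (simp add: has_vector_derivative_def has_derivative_at)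
  then have "(\<lambda>n. norm (f (t n) - f 0 - t n *\<^sub>R f') / norm (t n)) \<longlonglongrightarrow> 0"
    by (rule filterlim_compose[of _ _ "at 0"]) (use t in \<open>auto simp: filterlim_at\<close>)
  moreover have "norm (f (t n) - f 0 - t n *\<^sub>R f') / norm (t n) = norm ((1 / t n) *\<^sub>R (f (t n) - f 0) - f')" for n
  proof -
    have "(1 / t n) *\<^sub>R (f (t n) - f 0) - f' = (1 / t n) *\<^sub>R (f (t n) - f 0 - t n *\<^sub>R f')"
      using t(2) by (simp add: scaleR_diff_right)
    then show ?thesis by (simp add: divide_inverse mult.commute)
  qed
  ultimately have "(\<lambda>n. norm ((1 / t n) *\<^sub>R (f (t n) - f 0) - f')) \<longlonglongrightarrow> 0" by simp
  then show ?thesis by (simp add: tendsto_norm_zero_iff LIM_zero_iff)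
qed

section \<open>Outer corners and equivariance of Schubert cells\<close>

lemma young_antimono:
  assumes "young_diagram k m l" "1 \<le> i" "i \<le> p" shows "l p \<le> l i"
  using assms(3)
proof (induction rule: dec_induct)
  case (step n)
  have "l (Suc n) \<le> l n" using assms(1,2) step(1) by (simp add: young_diagram_def)
  then show ?case using step(3) by simp
qed simp

lemma corner_bounds:
  assumes "young_diagram k m l" "(p, q) \<in> outer_corners k l"
  shows "p \<in> {1..k}" "q \<in> {1..m}" "q = l p" "m - q + p \<le> k + m" "m + p - (m - q + p) = q"
proof -
  show 1: "p \<in> {1..k}" "q = l p" using assms(2) by (auto simp: outer_corners_def boxes_def)
  then show 2: "q \<in> {1..m}" using assms by (auto simp: outer_corners_def boxes_def young_diagram_def)
  show "m - q + p \<le> k + m" "m + p - (m - q + p) = q" using 1 2 by auto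
qed

text \<open>A diagram is the union of the rectangles spanned by its outer corners: from a box one
  moves down to the last row of the same length, and the end of this row is a corner.\<close>

lemma boxes_iff_corner:
  assumes y: "young_diagram k m l"
  shows "(i, j) \<in> boxes k l \<longleftrightarrow> 1 \<le> i \<and> 1 \<le> j \<and> (\<exists>(p, q)\<in>outer_corners k l. i \<le> p \<and> j \<le> q)"
proof
  assume "1 \<le> i \<and> 1 \<le> j \<and> (\<exists>(p, q)\<in>outer_corners k l. i \<le> p \<and> j \<le> q)"
  then obtain p q where pq: "(p, q) \<in> outer_corners k l" "i \<le> p" "j \<le> q" and ij: "1 \<le> i" "1 \<le> j" by auto
  have "l p \<le> l i" by (rule young_antimono[OF y ij(1) pq(2)])
  then show "(i, j) \<in> boxes k l" using pq ij corner_bounds[OF y pq(1)] by (auto simp: boxes_def)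
next
  assume b: "(i, j) \<in> boxes k l"
  define S where "S = {p. i \<le> p \<and> p \<le> k \<and> l p = l i}"
  have fS: "finite S" by (rule finite_subset[of _ "{..k}"]) (auto simp: S_def)
  have "i \<in> S" using b by (auto simp: S_def boxes_def)
  then have ne: "S \<noteq> {}" by blast
  define p where "p = Max S"
  have p: "i \<le> p" "p \<le> k" "l p = l i" using Max_in[OF fS ne] by (auto simp: p_def S_def)
  have "l (Suc p) < l p"
  proof (cases "p = k")
    case True
    then show ?thesis using y b p by (auto simp: young_diagram_def boxes_def)
  next
    case False
    have "Suc p \<notin> S" using Max_ge[OF fS, of "Suc p"] unfolding p_def[symmetric] by auto
    then have "l (Suc p) \<noteq> l p" using p False by (auto simp: S_def)
    moreover have "l (Suc p) \<le> l p" if "1 \<le> p" using y that by (simp add: young_diagram_def)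
    moreover have "1 \<le> p" using p(1) b by (auto simp: boxes_def)
    ultimately show ?thesis by linarith
  qed
  then have "(p, l p) \<in> outer_corners k l" using p b by (auto simp: outer_corners_def boxes_def)
  moreover have "j \<le> l p" using p b by (auto simp: boxes_def)
  ultimately show "1 \<le> i \<and> 1 \<le> j \<and> (\<exists>(p, q)\<in>outer_corners k l. i \<le> p \<and> j \<le> q)"
    using p b by (auto simp: boxes_def intro!: bexI[of _ "(p, l p)"])
qed

lemma finite_boxes: "finite (boxes k l)"
proof (rule finite_subset)
  show "boxes k l \<subseteq> (SIGMA i:{1..k}. {1..l i})" by (auto simp: boxes_def)
qed auto

lemma boxes_subset: "young_diagram k m l \<Longrightarrow> boxes k l \<subseteq> {1..k} \<times> {1..m}"
proof
  fix b assume y: "young_diagram k m l" and "b \<in> boxes k l"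
  then obtain i j where b: "b = (i, j)" "1 \<le> i" "i \<le> k" "1 \<le> j" "j \<le> l i" by (auto simp: boxes_def)
  then have "l i \<le> m" using y by (simp add: young_diagram_def)
  then show "b \<in> {1..k} \<times> {1..m}" using b by simp
qed

lemma complete_flag_act:
  assumes "complete_flag V" "invertible M" shows "complete_flag (\<lambda>i. act M (V i))"
  using assms by (auto simp: complete_flag_def subspace_act dim_act intro: act_mono[THEN subsetD])

lemma act_schubert_smooth:
  fixes V :: "nat \<Rightarrow> (real ^ ('k::finite + 'm::finite)) set"
  assumes M: "invertible M"
  shows "act M ` schubert_smooth V l = schubert_smooth (\<lambda>i. act M (V i)) l"
proof -
  have *: "act M L \<in> schubert_smooth (\<lambda>i. act M (V i)) l" if "L \<in> schubert_smooth V l" "invertible M"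
    for M and V :: "nat \<Rightarrow> (real ^ ('k::finite + 'm::finite)) set" and L
    using that by (auto simp: schubert_smooth_def grassmannian_def subspace_act dim_act simp flip: act_Int)
  show ?thesis
  proof
    show "act M ` schubert_smooth V l \<subseteq> schubert_smooth (\<lambda>i. act M (V i)) l" using * M by blast
    show "schubert_smooth (\<lambda>i. act M (V i)) l \<subseteq> act M ` schubert_smooth V l"
    proof
      fix L assume L: "L \<in> schubert_smooth (\<lambda>i. act M (V i)) l"
      have "invertible (matrix_inv M)" using matrix_inv_mult[OF M] by (auto simp: invertible_def)
      from *[OF L this] have "act (matrix_inv M) L \<in> schubert_smooth V l"
        by (simp add: act_act matrix_inv_mult[OF M])
      moreover have "L = act M (act (matrix_inv M) L)" by (simp add: act_act matrix_inv_mult[OF M])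
      ultimately show "L \<in> act M ` schubert_smooth V l" by blast
    qed
  qed
qed

context grass_frame begin

text \<open>Only the conditions at the outer corners are kept. Their indices come from
  \<open>l\<close> and not from the dimensions of \<open>L \<inter> V a\<close>, which may jump;
  this keeps the relation between \<open>L\<close> and its frames closed.\<close>

definition frames :: "(nat \<Rightarrow> (real ^ ('k + 'm)) set) \<Rightarrow> (nat \<Rightarrow> nat) \<Rightarrow> (real ^ ('k + 'm)) set \<Rightarrow>
    (real ^ ('k + 'm) ^ ('k + 'm)) set" where
  "frames V l L = {g. orthogonal_matrix g \<and> act g base_point = L \<and>
     (\<forall>(p, q)\<in>outer_corners CARD('k) l. (\<forall>i\<in>{1..p}. g *v E i \<in> V (CARD('m) - q + p)) \<and>
        (\<forall>j\<in>{1..q}. \<forall>x\<in>V (CARD('m) - q + p). (g *v F j) \<bullet> x = 0))}"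

lemma frames_props:
  assumes g: "g \<in> frames V l L"
  shows frames_orthogonal: "orthogonal_matrix g" and frames_act: "act g base_point = L"
    and frames_E: "i \<in> {1..CARD('k)} \<Longrightarrow> g *v E i \<in> L"
    and frames_F: "j \<in> {1..CARD('m)} \<Longrightarrow> x \<in> L \<Longrightarrow> (g *v F j) \<bullet> x = 0"
    and frames_EV: "(p, q) \<in> outer_corners CARD('k) l \<Longrightarrow> i \<in> {1..p} \<Longrightarrow> g *v E i \<in> V (CARD('m) - q + p)"
    and frames_FV: "(p, q) \<in> outer_corners CARD('k) l \<Longrightarrow> j \<in> {1..q} \<Longrightarrow> x \<in> V (CARD('m) - q + p) \<Longrightarrow> (g *v F j) \<bullet> x = 0"
proof -
  show og: "orthogonal_matrix g" and act: "act g base_point = L" using g by (auto simp: frames_def)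
  show "i \<in> {1..CARD('k)} \<Longrightarrow> g *v E i \<in> L" unfolding act[symmetric] act_def using E_base by blast
  show "j \<in> {1..CARD('m)} \<Longrightarrow> x \<in> L \<Longrightarrow> (g *v F j) \<bullet> x = 0"
    unfolding act[symmetric] act_def using F_base orthogonal_matrix_inner[OF og] by auto
  show "(p, q) \<in> outer_corners CARD('k) l \<Longrightarrow> i \<in> {1..p} \<Longrightarrow> g *v E i \<in> V (CARD('m) - q + p)"
    "(p, q) \<in> outer_corners CARD('k) l \<Longrightarrow> j \<in> {1..q} \<Longrightarrow> x \<in> V (CARD('m) - q + p) \<Longrightarrow> (g *v F j) \<bullet> x = 0"
    using g by (auto simp: frames_def)
qed

lemma schubert_smooth_dim:
  fixes V :: "nat \<Rightarrow> (real ^ ('k + 'm)) set"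
  shows "L \<in> schubert_smooth V l \<Longrightarrow> (p, q) \<in> outer_corners CARD('k) l \<Longrightarrow> dim (L \<inter> V (CARD('m) - q + p)) = p"
  by (auto simp: schubert_smooth_def)

lemma schubert_smooth_grassmannian:
  fixes V :: "nat \<Rightarrow> (real ^ ('k + 'm)) set"
  shows "L \<in> schubert_smooth V l \<Longrightarrow> L \<in> grassmannian"
  by (auto simp: schubert_smooth_def)

lemma framesI:
  assumes y: "young_diagram CARD('k) CARD('m) l" and L: "L \<in> schubert_smooth V l"
    and g: "orthogonal_matrix g" "act g base_point = L"
    and E: "\<And>a i. a \<le> CARD('k + 'm) \<Longrightarrow> i \<in> {1..dim (L \<inter> V a)} \<Longrightarrow> g *v E i \<in> V a"
    and F: "\<And>a j x. a \<le> CARD('k + 'm) \<Longrightarrow> j \<in> {1..CARD('m) + dim (L \<inter> V a) - a} \<Longrightarrow> x \<in> V a \<Longrightarrow> (g *v F j) \<bullet> x = 0"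
  shows "g \<in> frames V l L"
proof -
  have "(\<forall>i\<in>{1..p}. g *v E i \<in> V (CARD('m) - q + p)) \<and>
        (\<forall>j\<in>{1..q}. \<forall>x\<in>V (CARD('m) - q + p). (g *v F j) \<bullet> x = 0)"
    if c: "(p, q) \<in> outer_corners CARD('k) l" for p q
  proof -
    note b = corner_bounds[OF y c]
    have a: "CARD('m) - q + p \<le> CARD('k + 'm)" using b(4) by simp
    show ?thesis using E[OF a] F[OF a] unfolding schubert_smooth_dim[OF L c] b(5) by blast
  qed
  then show ?thesis using g by (auto simp: frames_def)
qed

lemma frames_nonempty:
  assumes "complete_flag V" "young_diagram CARD('k) CARD('m) l" "L \<in> schubert_smooth V l"
  obtains g where "g \<in> frames V l L"
  using adapted_orthogonal[OF assms(1) schubert_smooth_grassmannian[OF assms(3)]] framesI[OF assms(2,3)]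
  by metis

text \<open>Every condition is closed; membership in \<open>K n\<close> means being fixed by its
  projection, which survives the limit of the projections. This serves both the velocities of curves
  and the measurability of the conormal vector.\<close>

lemma frames_limit:
  assumes V: "complete_flag V" and y: "young_diagram CARD('k) CARD('m) l"
    and g: "\<And>n. g n \<in> frames V l (K n)" and K: "\<And>n. K n \<in> grassmannian" and L: "L \<in> grassmannian"
    and lim: "g \<longlonglongrightarrow> g'" "(\<lambda>n. proj_matrix (K n)) \<longlonglongrightarrow> proj_matrix L"
  shows "g' \<in> frames V l L"
proof -
  have sK: "subspace (K n)" for n using K by (auto simp: grassmannian_def)
  have sL: "subspace L" using L by (auto simp: grassmannian_def)
  have gv: "(\<lambda>n. g n *v x) \<longlonglongrightarrow> g' *v x" for x
    by (intro tendsto_matrix_vector_mult lim tendsto_const)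
  have og: "orthogonal_matrix g'"
    using closed_sequentially[OF compact_imp_closed[OF compact_orthogonal_matrices], of g g'] lim(1)
      frames_orthogonal[OF g] by simp
  have "act g' base_point = L"
  proof (rule act_base_eqI[OF orthogonal_matrix_invertible[OF og] L])
    fix i assume i: "i \<in> {1..CARD('k)}"
    have "(\<lambda>n. proj_matrix (K n) *v (g n *v E i)) \<longlonglongrightarrow> proj_matrix L *v (g' *v E i)"
      by (intro tendsto_matrix_vector_mult lim gv)
    moreover have "proj_matrix (K n) *v (g n *v E i) = g n *v E i" for n
      using frames_E[OF g i] sK by (intro proj_matrix_id)
    ultimately have "proj_matrix L *v (g' *v E i) = g' *v E i"
      using gv[of "E i"] LIMSEQ_unique by simp
    then show "g' *v E i \<in> L" using proj_matrix_range[OF sL] by blast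
  qed
  moreover have "(\<forall>i\<in>{1..p}. g' *v E i \<in> V (CARD('m) - q + p)) \<and>
        (\<forall>j\<in>{1..q}. \<forall>x\<in>V (CARD('m) - q + p). (g' *v F j) \<bullet> x = 0)"
    if c: "(p, q) \<in> outer_corners CARD('k) l" for p q
  proof (intro conjI ballI)
    have a: "CARD('m) - q + p \<le> CARD('k + 'm)" using corner_bounds(4)[OF y c] by simp
    fix i assume i: "i \<in> {1..p}"
    show "g' *v E i \<in> V (CARD('m) - q + p)"
      using closed_sequentially[OF closed_subspace[OF flag_subspace[OF V a]] _ gv] frames_EV[OF g c i] by blast
  next
    fix j x assume j: "j \<in> {1..q}" and x: "x \<in> V (CARD('m) - q + p)"
    have "(\<lambda>n. (g n *v F j) \<bullet> x) \<longlonglongrightarrow> (g' *v F j) \<bullet> x" by (intro tendsto_intros gv)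
    then show "(g' *v F j) \<bullet> x = 0" using frames_FV[OF g c j x] by (simp add: LIMSEQ_const_iff)
  qed
  ultimately show ?thesis using og by (auto simp: frames_def)
qed

lemma frames_act_flag:
  assumes g: "g \<in> frames V l L" and M: "orthogonal_matrix M"
  shows "M ** g \<in> frames (\<lambda>i. act M (V i)) l (act M L)"
proof -
  have "(M ** g *v F j) \<bullet> x = 0"
    if c: "(p, q) \<in> outer_corners CARD('k) l" "j \<in> {1..q}" "x \<in> act M (V (CARD('m) - q + p))" for p q j x
    using that frames_FV[OF g c(1,2)] orthogonal_matrix_inner[OF M]
    by (auto simp: act_def simp flip: matrix_vector_mul_assoc)
  moreover have "M ** g *v E i \<in> act M (V (CARD('m) - q + p))"
    if c: "(p, q) \<in> outer_corners CARD('k) l" "i \<in> {1..p}" for p q i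
    using frames_EV[OF g c] by (auto simp: act_def simp flip: matrix_vector_mul_assoc)
  moreover have "orthogonal_matrix (M ** g)" using M frames_orthogonal[OF g] by (rule orthogonal_matrix_mul)
  moreover have "act (M ** g) base_point = act M L" using frames_act[OF g] by (simp flip: act_act)
  ultimately show ?thesis by (auto simp: frames_def)
qed

definition frame_matrix :: "real ^ ('k + 'm) ^ ('k + 'm) \<Rightarrow> nat \<times> nat \<Rightarrow> real ^ ('k + 'm) ^ ('k + 'm)" where
  "frame_matrix g = (\<lambda>(i, j). outer (g *v F j) (g *v E i))"

lemma frame_matrix_on:
  assumes "orthogonal_matrix g" "b \<in> {1..CARD('k)} \<times> {1..CARD('m)}" "b' \<in> {1..CARD('k)} \<times> {1..CARD('m)}"
  shows "frame_matrix g b \<bullet> frame_matrix g b' = (if b = b' then 1 else 0)"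
  using assms by (auto simp: frame_matrix_def inner_outer_outer orthogonal_matrix_inner EE FF split: if_splits)

text \<open>Continuity of the intersections with the flag space is enough. Points of them that
  converge to \<open>x\<close> are fixed by the projections along the curve and are orthogonal to
  \<open>z\<close>, so \<open>z\<close> kills the difference quotients applied to these points. In
  the limit \<open>z\<close> kills \<open>(X + X^T) x\<close>, and the transposed part vanishes by
  \<open>X z = 0\<close>.\<close>

lemma tangent_space_orthogonal:
  fixes V :: "nat \<Rightarrow> (real ^ ('k + 'm)) set"
  assumes V: "complete_flag V" and y: "young_diagram CARD('k) CARD('m) l"
    and X: "X \<in> tangent_space (schubert_smooth V l) L" and c: "(p, q) \<in> outer_corners CARD('k) l"
    and x: "x \<in> L \<inter> V (CARD('m) - q + p)"
    and z: "\<And>v. v \<in> L \<Longrightarrow> z \<bullet> v = 0" "\<And>v. v \<in> V (CARD('m) - q + p) \<Longrightarrow> z \<bullet> v = 0"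
  shows "z \<bullet> (X *v x) = 0"
proof -
  let ?Y = "schubert_smooth V l" and ?W = "V (CARD('m) - q + p)"
  obtain \<gamma> \<epsilon> where \<gamma>: "\<epsilon> > 0" "\<gamma> 0 = L" "\<And>t :: real. \<bar>t\<bar> < \<epsilon> \<Longrightarrow> \<gamma> t \<in> ?Y"
    and d: "((\<lambda>t. proj_matrix (\<gamma> t)) has_vector_derivative (X + transpose X)) (at 0)"
    and hX: "X \<in> hom_perp L"
    using X by (auto simp: tangent_space_def)
  have L: "L \<in> ?Y" using \<gamma>(3)[of 0] \<gamma>(1,2) by simp
  have sW: "subspace ?W" using corner_bounds(4)[OF y c] flag_subspace[OF V] by simp
  \<comment> \<open>The denominator \<open>n + 2\<close> keeps all parameters strictly between 0 and
    \<open>\<epsilon>\<close>.\<close>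
  define t where "t n = \<epsilon> * inverse (real (Suc (Suc n)))" for n
  have t0: "t \<longlonglongrightarrow> 0"
    unfolding t_def using LIMSEQ_Suc[OF LIMSEQ_inverse_real_of_nat] tendsto_mult_right_zero by fast
  have "t n \<noteq> 0 \<and> \<bar>t n\<bar> < \<epsilon>" for n
  proof -
    have "0 < inverse (real (Suc (Suc n)))" "inverse (real (Suc (Suc n))) < 1"
      by (auto simp: inverse_eq_divide)
    then have "0 < t n" "t n < \<epsilon> * 1"
      unfolding t_def using \<gamma>(1) by (auto simp del: of_nat_Suc intro: mult_strict_left_mono)
    then show ?thesis by simp
  qed
  then have tn: "t n \<noteq> 0" "\<gamma> (t n) \<in> ?Y" for n using \<gamma>(3) by auto
  have "\<exists>g. g \<in> frames V l (\<gamma> (t n))" for n using frames_nonempty[OF V y tn(2)] by blast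
  then obtain g where g: "\<And>n. g n \<in> frames V l (\<gamma> (t n))" by metis
  \<comment> \<open>The frames along the curve are chosen pointwise; compactness of the orthogonal
    group supplies a limit along a subsequence, and the limit is a frame for
    \<open>L\<close>.\<close>
  have "\<forall>n. g n \<in> {g. orthogonal_matrix g}" using frames_orthogonal[OF g] by blast
  then obtain g' r where r: "strict_mono (r :: nat \<Rightarrow> nat)" and g': "(g \<circ> r) \<longlonglongrightarrow> g'"
    using compact_orthogonal_matrices unfolding compact_def by blast
  define s where "s = t \<circ> r"
  have s: "s \<longlonglongrightarrow> 0" "\<And>n. s n \<noteq> 0" "\<And>n. \<gamma> (s n) \<in> ?Y" "\<And>n. (g \<circ> r) n \<in> frames V l (\<gamma> (s n))"
    using LIMSEQ_subseq_LIMSEQ[OF t0 r] tn g by (auto simp: s_def)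
  have "isCont (\<lambda>t. proj_matrix (\<gamma> t)) 0"
    using d has_vector_derivative_continuous by blast
  then have "(\<lambda>n. proj_matrix (\<gamma> (s n))) \<longlonglongrightarrow> proj_matrix L"
    using s(1) \<gamma>(2) isCont_tendsto_compose by fastforce
  then have fg': "g' \<in> frames V l L"
    using schubert_smooth_grassmannian s(3) L by (intro frames_limit[OF V y s(4) _ _ g']) auto
  have sp: "act h (coord_sub p CARD('m)) = K \<inter> ?W" if "h \<in> frames V l K" "K \<in> ?Y" for h K
    using adapted_span[OF frames_orthogonal[OF that(1)] frames_act[OF that(1)] schubert_smooth_grassmannian[OF that(2)] sW]
      frames_EV[OF that(1) c] schubert_smooth_dim[OF that(2) c] by auto
  obtain v where v: "v \<in> coord_sub p CARD('m)" "x = g' *v v"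
    using sp[OF fg' L] x by (auto simp: act_def)
  have xn: "(g \<circ> r) n *v v \<in> \<gamma> (s n) \<inter> ?W" for n
    using sp[OF s(4) s(3)] v(1) by (auto simp: act_def)
  let ?D = "\<lambda>n. (1 / s n) *\<^sub>R (proj_matrix (\<gamma> (s n)) - proj_matrix (\<gamma> 0))"
  have "(\<lambda>n. z \<bullet> (?D n *v ((g \<circ> r) n *v v))) \<longlonglongrightarrow> z \<bullet> ((X + transpose X) *v (g' *v v))"
    by (intro tendsto_inner tendsto_const tendsto_matrix_vector_mult g'
      has_vector_derivative_quotient_tendsto[OF d s(1,2)])
  moreover have "z \<bullet> (?D n *v ((g \<circ> r) n *v v)) = 0" for n
  proof -
    let ?x = "(g \<circ> r) n *v v"
    have "subspace (\<gamma> (s n))" "subspace L" using s(3)[of n] L by (auto simp: schubert_smooth_def grassmannian_def)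
    then have "proj_matrix (\<gamma> (s n)) *v ?x = ?x" "z \<bullet> (proj_matrix (\<gamma> 0) *v ?x) = 0"
      using xn[of n] z(1) proj_matrix_in[of L ?x] \<gamma>(2) by (auto intro: proj_matrix_id)
    moreover have "z \<bullet> ?x = 0" using z(2) xn[of n] by blast
    ultimately show ?thesis
      by (simp add: matrix_vector_mult_diff_rdistrib inner_diff_right flip: scaleR_matrix_vector_assoc)
  qed
  ultimately have "z \<bullet> ((X + transpose X) *v x) = 0"
    unfolding v(2) by (simp only: LIMSEQ_const_iff)
  moreover have "z \<bullet> (transpose X *v x) = 0"
  proof -
    have "z \<in> orthogonal_comp L" using z(1) by (simp add: orthogonal_comp_def orthogonal_def inner_commute)
    then have "X *v z = 0" using hX by (simp add: hom_perp_def)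
    then show ?thesis using inner_matrix_vector[of X z x] by simp
  qed
  ultimately show ?thesis by (simp add: matrix_vector_mult_add_rdistrib inner_add_right)
qed

end

context grass_frame begin

section \<open>Tangent curves and the conormal space\<close>

lemma frame_matrix_hom_perp:
  assumes g: "orthogonal_matrix g" "act g base_point = L" and b: "b \<in> {1..CARD('k)} \<times> {1..CARD('m)}"
  shows "frame_matrix g b \<in> hom_perp L"
proof -
  obtain i j where ij: "b = (i, j)" "i \<in> {1..CARD('k)}" "j \<in> {1..CARD('m)}" using b by auto
  have EL: "g *v E i \<in> L" unfolding g(2)[symmetric] act_def using E_base[OF ij(2)] by blast
  have FL: "(g *v F j) \<bullet> x = 0" if "x \<in> L" for x
    using that F_base[OF ij(3)] orthogonal_matrix_inner[OF g(1)] unfolding g(2)[symmetric] act_def by auto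
  have "g *v F j \<in> orthogonal_comp L"
    using FL by (simp add: orthogonal_comp_def orthogonal_def inner_commute)
  moreover have "subspace (orthogonal_comp L)" by (rule subspace_orthogonal_comp)
  ultimately show ?thesis
    using EL by (auto simp: hom_perp_def ij(1) frame_matrix_def outer_mult_vec orthogonal_comp_def
        orthogonal_def intro: subspace_scale)
qed

lemma hom_perp_expand:
  assumes g: "orthogonal_matrix g" "act g base_point = L" and X: "X \<in> hom_perp L"
  shows "X = (\<Sum>b\<in>{1..CARD('k)} \<times> {1..CARD('m)}. (X \<bullet> frame_matrix g b) *\<^sub>R frame_matrix g b)"
proof -
  let ?R = "\<Sum>b\<in>{1..CARD('k)} \<times> {1..CARD('m)}. (X \<bullet> frame_matrix g b) *\<^sub>R frame_matrix g b"
  have Rv: "?R *v x = (\<Sum>i=1..CARD('k). \<Sum>j=1..CARD('m).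
      ((g *v F j) \<bullet> (X *v (g *v E i))) *\<^sub>R ((g *v E i) \<bullet> x) *\<^sub>R (g *v F j))" for x
  proof -
    have "?R *v x = (\<Sum>b\<in>{1..CARD('k)} \<times> {1..CARD('m)}. ((X \<bullet> frame_matrix g b) *\<^sub>R frame_matrix g b) *v x)"
      using linear_sum[of "\<lambda>A. A *v x"]
        bounded_bilinear.bounded_linear_left[OF bounded_bilinear_matrix_vector_mult, THEN bounded_linear.linear]
      by blast
    also have "\<dots> = (\<Sum>(i, j)\<in>{1..CARD('k)} \<times> {1..CARD('m)}.
      ((g *v F j) \<bullet> (X *v (g *v E i))) *\<^sub>R ((g *v E i) \<bullet> x) *\<^sub>R (g *v F j))"
      by (intro sum.cong refl)
        (auto simp: frame_matrix_def inner_outer outer_mult_vec simp flip: scaleR_matrix_vector_assoc)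
    finally show ?thesis by (simp add: sum.cartesian_product)
  qed
  have gE: "(g *v E i) \<bullet> (g *v E i') = (if i = i' then 1 else 0)" if "i \<in> {1..CARD('k)}" "i' \<in> {1..CARD('k)}" for i i'
    using EE[OF that] by (simp add: orthogonal_matrix_inner[OF g(1)])
  have "X ** g = ?R ** g"
  proof (rule matrix_eq_frame)
    fix i assume i: "i \<in> {1..CARD('k)}"
    let ?y = "X *v (g *v E i)"
    have L: "g *v E i' \<in> L" if "i' \<in> {1..CARD('k)}" for i'
      unfolding g(2)[symmetric] act_def using E_base[OF that] by blast
    have "?y \<in> orthogonal_comp L" using X L[OF i] by (simp add: hom_perp_def)
    then have 0: "(g *v E i') \<bullet> ?y = 0" if "i' \<in> {1..CARD('k)}" for i'
      using L[OF that] by (simp add: orthogonal_comp_def orthogonal_def)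
    have "transpose g *v ?y = (\<Sum>i'=1..CARD('k). (E i' \<bullet> (transpose g *v ?y)) *\<^sub>R E i')
       + (\<Sum>j=1..CARD('m). (F j \<bullet> (transpose g *v ?y)) *\<^sub>R F j)" by (rule frame_expand)
    also have "\<dots> = (\<Sum>j=1..CARD('m). ((g *v F j) \<bullet> ?y) *\<^sub>R F j)"
      using 0 by (simp add: inner_matrix_vector)
    finally have "g *v (transpose g *v ?y) = g *v (\<Sum>j=1..CARD('m). ((g *v F j) \<bullet> ?y) *\<^sub>R F j)" by simp
    moreover have "g *v (transpose g *v ?y) = ?y"
      unfolding matrix_vector_mul_assoc[of g "transpose g"] orthogonal_matrix_mult_transpose(2)[OF g(1)] by simp
    ultimately have y: "?y = (\<Sum>j=1..CARD('m). ((g *v F j) \<bullet> ?y) *\<^sub>R (g *v F j))"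
      by (simp only: matrix_frame_sum)
    have "?R *v (g *v E i) = (\<Sum>i'=1..CARD('k). if i' = i then
        (\<Sum>j=1..CARD('m). ((g *v F j) \<bullet> (X *v (g *v E i))) *\<^sub>R (g *v F j)) else 0)"
      unfolding Rv using i gE by (intro sum.cong refl) auto
    also have "\<dots> = ?y" using i y by simp
    finally show "X ** g *v E i = ?R ** g *v E i" by (simp flip: matrix_vector_mul_assoc)
  next
    fix j assume j: "j \<in> {1..CARD('m)}"
    have 0: "(g *v F j) \<bullet> x = 0" if "x \<in> L" for x
      using that F_base[OF j] orthogonal_matrix_inner[OF g(1)] unfolding g(2)[symmetric] act_def by auto
    then have "g *v F j \<in> orthogonal_comp L" by (simp add: orthogonal_comp_def orthogonal_def inner_commute)
    then have "X *v (g *v F j) = 0" using X by (simp add: hom_perp_def)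
    moreover have "?R *v (g *v F j) = 0"
      unfolding Rv using j EF by (intro sum.neutral ballI) (simp add: orthogonal_matrix_inner[OF g(1)])
    ultimately show "X ** g *v F j = ?R ** g *v F j" by (simp flip: matrix_vector_mul_assoc)
  qed
  then have "X ** (g ** transpose g) = ?R ** (g ** transpose g)" by (simp only: matrix_mul_assoc)
  then show ?thesis using orthogonal_matrix_mult_transpose(2)[OF g(1)] by (simp only: matrix_mul_rid)
qed

text \<open>The curve \<open>A (1 + t F\<^sub>j E\<^sub>i\<^sup>T) A\<^sup>-\<^sup>1 L\<close> stays in the Schubert cell, because the elementary
  matrix preserves all coordinate subspaces belonging to the corners.\<close>

lemma frame_matrix_tangent:
  fixes V :: "nat \<Rightarrow> (real ^ ('k + 'm)) set"
  assumes V: "complete_flag V" and y: "young_diagram CARD('k) CARD('m) l" and L: "L \<in> schubert_smooth V l"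
    and g: "orthogonal_matrix g" "act g base_point = L"
    and A: "invertible A" "\<And>i. i \<in> {1..CARD('k)} \<Longrightarrow> A *v E i = g *v E i"
      "\<And>j. j \<in> {1..CARD('m)} \<Longrightarrow> A *v F j - g *v F j \<in> L"
      "\<And>a. a \<le> CARD('k + 'm) \<Longrightarrow> act A (coord_sub (dim (L \<inter> V a)) (CARD('m) + dim (L \<inter> V a) - a)) = V a"
    and ij: "i \<in> {1..CARD('k)}" "j \<in> {1..CARD('m)}" "(i, j) \<notin> boxes CARD('k) l"
  shows "frame_matrix g (i, j) \<in> tangent_space (schubert_smooth V l) L"
proof -
  let ?Z = "frame_matrix g (i, j)"
  define B where "B = matrix_inv A"
  \<comment> \<open>The elementary matrix \<open>F j (E i)^T\<close>, conjugated by
    \<open>A\<close>.\<close>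
  define W where "W = outer (A *v F j) (transpose B *v E i)"
  have sL: "subspace L" "dim L = CARD('k)" using L by (auto simp: schubert_smooth_def grassmannian_def)
  have BA: "B ** A = mat 1" using A(1) by (simp add: B_def matrix_inv_mult)
  have Wv: "W *v (A *v v) = (E i \<bullet> v) *\<^sub>R (A *v F j)" for v
  proof -
    have "(transpose B *v E i) \<bullet> (A *v v) = E i \<bullet> (B *v (A *v v))"
      using inner_matrix_vector[of "transpose B" "E i"] by simp
    also have "\<dots> = E i \<bullet> v" using BA by (simp add: matrix_vector_mul_assoc)
    finally show ?thesis by (simp add: W_def outer_mult_vec)
  qed
  have gL: "g *v E i' \<in> L" if "i' \<in> {1..CARD('k)}" for i'
    unfolding g(2)[symmetric] act_def using E_base[OF that] by blast
  have FL: "(g *v F j) \<bullet> x = 0" if "x \<in> L" for x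
    using that F_base[OF ij(2)] orthogonal_matrix_inner[OF g(1)] unfolding g(2)[symmetric] act_def by auto
  define P where "P = proj_matrix L"
  \<comment> \<open>\<open>A\<close> agrees with \<open>g\<close> on the base point and, modulo
    \<open>L\<close>, on the \<open>F j\<close>. So compressing \<open>W\<close> by \<open>P\<close>
    on the right and by \<open>mat 1 - P\<close> on the left turns it into the frame matrix of
    \<open>g\<close>, although the curve is built from \<open>A\<close>.\<close>
  have P1: "P *v (transpose B *v E i) = g *v E i"
  proof -
    have "P *v (transpose B *v E i - g *v E i) = 0" unfolding P_def
    proof (rule proj_matrix_orthogonal[OF sL(1)])
      fix z assume "z \<in> L"
      then obtain x where x: "x \<in> base_point" "z = g *v x" unfolding g(2)[symmetric] act_def by blast
      have xs: "x = (\<Sum>i=1..CARD('k). (E i \<bullet> x) *\<^sub>R E i)" using frame_expand[of x] base_iff x(1) by simp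
      have "A *v x = (\<Sum>i=1..CARD('k). (E i \<bullet> x) *\<^sub>R (A *v E i))"
        using arg_cong[OF xs, of "(*v) A"] by (simp only: matrix_frame_sum)
      moreover have "g *v x = (\<Sum>i=1..CARD('k). (E i \<bullet> x) *\<^sub>R (g *v E i))"
        using arg_cong[OF xs, of "(*v) g"] by (simp only: matrix_frame_sum)
      ultimately have Ax: "z = A *v x" using A(2) x(2) by simp
      have "(transpose B *v E i) \<bullet> z = E i \<bullet> (B *v (A *v x))"
        unfolding Ax using inner_matrix_vector[of "transpose B" "E i"] by simp
      also have "\<dots> = E i \<bullet> x" using BA by (simp add: matrix_vector_mul_assoc)
      also have "\<dots> = (g *v E i) \<bullet> z" unfolding x(2) by (simp add: orthogonal_matrix_inner[OF g(1)])
      finally show "(transpose B *v E i - g *v E i) \<bullet> z = 0" by (simp add: inner_diff_left)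
    qed
    moreover have "P *v (g *v E i) = g *v E i" unfolding P_def using gL[OF ij(1)] sL(1) by (intro proj_matrix_id)
    ultimately show ?thesis by (simp add: matrix_vector_mult_diff_distrib)
  qed
  have P2: "(mat 1 - P) *v (A *v F j) = g *v F j"
  proof -
    have "P *v (A *v F j - g *v F j) = A *v F j - g *v F j"
      unfolding P_def using A(3)[OF ij(2)] sL(1) by (intro proj_matrix_id)
    moreover have "P *v (g *v F j) = 0" unfolding P_def using FL sL(1) by (intro proj_matrix_orthogonal)
    ultimately show ?thesis
      by (simp add: matrix_vector_mult_diff_rdistrib matrix_vector_mult_diff_distrib)
  qed
  have "(mat 1 - P) ** W ** P = ?Z"
    using P1 P2 by (simp add: W_def matrix_mult_outer outer_matrix_mult transpose_proj_matrix[OF sL(1)] P_def frame_matrix_def)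
  then have d: "((\<lambda>t. proj_matrix (act (mat 1 + t *\<^sub>R W) L)) has_vector_derivative (?Z + transpose ?Z)) (at 0)"
    using proj_matrix_curve(1)[OF sL(1), of W] by (simp add: P_def)
  obtain \<epsilon> where \<epsilon>: "0 < \<epsilon>" "\<And>t :: real. t \<noteq> 0 \<Longrightarrow> \<bar>t\<bar> < \<epsilon> \<Longrightarrow> invertible (mat 1 + t *\<^sub>R W)"
    using proj_matrix_curve(2)[OF sL(1), of W] unfolding eventually_at by (auto simp: dist_real_def)
  have inv: "invertible (mat 1 + t *\<^sub>R W)" if "\<bar>t\<bar> < \<epsilon>" for t :: real
    using \<epsilon>(2)[OF _ that] by (cases "t = 0") (auto simp: invertible_def)
  have WV: "W *v x \<in> V (CARD('m) - q + p)" if c: "(p, q) \<in> outer_corners CARD('k) l" "x \<in> V (CARD('m) - q + p)" for p q x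
  proof -
    note b = corner_bounds[OF y c(1)]
    have a: "CARD('m) - q + p \<le> CARD('k + 'm)" using b(4) by simp
    have AV: "act A (coord_sub p q) = V (CARD('m) - q + p)"
      using A(4)[OF a] unfolding schubert_smooth_dim[OF L c(1)] b(5) .
    then obtain v where v: "v \<in> coord_sub p q" "x = A *v v" using c(2) unfolding act_def by blast
    \<comment> \<open>For \<open>i \<le> p\<close>, having \<open>j \<le> q\<close> would make
      \<open>(i, j)\<close> a box, so \<open>j > q\<close> and \<open>F j\<close> belongs to the
      model space. For \<open>i > p\<close> the coefficient vanishes on the model space.\<close>
    have "(E i \<bullet> v) *\<^sub>R F j \<in> coord_sub p q"
    proof (cases "i \<le> p")
      case True
      then have "q < j" using ij boxes_iff_corner[OF y] c(1) by fastforce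
      moreover have "q \<le> CARD('m)" using b(2) by simp
      ultimately have "F j \<in> coord_sub p q" using ij(2) FF EF by (auto simp: coord_sub_def)
      then show ?thesis using subspace_coord_sub[of p q] b by (intro subspace_scale) auto
    next
      case False
      then show ?thesis using v(1) ij(1) subspace_0[OF subspace_coord_sub[of p q]] b by (auto simp: coord_sub_def)
    qed
    then have "A *v ((E i \<bullet> v) *\<^sub>R F j) \<in> V (CARD('m) - q + p)" unfolding AV[symmetric] act_def by blast
    then show ?thesis by (simp add: v(2) Wv matrix_vector_mult_scaleR)
  qed
  have curve: "act (mat 1 + t *\<^sub>R W) L \<in> schubert_smooth V l" if t: "\<bar>t\<bar> < \<epsilon>" for t :: real
  proof -
    let ?M = "mat 1 + t *\<^sub>R W"
    have "dim (act ?M L \<inter> V (CARD('m) - q + p)) = p" if c: "(p, q) \<in> outer_corners CARD('k) l" for p q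
    proof -
      let ?V = "V (CARD('m) - q + p)"
      have sV: "subspace ?V" using corner_bounds(4)[OF y c] flag_subspace[OF V] by simp
      have "act ?M ?V = ?V"
      proof (rule subspace_dim_equal)
        show "act ?M ?V \<subseteq> ?V"
        proof
          fix u assume "u \<in> act ?M ?V"
          then obtain x where "x \<in> ?V" "u = x + t *\<^sub>R (W *v x)"
            by (auto simp: act_def matrix_vector_mult_add_rdistrib scaleR_matrix_vector_assoc)
          then show "u \<in> ?V" using WV[OF c] by (simp add: subspace_add subspace_scale sV)
        qed
      qed (simp_all add: sV subspace_act dim_act[OF inv[OF t]])
      then have "act ?M L \<inter> ?V = act ?M (L \<inter> ?V)" using act_Int[OF inv[OF t]] by metis
      then show ?thesis using dim_act[OF inv[OF t]] schubert_smooth_dim[OF L c] by simp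
    qed
    moreover have "act ?M L \<in> grassmannian" using sL by (simp add: grassmannian_def subspace_act dim_act[OF inv[OF t]])
    ultimately show ?thesis by (auto simp: schubert_smooth_def)
  qed
  have "?Z \<in> hom_perp L" using frame_matrix_hom_perp[OF g] ij by simp
  then show ?thesis unfolding tangent_space_def
    using \<epsilon>(1) d curve by (auto intro!: exI[of _ "\<lambda>t. act (mat 1 + t *\<^sub>R W) L"] exI[of _ \<epsilon>])
qed

lemma subspace_hom_perp: "subspace (hom_perp L)"
  unfolding hom_perp_def subspace_def
  by (auto simp: matrix_vector_mult_add_rdistrib subspace_add[OF subspace_orthogonal_comp]
      subspace_scale[OF subspace_orthogonal_comp] subspace_0[OF subspace_orthogonal_comp] simp flip: scaleR_matrix_vector_assoc)

text \<open>The span is contained in the conormal space for every frame, by the constraint on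
  velocities. For the reverse, tangent curves are available for a frame \<open>h\<close> with a
  companion basis \<open>A\<close>; this fixes the dimension, and a dimension count transfers the
  equality to the given \<open>g\<close>.\<close>

lemma conormal_space_frame:
  fixes V :: "nat \<Rightarrow> (real ^ ('k + 'm)) set"
  assumes V: "complete_flag V" and y: "young_diagram CARD('k) CARD('m) l" and L: "L \<in> schubert_smooth V l"
    and g: "g \<in> frames V l L"
  shows "conormal_space (schubert_smooth V l) L = span (frame_matrix g ` boxes CARD('k) l)"
proof -
  let ?C = "conormal_space (schubert_smooth V l) L" and ?b = "boxes CARD('k) l"
  have bs: "?b \<subseteq> {1..CARD('k)} \<times> {1..CARD('m)}" by (rule boxes_subset[OF y])
  have sC: "subspace ?C"
    using subspace_hom_perp[of L] by (auto simp: conormal_space_def subspace_def inner_add_left)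
  have sub: "span (frame_matrix h ` ?b) \<subseteq> ?C" if h: "h \<in> frames V l L" for h
  proof (intro span_minimal sC subsetI)
    fix X assume "X \<in> frame_matrix h ` ?b"
    then obtain i j where ij: "(i, j) \<in> ?b" and X: "X = frame_matrix h (i, j)" by auto
    have ij': "i \<in> {1..CARD('k)}" "j \<in> {1..CARD('m)}" using bs ij by auto
    have "X \<in> hom_perp L"
      unfolding X using frames_orthogonal[OF h] frames_act[OF h] ij' by (intro frame_matrix_hom_perp) auto
    moreover have "X \<bullet> Z = 0" if Z: "Z \<in> tangent_space (schubert_smooth V l) L" for Z
    proof -
      obtain p q where c: "(p, q) \<in> outer_corners CARD('k) l" "i \<le> p" "j \<le> q"
        using ij boxes_iff_corner[OF y] by fastforce
      have "(h *v F j) \<bullet> (Z *v (h *v E i)) = 0"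
      proof (rule tangent_space_orthogonal[OF V y Z c(1)])
        show "h *v E i \<in> L \<inter> V (CARD('m) - q + p)"
          using frames_E[OF h ij'(1)] frames_EV[OF h c(1), of i] c(2) ij' by auto
        show "(h *v F j) \<bullet> v = 0" if "v \<in> L" for v using frames_F[OF h ij'(2) that] .
        show "(h *v F j) \<bullet> v = 0" if "v \<in> V (CARD('m) - q + p)" for v
          using frames_FV[OF h c(1) _ that, of j] c(3) ij' by auto
      qed
      then show ?thesis by (simp add: X frame_matrix_def inner_commute[of "outer _ _"] inner_outer)
    qed
    ultimately show "X \<in> ?C" by (simp add: conormal_space_def)
  qed
  have dim: "dim (span (frame_matrix h ` ?b)) = card ?b" if "h \<in> frames V l L" for h
    using frame_matrix_on[OF frames_orthogonal[OF that]] bs by (intro dim_span_orthonormal_family) blast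
  obtain h A where h: "orthogonal_matrix h" "act h base_point = L"
    "\<And>a i. a \<le> CARD('k + 'm) \<Longrightarrow> i \<in> {1..dim (L \<inter> V a)} \<Longrightarrow> h *v E i \<in> V a"
    "\<And>a j x. a \<le> CARD('k + 'm) \<Longrightarrow> j \<in> {1..CARD('m) + dim (L \<inter> V a) - a} \<Longrightarrow> x \<in> V a \<Longrightarrow> (h *v F j) \<bullet> x = 0"
    and A: "invertible A" "\<And>i. i \<in> {1..CARD('k)} \<Longrightarrow> A *v E i = h *v E i"
    "\<And>j. j \<in> {1..CARD('m)} \<Longrightarrow> A *v F j - h *v F j \<in> L"
    "\<And>a. a \<le> CARD('k + 'm) \<Longrightarrow> act A (coord_sub (dim (L \<inter> V a)) (CARD('m) + dim (L \<inter> V a) - a)) = V a"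
    by (rule adapted_basis[OF V schubert_smooth_grassmannian[OF L]]) (rule that)
  have hf: "h \<in> frames V l L" by (rule framesI[OF y L h])
  have "?C \<subseteq> span (frame_matrix h ` ?b)"
  proof
    fix X assume X: "X \<in> ?C"
    then have "X \<in> hom_perp L" by (simp add: conormal_space_def)
    then have "X = (\<Sum>b\<in>{1..CARD('k)} \<times> {1..CARD('m)}. (X \<bullet> frame_matrix h b) *\<^sub>R frame_matrix h b)"
      by (rule hom_perp_expand[OF h(1,2)])
    also have "\<dots> = (\<Sum>b\<in>?b. (X \<bullet> frame_matrix h b) *\<^sub>R frame_matrix h b)"
    proof (rule sum.mono_neutral_right)
      show "\<forall>b\<in>{1..CARD('k)} \<times> {1..CARD('m)} - ?b. (X \<bullet> frame_matrix h b) *\<^sub>R frame_matrix h b = 0"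
      proof
        fix b assume b: "b \<in> {1..CARD('k)} \<times> {1..CARD('m)} - ?b"
        then have "frame_matrix h b \<in> tangent_space (schubert_smooth V l) L"
          using frame_matrix_tangent[OF V y L h(1,2) A] by auto
        then show "(X \<bullet> frame_matrix h b) *\<^sub>R frame_matrix h b = 0" using X by (simp add: conormal_space_def)
      qed
    qed (use bs in auto)
    also have "\<dots> \<in> span (frame_matrix h ` ?b)" by (intro span_sum span_scale span_base) auto
    finally show "X \<in> span (frame_matrix h ` ?b)" .
  qed
  then have "dim ?C \<le> card ?b" using dim_subset[of ?C "span (frame_matrix h ` ?b)"] dim[OF hf] by simp
  then show ?thesis
    using subspace_dim_equal[OF subspace_span sC sub[OF g]] dim[OF g] by simp
qed

lemma schubert_smooth_transitive:
  fixes V :: "nat \<Rightarrow> (real ^ ('k + 'm)) set"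
  assumes V: "complete_flag V" and y: "young_diagram CARD('k) CARD('m) l"
    and L: "L \<in> schubert_smooth V l" "L' \<in> schubert_smooth V l"
  shows "\<exists>g. orthogonal_matrix g \<and> act g L = L' \<and>
     (\<lambda>X. g ** X ** transpose g) ` conormal_space (schubert_smooth V l) L = conormal_space (schubert_smooth V l) L'"
proof -
  obtain h h' where h: "h \<in> frames V l L" and h': "h' \<in> frames V l L'"
    using frames_nonempty[OF V y L(1)] frames_nonempty[OF V y L(2)] by metis
  note o = frames_orthogonal[OF h] frames_orthogonal[OF h']
  let ?g = "h' ** transpose h"
  have gh: "?g ** h = h'" using o(1) by (simp add: orthogonal_matrix flip: matrix_mul_assoc)
  have "orthogonal_matrix ?g" using o by (simp add: orthogonal_matrix_mul)
  moreover have "act ?g L = L'"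
    unfolding frames_act[OF h, symmetric] act_act gh by (rule frames_act[OF h'])
  moreover have "(\<lambda>X. ?g ** X ** transpose ?g) ` span (frame_matrix h ` boxes CARD('k) l) = span (frame_matrix h' ` boxes CARD('k) l)"
  proof -
    have lin: "linear (\<lambda>X. ?g ** X ** transpose ?g)"
      by (intro bounded_linear.linear bounded_linear_compose[OF matmul.bounded_linear_left] matmul.bounded_linear_right)
    have "?g ** frame_matrix h b ** transpose ?g = frame_matrix h' b" for b
      by (cases b) (simp add: frame_matrix_def matrix_mult_outer outer_matrix_mult matrix_vector_mul_assoc gh)
    then show ?thesis unfolding linear_span_image[OF lin, symmetric] by (simp add: image_image)
  qed
  ultimately show ?thesis
    unfolding conormal_space_frame[OF V y L(1) h] conormal_space_frame[OF V y L(2) h'] by blast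
qed

end

section \<open>Charts of Schubert cells\<close>

text \<open>A family as demanded by \<open>smooth_on\<close>: matrix expressions in \<open>X\<close>
  and the inverse of \<open>N X\<close>. It is closed under directional derivatives as soon as all
  \<open>N X\<close> are invertible and the derivatives of \<open>N\<close> belong to it.\<close>

inductive_set smooth_class :: "(real ^ 'n ^ 'n \<Rightarrow> real ^ 'n ^ 'n) \<Rightarrow> (real ^ 'n ^ 'n \<Rightarrow> real ^ 'n ^ 'n) set"
  for N :: "real ^ 'n ^ 'n \<Rightarrow> real ^ 'n ^ 'n" where
  smooth_const: "(\<lambda>X. C) \<in> smooth_class N"
| smooth_ident: "(\<lambda>X. X) \<in> smooth_class N"
| smooth_linear: "g \<in> smooth_class N \<Longrightarrow> bounded_linear f \<Longrightarrow> (\<lambda>X. f (g X)) \<in> smooth_class N"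
| smooth_add: "g \<in> smooth_class N \<Longrightarrow> h \<in> smooth_class N \<Longrightarrow> (\<lambda>X. g X + h X) \<in> smooth_class N"
| smooth_mult: "g \<in> smooth_class N \<Longrightarrow> h \<in> smooth_class N \<Longrightarrow> (\<lambda>X. g X ** h X) \<in> smooth_class N"
| smooth_inv: "(\<lambda>X. matrix_inv (N X)) \<in> smooth_class N"

lemma smooth_class_smooth_on:
  fixes N :: "real ^ 'n ^ 'n \<Rightarrow> real ^ 'n ^ 'n"
  assumes inv: "\<And>X. invertible (N X)"
    and N': "\<And>X. (N has_derivative N' X) (at X)" "\<And>v. (\<lambda>X. N' X v) \<in> smooth_class N"
    and g: "g \<in> smooth_class N"
  shows "smooth_on U g"
proof -
  have "\<exists>g'. (\<forall>X. (g has_derivative g' X) (at X)) \<and> (\<forall>v. (\<lambda>X. g' X v) \<in> smooth_class N)"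
    if "g \<in> smooth_class N" for g
    using that
  proof induction
    case (smooth_const C)
    show ?case by (intro exI[of _ "\<lambda>X v. 0"]) (auto intro: smooth_class.smooth_const)
  next
    case smooth_ident
    show ?case by (intro exI[of _ "\<lambda>X v. v"]) (auto intro: smooth_class.smooth_const)
  next
    case (smooth_linear g f)
    from smooth_linear.IH obtain g' where g': "\<And>X. (g has_derivative g' X) (at X)" "\<And>v. (\<lambda>X. g' X v) \<in> smooth_class N" by blast
    have "((\<lambda>X. f (g X)) has_derivative (\<lambda>v. f (g' X v))) (at X)" for X
      by (rule bounded_linear.has_derivative[OF smooth_linear.hyps(2) g'(1)])
    moreover have "(\<lambda>X. f (g' X v)) \<in> smooth_class N" for v
      by (rule smooth_class.smooth_linear[OF g'(2) smooth_linear.hyps(2)])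
    ultimately show ?case by (intro exI[of _ "\<lambda>X v. f (g' X v)"]) simp
  next
    case (smooth_add g h)
    from smooth_add.IH obtain g' h' where g': "\<And>X. (g has_derivative g' X) (at X)" "\<And>v. (\<lambda>X. g' X v) \<in> smooth_class N"
      and h': "\<And>X. (h has_derivative h' X) (at X)" "\<And>v. (\<lambda>X. h' X v) \<in> smooth_class N" by blast
    have "((\<lambda>X. g X + h X) has_derivative (\<lambda>v. g' X v + h' X v)) (at X)" for X
      by (rule has_derivative_add[OF g'(1) h'(1)])
    moreover have "(\<lambda>X. g' X v + h' X v) \<in> smooth_class N" for v
      by (rule smooth_class.smooth_add[OF g'(2) h'(2)])
    ultimately show ?case by (intro exI[of _ "\<lambda>X v. g' X v + h' X v"]) simp
  next
    case (smooth_mult g h)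
    from smooth_mult.IH obtain g' h' where g': "\<And>X. (g has_derivative g' X) (at X)" "\<And>v. (\<lambda>X. g' X v) \<in> smooth_class N"
      and h': "\<And>X. (h has_derivative h' X) (at X)" "\<And>v. (\<lambda>X. h' X v) \<in> smooth_class N" by blast
    have "((\<lambda>X. g X ** h X) has_derivative (\<lambda>v. g X ** h' X v + g' X v ** h X)) (at X)" for X
      by (rule bounded_bilinear.FDERIV[OF bounded_bilinear_matrix_mult g'(1) h'(1)])
    moreover have "(\<lambda>X. g X ** h' X v + g' X v ** h X) \<in> smooth_class N" for v
      by (rule smooth_class.smooth_add[OF smooth_class.smooth_mult[OF smooth_mult.hyps(1) h'(2)]
            smooth_class.smooth_mult[OF g'(2) smooth_mult.hyps(2)]])
    ultimately show ?case by (intro exI[of _ "\<lambda>X v. g X ** h' X v + g' X v ** h X"]) simp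
  next
    case smooth_inv
    have "((\<lambda>X. matrix_inv (N X)) has_derivative (\<lambda>v. - (matrix_inv (N X) ** N' X v ** matrix_inv (N X)))) (at X)" for X
      by (rule has_derivative_matrix_inv'[OF N'(1) inv])
    moreover have "(\<lambda>X. - (matrix_inv (N X) ** N' X v ** matrix_inv (N X))) \<in> smooth_class N" for v
      by (rule smooth_class.smooth_linear[OF smooth_class.smooth_mult[OF
            smooth_class.smooth_mult[OF smooth_class.smooth_inv N'(2)] smooth_class.smooth_inv]
            bounded_linear_minus[OF bounded_linear_ident]])
    ultimately show ?case
      by (intro exI[of _ "\<lambda>X v. - (matrix_inv (N X) ** N' X v ** matrix_inv (N X))"]) simp
  qed
  then show ?thesis unfolding smooth_on_def using g by (intro exI[of _ "smooth_class N"]) blast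
qed

lemma differentiable_matrix_mult:
  fixes f :: "'a::real_normed_vector \<Rightarrow> real ^ 'n ^ 'm" and g :: "'a \<Rightarrow> real ^ 'p ^ 'n"
  assumes "f differentiable (at x)" "g differentiable (at x)"
  shows "(\<lambda>x. f x ** g x) differentiable (at x)"
  using assms bounded_bilinear.FDERIV[OF bounded_bilinear_matrix_mult] unfolding differentiable_def by blast

lemma differentiable_matrix_inv:
  fixes f :: "'a::real_normed_vector \<Rightarrow> real ^ 'n ^ 'n"
  assumes "f differentiable (at x)" "invertible (f x)"
  shows "(\<lambda>x. matrix_inv (f x)) differentiable (at x)"
  using assms has_derivative_matrix_inv' unfolding differentiable_def by blast

context grass_frame begin

abbreviation (input) P0 :: "real ^ ('k + 'm) ^ ('k + 'm)" where "P0 \<equiv> proj_matrix base_point"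
abbreviation (input) Q0 :: "real ^ ('k + 'm) ^ ('k + 'm)" where "Q0 \<equiv> mat 1 - proj_matrix base_point"

lemma P0_simps:
  "P0 ** P0 = P0" "M ** P0 ** P0 = M ** P0" "P0 ** Q0 = 0" "M ** P0 ** Q0 = 0" "Q0 ** P0 = 0" "M ** Q0 ** P0 = 0"
  "Q0 ** Q0 = Q0" "M ** Q0 ** Q0 = M ** Q0" "transpose P0 = P0" "transpose Q0 = Q0"
  for M :: "real ^ ('k + 'm) ^ ('k + 'm)"
proof -
  show PP: "P0 ** P0 = P0" using subspace_base by (rule proj_matrix_idem)
  show PQ: "P0 ** Q0 = 0" and QP: "Q0 ** P0 = 0" using PP by (simp_all add: matmul.diff_left matmul.diff_right)
  show QQ: "Q0 ** Q0 = Q0" using PP by (simp add: matmul.diff_left matmul.diff_right)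
  show "M ** P0 ** P0 = M ** P0" "M ** P0 ** Q0 = 0" "M ** Q0 ** P0 = 0" "M ** Q0 ** Q0 = M ** Q0"
    by (simp_all only: PP PQ QP QQ matmul.zero_right flip: matrix_mul_assoc)
  show "transpose P0 = P0" using subspace_base by (rule transpose_proj_matrix)
  then show "transpose Q0 = Q0" by (simp add: transpose_diff transpose_mat)
qed

text \<open>Compression to the block that is Hom at the base point. \<open>submanifold\<close> asks
  for parametrizations on open sets of the full matrix space, so charts are defined for all matrices
  and see only this block.\<close>

definition hproj :: "real ^ ('k + 'm) ^ ('k + 'm) \<Rightarrow> real ^ ('k + 'm) ^ ('k + 'm)" where
  "hproj X = Q0 ** X ** P0"

lemma bounded_linear_hproj: "bounded_linear hproj"
  unfolding hproj_def
  by (intro bounded_linear_compose[OF matmul.bounded_linear_left] matmul.bounded_linear_right)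

lemma hom_perp_base_iff: "X \<in> hom_perp base_point \<longleftrightarrow> hproj X = X"
proof
  assume X: "X \<in> hom_perp (base_point :: (real ^ ('k + 'm)) set)"
  have "hproj X *v x = X *v x" for x
  proof -
    have "Q0 *v x \<in> orthogonal_comp base_point"
      using proj_matrix_compl[OF subspace_base]
      by (auto simp: orthogonal_comp_def orthogonal_def inner_commute matrix_vector_mult_diff_rdistrib)
    then have "X *v (Q0 *v x) = 0" using X by (simp add: hom_perp_def)
    then have XP: "X *v (P0 *v x) = X *v x"
      by (simp add: matrix_vector_mult_diff_rdistrib matrix_vector_mult_diff_distrib)
    have "X *v (P0 *v x) \<in> orthogonal_comp base_point"
      using X proj_matrix_in[OF subspace_base] by (simp add: hom_perp_def)
    then have "P0 *v (X *v (P0 *v x)) = 0"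
      by (intro proj_matrix_orthogonal subspace_base) (auto simp: orthogonal_comp_def orthogonal_def inner_commute)
    then show ?thesis using XP
      by (simp add: hproj_def matrix_vector_mult_diff_rdistrib flip: matrix_vector_mul_assoc)
  qed
  then show "hproj X = X" by (simp add: matrix_eq)
next
  assume X: "hproj X = X"
  show "X \<in> hom_perp base_point"
    unfolding hom_perp_def
  proof (intro CollectI conjI ballI)
    fix x :: "real ^ ('k + 'm)" assume "x \<in> base_point"
    have "X *v x = Q0 *v (X *v (P0 *v x))" by (subst X[symmetric]) (simp add: hproj_def flip: matrix_vector_mul_assoc)
    then show "X *v x \<in> orthogonal_comp base_point"
      using proj_matrix_compl[OF subspace_base]
      by (auto simp: orthogonal_comp_def orthogonal_def inner_commute matrix_vector_mult_diff_rdistrib)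
  next
    fix x :: "real ^ ('k + 'm)" assume "x \<in> orthogonal_comp base_point"
    then have "P0 *v x = 0"
      by (intro proj_matrix_orthogonal subspace_base) (auto simp: orthogonal_comp_def orthogonal_def inner_commute)
    then show "X *v x = 0" by (subst X[symmetric]) (simp add: hproj_def flip: matrix_vector_mul_assoc)
  qed
qed

lemma hproj_P0: "P0 ** hproj X = 0" "hproj X ** P0 = hproj X" "M ** P0 ** hproj X = 0" "Q0 ** hproj X = hproj X"
    "hproj X ** Q0 = 0" "hproj X ** hproj Y = 0" "P0 ** transpose (hproj X) = transpose (hproj X)" "transpose (hproj X) ** P0 = 0"
  for M :: "real ^ ('k + 'm) ^ ('k + 'm)"
proof -
  show "P0 ** hproj X = 0" "hproj X ** P0 = hproj X" "M ** P0 ** hproj X = 0" "Q0 ** hproj X = hproj X"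
    "hproj X ** Q0 = 0" "hproj X ** hproj Y = 0"
    by (simp_all add: hproj_def matrix_mul_assoc P0_simps matmul.zero_left)
  have "transpose (hproj X) = P0 ** transpose X ** Q0"
    by (simp add: hproj_def matrix_transpose_mul matrix_mul_assoc P0_simps)
  then show "P0 ** transpose (hproj X) = transpose (hproj X)" "transpose (hproj X) ** P0 = 0"
    by (simp_all add: matrix_mul_assoc P0_simps)
qed

text \<open>The affine chart of the Grassmannian: \<open>mat 1 + hproj X\<close> maps the base point
  to the graph of \<open>hproj X\<close>, and \<open>A\<close> moves the centre \<open>X = 0\<close>
  to the given subspace.\<close>

definition chart_matrix :: "real ^ ('k + 'm) ^ ('k + 'm) \<Rightarrow> real ^ ('k + 'm) ^ ('k + 'm) \<Rightarrow> real ^ ('k + 'm) ^ ('k + 'm)"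
  where "chart_matrix A X = A ** (mat 1 + hproj X)"

definition chart :: "real ^ ('k + 'm) ^ ('k + 'm) \<Rightarrow> real ^ ('k + 'm) ^ ('k + 'm) \<Rightarrow> real ^ ('k + 'm) ^ ('k + 'm)"
  where "chart A X = (1 / sqrt 2) *\<^sub>R range_proj P0 (chart_matrix A X)"

lemma invertible_mult: "invertible A \<Longrightarrow> invertible B \<Longrightarrow> invertible (A ** (B :: real ^ 'p ^ 'p))"
  for A :: "real ^ 'p ^ 'p"
  by (simp add: invertible_det_nz det_mul)

lemma invertible_chart_matrix: "invertible A \<Longrightarrow> invertible (chart_matrix A X)"
proof -
  have "(mat 1 + hproj X) ** (mat 1 - hproj X) = mat 1"
    by (simp add: matmul.add_left matmul.diff_right hproj_P0)
  then have "invertible (mat 1 + hproj X)" by (rule matrix_inv_eqI(2))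
  then show "invertible A \<Longrightarrow> invertible (chart_matrix A X)"
    unfolding chart_matrix_def by (intro invertible_mult)
qed

lemma invertible_kernel: "invertible A \<Longrightarrow> A *v x = 0 \<Longrightarrow> x = 0" for A :: "real ^ 'p ^ 'p"
  using matrix_inv_mult(2)[of A] by (metis matrix_vector_mul_assoc matrix_vector_mul_lid matrix_vector_mult_0_right)

lemma chart_eq:
  assumes "invertible A" shows "chart A X = gr_embed (act (chart_matrix A X) base_point)"
  unfolding chart_def gr_embed_def
  using range_proj[OF subspace_base invertible_kernel[OF invertible_chart_matrix[OF assms]]] by simp

text \<open>Undoing \<open>A\<close> and the factor of \<open>gr_embed\<close> turns the projection
  onto the \<open>A\<close>-image of the graph of \<open>Z\<close> into
  \<open>(P0 + Z) I (P0 + Z^T)\<close>, with \<open>I\<close> the inverse Gram matrix. Its blocks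
  \<open>P0 I P0\<close> and \<open>Z I P0\<close> have \<open>Z\<close> as quotient; adding
  \<open>Q0\<close> makes the first block invertible as a full matrix.\<close>

definition unchart_gram :: "real ^ ('k + 'm) ^ ('k + 'm) \<Rightarrow> real ^ ('k + 'm) ^ ('k + 'm) \<Rightarrow> real ^ ('k + 'm) ^ ('k + 'm)" where
  "unchart_gram A M = P0 ** (sqrt 2 *\<^sub>R (matrix_inv A ** M ** transpose (matrix_inv A))) ** P0 + Q0"

definition unchart :: "real ^ ('k + 'm) ^ ('k + 'm) \<Rightarrow> real ^ ('k + 'm) ^ ('k + 'm) \<Rightarrow> real ^ ('k + 'm) ^ ('k + 'm)" where
  "unchart A M = Q0 ** (sqrt 2 *\<^sub>R (matrix_inv A ** M ** transpose (matrix_inv A))) ** P0 **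
     matrix_inv (unchart_gram A M) ** P0"

lemma unchart_chart:
  assumes A: "invertible A"
  shows "invertible (unchart_gram A (chart A X))" "unchart A (chart A X) = hproj X"
proof -
  let ?B = "matrix_inv A" and ?Z = "hproj X"
  let ?N = "gram P0 (chart_matrix A X)"
  let ?I = "matrix_inv ?N"
  define R where "R = sqrt 2 *\<^sub>R (?B ** chart A X ** transpose ?B)"
  have BA: "?B ** A = mat 1" using A by (rule matrix_inv_mult)
  have ABt: "transpose A ** transpose ?B = mat 1"
    using BA by (metis matrix_transpose_mul transpose_mat)
  have N: "invertible ?N"
    by (rule invertible_gram[OF subspace_base invertible_kernel[OF invertible_chart_matrix[OF A]]])
  have NP: "?N ** P0 = P0 ** ?N"
    by (simp add: gram_def matmul.add_left matmul.add_right matrix_mul_assoc P0_simps matmul.diff_left matmul.diff_right)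
  have "?I ** (?N ** P0) ** ?I = ?I ** (P0 ** ?N) ** ?I" by (simp only: NP)
  then have IP: "P0 ** ?I = ?I ** P0"
    using matrix_inv_mult[OF N] by (simp add: matrix_mul_assoc) (simp add: matrix_inv_mult[OF N] flip: matrix_mul_assoc)
  have "R = (?B ** A) ** ((mat 1 + ?Z) ** P0) ** ?I ** (P0 ** transpose (mat 1 + ?Z)) ** (transpose A ** transpose ?B)"
    by (simp add: R_def chart_def range_proj_def chart_matrix_def matrix_transpose_mul matrix_mul_assoc
        matmul.scaleR_left matmul.scaleR_right)
  then have R: "R = (P0 + ?Z) ** ?I ** (P0 + transpose ?Z)"
    unfolding BA ABt by (simp add: matmul.add_left matmul.add_right hproj_P0 transpose_add transpose_mat)
  have PRP: "P0 ** R ** P0 = P0 ** ?I ** P0"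
    unfolding R by (simp add: matmul.add_left matmul.add_right matrix_mul_assoc hproj_P0 P0_simps matmul.zero_left)
      (simp add: hproj_P0 matmul.zero_right flip: matrix_mul_assoc)
  have QRP: "Q0 ** R ** P0 = ?Z ** ?I ** P0"
    unfolding R by (simp add: matmul.add_left matmul.add_right matrix_mul_assoc hproj_P0 P0_simps matmul.zero_left)
      (simp add: hproj_P0 matmul.zero_right flip: matrix_mul_assoc)
  have IPN: "?I ** P0 ** ?N = P0"
  proof -
    have "?I ** P0 ** ?N = P0 ** (?I ** ?N)" by (simp only: IP[symmetric] matrix_mul_assoc)
    then show ?thesis using matrix_inv_mult[OF N] by simp
  qed
  have K: "unchart_gram A (chart A X) = P0 ** ?I ** P0 + Q0"
    unfolding unchart_gram_def R_def[symmetric] PRP ..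
  \<comment> \<open>\<open>?N\<close> and its inverse commute with \<open>P0\<close>, so their
    compressions, completed by \<open>Q0\<close>, are inverse to each other.\<close>
  have KN: "(P0 ** ?I ** P0 + Q0) ** (P0 ** ?N ** P0 + Q0) = mat 1"
  proof -
    have "(P0 ** ?I ** P0 + Q0) ** (P0 ** ?N ** P0 + Q0) = P0 ** (?I ** P0 ** ?N) ** P0 + Q0"
      unfolding matmul.add_left matmul.add_right matrix_mul_assoc by (simp only: P0_simps matmul.zero_left add_0 add_0_right)
    also have "\<dots> = mat 1" by (simp add: IPN P0_simps)
    finally show ?thesis .
  qed
  show "invertible (unchart_gram A (chart A X))" unfolding K by (rule matrix_inv_eqI(2)[OF KN])
  have "unchart A (chart A X) = ?Z ** ?I ** P0 ** (P0 ** ?N ** P0 + Q0) ** P0"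
    unfolding unchart_def R_def[symmetric] QRP K matrix_inv_eqI(1)[OF KN] ..
  also have "\<dots> = ?Z ** (?I ** P0 ** ?N) ** P0"
    unfolding matmul.add_left matmul.add_right matrix_mul_assoc by (simp only: P0_simps matmul.zero_left add_0_right)
  also have "\<dots> = ?Z" by (simp add: IPN hproj_P0)
  finally show "unchart A (chart A X) = hproj X" .
qed

text \<open>Invertibility of the first block makes the subspace, pulled back by \<open>A\<close>, a
  graph over the base point: if \<open>z\<close> is the preimage of \<open>E i\<close> under
  \<open>?K\<close>, then \<open>R *v z\<close> lies in the pulled back subspace and has base
  component \<open>E i\<close>, so it is the graph point over \<open>E i\<close>.\<close>

lemma chart_unchart:
  fixes L :: "(real ^ ('k + 'm)) set"
  assumes A: "invertible A" and L: "L \<in> grassmannian" and K: "invertible (unchart_gram A (gr_embed L))"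
  shows "act (chart_matrix A (unchart A (gr_embed L))) base_point = L"
    and "hproj (unchart A (gr_embed L)) = unchart A (gr_embed L)"
proof -
  let ?B = "matrix_inv A" and ?\<Pi> = "proj_matrix L" and ?X = "unchart A (gr_embed L)"
  let ?K = "unchart_gram A (gr_embed L)"
  have sL: "subspace L" using L by (simp add: grassmannian_def)
  define R where "R = ?B ** ?\<Pi> ** transpose ?B"
  have R: "sqrt 2 *\<^sub>R (?B ** gr_embed L ** transpose ?B) = R"
    by (simp add: R_def gr_embed_def matmul.scaleR_left matmul.scaleR_right)
  have Kd: "?K = P0 ** R ** P0 + Q0" unfolding unchart_gram_def R ..
  have X: "?X = Q0 ** R ** P0 ** matrix_inv ?K ** P0" unfolding unchart_def R ..
  show hX: "hproj ?X = ?X" unfolding X hproj_def by (simp add: matrix_mul_assoc P0_simps)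
  have KP: "P0 ** ?K = ?K ** P0"
    unfolding Kd matmul.add_left matmul.add_right matrix_mul_assoc by (simp only: P0_simps)
  have IP: "P0 ** matrix_inv ?K = matrix_inv ?K ** P0"
  proof -
    have "matrix_inv ?K ** (P0 ** ?K) ** matrix_inv ?K = matrix_inv ?K ** (?K ** P0) ** matrix_inv ?K" by (simp only: KP)
    then show ?thesis
      using matrix_inv_mult[OF K] by (simp add: matrix_mul_assoc) (simp add: matrix_inv_mult[OF K] flip: matrix_mul_assoc)
  qed
  show "act (chart_matrix A ?X) base_point = L"
  proof (rule act_base_eqI[OF invertible_chart_matrix[OF A] L])
    fix i assume i: "i \<in> {1..CARD('k)}"
    have x: "P0 *v E i = E i" by (rule proj_matrix_id[OF subspace_base E_base[OF i]])
    define z where "z = matrix_inv ?K *v E i"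
    have Pz: "P0 *v z = z"
      unfolding z_def using x by (simp add: matrix_vector_mul_assoc IP) (simp add: x flip: matrix_vector_mul_assoc)
    have "?K *v z = E i" unfolding z_def by (simp add: matrix_vector_mul_assoc matrix_inv_mult[OF K])
    then have PR: "P0 *v (R *v z) = E i"
      unfolding Kd using Pz by (simp add: matrix_vector_mult_add_rdistrib matrix_vector_mult_diff_rdistrib flip: matrix_vector_mul_assoc)
    have "?X *v E i = Q0 *v (R *v z)"
      unfolding X using x Pz by (simp add: z_def[symmetric] flip: matrix_vector_mul_assoc)
    then have "(mat 1 + hproj ?X) *v E i = P0 *v (R *v z) + Q0 *v (R *v z)"
      by (simp only: hX matrix_vector_mult_add_rdistrib matrix_vector_mul_lid PR)
    also have "\<dots> = R *v z" by (simp add: matrix_vector_mult_diff_rdistrib)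
    finally have "chart_matrix A ?X *v E i = A *v (R *v z)"
      by (simp add: chart_matrix_def flip: matrix_vector_mul_assoc)
    also have "\<dots> = ?\<Pi> *v (transpose ?B *v z)"
      unfolding R_def by (simp add: matrix_vector_mul_assoc matrix_mul_assoc matrix_inv_mult[OF A])
    also have "\<dots> \<in> L" by (rule proj_matrix_in[OF sL])
    finally show "chart_matrix A ?X *v E i \<in> L" .
  qed
qed

text \<open>Parameter space of a Schubert cell: the entries belonging to boxes of \<open>l\<close> vanish.\<close>

definition cell_space :: "(nat \<Rightarrow> nat) \<Rightarrow> (real ^ ('k + 'm) ^ ('k + 'm)) set" where
  "cell_space l = {X \<in> hom_perp base_point. \<forall>(i, j)\<in>boxes CARD('k) l. F j \<bullet> (X *v E i) = 0}"

lemma frame_matrix_1: "frame_matrix (mat 1) (i, j) = outer (F j) (E i)"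
  by (simp add: frame_matrix_def)

lemma cell_space_span:
  assumes y: "young_diagram CARD('k) CARD('m) l"
  shows "cell_space l = span (frame_matrix (mat 1) ` ({1..CARD('k)} \<times> {1..CARD('m)} - boxes CARD('k) l))"
    and "dim (cell_space l) = CARD('k) * CARD('m) - card (boxes CARD('k) l)"
proof -
  let ?g = "{1..CARD('k)} \<times> {1..CARD('m)}" and ?b = "boxes CARD('k) l"
  have o1: "orthogonal_matrix (mat 1 :: real ^ ('k + 'm) ^ ('k + 'm))" by (rule orthogonal_matrix_id)
  have c: "X \<bullet> frame_matrix (mat 1) (i, j) = F j \<bullet> (X *v E i)" for X i j
    by (simp add: frame_matrix_1 inner_outer)
  have "cell_space l = {X \<in> hom_perp base_point. \<forall>b\<in>?b. X \<bullet> frame_matrix (mat 1) b = 0}"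
    unfolding cell_space_def using c by (auto split: prod.splits)
  then have sub: "subspace (cell_space l)"
    using subspace_hom_perp[of base_point] by (auto simp: subspace_def inner_add_left)
  show eq: "cell_space l = span (frame_matrix (mat 1) ` (?g - ?b))"
  proof
    show "cell_space l \<subseteq> span (frame_matrix (mat 1) ` (?g - ?b))"
    proof
      fix X assume X: "X \<in> cell_space l"
      then have "X = (\<Sum>b\<in>?g. (X \<bullet> frame_matrix (mat 1) b) *\<^sub>R frame_matrix (mat 1) b)"
        by (intro hom_perp_expand[OF o1]) (auto simp: cell_space_def)
      also have "\<dots> = (\<Sum>b\<in>?g - ?b. (X \<bullet> frame_matrix (mat 1) b) *\<^sub>R frame_matrix (mat 1) b)"
        by (rule sum.mono_neutral_right) (use X c in \<open>auto simp: cell_space_def\<close>)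
      also have "\<dots> \<in> span (frame_matrix (mat 1) ` (?g - ?b))" by (intro span_sum span_scale span_base) auto
      finally show "X \<in> span (frame_matrix (mat 1) ` (?g - ?b))" .
    qed
    show "span (frame_matrix (mat 1) ` (?g - ?b)) \<subseteq> cell_space l"
    proof (intro span_minimal sub subsetI)
      fix X assume "X \<in> frame_matrix (mat 1) ` (?g - ?b)"
      then obtain b where b: "b \<in> ?g - ?b" "X = frame_matrix (mat 1) b" by blast
      have "X \<in> hom_perp base_point" unfolding b(2) using b(1) by (intro frame_matrix_hom_perp[OF o1]) auto
      moreover have "F j \<bullet> (X *v E i) = 0" if ij: "(i, j) \<in> ?b" for i j
      proof -
        have "(i, j) \<in> ?g" using boxes_subset[OF y] ij by blast
        then show ?thesis
          unfolding c[symmetric] b(2) using frame_matrix_on[OF o1, of b "(i, j)"] b(1) ij by auto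
      qed
      ultimately show "X \<in> cell_space l" by (auto simp: cell_space_def)
    qed
  qed
  have "dim (span (frame_matrix (mat 1) ` (?g - ?b))) = card (?g - ?b)"
    by (rule dim_span_orthonormal_family) (rule frame_matrix_on[OF o1], auto)
  also have "\<dots> = CARD('k) * CARD('m) - card ?b"
    using card_Diff_subset[OF finite_boxes boxes_subset[OF y]] by (simp add: card_cartesian_product)
  finally show "dim (cell_space l) = CARD('k) * CARD('m) - card ?b" unfolding eq .
qed

text \<open>In the chart the condition at a corner becomes linear. The graph meets the model space
  over those \<open>x\<close> in the span of \<open>E 1, ..., E p\<close> for which
  \<open>X *v x\<close> has no component along \<open>F 1, ..., F q\<close>. This intersection has
  dimension \<open>p\<close> iff all \<open>x\<close> in that span qualify.\<close>

lemma cell_space_iff: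
  assumes y: "young_diagram CARD('k) CARD('m) l" and A: "invertible A"
    and AV: "\<And>p q. (p, q) \<in> outer_corners CARD('k) l \<Longrightarrow> act A (coord_sub p q) = V (CARD('m) - q + p)"
    and X: "hproj X = X"
  shows "act (chart_matrix A X) base_point \<in> schubert_smooth V l \<longleftrightarrow> X \<in> cell_space l"
proof -
  let ?M = "mat 1 + X"
  have iM: "invertible ?M"
    using invertible_chart_matrix[of "mat 1" X] X by (simp add: chart_matrix_def invertible_def)
  have PX: "P0 *v (X *v x) = 0" for x
  proof -
    have "P0 ** X = 0" using hproj_P0(1)[of X] X by simp
    then show ?thesis by (simp add: matrix_vector_mul_assoc)
  qed
  have EX: "E i \<bullet> (X *v x) = 0" if "i \<in> {1..CARD('k)}" for i x
  proof -
    have "E i \<bullet> (X *v x) = (P0 *v E i) \<bullet> (X *v x)"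
      using proj_matrix_id[OF subspace_base E_base[OF that]] by simp
    also have "\<dots> = 0" using inner_matrix_vector[of P0 "E i"] by (simp add: P0_simps PX)
    finally show ?thesis .
  qed
  have corner: "dim (act (chart_matrix A X) base_point \<inter> V (CARD('m) - q + p)) = p \<longleftrightarrow>
      (\<forall>i\<in>{1..p}. \<forall>j\<in>{1..q}. F j \<bullet> (X *v E i) = 0)" if c: "(p, q) \<in> outer_corners CARD('k) l" for p q
  proof -
    note b = corner_bounds[OF y c]
    have pk: "p \<le> CARD('k)" and qm: "q \<le> CARD('m)" using b by auto
    define T where "T = {x \<in> coord_sub p CARD('m). \<forall>j\<in>{1..q}. F j \<bullet> (X *v x) = 0}"
    have cs: "coord_sub p CARD('m) = {x \<in> base_point. \<forall>i\<in>{p<..CARD('k)}. E i \<bullet> x = 0}"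
      by (auto simp: coord_sub_def base_iff)
    have "act (chart_matrix A X) base_point = act A (act ?M base_point)"
      by (simp add: act_act chart_matrix_def X)
    then have "act (chart_matrix A X) base_point \<inter> V (CARD('m) - q + p) = act A (act ?M base_point \<inter> coord_sub p q)"
      using AV[OF c] act_Int[OF A] by simp
    also have "act ?M base_point \<inter> coord_sub p q = act ?M T"
    proof
      have iff: "?M *v x \<in> coord_sub p q \<longleftrightarrow> x \<in> T" if x: "x \<in> base_point" for x
        using x EX qm F_base by (auto simp: T_def cs coord_sub_def matrix_vector_mult_add_rdistrib inner_add_right)
      then show "act ?M base_point \<inter> coord_sub p q \<subseteq> act ?M T" by (auto simp: act_def)
      show "act ?M T \<subseteq> act ?M base_point \<inter> coord_sub p q"
        using iff by (auto simp: act_def T_def cs)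
    qed
    finally have d: "dim (act (chart_matrix A X) base_point \<inter> V (CARD('m) - q + p)) = dim T"
      by (simp add: dim_act[OF A] dim_act[OF iM])
    have sC: "subspace (coord_sub p CARD('m))" and dC: "dim (coord_sub p CARD('m)) = p"
      using subspace_coord_sub[OF pk order_refl] dim_coord_sub[OF pk order_refl] by simp_all
    have sT: "subspace T"
      using sC by (auto simp: T_def subspace_def matrix_vector_right_distrib inner_add_right matrix_vector_mult_scaleR)
    have Ein: "E i \<in> coord_sub p CARD('m)" if "i \<in> {1..p}" for i
      using that pk E_base[of i] EE by (auto simp: cs)
    show ?thesis
    proof
      assume "dim (act (chart_matrix A X) base_point \<inter> V (CARD('m) - q + p)) = p"
      then have "T = coord_sub p CARD('m)"
        using d dC by (intro subspace_dim_equal sT sC) (auto simp: T_def)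
      then show "\<forall>i\<in>{1..p}. \<forall>j\<in>{1..q}. F j \<bullet> (X *v E i) = 0" using Ein by (auto simp: T_def)
    next
      assume 0: "\<forall>i\<in>{1..p}. \<forall>j\<in>{1..q}. F j \<bullet> (X *v E i) = 0"
      have "F j \<bullet> (X *v x) = 0" if x: "x \<in> coord_sub p CARD('m)" and j: "j \<in> {1..q}" for x j
      proof -
        have "x = (\<Sum>i=1..CARD('k). (E i \<bullet> x) *\<^sub>R E i)" using frame_expand[of x] x by (simp add: coord_sub_def)
        from arg_cong[OF this, of "(*v) X"] have "X *v x = (\<Sum>i=1..CARD('k). (E i \<bullet> x) *\<^sub>R (X *v E i))"
          by (simp only: matrix_frame_sum)
        then have "F j \<bullet> (X *v x) = (\<Sum>i=1..CARD('k). (E i \<bullet> x) * (F j \<bullet> (X *v E i)))"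
          by (simp add: inner_sum_right)
        also have "\<dots> = 0"
        proof (intro sum.neutral ballI)
          fix i assume i: "i \<in> {1..CARD('k)}"
          show "(E i \<bullet> x) * (F j \<bullet> (X *v E i)) = 0"
            using x i j 0 by (cases "i \<le> p") (auto simp: coord_sub_def)
        qed
        finally show ?thesis .
      qed
      then have "T = coord_sub p CARD('m)" by (auto simp: T_def)
      then show "dim (act (chart_matrix A X) base_point \<inter> V (CARD('m) - q + p)) = p" using d dC by simp
    qed
  qed
  have "act (chart_matrix A X) base_point \<in> schubert_smooth V l \<longleftrightarrow>
     (\<forall>(p, q)\<in>outer_corners CARD('k) l. \<forall>i\<in>{1..p}. \<forall>j\<in>{1..q}. F j \<bullet> (X *v E i) = 0)"
    using corner act_base_grassmannian[OF invertible_chart_matrix[OF A]] by (auto simp: schubert_smooth_def)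
  also have "\<dots> \<longleftrightarrow> (\<forall>(i, j)\<in>boxes CARD('k) l. F j \<bullet> (X *v E i) = 0)"
    using boxes_iff_corner[OF y] by fastforce
  also have "\<dots> \<longleftrightarrow> X \<in> cell_space l" using X hom_perp_base_iff by (simp add: cell_space_def)
  finally show ?thesis .
qed

end

section \<open>Submanifold structure of the cells\<close>

lemma smooth_on_differentiable: "smooth_on U f \<Longrightarrow> x \<in> U \<Longrightarrow> f differentiable (at x)"
  unfolding smooth_on_def differentiable_def by blast

context grass_frame begin

lemma smooth_on_chart:
  assumes A: "invertible A" shows "smooth_on U (chart A)"
proof -
  let ?c = "chart_matrix A"
  let ?N = "\<lambda>X. gram P0 (?c X)"
  let ?N' = "\<lambda>X v. P0 ** transpose (A ** hproj v) ** ?c X ** P0 + P0 ** transpose (?c X) ** (A ** hproj v) ** P0"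
  note sc = smooth_class.smooth_const and si = smooth_class.smooth_ident and sl = smooth_class.smooth_linear
    and sa = smooth_class.smooth_add and sm = smooth_class.smooth_mult
  note md = bounded_bilinear.FDERIV[OF bounded_bilinear_matrix_mult]
  have c: "?c \<in> smooth_class ?N"
    unfolding chart_matrix_def[abs_def] by (rule sm[OF sc sa[OF sc sl[OF si bounded_linear_hproj]]])
  have ct: "(\<lambda>X. transpose (?c X)) \<in> smooth_class ?N" by (rule sl[OF c bounded_linear_transpose])
  have cd: "(?c has_derivative (\<lambda>v. A ** hproj v)) (at X)" for X
  proof -
    have "?c = (\<lambda>X. A ** mat 1 + A ** hproj X)" by (simp add: fun_eq_iff chart_matrix_def matmul.add_right)
    moreover have "bounded_linear (\<lambda>v. A ** hproj v)"
      by (rule bounded_linear_compose[OF matmul.bounded_linear_right bounded_linear_hproj])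
    ultimately show ?thesis
      using has_derivative_add[OF has_derivative_const bounded_linear_imp_has_derivative, of "\<lambda>v. A ** hproj v"] by simp
  qed
  have "(?N has_derivative ?N' X) (at X)" for X
    unfolding gram_def
    by (rule has_derivative_eq_rhs, rule has_derivative_add_const, rule md, rule md, rule md,
        rule has_derivative_const, rule bounded_linear.has_derivative[OF bounded_linear_transpose cd], rule cd,
        rule has_derivative_const)
      (simp add: fun_eq_iff matmul.add_left matmul.zero_left matmul.zero_right add.commute)
  moreover have "(\<lambda>X. ?N' X v) \<in> smooth_class ?N" for v
    by (rule sa[OF sm[OF sm[OF sc c] sc] sm[OF sm[OF sm[OF sc ct] sc] sc]])
  moreover have "invertible (?N X)" for X
    by (rule invertible_gram[OF subspace_base invertible_kernel[OF invertible_chart_matrix[OF A]]])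
  moreover have "chart A \<in> smooth_class ?N"
    unfolding chart_def[abs_def] range_proj_def
    by (rule sl[OF sm[OF sm[OF sm[OF sm[OF c sc] smooth_class.smooth_inv] sc] ct] bounded_linear_scaleR_right])
  ultimately show ?thesis by (rule_tac smooth_class_smooth_on)
qed

lemma bounded_linear_unchart_part:
  "bounded_linear (\<lambda>M. C ** (sqrt 2 *\<^sub>R (matrix_inv A ** M ** transpose (matrix_inv A))) ** P0)"
  for C :: "real ^ ('k + 'm) ^ ('k + 'm)"
  by (intro bounded_linear_compose[OF matmul.bounded_linear_left] bounded_linear_compose[OF matmul.bounded_linear_right]
      bounded_linear_compose[OF bounded_linear_scaleR_right] matmul.bounded_linear_right)

lemma differentiable_unchart_gram: "unchart_gram A differentiable (at M)"
  unfolding unchart_gram_def[abs_def]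
  by (intro differentiable_add differentiable_const linear_imp_differentiable bounded_linear.linear bounded_linear_unchart_part)

lemma differentiable_unchart: "invertible (unchart_gram A M) \<Longrightarrow> unchart A differentiable (at M)"
  unfolding unchart_def[abs_def]
  by (intro differentiable_matrix_mult differentiable_const differentiable_matrix_inv differentiable_unchart_gram
      linear_imp_differentiable bounded_linear.linear bounded_linear_unchart_part)

lemma open_unchart_domain: "open {M. invertible (unchart_gram A M)}"
proof -
  have "continuous_on UNIV (unchart_gram A)"
    using differentiable_imp_continuous_within[OF differentiable_unchart_gram] continuous_at_imp_continuous_on by blast
  from open_vimage[OF open_invertible this] show ?thesis by (simp add: vimage_def)
qed

lemma cell_basis:
  fixes V :: "nat \<Rightarrow> (real ^ ('k + 'm)) set"
  assumes V: "complete_flag V" and y: "young_diagram CARD('k) CARD('m) l" and L: "L \<in> schubert_smooth V l"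
  obtains A where "invertible A" "act A base_point = L"
    "\<And>p q. (p, q) \<in> outer_corners CARD('k) l \<Longrightarrow> act A (coord_sub p q) = V (CARD('m) - q + p)"
proof -
  obtain h A where h: "orthogonal_matrix h" "act h base_point = L"
    "\<And>a i. a \<le> CARD('k + 'm) \<Longrightarrow> i \<in> {1..dim (L \<inter> V a)} \<Longrightarrow> h *v E i \<in> V a"
    "\<And>a j x. a \<le> CARD('k + 'm) \<Longrightarrow> j \<in> {1..CARD('m) + dim (L \<inter> V a) - a} \<Longrightarrow> x \<in> V a \<Longrightarrow> (h *v F j) \<bullet> x = 0"
    and A: "invertible A" "\<And>i. i \<in> {1..CARD('k)} \<Longrightarrow> A *v E i = h *v E i"
    "\<And>j. j \<in> {1..CARD('m)} \<Longrightarrow> A *v F j - h *v F j \<in> L"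
    "\<And>a. a \<le> CARD('k + 'm) \<Longrightarrow> act A (coord_sub (dim (L \<inter> V a)) (CARD('m) + dim (L \<inter> V a) - a)) = V a"
    by (rule adapted_basis[OF V schubert_smooth_grassmannian[OF L]]) (rule that)
  show ?thesis
  proof (rule that[OF A(1)])
    show "act A base_point = L"
    proof (rule act_base_eqI[OF A(1) schubert_smooth_grassmannian[OF L]])
      fix i assume i: "i \<in> {1..CARD('k)}"
      show "A *v E i \<in> L" unfolding A(2)[OF i] h(2)[symmetric] act_def using E_base[OF i] by blast
    qed
    fix p q assume c: "(p, q) \<in> outer_corners CARD('k) l"
    note b = corner_bounds[OF y c]
    have a: "CARD('m) - q + p \<le> CARD('k + 'm)" using b(4) by simp
    show "act A (coord_sub p q) = V (CARD('m) - q + p)"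
      using A(4)[OF a] unfolding schubert_smooth_dim[OF L c] b(5) .
  qed
qed

text \<open>The domain of the inverse chart is open, so this exact description of the image yields
  its relative openness in the cell.\<close>

lemma chart_image:
  assumes y: "young_diagram CARD('k) CARD('m) l" and A: "invertible A"
    and AV: "\<And>p q. (p, q) \<in> outer_corners CARD('k) l \<Longrightarrow> act A (coord_sub p q) = V (CARD('m) - q + p)"
  shows "chart A ` cell_space l = gr_embed ` schubert_smooth V l \<inter> {M. invertible (unchart_gram A M)}"
proof
  show "chart A ` cell_space l \<subseteq> gr_embed ` schubert_smooth V l \<inter> {M. invertible (unchart_gram A M)}"
  proof
    fix M assume "M \<in> chart A ` cell_space l"
    then obtain X where X: "X \<in> cell_space l" "M = chart A X" by blast
    then have "hproj X = X" using hom_perp_base_iff by (simp add: cell_space_def)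
    then show "M \<in> gr_embed ` schubert_smooth V l \<inter> {M. invertible (unchart_gram A M)}"
      using cell_space_iff[OF y A AV] X unchart_chart(1)[OF A, of X] chart_eq[OF A, of X] by auto
  qed
  show "gr_embed ` schubert_smooth V l \<inter> {M. invertible (unchart_gram A M)} \<subseteq> chart A ` cell_space l"
  proof
    fix M assume "M \<in> gr_embed ` schubert_smooth V l \<inter> {M. invertible (unchart_gram A M)}"
    then obtain L where L: "L \<in> schubert_smooth V l" "M = gr_embed L" "invertible (unchart_gram A (gr_embed L))" by blast
    note cu = chart_unchart[OF A schubert_smooth_grassmannian[OF L(1)] L(3)]
    have "unchart A M \<in> cell_space l" using cell_space_iff[OF y A AV cu(2)] cu(1) L by simp
    moreover have "chart A (unchart A M) = M" using chart_eq[OF A] cu(1) L(2) by simp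
    ultimately show "M \<in> chart A ` cell_space l" by (metis image_eqI)
  qed
qed

lemma submanifold_schubert_smooth:
  fixes V :: "nat \<Rightarrow> (real ^ ('k + 'm)) set"
  assumes V: "complete_flag V" and y: "young_diagram CARD('k) CARD('m) l"
  shows "submanifold (CARD('k) * CARD('m) - card (boxes CARD('k) l)) (schubert_smooth V l)"
  unfolding submanifold_def
proof
  fix L assume L: "L \<in> schubert_smooth V l"
  let ?S = "cell_space l"
  obtain A where A: "invertible A" and AL: "act A base_point = L"
    and AV: "\<And>p q. (p, q) \<in> outer_corners CARD('k) l \<Longrightarrow> act A (coord_sub p q) = V (CARD('m) - q + p)"
    by (rule cell_basis[OF V y L]) (rule that)
  have hS: "hproj X = X" if "X \<in> ?S" for X using that hom_perp_base_iff by (simp add: cell_space_def)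
  have cd: "chart A differentiable (at X)" for X
    by (rule smooth_on_differentiable[OF smooth_on_chart[OF A, of UNIV]]) simp
  have img: "chart A ` ?S = gr_embed ` schubert_smooth V l \<inter> {M. invertible (unchart_gram A M)}"
    by (rule chart_image[OF y A AV])
  \<comment> \<open>\<open>unchart A\<close> after \<open>chart A\<close> is the linear map
    \<open>hproj\<close>, which is the identity on the parameter space; by the chain rule the
    derivative has a left inverse there.\<close>
  have inj: "inj_on (frechet_derivative (chart A) (at X)) ?S" for X
  proof -
    let ?D = "frechet_derivative (chart A) (at X)"
    obtain G where G: "(unchart A has_derivative G) (at (chart A X))"
      using differentiable_unchart[OF unchart_chart(1)[OF A]] unfolding differentiable_def by blast
    have "(unchart A \<circ> chart A has_derivative G \<circ> ?D) (at X)"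
      by (rule diff_chain_at[OF frechet_derivative_works[THEN iffD1, OF cd] G])
    moreover have "unchart A \<circ> chart A = hproj" using unchart_chart(2)[OF A] by (simp add: fun_eq_iff)
    moreover have "(hproj has_derivative hproj) (at X)"
      by (rule bounded_linear_imp_has_derivative[OF bounded_linear_hproj])
    ultimately have "G \<circ> ?D = hproj" using has_derivative_unique by metis
    then have GD: "G (?D v) = hproj v" for v by (simp add: fun_eq_iff)
    show ?thesis
    proof (rule inj_onI)
      fix v w assume vw: "v \<in> ?S" "w \<in> ?S" "?D v = ?D w"
      then have "hproj v = hproj w" using GD[of v] GD[of w] by simp
      then show "v = w" using hS vw by simp
    qed
  qed
  have "continuous_on ?S (chart A)"
    by (intro continuous_at_imp_continuous_on ballI differentiable_imp_continuous_within cd)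
  moreover have "continuous_on (chart A ` ?S) (unchart A)"
    using unchart_chart(1)[OF A]
    by (intro continuous_at_imp_continuous_on ballI differentiable_imp_continuous_within differentiable_unchart) auto
  moreover have "unchart A (chart A X) = X" if "X \<in> ?S" for X using unchart_chart(2)[OF A] hS[OF that] by simp
  ultimately have hom: "homeomorphism ?S (chart A ` ?S) (chart A) (unchart A)"
    by (intro homeomorphismI) auto
  have op: "openin (top_of_set (gr_embed ` schubert_smooth V l)) (chart A ` ?S)"
    unfolding img using open_unchart_domain by (rule openin_open_Int)
  have "chart A 0 = gr_embed L"
    using chart_eq[OF A, of 0] AL linear_0[OF bounded_linear.linear[OF bounded_linear_hproj]]
    by (simp add: chart_matrix_def)
  moreover have "0 \<in> ?S" unfolding cell_space_span(1)[OF y] by (rule span_0)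
  ultimately have mem: "gr_embed L \<in> chart A ` ?S" by (metis imageI)
  have "subspace ?S" unfolding cell_space_span(1)[OF y] by (rule subspace_span)
  then show "\<exists>U S \<phi> \<psi>. open U \<and> subspace S \<and> dim S = CARD('k) * CARD('m) - card (boxes CARD('k) l) \<and>
     smooth_on U (\<phi> :: real ^ ('k + 'm) ^ ('k + 'm) \<Rightarrow> real ^ ('k + 'm) ^ ('k + 'm)) \<and>
     (\<forall>x \<in> U \<inter> S. inj_on (frechet_derivative \<phi> (at x)) S) \<and>
     homeomorphism (U \<inter> S) (\<phi> ` (U \<inter> S)) \<phi> \<psi> \<and>
     openin (top_of_set (gr_embed ` schubert_smooth V l)) (\<phi> ` (U \<inter> S)) \<and>
     gr_embed L \<in> \<phi> ` (U \<inter> S)"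
  proof (intro exI conjI)
    show "open UNIV" by simp
    show "subspace ?S" by fact
    show "dim ?S = CARD('k) * CARD('m) - card (boxes CARD('k) l)" by (rule cell_space_span(2)[OF y])
    show "smooth_on UNIV (chart A)" by (rule smooth_on_chart[OF A])
    show "\<forall>x\<in>UNIV \<inter> ?S. inj_on (frechet_derivative (chart A) (at x)) ?S" using inj by blast
    show "homeomorphism (UNIV \<inter> ?S) (chart A ` (UNIV \<inter> ?S)) (chart A) (unchart A)"
      unfolding Int_UNIV_left by (rule hom)
    show "openin (top_of_set (gr_embed ` schubert_smooth V l)) (chart A ` (UNIV \<inter> ?S))"
      unfolding Int_UNIV_left by (rule op)
    show "gr_embed L \<in> chart A ` (UNIV \<inter> ?S)" unfolding Int_UNIV_left by (rule mem)
  qed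
qed

lemma cohomogeneous_schubert_smooth:
  fixes V :: "nat \<Rightarrow> (real ^ ('k + 'm)) set"
  assumes V: "complete_flag V" and y: "young_diagram CARD('k) CARD('m) l"
  shows "cohomogeneous (schubert_smooth V l)"
  unfolding cohomogeneous_def
proof (intro conjI ballI)
  show "schubert_smooth V l \<subseteq> grassmannian" using schubert_smooth_grassmannian by blast
  show "\<exists>D. submanifold D (schubert_smooth V l)" using submanifold_schubert_smooth[OF V y] by (rule exI)
qed (rule schubert_smooth_transitive[OF V y])

end

text \<open>Boundedness is part of the notion because it is what makes products of Lipschitz
  functions Lipschitz again.\<close>

definition bounded_lipschitz_on :: "'a::metric_space set \<Rightarrow> ('a \<Rightarrow> 'b::real_normed_vector) \<Rightarrow> bool" where
  "bounded_lipschitz_on T f \<longleftrightarrow> (\<exists>C\<ge>0. (\<forall>x\<in>T. norm (f x) \<le> C) \<and> (\<forall>x\<in>T. \<forall>y\<in>T. norm (f x - f y) \<le> C * dist x y))"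

lemma bounded_lipschitz_onI:
  assumes "\<And>x. x \<in> T \<Longrightarrow> norm (f x) \<le> C" "\<And>x y. x \<in> T \<Longrightarrow> y \<in> T \<Longrightarrow> norm (f x - f y) \<le> D * dist x y"
  shows "bounded_lipschitz_on T f"
proof -
  let ?K = "max 0 (max C D)"
  have "norm (f x) \<le> ?K" if "x \<in> T" for x using assms(1)[OF that] by linarith
  moreover have "norm (f x - f y) \<le> ?K * dist x y" if "x \<in> T" "y \<in> T" for x y
    using assms(2)[OF that] mult_right_mono[of D ?K "dist x y"] by fastforce
  ultimately show ?thesis unfolding bounded_lipschitz_on_def by (intro exI[of _ ?K]) auto
qed

lemma bounded_lipschitz_on_const: "bounded_lipschitz_on T (\<lambda>x. c)"
  by (rule bounded_lipschitz_onI[of _ _ "norm c" 0]) auto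

lemma bounded_lipschitz_on_ident:
  assumes "bounded T" shows "bounded_lipschitz_on T (\<lambda>x. x)"
proof -
  obtain C where "\<And>x. x \<in> T \<Longrightarrow> norm x \<le> C" using assms bounded_iff by blast
  then show ?thesis by (rule bounded_lipschitz_onI[where D = 1]) (auto simp: dist_norm)
qed

lemma bounded_lipschitz_on_linear:
  assumes "bounded_lipschitz_on T f" "bounded_linear g" shows "bounded_lipschitz_on T (\<lambda>x. g (f x))"
proof -
  obtain C where C: "0 \<le> C" "\<And>x. x \<in> T \<Longrightarrow> norm (f x) \<le> C" "\<And>x y. x \<in> T \<Longrightarrow> y \<in> T \<Longrightarrow> norm (f x - f y) \<le> C * dist x y"
    using assms(1) unfolding bounded_lipschitz_on_def by blast
  obtain K where K: "0 < K" "\<And>x. norm (g x) \<le> norm x * K" using bounded_linear.pos_bounded[OF assms(2)] by blast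
  show ?thesis
  proof (rule bounded_lipschitz_onI)
    show "norm (g (f x)) \<le> C * K" if "x \<in> T" for x
      using K(2)[of "f x"] mult_right_mono[OF C(2)[OF that], of K] K(1) by linarith
    show "norm (g (f x) - g (f y)) \<le> (C * K) * dist x y" if "x \<in> T" "y \<in> T" for x y
    proof -
      have "norm (g (f x) - g (f y)) \<le> norm (f x - f y) * K"
        using K(2)[of "f x - f y"] by (simp add: linear_diff[OF bounded_linear.linear[OF assms(2)]])
      also have "\<dots> \<le> (C * dist x y) * K" using C(3)[OF that] K(1) by (intro mult_right_mono) auto
      finally show ?thesis by (simp add: mult_ac)
    qed
  qed
qed

lemma bounded_lipschitz_on_add:
  assumes "bounded_lipschitz_on T f" "bounded_lipschitz_on T g" shows "bounded_lipschitz_on T (\<lambda>x. f x + g x)"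
proof -
  obtain C where C: "0 \<le> C" "\<And>x. x \<in> T \<Longrightarrow> norm (f x) \<le> C" "\<And>x y. x \<in> T \<Longrightarrow> y \<in> T \<Longrightarrow> norm (f x - f y) \<le> C * dist x y"
    using assms(1) unfolding bounded_lipschitz_on_def by blast
  obtain K where K: "0 \<le> K" "\<And>x. x \<in> T \<Longrightarrow> norm (g x) \<le> K" "\<And>x y. x \<in> T \<Longrightarrow> y \<in> T \<Longrightarrow> norm (g x - g y) \<le> K * dist x y"
    using assms(2) unfolding bounded_lipschitz_on_def by blast
  show ?thesis
  proof (rule bounded_lipschitz_onI)
    show "norm (f x + g x) \<le> C + K" if "x \<in> T" for x
      using norm_triangle_ineq[of "f x" "g x"] C(2)[OF that] K(2)[OF that] by linarith
    show "norm (f x + g x - (f y + g y)) \<le> (C + K) * dist x y" if "x \<in> T" "y \<in> T" for x y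
      using norm_triangle_ineq[of "f x - f y" "g x - g y"] C(3)[OF that] K(3)[OF that]
      by (simp add: algebra_simps)
  qed
qed

lemma bounded_lipschitz_on_matrix_mult:
  fixes f :: "'a::metric_space \<Rightarrow> real ^ 'n ^ 'm" and g :: "'a \<Rightarrow> real ^ 'p ^ 'n"
  assumes "bounded_lipschitz_on T f" "bounded_lipschitz_on T g" shows "bounded_lipschitz_on T (\<lambda>x. f x ** g x)"
proof -
  obtain C where C: "0 \<le> C" "\<And>x. x \<in> T \<Longrightarrow> norm (f x) \<le> C" "\<And>x y. x \<in> T \<Longrightarrow> y \<in> T \<Longrightarrow> norm (f x - f y) \<le> C * dist x y"
    using assms(1) unfolding bounded_lipschitz_on_def by blast
  obtain K where K: "0 \<le> K" "\<And>x. x \<in> T \<Longrightarrow> norm (g x) \<le> K" "\<And>x y. x \<in> T \<Longrightarrow> y \<in> T \<Longrightarrow> norm (g x - g y) \<le> K * dist x y"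
    using assms(2) unfolding bounded_lipschitz_on_def by blast
  obtain B where B: "0 < B" "\<And>(X :: real ^ 'n ^ 'm) (Y :: real ^ 'p ^ 'n). norm (X ** Y) \<le> norm X * norm Y * B"
    using matmul.pos_bounded by blast
  show ?thesis
  proof (rule bounded_lipschitz_onI)
    show "norm (f x ** g x) \<le> C * K * B" if "x \<in> T" for x
      by (rule order.trans[OF B(2)]) (intro mult_right_mono mult_mono C K that; use B C K in simp)
    show "norm (f x ** g x - f y ** g y) \<le> (2 * (C * K * B)) * dist x y" if "x \<in> T" "y \<in> T" for x y
    proof -
      have "f x ** g x - f y ** g y = (f x - f y) ** g x + f y ** (g x - g y)"
        by (simp add: matmul.diff_left matmul.diff_right)
      then have "norm (f x ** g x - f y ** g y) \<le> norm ((f x - f y) ** g x) + norm (f y ** (g x - g y))"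
        using norm_triangle_ineq by metis
      also have "\<dots> \<le> (C * dist x y) * K * B + C * (K * dist x y) * B"
        by (intro add_mono order.trans[OF B(2)] mult_right_mono mult_mono C K that; use B C K that in simp)
      finally show ?thesis by (simp add: mult_ac)
    qed
  qed
qed

text \<open>The difference of two inverses is the difference of the matrices, multiplied by one
  inverse on either side. In the applications the bound on the inverses comes from continuity or
  compactness.\<close>

lemma bounded_lipschitz_on_matrix_inv:
  fixes f :: "'a::metric_space \<Rightarrow> real ^ 'n ^ 'n"
  assumes f: "bounded_lipschitz_on T f" and inv: "\<And>x. x \<in> T \<Longrightarrow> invertible (f x)"
    and bd: "\<And>x. x \<in> T \<Longrightarrow> norm (matrix_inv (f x)) \<le> K"
  shows "bounded_lipschitz_on T (\<lambda>x. matrix_inv (f x))"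
proof -
  obtain C where C: "0 \<le> C" "\<And>x y. x \<in> T \<Longrightarrow> y \<in> T \<Longrightarrow> norm (f x - f y) \<le> C * dist x y"
    using f unfolding bounded_lipschitz_on_def by blast
  obtain B where B: "0 < B" "\<And>(X :: real ^ 'n ^ 'n) (Y :: real ^ 'n ^ 'n). norm (X ** Y) \<le> norm X * norm Y * B"
    using matmul.pos_bounded by blast
  show ?thesis
  proof (rule bounded_lipschitz_onI[OF bd])
    fix x y assume xy: "x \<in> T" "y \<in> T"
    have K: "0 \<le> K" using bd[OF xy(1)] norm_ge_zero order.trans by blast
    have "matrix_inv (f x) - matrix_inv (f y) = matrix_inv (f x) ** (f y - f x) ** matrix_inv (f y)"
      using matrix_inv_mult[OF inv[OF xy(1)]] matrix_inv_mult[OF inv[OF xy(2)]]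
      by (simp add: matmul.diff_left matmul.diff_right) (simp flip: matrix_mul_assoc)
    also have "norm \<dots> \<le> norm (matrix_inv (f x) ** (f y - f x)) * norm (matrix_inv (f y)) * B" by (rule B(2))
    also have "\<dots> \<le> (norm (matrix_inv (f x)) * norm (f y - f x) * B) * norm (matrix_inv (f y)) * B"
      by (intro mult_right_mono B(2)) (use B in auto)
    also have "\<dots> \<le> (K * (C * dist x y) * B) * K * B"
      using C(2)[OF xy(2,1)] B(1) C(1) K bd[OF xy(1)] bd[OF xy(2)]
      by (intro mult_right_mono mult_mono) (auto simp: dist_commute)
    finally show "norm (matrix_inv (f x) - matrix_inv (f y)) \<le> (K * C * B * K * B) * dist x y" by (simp add: mult_ac)
  qed
qed

context grass_frame begin

text \<open>Near the centre of a chart the inverse chart is Lipschitz, and it maps a piece of the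
  cell onto a neighbourhood of 0 in the parameter space. This space is spanned by elements of
  \<open>Basis\<close>, so the lower bound for Hausdorff measure applies with
  \<open>unchart A\<close> as the Lipschitz map.\<close>

lemma hausdorff_schubert_smooth_pos:
  fixes V :: "nat \<Rightarrow> (real ^ ('k + 'm)) set"
  assumes V: "complete_flag V" and y: "young_diagram CARD('k) CARD('m) l" and L: "L \<in> schubert_smooth V l"
    and basis: "frame_matrix (mat 1) ` ({1..CARD('k)} \<times> {1..CARD('m)}) \<subseteq> Basis"
  shows "0 < hausdorff_outer (CARD('k) * CARD('m) - card (boxes CARD('k) l)) (gr_embed ` schubert_smooth V l)"
proof -
  let ?S = "cell_space l" and ?D = "CARD('k) * CARD('m) - card (boxes CARD('k) l)"
  let ?B = "frame_matrix (mat 1) ` ({1..CARD('k)} \<times> {1..CARD('m)} - boxes CARD('k) l)"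
  obtain A where A: "invertible A" and AL: "act A base_point = L"
    and AV: "\<And>p q. (p, q) \<in> outer_corners CARD('k) l \<Longrightarrow> act A (coord_sub p q) = V (CARD('m) - q + p)"
    by (rule cell_basis[OF V y L]) (rule that)
  have hS: "hproj X = X" if "X \<in> ?S" for X using that hom_perp_base_iff by (simp add: cell_space_def)
  have B: "?B \<subseteq> Basis" using basis by blast
  have fB: "finite ?B" using B finite_Basis finite_subset by blast
  have "independent ?B" using independent_mono[OF independent_Basis B] .
  then have cB: "card ?B = ?D" using cell_space_span[OF y] by (simp add: dim_eq_card_independent)
  let ?M0 = "chart A 0"
  have cd: "chart A differentiable (at X)" for X
    by (rule smooth_on_differentiable[OF smooth_on_chart[OF A, of UNIV]]) simp
  have gd: "isCont (unchart_gram A) M" for M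
    using differentiable_imp_continuous_within[OF differentiable_unchart_gram] .
  let ?iv = "\<lambda>M. matrix_inv (unchart_gram A M)"
  have "isCont ?iv ?M0"
  proof (rule isCont_o2[OF gd])
    show "isCont matrix_inv (unchart_gram A ?M0)"
      using continuous_on_matrix_inv unchart_chart(1)[OF A, of 0]
      unfolding continuous_on_eq_continuous_at[OF open_invertible] by blast
  qed
  then have "\<forall>\<^sub>F M in nhds ?M0. dist (?iv M) (?iv ?M0) < 1"
    by (intro tendstoD tendsto_at_iff_tendsto_nhds[THEN iffD1]) (simp_all add: isCont_def)
  moreover have "\<forall>\<^sub>F M in nhds ?M0. M \<in> {M. invertible (unchart_gram A M)}"
    using unchart_chart(1)[OF A, of 0] open_unchart_domain eventually_nhds by blast
  ultimately have "\<forall>\<^sub>F M in nhds ?M0. invertible (unchart_gram A M) \<and> norm (?iv M) \<le> norm (?iv ?M0) + 1"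
  proof eventually_elim
    case (elim M)
    then show ?case using norm_triangle_ineq2[of "?iv M" "?iv ?M0"] by (simp add: dist_norm)
  qed
  then obtain \<rho> where \<rho>: "0 < \<rho>" "\<And>M. dist M ?M0 < \<rho> \<Longrightarrow> invertible (unchart_gram A M) \<and> norm (?iv M) \<le> norm (?iv ?M0) + 1"
    unfolding eventually_nhds_metric by blast
  let ?T = "ball ?M0 \<rho>"
  note bl = bounded_lipschitz_on_linear[OF bounded_lipschitz_on_ident[OF bounded_ball] bounded_linear_unchart_part]
  have bg: "bounded_lipschitz_on ?T (unchart_gram A)"
    unfolding unchart_gram_def[abs_def] by (intro bounded_lipschitz_on_add bounded_lipschitz_on_const bl)
  have "bounded_lipschitz_on ?T (unchart A)"
    unfolding unchart_def[abs_def]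
    by (intro bounded_lipschitz_on_matrix_mult bounded_lipschitz_on_const bl
        bounded_lipschitz_on_matrix_inv[OF bg, where K = "norm (?iv ?M0) + 1"])
      (use \<rho>(2) in \<open>auto simp: dist_commute\<close>)
  then obtain C where C: "0 \<le> C" "\<And>x y. x \<in> ?T \<Longrightarrow> y \<in> ?T \<Longrightarrow> norm (unchart A x - unchart A y) \<le> C * dist x y"
    unfolding bounded_lipschitz_on_def by blast
  have "isCont (chart A) 0" using differentiable_imp_continuous_within[OF cd] .
  then obtain \<delta> where \<delta>: "0 < \<delta>" "\<And>X. dist X 0 < \<delta> \<Longrightarrow> dist (chart A X) ?M0 < \<rho>"
    using \<rho>(1) unfolding continuous_at_eps_delta by blast
  \<comment> \<open>If every coordinate is at most \<open>r\<close>, the triangle inequality keeps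
    the parameter in the ball of radius \<open>\<delta>\<close>; the \<open>+ 1\<close> makes this
    strict and covers an empty \<open>?B\<close>.\<close>
  define r where "r = \<delta> / (real (card ?B) + 1)"
  have r: "0 < r" using \<delta>(1) by (simp add: r_def)
  let ?A = "chart A ` {X \<in> ?S. norm X < \<delta>}"
  have sub: "?A \<subseteq> gr_embed ` schubert_smooth V l"
  proof -
    have "chart A ` ?S = gr_embed ` schubert_smooth V l \<inter> {M. invertible (unchart_gram A M)}"
      by (rule chart_image[OF y A AV])
    then show ?thesis by blast
  qed
  have T: "x \<in> ?T" if "x \<in> ?A" for x using that \<delta>(2) by (auto simp: dist_commute)
  have "0 < hausdorff_outer ?D ?A"
  proof (rule hausdorff_outer_posI[where f = "unchart A" and L = "C + 1" and r = r and ?z0.0 = 0])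
    show "?B \<subseteq> Basis" "card ?B = ?D" by fact+
    show "0 < C + 1" "0 < r" using C r by auto
    show "norm (unchart A x - unchart A y) \<le> (C + 1) * dist x y" if "x \<in> ?A" "y \<in> ?A" for x y
      using C(2)[OF T T, of x y] that by (simp add: distrib_right add_increasing2)
    fix z assume z: "\<And>b. b \<in> ?B \<Longrightarrow> \<bar>(z - 0) \<bullet> b\<bar> \<le> r"
    define X where "X = (\<Sum>b\<in>?B. (z \<bullet> b) *\<^sub>R b)"
    have XS: "X \<in> ?S" unfolding cell_space_span(1)[OF y] X_def by (intro span_sum span_scale span_base) auto
    have "norm X \<le> (\<Sum>b\<in>?B. norm ((z \<bullet> b) *\<^sub>R b))" unfolding X_def by (rule norm_sum)
    also have "\<dots> \<le> (\<Sum>b\<in>?B. r)"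
    proof (rule sum_mono)
      fix b assume b: "b \<in> ?B"
      then have "norm b = 1" using B norm_Basis by blast
      then show "norm ((z \<bullet> b) *\<^sub>R b) \<le> r" using z[OF b] by simp
    qed
    also have "\<dots> < \<delta>" using \<delta>(1) by (simp add: r_def field_simps)
    finally have "chart A X \<in> ?A" using XS by blast
    moreover have "unchart A (chart A X) = X" using unchart_chart(2)[OF A] hS[OF XS] by simp
    moreover have "X \<bullet> b = z \<bullet> b" if b: "b \<in> ?B" for b
    proof -
      have "X \<bullet> b = (\<Sum>b'\<in>?B. if b' = b then z \<bullet> b else 0)"
        unfolding X_def inner_sum_left
      proof (intro sum.cong refl)
        fix b' assume "b' \<in> ?B"
        then have "b' \<bullet> b = (if b' = b then 1 else 0)" using b B by (intro inner_Basis) auto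
        then show "((z \<bullet> b') *\<^sub>R b') \<bullet> b = (if b' = b then z \<bullet> b else 0)" by simp
      qed
      then show ?thesis using b fB by simp
    qed
    ultimately show "\<exists>x\<in>?A. \<forall>b\<in>?B. unchart A x \<bullet> b = z \<bullet> b" by (metis (no_types, lifting))
  qed
  also have "\<dots> \<le> hausdorff_outer ?D (gr_embed ` schubert_smooth V l)" by (rule hausdorff_outer_mono[OF sub])
  finally show ?thesis .
qed

end

section \<open>Volumes of Schubert varieties\<close>

lemma diameter_leI:
  fixes S :: "'a::metric_space set"
  assumes "0 \<le> d" "\<And>x y. x \<in> S \<Longrightarrow> y \<in> S \<Longrightarrow> dist x y \<le> d"
  shows "bounded S" "diameter S \<le> d"
proof -
  show "bounded S" unfolding bounded_two_points using assms(2) by blast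
  show "diameter S \<le> d"
    using assms by (auto simp: diameter_def intro!: cSUP_least)
qed

lemma hausdorff_outer_finite_UN:
  assumes "finite I" "\<And>i. i \<in> I \<Longrightarrow> hausdorff_outer D (A i) < \<infinity>"
  shows "hausdorff_outer D (\<Union>i\<in>I. A i) < \<infinity>"
  using assms
proof (induction rule: finite_induct)
  case (insert i I)
  have "hausdorff_outer D (\<Union>j\<in>insert i I. A j) \<le> hausdorff_outer D (A i) + hausdorff_outer D (\<Union>j\<in>I. A j)"
    using hausdorff_outer_subadditive[of D "A i" "\<Union>j\<in>I. A j"] by simp
  also have "\<dots> < \<infinity>" using insert by simp
  finally show ?case .
qed simp

text \<open>Lipschitz images of a cube of dimension \<open>D\<close>: subdivide every coordinate into \<open>N\<close> intervals.\<close>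

lemma hausdorff_outer_cube_image:
  fixes f :: "'a::metric_space \<Rightarrow> 'b::metric_space" and \<phi> :: "'a \<Rightarrow> 'i \<Rightarrow> real"
  assumes I: "finite I" and cube: "\<And>x i. x \<in> T \<Longrightarrow> i \<in> I \<Longrightarrow> \<phi> x i \<in> {-1..1}"
    and C: "0 \<le> C" and lip: "\<And>x y e. x \<in> T \<Longrightarrow> y \<in> T \<Longrightarrow> (\<And>i. i \<in> I \<Longrightarrow> \<bar>\<phi> x i - \<phi> y i\<bar> \<le> e) \<Longrightarrow> 0 \<le> e \<Longrightarrow> dist (f x) (f y) \<le> C * e"
  shows "hausdorff_outer (card I) (f ` T) < \<infinity>"
proof (rule hausdorff_outer_finiteI[where c = "2 * C" and M = 1])
  show "0 \<le> 2 * C" using C by simp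
  fix N :: nat assume N: "0 < N"
  define S where "S \<kappa> = f ` {x \<in> T. \<forall>i\<in>I. - 1 + 2 * real (\<kappa> i) / N \<le> \<phi> x i \<and> \<phi> x i \<le> - 1 + 2 * (real (\<kappa> i) + 1) / N}" for \<kappa>
  let ?K = "I \<rightarrow>\<^sub>E {..<N}"
  have fK: "finite ?K" using I by (intro finite_PiE) auto
  show "\<exists>F. finite F \<and> card F \<le> 1 * N ^ card I \<and> f ` T \<subseteq> \<Union>F \<and> (\<forall>S\<in>F. bounded S \<and> diameter S \<le> 2 * C / real N)"
  proof (intro exI conjI ballI)
    show "finite (S ` ?K)" using fK by simp
    show "card (S ` ?K) \<le> 1 * N ^ card I"
      using card_image_le[OF fK, of S] I by (simp add: card_PiE)
    show "f ` T \<subseteq> \<Union>(S ` ?K)"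
    proof
      fix y assume "y \<in> f ` T"
      then obtain x where x: "x \<in> T" "y = f x" by blast
      have "\<exists>k<N. - 1 + 2 * real k / N \<le> \<phi> x i \<and> \<phi> x i \<le> - 1 + 2 * (real k + 1) / N" if i: "i \<in> I" for i
      proof -
        let ?t = "(\<phi> x i + 1) * N / 2"
        have "0 \<le> (\<phi> x i + 1) * N" "(\<phi> x i + 1) * N \<le> 2 * N"
          using cube[OF x(1) i] by (auto intro!: mult_nonneg_nonneg mult_right_mono)
        then have t: "0 \<le> ?t" "?t \<le> N" by auto
        \<comment> \<open>The right end point, where the floor would give \<open>N\<close>, is put
          into the last interval.\<close>
        define k where "k = (if ?t = N then N - 1 else nat \<lfloor>?t\<rfloor>)"
        have "k < N \<and> real k \<le> ?t \<and> ?t \<le> real k + 1"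
        proof (cases "?t = N")
          case True
          then show ?thesis using N by (simp add: k_def of_nat_diff)
        next
          case False
          then have "real_of_int \<lfloor>?t\<rfloor> < N" using t by linarith
          then have "\<lfloor>?t\<rfloor> < int N" by linarith
          moreover have "0 \<le> \<lfloor>?t\<rfloor>" using t by simp
          ultimately show ?thesis using False by (simp add: k_def) linarith
        qed
        then show ?thesis using N by (intro exI[of _ k]) (auto simp: field_simps)
      qed
      then obtain \<kappa> where \<kappa>: "\<And>i. i \<in> I \<Longrightarrow> \<kappa> i < N \<and> - 1 + 2 * real (\<kappa> i) / N \<le> \<phi> x i \<and> \<phi> x i \<le> - 1 + 2 * (real (\<kappa> i) + 1) / N"
        by metis
      have "restrict \<kappa> I \<in> ?K" using \<kappa> by auto
      moreover have "y \<in> S (restrict \<kappa> I)" using \<kappa> x by (auto simp: S_def)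
      ultimately show "y \<in> \<Union>(S ` ?K)" by blast
    qed
    fix R assume "R \<in> S ` ?K"
    then obtain \<kappa> where R: "R = S \<kappa>" by blast
    have d: "dist u v \<le> 2 * C / N" if uv: "u \<in> R" "v \<in> R" for u v
    proof -
      obtain x y where x: "x \<in> T" "u = f x" "\<And>i. i \<in> I \<Longrightarrow> - 1 + 2 * real (\<kappa> i) / N \<le> \<phi> x i \<and> \<phi> x i \<le> - 1 + 2 * (real (\<kappa> i) + 1) / N"
        and y: "y \<in> T" "v = f y" "\<And>i. i \<in> I \<Longrightarrow> - 1 + 2 * real (\<kappa> i) / N \<le> \<phi> y i \<and> \<phi> y i \<le> - 1 + 2 * (real (\<kappa> i) + 1) / N"
        using uv unfolding R S_def by auto
      have "\<bar>\<phi> x i - \<phi> y i\<bar> \<le> 2 / N" if "i \<in> I" for i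
      proof -
        have "2 * (real (\<kappa> i) + 1) / N = 2 * real (\<kappa> i) / N + 2 / N" by (simp add: add_divide_distrib distrib_left)
        then show ?thesis using x(3)[OF that] y(3)[OF that] by linarith
      qed
      then have "dist (f x) (f y) \<le> C * (2 / N)" by (intro lip x y) auto
      then show ?thesis by (simp add: x(2) y(2) mult.commute)
    qed
    have "0 \<le> 2 * C / N" using C by simp
    from diameter_leI[OF this d] show "bounded R" "diameter R \<le> 2 * C / real N" by auto
  qed
qed

lemma matrix_sum_vector: "(\<Sum>i\<in>I. A i) *v x = (\<Sum>i\<in>I. A i *v x)" for A :: "'i \<Rightarrow> real ^ 'n ^ 'm"
  by (rule linear_sum[of "\<lambda>A. A *v x"])
    (rule bounded_bilinear.bounded_linear_left[OF bounded_bilinear_matrix_vector_mult, THEN bounded_linear.linear])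

text \<open>Gram-Schmidt for the flag, as the case \<open>L = UNIV\<close> of
  \<open>flag_frame\<close>: there the intersection grows at every step.\<close>

lemma flag_orthonormal:
  fixes V :: "nat \<Rightarrow> (real ^ 'n) set"
  assumes V: "complete_flag V"
  obtains u where
    "\<And>i j. i \<in> {1..CARD('n)} \<Longrightarrow> j \<in> {1..CARD('n)} \<Longrightarrow> u i \<bullet> u j = (if i = j then 1 else 0)"
    "\<And>a. a \<le> CARD('n) \<Longrightarrow> V a = {x. \<forall>c\<in>{a<..CARD('n)}. u c \<bullet> x = 0}"
    "\<And>a. a \<le> CARD('n) \<Longrightarrow> V a = span (u ` {1..a})"
proof -
  let ?n = "CARD('n)"
  obtain u J where u: "\<And>i j. i \<in> {1..?n} \<Longrightarrow> j \<in> {1..?n} \<Longrightarrow> u i \<bullet> u j = (if i = j then 1 else 0)"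
    and J: "J \<subseteq> {1..?n}" and dJ: "\<And>a. a \<le> ?n \<Longrightarrow> dim (UNIV \<inter> V a) = card (J \<inter> {1..a})"
    and uJ: "\<And>i. i \<in> J \<Longrightarrow> u i \<in> UNIV \<inter> V i"
    by (rule flag_frame[OF V subspace_UNIV]) (rule that)
  have "card J = ?n" using dJ[of ?n] flag_dim[OF V, of ?n] J by (simp add: Int_absorb2)
  then have J': "J = {1..?n}" using J by (intro card_subset_eq) auto
  have sp: "V a = span (u ` {1..a})" if a: "a \<le> ?n" for a
  proof (rule subspace_dim_equal[symmetric])
    show "span (u ` {1..a}) \<subseteq> V a"
    proof (intro span_minimal flag_subspace[OF V a] subsetI)
      fix x assume "x \<in> u ` {1..a}"
      then obtain i where i: "i \<in> {1..a}" "x = u i" by blast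
      then have "u i \<in> V i" using uJ[of i] a J' by auto
      moreover have "V i \<subseteq> V a" using i a by (intro flag_mono[OF V]) auto
      ultimately show "x \<in> V a" using i by blast
    qed
    have "dim (span (u ` {1..a})) = card {1..a}" using a u by (intro dim_span_orthonormal_family) auto
    then show "dim (V a) \<le> dim (span (u ` {1..a}))" using flag_dim[OF V a] by simp
  qed (auto intro: flag_subspace[OF V a])
  show ?thesis
  proof (rule that[OF u _ sp])
    fix a assume a: "a \<le> ?n"
    have "{1..?n} - {1..a} = {a<..?n}" using a by auto
    then show "V a = {x. \<forall>c\<in>{a<..?n}. u c \<bullet> x = 0}"
      using orthonormal_family_subspace(1)[of "{1..?n}" u "{1..a}", OF u] a sp[OF a] by simp
  qed
qed

section \<open>Pivot normal forms and finite volume\<close>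

context grass_frame begin

text \<open>\<open>j\<close> is the sequence of pivots; in the \<open>i\<close>-th basis vector the coordinates at the earlier
  pivots vanish, the one at its own pivot is \<open>1\<close>, and \<open>b i\<close> bounds the support.\<close>

definition pivot_matrices :: "(nat \<Rightarrow> real ^ ('k + 'm)) \<Rightarrow> (nat \<Rightarrow> nat) \<Rightarrow> (nat \<Rightarrow> nat) \<Rightarrow> (real ^ ('k + 'm) ^ ('k + 'm)) set" where
  "pivot_matrices u b j = {A. (\<forall>i\<in>{1..CARD('m)}. A *v F i = 0) \<and> (\<forall>i\<in>{1..CARD('k)}.
     (\<forall>c\<in>{1..CARD('k + 'm)}. u c \<bullet> (A *v E i) \<in> {-1..1} \<and> (b i < c \<longrightarrow> u c \<bullet> (A *v E i) = 0)) \<and>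
     (\<forall>s\<in>{1..<i}. u (j s) \<bullet> (A *v E i) = 0) \<and> u (j i) \<bullet> (A *v E i) = 1)}"

text \<open>At the pivot \<open>j i\<close> all later basis vectors vanish, so the pivot coordinates
  form a triangular system with ones on the diagonal, and the coefficients vanish by induction on
  \<open>i\<close>.\<close>

lemma pivot_matrix_inj:
  assumes A: "A \<in> pivot_matrices u b j" and x: "x \<in> base_point" and 0: "A *v x = 0"
  shows "x = 0"
proof -
  have xs: "x = (\<Sum>i=1..CARD('k). (E i \<bullet> x) *\<^sub>R E i)" using frame_expand[of x] base_iff x by simp
  from arg_cong[OF this, of "(*v) A"] have Ax: "(\<Sum>i=1..CARD('k). (E i \<bullet> x) *\<^sub>R (A *v E i)) = 0"
    by (simp only: matrix_frame_sum 0)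
  have "E i \<bullet> x = 0" if "i \<in> {1..CARD('k)}" for i
    using that
  proof (induction i rule: less_induct)
    case (less i)
    have "0 = (\<Sum>i'=1..CARD('k). (E i' \<bullet> x) * (u (j i) \<bullet> (A *v E i')))"
      using arg_cong[OF Ax, of "inner (u (j i))"] by (simp add: inner_sum_right)
    also have "\<dots> = (\<Sum>i'=1..CARD('k). if i' = i then E i \<bullet> x else 0)"
    proof (intro sum.cong refl)
      fix i' assume i': "i' \<in> {1..CARD('k)}"
      show "(E i' \<bullet> x) * (u (j i) \<bullet> (A *v E i')) = (if i' = i then E i \<bullet> x else 0)"
      proof (cases i' i rule: linorder_cases)
        case less
        then show ?thesis using less.IH[of i'] i' by simp
      next
        case equal
        then show ?thesis using A i' by (auto simp: pivot_matrices_def)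
      next
        case greater
        then have "i \<in> {1..<i'}" using less.prems by simp
        then have "u (j i) \<bullet> (A *v E i') = 0" using A i' unfolding pivot_matrices_def by blast
        then show ?thesis using greater by simp
      qed
    qed
    finally show ?case using less.prems by simp
  qed
  then show ?thesis using xs by simp
qed

lemma compact_pivot_matrices:
  assumes u: "\<And>c d. c \<in> {1..CARD('k + 'm)} \<Longrightarrow> d \<in> {1..CARD('k + 'm)} \<Longrightarrow> u c \<bullet> u d = (if c = d then 1 else 0)"
  shows "compact (pivot_matrices u b j)"
proof -
  let ?n = "CARD('k + 'm)"
  have Ax: "A *v x = (\<Sum>i=1..CARD('k). (E i \<bullet> x) *\<^sub>R (A *v E i)) + (\<Sum>i=1..CARD('m). (F i \<bullet> x) *\<^sub>R (A *v F i))" for A :: "real ^ ('k + 'm) ^ ('k + 'm)" and x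
    by (subst (1) frame_expand[of x]) (simp add: matrix_vector_right_distrib matrix_frame_sum)
  have lin: "continuous_on UNIV (\<lambda>A. (A :: real ^ ('k + 'm) ^ ('k + 'm)) *v x)" for x
    by (intro linear_continuous_on bounded_bilinear.bounded_linear_left[OF bounded_bilinear_matrix_vector_mult])
  have "pivot_matrices u b j = (\<Inter>i\<in>{1..CARD('m)}. {A. A *v F i = 0}) \<inter> (\<Inter>i\<in>{1..CARD('k)}.
     (\<Inter>c\<in>{1..?n}. {A. - 1 \<le> u c \<bullet> (A *v E i)} \<inter> {A. u c \<bullet> (A *v E i) \<le> 1}) \<inter>
     (\<Inter>c\<in>{c\<in>{1..?n}. b i < c}. {A. u c \<bullet> (A *v E i) = 0}) \<inter>
     (\<Inter>s\<in>{1..<i}. {A. u (j s) \<bullet> (A *v E i) = 0}) \<inter> {A. u (j i) \<bullet> (A *v E i) = 1})"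
    unfolding pivot_matrices_def by auto
  then have "closed (pivot_matrices u b j)"
    by (auto intro!: closed_INT closed_Int closed_Collect_eq closed_Collect_le continuous_intros lin)
  moreover have "bounded (pivot_matrices u b j)"
  proof -
    have "norm A \<le> real CARD('k + 'm) * (real CARD('k + 'm) * real CARD('k + 'm))" if A: "A \<in> pivot_matrices u b j" for A
    proof -
      have nE: "norm (A *v E i) \<le> ?n" if i: "i \<in> {1..CARD('k)}" for i
      proof -
        have "A *v E i = (\<Sum>c\<in>{1..?n}. (u c \<bullet> (A *v E i)) *\<^sub>R u c)"
          by (rule orthonormal_family_expand[OF u]) auto
        also have "norm \<dots> \<le> (\<Sum>c\<in>{1..?n}. norm ((u c \<bullet> (A *v E i)) *\<^sub>R u c))" by (rule norm_sum)
        also have "\<dots> \<le> (\<Sum>c\<in>{1..?n}. 1)"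
        proof (rule sum_mono)
          fix c assume c: "c \<in> {1..?n}"
          have "norm (u c) = 1" using u[OF c c] by (simp add: norm_eq_1)
          moreover have "\<bar>u c \<bullet> (A *v E i)\<bar> \<le> 1" using A c i by (auto simp: pivot_matrices_def abs_le_iff)
          ultimately show "norm ((u c \<bullet> (A *v E i)) *\<^sub>R u c) \<le> 1" by simp
        qed
        finally show ?thesis by simp
      qed
      have nA: "norm (A *v x) \<le> real ?n * real ?n" if x: "norm x \<le> 1" for x
      proof -
        have "A *v x = (\<Sum>i=1..CARD('k). (E i \<bullet> x) *\<^sub>R (A *v E i))"
          using Ax[of A x] A by (simp add: pivot_matrices_def)
        also have "norm \<dots> \<le> (\<Sum>i=1..CARD('k). norm ((E i \<bullet> x) *\<^sub>R (A *v E i)))" by (rule norm_sum)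
        also have "\<dots> \<le> (\<Sum>i=1..CARD('k). 1 * real ?n)"
        proof (rule sum_mono)
          fix i assume i: "i \<in> {1..CARD('k)}"
          have "norm (E i) = 1" using EE[OF i i] by (simp add: norm_eq_1)
          then have "\<bar>E i \<bullet> x\<bar> \<le> 1" using Cauchy_Schwarz_ineq2[of "E i" x] x by simp
          then show "norm ((E i \<bullet> x) *\<^sub>R (A *v E i)) \<le> 1 * real ?n"
            unfolding norm_scaleR using nE[OF i] by (intro mult_mono) auto
        qed
        also have "\<dots> \<le> real ?n * real ?n" by (simp add: mult_right_mono)
        finally show ?thesis .
      qed
      have "norm A \<le> (\<Sum>r\<in>UNIV. norm (A $ r))" by (simp add: norm_vec_def L2_set_le_sum)
      also have "\<dots> \<le> (\<Sum>r\<in>(UNIV :: ('k + 'm) set). real ?n * real ?n)"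
      proof (rule sum_mono)
        fix r :: "'k + 'm"
        show "norm (A $ r) \<le> real ?n * real ?n"
        proof (cases "A $ r = 0")
          case False
          let ?x = "(1 / norm (A $ r)) *\<^sub>R A $ r"
          have "(A *v ?x) $ r = norm (A $ r)"
            using False by (simp add: matrix_vector_mul_component inner_scaleR_right power2_norm_eq_inner[symmetric] power2_eq_square)
          then have "norm (A $ r) \<le> norm (A *v ?x)" using component_le_norm_cart[of "A *v ?x" r] by simp
          also have "\<dots> \<le> real ?n * real ?n" using False by (intro nA) simp
          finally show ?thesis .
        qed simp
      qed
      finally show ?thesis by simp
    qed
    then show ?thesis unfolding bounded_iff by blast
  qed
  ultimately show ?thesis by (simp add: compact_eq_bounded_closed)
qed

text \<open>The \<open>i\<close>-th vector is free at the \<open>b i - i\<close> positions up to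
  \<open>b i\<close> that are not among the first \<open>i\<close> pivots, so the parameters lie in
  a cube of the stated dimension. Compactness bounds the inverse Gram matrix, and with it the
  Lipschitz constant of the projection formula.\<close>

lemma pivot_matrices_hausdorff:
  fixes u :: "nat \<Rightarrow> real ^ ('k + 'm)"
  assumes u: "\<And>c d. c \<in> {1..CARD('k + 'm)} \<Longrightarrow> d \<in> {1..CARD('k + 'm)} \<Longrightarrow> u c \<bullet> u d = (if c = d then 1 else 0)"
    and j: "inj_on j {1..CARD('k)}" "\<And>i. i \<in> {1..CARD('k)} \<Longrightarrow> j i \<in> {1..b i}"
    and b: "\<And>i. i \<in> {1..CARD('k)} \<Longrightarrow> b i \<le> CARD('k + 'm)" "\<And>s i. 1 \<le> s \<Longrightarrow> s \<le> i \<Longrightarrow> i \<le> CARD('k) \<Longrightarrow> b s \<le> b i"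
  shows "hausdorff_outer (\<Sum>i=1..CARD('k). b i - i) ((\<lambda>A. gr_embed (act A base_point)) ` pivot_matrices u b j) < \<infinity>"
proof -
  let ?T = "pivot_matrices u b j" and ?n = "CARD('k + 'm)"
  let ?I = "SIGMA i:{1..CARD('k)}. {1..b i} - j ` {1..i}"
  define f where "f A = (1 / sqrt 2) *\<^sub>R range_proj P0 A" for A :: "real ^ ('k + 'm) ^ ('k + 'm)"
  have f: "gr_embed (act A base_point) = f A" if "A \<in> ?T" for A
    unfolding gr_embed_def f_def using range_proj[OF subspace_base pivot_matrix_inj[OF that]] by simp
  have cI: "card ?I = (\<Sum>i=1..CARD('k). b i - i)"
  proof -
    have "card ({1..b i} - j ` {1..i}) = b i - i" if i: "i \<in> {1..CARD('k)}" for i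
    proof -
      have "j ` {1..i} \<subseteq> {1..b i}"
      proof
        fix x assume "x \<in> j ` {1..i}"
        then obtain s where "s \<in> {1..i}" "x = j s" by blast
        then show "x \<in> {1..b i}" using j(2)[of s] b(2)[of s i] i by auto
      qed
      moreover have "inj_on j {1..i}" by (rule inj_on_subset[OF j(1)]) (use i in auto)
      then have "card (j ` {1..i}) = i" by (simp add: card_image)
      ultimately show ?thesis by (simp add: card_Diff_subset)
    qed
    then show ?thesis by simp
  qed
  have inv: "invertible (gram P0 A)" if "A \<in> ?T" for A
    by (rule invertible_gram[OF subspace_base pivot_matrix_inj[OF that]])
  note cmp = compact_pivot_matrices[OF u, of b j]
  note bi = bounded_lipschitz_on_ident[OF compact_imp_bounded[OF cmp]]
  note bt = bounded_lipschitz_on_linear[OF bi bounded_linear_transpose]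
  have bg: "bounded_lipschitz_on ?T (gram P0)"
    unfolding gram_def[abs_def]
    by (intro bounded_lipschitz_on_add bounded_lipschitz_on_const bounded_lipschitz_on_matrix_mult bi bt)
  have "continuous_on ?T (gram P0)"
    unfolding gram_def[abs_def]
    by (intro continuous_intros bounded_bilinear.continuous_on[OF bounded_bilinear_matrix_mult]
        bounded_linear.continuous_on[OF bounded_linear_transpose])
  then have "continuous_on ?T (\<lambda>A. matrix_inv (gram P0 A))"
    by (rule continuous_on_compose2[OF continuous_on_matrix_inv]) (use inv in auto)
  then have "bounded ((\<lambda>A. matrix_inv (gram P0 A)) ` ?T)"
    using cmp compact_continuous_image compact_imp_bounded by blast
  then obtain K where K: "\<And>A. A \<in> ?T \<Longrightarrow> norm (matrix_inv (gram P0 A)) \<le> K" unfolding bounded_iff by blast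
  have "bounded_lipschitz_on ?T (\<lambda>A. matrix_inv (gram P0 A))"
    by (rule bounded_lipschitz_on_matrix_inv[OF bg inv K])
  then have "bounded_lipschitz_on ?T (range_proj P0)"
    unfolding range_proj_def[abs_def]
    by (intro bounded_lipschitz_on_const bounded_lipschitz_on_matrix_mult bi bt)
  then have "bounded_lipschitz_on ?T f"
    unfolding f_def[abs_def] by (rule bounded_lipschitz_on_linear[OF _ bounded_linear_scaleR_right])
  then obtain C where C: "0 \<le> C" "\<And>A B. A \<in> ?T \<Longrightarrow> B \<in> ?T \<Longrightarrow> norm (f A - f B) \<le> C * dist A B"
    unfolding bounded_lipschitz_on_def by blast
  \<comment> \<open>Converts a common bound on the free coordinates into a bound on the matrix
    norm.\<close>
  define nI where "nI = (\<Sum>p\<in>?I. norm (outer (u (snd p)) (E (fst p))))"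
  have fI: "finite ?I" by auto
  have "hausdorff_outer (card ?I) (f ` ?T) < \<infinity>"
  proof (rule hausdorff_outer_cube_image[OF fI, where C = "C * nI" and \<phi> = "\<lambda>A p. u (snd p) \<bullet> (A *v E (fst p))"])
    show "u (snd p) \<bullet> (A *v E (fst p)) \<in> {-1..1}" if "A \<in> ?T" "p \<in> ?I" for A p
      using that b(1) unfolding pivot_matrices_def by fastforce
    show "0 \<le> C * nI" using C(1) by (simp add: nI_def sum_nonneg)
    fix A B e assume AB: "A \<in> ?T" "B \<in> ?T" and e: "0 \<le> e"
      and d: "\<And>p. p \<in> ?I \<Longrightarrow> \<bar>u (snd p) \<bullet> (A *v E (fst p)) - u (snd p) \<bullet> (B *v E (fst p))\<bar> \<le> e"
    have "A - B = (\<Sum>p\<in>?I. (u (snd p) \<bullet> ((A - B) *v E (fst p))) *\<^sub>R outer (u (snd p)) (E (fst p)))" (is "_ = ?R")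
    proof (rule matrix_eq_frame)
      have Rv: "?R *v x = (\<Sum>p\<in>?I. (u (snd p) \<bullet> ((A - B) *v E (fst p))) *\<^sub>R (E (fst p) \<bullet> x) *\<^sub>R u (snd p))" for x
      proof -
        have "?R *v x = (\<Sum>p\<in>?I. ((u (snd p) \<bullet> ((A - B) *v E (fst p))) *\<^sub>R outer (u (snd p)) (E (fst p))) *v x)"
          by (rule matrix_sum_vector)
        then show ?thesis by (simp add: outer_mult_vec flip: scaleR_matrix_vector_assoc)
      qed
      fix i assume i: "i \<in> {1..CARD('k)}"
      let ?y = "(A - B) *v E i"
      have out: "u c \<bullet> ?y = 0" if c: "c \<in> {1..?n} - ({1..b i} - j ` {1..i})" for c
      proof -
        consider "b i < c" | s where "s \<in> {1..<i}" "c = j s" | "c = j i"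
        proof -
          assume 1: "b i < c \<Longrightarrow> thesis" and 2: "\<And>s. s \<in> {1..<i} \<Longrightarrow> c = j s \<Longrightarrow> thesis" and 3: "c = j i \<Longrightarrow> thesis"
          show thesis
          proof (cases "b i < c")
            case False
            then obtain s where s: "s \<in> {1..i}" "c = j s" using c by auto
            then show thesis using 2[of s] 3 by (cases "s = i") auto
          qed (rule 1)
        qed
        then show ?thesis
        proof cases
          case 1
          then have "u c \<bullet> (A *v E i) = 0" "u c \<bullet> (B *v E i) = 0"
            using AB i c unfolding pivot_matrices_def by auto
          then show ?thesis by (simp add: matrix_vector_mult_diff_rdistrib inner_diff_right)
        next
          case 2
          then have "u c \<bullet> (A *v E i) = 0" "u c \<bullet> (B *v E i) = 0"
            using AB i unfolding pivot_matrices_def by auto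
          then show ?thesis by (simp add: matrix_vector_mult_diff_rdistrib inner_diff_right)
        next
          case 3
          then have "u c \<bullet> (A *v E i) = 1" "u c \<bullet> (B *v E i) = 1"
            using AB i unfolding pivot_matrices_def by auto
          then show ?thesis by (simp add: matrix_vector_mult_diff_rdistrib inner_diff_right)
        qed
      qed
      have "?y = (\<Sum>c\<in>{1..?n}. (u c \<bullet> ?y) *\<^sub>R u c)"
        by (rule orthonormal_family_expand[OF u]) auto
      also have "\<dots> = (\<Sum>c\<in>{1..b i} - j ` {1..i}. (u c \<bullet> ?y) *\<^sub>R u c)"
        using out b(1)[OF i] by (intro sum.mono_neutral_right) auto
      finally have y: "?y = (\<Sum>c\<in>{1..b i} - j ` {1..i}. (u c \<bullet> ?y) *\<^sub>R u c)" .
      have "?R *v E i = (\<Sum>i'=1..CARD('k). \<Sum>c\<in>{1..b i'} - j ` {1..i'}.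
          (u c \<bullet> ((A - B) *v E i')) *\<^sub>R (E i' \<bullet> E i) *\<^sub>R u c)"
        unfolding Rv by (subst sum.Sigma) (auto simp: case_prod_unfold)
      also have "\<dots> = (\<Sum>i'=1..CARD('k). if i' = i then ?y else 0)"
      proof (intro sum.cong refl)
        fix i' assume i': "i' \<in> {1..CARD('k)}"
        show "(\<Sum>c\<in>{1..b i'} - j ` {1..i'}. (u c \<bullet> ((A - B) *v E i')) *\<^sub>R (E i' \<bullet> E i) *\<^sub>R u c) = (if i' = i then ?y else 0)"
          using y EE[OF i' i] by auto
      qed
      finally show "(A - B) *v E i = ?R *v E i" using i by simp
    next
      fix i assume i: "i \<in> {1..CARD('m)}"
      have "A *v F i = 0" "B *v F i = 0" using AB i unfolding pivot_matrices_def by blast+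
      moreover have "?R *v F i = 0"
      proof -
        have "?R *v F i = (\<Sum>p\<in>?I. ((u (snd p) \<bullet> ((A - B) *v E (fst p))) *\<^sub>R outer (u (snd p)) (E (fst p))) *v F i)"
          by (rule matrix_sum_vector)
        also have "\<dots> = 0"
          using EF i by (intro sum.neutral ballI) (auto simp: outer_mult_vec simp flip: scaleR_matrix_vector_assoc)
        finally show ?thesis .
      qed
      ultimately show "(A - B) *v F i = ?R *v F i" by (simp add: matrix_vector_mult_diff_rdistrib)
    qed
    then have "norm (A - B) = norm ?R" by simp
    also have "\<dots> \<le> (\<Sum>p\<in>?I. norm ((u (snd p) \<bullet> ((A - B) *v E (fst p))) *\<^sub>R outer (u (snd p)) (E (fst p))))" by (rule norm_sum)
    also have "\<dots> \<le> (\<Sum>p\<in>?I. e * norm (outer (u (snd p)) (E (fst p))))"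
      using d by (intro sum_mono) (simp add: mult_right_mono matrix_vector_mult_diff_rdistrib inner_diff_right)
    also have "\<dots> = nI * e"
      unfolding nI_def sum_distrib_right by (intro sum.cong refl) (simp add: mult.commute)
    finally have "dist A B \<le> nI * e" by (simp add: dist_norm)
    then have "C * dist A B \<le> C * (nI * e)" using C(1) by (rule mult_left_mono)
    then show "dist (f A) (f B) \<le> C * nI * e" using C(2)[OF AB] by (simp add: dist_norm mult.assoc)
  qed
  moreover have "(\<lambda>A. gr_embed (act A base_point)) ` ?T = f ` ?T" using f by (intro image_cong) auto
  ultimately show ?thesis by (simp add: cI)
qed

text \<open>\<open>b i\<close> is the flag index belonging to the end of row \<open>i\<close> and
  bounds the \<open>i\<close>-th pivot. As \<open>b i - i\<close> counts the squares of the
  rectangle missing in row \<open>i\<close>, the sum is the dimension of the cell.\<close>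

lemma pivot_bound:
  assumes y: "young_diagram CARD('k) CARD('m) l"
  defines "b \<equiv> \<lambda>i. CARD('m) - l i + i"
  shows "i \<in> {1..CARD('k)} \<Longrightarrow> b i \<le> CARD('k + 'm)" "i \<in> {1..CARD('k)} \<Longrightarrow> 1 \<le> b i"
    "1 \<le> s \<Longrightarrow> s \<le> i \<Longrightarrow> i \<le> CARD('k) \<Longrightarrow> b s \<le> b i"
    "1 \<le> s \<Longrightarrow> s < i \<Longrightarrow> i \<le> CARD('k) \<Longrightarrow> b s < b i"
    "(\<Sum>i=1..CARD('k). b i - i) = CARD('k) * CARD('m) - card (boxes CARD('k) l)"
proof -
  have lm: "l i \<le> CARD('m)" if "i \<in> {1..CARD('k)}" for i using y that by (auto simp: young_diagram_def)
  show "i \<in> {1..CARD('k)} \<Longrightarrow> b i \<le> CARD('k + 'm)" "i \<in> {1..CARD('k)} \<Longrightarrow> 1 \<le> b i" by (auto simp: b_def)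
  show "1 \<le> s \<Longrightarrow> s \<le> i \<Longrightarrow> i \<le> CARD('k) \<Longrightarrow> b s \<le> b i" using young_antimono[OF y, of s i] by (simp add: b_def)
  show "1 \<le> s \<Longrightarrow> s < i \<Longrightarrow> i \<le> CARD('k) \<Longrightarrow> b s < b i" using young_antimono[OF y, of s i] by (simp add: b_def)
  have "boxes CARD('k) l = (SIGMA i:{1..CARD('k)}. {1..l i})" by (auto simp: boxes_def)
  then have "card (boxes CARD('k) l) = (\<Sum>i=1..CARD('k). l i)" by simp
  moreover have "(\<Sum>i=1..CARD('k). CARD('m) - l i) = (\<Sum>i=1..CARD('k). CARD('m)) - (\<Sum>i=1..CARD('k). l i)"
    using lm by (intro sum_subtractf_nat) auto
  moreover have "(\<Sum>i=1..CARD('k). b i - i) = (\<Sum>i=1..CARD('k). CARD('m) - l i)"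
    by (intro sum.cong refl) (simp add: b_def)
  ultimately show "(\<Sum>i=1..CARD('k). b i - i) = CARD('k) * CARD('m) - card (boxes CARD('k) l)" by simp
qed

text \<open>Greedy elimination, valid on the whole closed variety. After \<open>r\<close> pivots,
  \<open>L \<inter> V (b (r + 1))\<close> has dimension at least \<open>r + 1\<close>, so it
  contains a nonzero vector that vanishes at these pivots. Its largest coordinate becomes the next
  pivot and is scaled to 1; this keeps all coordinates in \<open>[-1, 1]\<close>, which an ordered
  echelon form would not ensure.\<close>

lemma schubert_pivots:
  fixes V :: "nat \<Rightarrow> (real ^ ('k + 'm)) set"
  assumes V: "complete_flag V" and y: "young_diagram CARD('k) CARD('m) l" and L: "L \<in> schubert V l"
    and u: "\<And>i j. i \<in> {1..CARD('k + 'm)} \<Longrightarrow> j \<in> {1..CARD('k + 'm)} \<Longrightarrow> u i \<bullet> u j = (if i = j then 1 else 0)"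
    and uV: "\<And>a. a \<le> CARD('k + 'm) \<Longrightarrow> V a = {x. \<forall>c\<in>{a<..CARD('k + 'm)}. u c \<bullet> x = 0}"
  defines "b \<equiv> \<lambda>i. CARD('m) - l i + i"
  obtains j A where "j \<in> {1..CARD('k)} \<rightarrow>\<^sub>E {1..CARD('k + 'm)}" "inj_on j {1..CARD('k)}"
    "\<And>i. i \<in> {1..CARD('k)} \<Longrightarrow> j i \<in> {1..b i}" "A \<in> pivot_matrices u b j" "act A base_point = L"
proof -
  let ?n = "CARD('k + 'm)" and ?k = "CARD('k)"
  have Lg: "L \<in> grassmannian" using L by (simp add: schubert_def)
  have L': "subspace L" "dim L = ?k" using Lg by (auto simp: grassmannian_def)
  have pb: "\<And>i. i \<in> {1..CARD('k)} \<Longrightarrow> b i \<le> CARD('k + 'm)" "\<And>i. i \<in> {1..CARD('k)} \<Longrightarrow> 1 \<le> b i"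
    "\<And>s i. 1 \<le> s \<Longrightarrow> s \<le> i \<Longrightarrow> i \<le> CARD('k) \<Longrightarrow> b s \<le> b i"
    "\<And>s i. 1 \<le> s \<Longrightarrow> s < i \<Longrightarrow> i \<le> CARD('k) \<Longrightarrow> b s < b i"
    unfolding b_def by (fact pivot_bound[OF y])+
  have dL: "i \<le> dim (L \<inter> V (b i))" if i: "i \<in> {1..?k}" for i
  \<comment> \<open>An empty row carries no box; there the bound holds for every \<open>L\<close> by
    a dimension count.\<close>
  proof (cases "l i = 0")
    case True
    have "b i \<le> CARD('m) + dim (L \<inter> V (b i))" by (rule flag_dim_bounds(3)[OF V Lg pb(1)[OF i]])
    then show ?thesis using True by (simp add: b_def)
  next
    case False
    then have "(i, l i) \<in> boxes ?k l" using i by (auto simp: boxes_def)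
    then show ?thesis using L by (auto simp: schubert_def b_def)
  qed
  let ?P = "\<lambda>j x i. x i \<in> L \<and> x i \<in> V (b i) \<and> (\<forall>c\<in>{1..?n}. u c \<bullet> x i \<in> {-1..1}) \<and>
      (\<forall>s\<in>{1..<i}. u (j s) \<bullet> x i = 0) \<and> u (j i) \<bullet> x i = (1 :: real) \<and> j i \<in> {1..b i}"
  have "\<exists>j x. \<forall>i\<in>{1..r}. ?P j x i" if "r \<le> ?k" for r
    using that
  proof (induction r)
    case (Suc r)
    have "\<exists>j x. \<forall>i\<in>{1..r}. ?P j x i" by (rule Suc.IH) (use Suc.prems in simp)
    then obtain j x where jx': "\<forall>i\<in>{1..r}. ?P j x i" by (elim exE)
    have jx: "?P j x i" if "i \<in> {1..r}" for i by (rule bspec[OF jx' that])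
    let ?i = "Suc r"
    have i: "?i \<in> {1..?k}" using Suc.prems by simp
    have bi: "b ?i \<le> ?n" by (rule pb(1)[OF i])
    have jn: "j ` {1..r} \<subseteq> {1..?n}"
    proof
      fix c assume "c \<in> j ` {1..r}"
      then obtain s where s: "s \<in> {1..r}" "c = j s" by blast
      then have "s \<in> {1..?k}" using i by auto
      then show "c \<in> {1..?n}" using jx[OF s(1)] pb(1)[of s] s(2) by auto
    qed
    define T where "T = {x. \<forall>c\<in>j ` {1..r}. u c \<bullet> x = 0}"
    have "{1..?n} - ({1..?n} - j ` {1..r}) = j ` {1..r}" using jn by blast
    then have "dim T = card ({1..?n} - j ` {1..r})"
      unfolding T_def using orthonormal_family_subspace(2)[of "{1..?n}" u "{1..?n} - j ` {1..r}", OF u] by simp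
    also have "\<dots> = ?n - card (j ` {1..r})" using jn by (subst card_Diff_subset) (auto intro: finite_subset)
    finally have dT: "?n - r \<le> dim T" using card_image_le[of "{1..r}" j] by simp
    have sT: "subspace T" by (auto simp: T_def subspace_def inner_add_right)
    have sW: "subspace (L \<inter> V (b ?i))" using L' flag_subspace[OF V bi] by (simp add: subspace_inter)
    have "dim (ssum (L \<inter> V (b ?i)) T) \<le> ?n" using dim_subset_UNIV[of "ssum (L \<inter> V (b ?i)) T"] by simp
    then have "0 < dim (L \<inter> V (b ?i) \<inter> T)" using dim_ssum[OF sW sT] dT dL[OF i] Suc.prems by simp
    then have "\<not> L \<inter> V (b ?i) \<inter> T \<subseteq> {0}" using dim_eq_0[of "L \<inter> V (b ?i) \<inter> T"] by linarith
    then obtain z where z: "z \<in> L \<inter> V (b ?i) \<inter> T" "z \<noteq> 0" by blast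
    let ?M = "Max ((\<lambda>c. \<bar>u c \<bullet> z\<bar>) ` {1..?n})"
    have "1 \<le> ?k" using i by simp
    then have "?M \<in> (\<lambda>c. \<bar>u c \<bullet> z\<bar>) ` {1..?n}" by (intro Max_in) auto
    then obtain c0 where c0: "c0 \<in> {1..?n}" "\<bar>u c0 \<bullet> z\<bar> = ?M" by auto
    have mx: "\<bar>u c \<bullet> z\<bar> \<le> \<bar>u c0 \<bullet> z\<bar>" if "c \<in> {1..?n}" for c
      unfolding c0(2) using that by (intro Max_ge) auto
    have nz: "u c0 \<bullet> z \<noteq> 0"
    proof
      assume "u c0 \<bullet> z = 0"
      then have "u c \<bullet> z = 0" if "c \<in> {1..?n}" for c using mx[OF that] by simp
      moreover have "z = (\<Sum>c\<in>{1..?n}. (u c \<bullet> z) *\<^sub>R u c)" by (rule orthonormal_family_expand[OF u]) auto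
      ultimately show False using z(2) by simp
    qed
    define w where "w = (1 / (u c0 \<bullet> z)) *\<^sub>R z"
    have uw: "u c \<bullet> w = (u c \<bullet> z) / (u c0 \<bullet> z)" for c by (simp add: w_def)
    have "u c \<bullet> w \<in> {-1..1}" if "c \<in> {1..?n}" for c
    proof -
      have "\<bar>u c \<bullet> w\<bar> \<le> 1" unfolding uw abs_divide using mx[OF that] nz by simp
      then show ?thesis by (simp add: abs_le_iff)
    qed
    moreover have "c0 \<le> b ?i"
    proof (rule ccontr)
      assume "\<not> c0 \<le> b ?i"
      then have "u c0 \<bullet> z = 0" using z(1) uV[OF bi] c0(1) by auto
      then show False using nz by simp
    qed
    moreover have "w \<in> L" "w \<in> V (b ?i)"
      using z(1) L' flag_subspace[OF V bi] by (auto simp: w_def intro: subspace_scale)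
    moreover have "u (j s) \<bullet> w = 0" if "s \<in> {1..<?i}" for s
      using z(1) that by (auto simp: uw T_def)
    ultimately have new: "?P (j(?i := c0)) (x(?i := w)) ?i" using c0(1) nz by (auto simp: uw)
    have old: "?P (j(?i := c0)) (x(?i := w)) i'" if "i' \<in> {1..r}" for i' using jx[OF that] that by auto
    have "?P (j(?i := c0)) (x(?i := w)) i'" if "i' \<in> {1..?i}" for i'
    proof (cases "i' = ?i")
      case False
      then have "i' \<in> {1..r}" using that by auto
      then show ?thesis by (rule old)
    qed (use new in blast)
    then show ?case by blast
  qed simp
  then obtain j0 x where jx: "\<And>i. i \<in> {1..?k} \<Longrightarrow> ?P j0 x i" by blast
  define j where "j = restrict j0 {1..?k}"
  have j: "j i = j0 i" if "i \<in> {1..?k}" for i using that by (simp add: j_def)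
  obtain A where AE: "\<And>i. i \<in> {1..?k} \<Longrightarrow> A *v E i = x i" and AF: "\<And>i. i \<in> {1..CARD('m)} \<Longrightarrow> A *v F i = 0"
    by (rule matrix_of_frame[of x "\<lambda>_. 0"]) (rule that)
  have jb: "j i \<in> {1..b i}" if "i \<in> {1..?k}" for i using jx[OF that] j[OF that] by simp
  have js: "u (j s) \<bullet> x i = 0" if "i \<in> {1..?k}" "s \<in> {1..<i}" for i s
    using jx[OF that(1)] that j[of s] by auto
  have ji: "u (j i) \<bullet> x i = 1" if "i \<in> {1..?k}" for i
    using jx[OF that(1)] j[OF that] by auto
  have "A \<in> pivot_matrices u b j"
  proof -
    have "u c \<bullet> x i = 0" if "i \<in> {1..?k}" "c \<in> {1..?n}" "b i < c" for i c
      using jx[OF that(1)] uV[OF pb(1)[OF that(1)]] that by auto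
    then show ?thesis using jx js ji AE AF unfolding pivot_matrices_def by auto
  qed
  moreover have "act A base_point = L"
  proof (rule subspace_dim_equal)
    show "subspace (act A base_point)" by (intro subspace_act subspace_base)
    show "act A base_point \<subseteq> L"
    proof -
      have "act A base_point = span ((*v) A ` E ` {1..?k})"
        unfolding act_def base_span by (rule linear_span_image[symmetric]) simp
      also have "\<dots> \<subseteq> L" using AE jx by (intro span_minimal L'(1)) auto
      finally show ?thesis .
    qed
    have "inj_on ((*v) A) (span base_point)"
      unfolding span_eq_iff[THEN iffD2, OF subspace_base]
    proof (rule inj_onI)
      fix v w :: "real ^ ('k + 'm)" assume vw: "v \<in> base_point" "w \<in> base_point" "A *v v = A *v w"
      then have "v - w = 0"
        by (rule_tac pivot_matrix_inj[OF \<open>A \<in> pivot_matrices u b j\<close>])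
          (simp_all add: subspace_diff[OF subspace_base] matrix_vector_mult_diff_distrib)
      then show "v = w" by simp
    qed
    then have "dim (act A base_point) = ?k" unfolding act_def by (subst dim_image_eq) (simp_all add: dim_base)
    then show "dim L \<le> dim (act A base_point)" using L' by simp
  qed (rule L')
  moreover have "inj_on j {1..?k}"
  proof (rule inj_onI)
    have *: "j s \<noteq> j i" if "s < i" "s \<in> {1..?k}" "i \<in> {1..?k}" for s i
      using js[OF that(3), of s] ji[OF that(3)] that by auto
    fix s i assume "s \<in> {1..?k}" "i \<in> {1..?k}" "j s = j i"
    then show "s = i" using *[of s i] *[of i s] by (cases s i rule: linorder_cases) auto
  qed
  moreover have "j \<in> {1..?k} \<rightarrow>\<^sub>E {1..?n}"
  proof (rule PiE_I)
    fix i assume i: "i \<in> {1..?k}"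
    show "j i \<in> {1..?n}" using jb[OF i] pb(1)[OF i] by auto
  qed (auto simp: j_def)
  ultimately show ?thesis using jb by (intro that) auto
qed

lemma hausdorff_schubert_finite:
  fixes V :: "nat \<Rightarrow> (real ^ ('k + 'm)) set"
  assumes V: "complete_flag V" and y: "young_diagram CARD('k) CARD('m) l"
  shows "hausdorff_outer (CARD('k) * CARD('m) - card (boxes CARD('k) l)) (gr_embed ` schubert V l) < \<infinity>"
proof -
  let ?b = "\<lambda>i. CARD('m) - l i + i"
  obtain u where u: "\<And>i j. i \<in> {1..CARD('k + 'm)} \<Longrightarrow> j \<in> {1..CARD('k + 'm)} \<Longrightarrow> u i \<bullet> u j = (if i = j then 1 else 0)"
    and uV: "\<And>a. a \<le> CARD('k + 'm) \<Longrightarrow> V a = {x. \<forall>c\<in>{a<..CARD('k + 'm)}. u c \<bullet> x = 0}"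
    by (rule flag_orthonormal[OF V]) (rule that)
  define J where "J = {j \<in> {1..CARD('k)} \<rightarrow>\<^sub>E {1..CARD('k + 'm)}. inj_on j {1..CARD('k)} \<and> (\<forall>i\<in>{1..CARD('k)}. j i \<in> {1..?b i})}"
  have "finite ({1..CARD('k)} \<rightarrow>\<^sub>E {1..CARD('k + 'm)})" by (rule finite_PiE) simp_all
  then have fJ: "finite J" unfolding J_def by simp
  have "gr_embed ` schubert V l \<subseteq> (\<Union>j\<in>J. (\<lambda>A. gr_embed (act A base_point)) ` pivot_matrices u ?b j)"
  proof
    fix M assume "M \<in> gr_embed ` schubert V l"
    then obtain L where L: "L \<in> schubert V l" "M = gr_embed L" by blast
    obtain j A where "j \<in> {1..CARD('k)} \<rightarrow>\<^sub>E {1..CARD('k + 'm)}" "inj_on j {1..CARD('k)}"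
      "\<And>i. i \<in> {1..CARD('k)} \<Longrightarrow> j i \<in> {1..?b i}" "A \<in> pivot_matrices u ?b j" "act A base_point = L"
      by (rule schubert_pivots[OF V y L(1), of u]) (rule u, assumption, assumption, rule uV, assumption, rule that)
    then have "j \<in> J" "M = gr_embed (act A base_point)" "A \<in> pivot_matrices u ?b j" using L(2) by (auto simp: J_def)
    then show "M \<in> (\<Union>j\<in>J. (\<lambda>A. gr_embed (act A base_point)) ` pivot_matrices u ?b j)" by blast
  qed
  then have "hausdorff_outer (CARD('k) * CARD('m) - card (boxes CARD('k) l)) (gr_embed ` schubert V l)
     \<le> hausdorff_outer (CARD('k) * CARD('m) - card (boxes CARD('k) l))
          (\<Union>j\<in>J. (\<lambda>A. gr_embed (act A base_point)) ` pivot_matrices u ?b j)"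
    by (rule hausdorff_outer_mono)
  also have "\<dots> < \<infinity>"
  proof (rule hausdorff_outer_finite_UN[OF fJ])
    fix j assume "j \<in> J"
    then have j: "inj_on j {1..CARD('k)}" "\<And>i. i \<in> {1..CARD('k)} \<Longrightarrow> j i \<in> {1..?b i}" by (auto simp: J_def)
    show "hausdorff_outer (CARD('k) * CARD('m) - card (boxes CARD('k) l))
          ((\<lambda>A. gr_embed (act A base_point)) ` pivot_matrices u ?b j) < \<infinity>"
      using pivot_matrices_hausdorff[OF u j pivot_bound(1)[OF y] pivot_bound(3)[OF y]]
      unfolding pivot_bound(5)[OF y] .
  qed
  finally show ?thesis .
qed

text \<open>The witness is spanned by the flag basis vectors at the positions
  \<open>b 1 < ... < b k\<close>. Exactly \<open>p\<close> of these are at most \<open>b p\<close>,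
  and \<open>b p\<close> is the flag index of a corner in row \<open>p\<close>.\<close>

lemma schubert_smooth_nonempty:
  fixes V :: "nat \<Rightarrow> (real ^ ('k + 'm)) set"
  assumes V: "complete_flag V" and y: "young_diagram CARD('k) CARD('m) l"
  shows "schubert_smooth V l \<noteq> {}"
proof -
  let ?n = "CARD('k + 'm)" and ?k = "CARD('k)"
  define b where "b = (\<lambda>i. CARD('m) - l i + i)"
  have pb: "\<And>i. i \<in> {1..CARD('k)} \<Longrightarrow> b i \<le> CARD('k + 'm)" "\<And>i. i \<in> {1..CARD('k)} \<Longrightarrow> 1 \<le> b i"
    "\<And>s i. 1 \<le> s \<Longrightarrow> s \<le> i \<Longrightarrow> i \<le> CARD('k) \<Longrightarrow> b s \<le> b i"
    "\<And>s i. 1 \<le> s \<Longrightarrow> s < i \<Longrightarrow> i \<le> CARD('k) \<Longrightarrow> b s < b i"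
    unfolding b_def by (fact pivot_bound[OF y])+
  obtain u where u: "\<And>i j. i \<in> {1..?n} \<Longrightarrow> j \<in> {1..?n} \<Longrightarrow> u i \<bullet> u j = (if i = j then 1 else 0)"
    and uV: "\<And>a. a \<le> ?n \<Longrightarrow> V a = {x. \<forall>c\<in>{a<..?n}. u c \<bullet> x = 0}"
    by (rule flag_orthonormal[OF V]) (rule that)
  define L where "L = span (u ` b ` {1..?k})"
  have bn: "b ` {1..?k} \<subseteq> {1..?n}"
    using pb(1,2) by (intro image_subsetI) (simp only: atLeastAtMost_iff)
  have lt: "b s < b i \<longleftrightarrow> s < i" if "s \<in> {1..?k}" "i \<in> {1..?k}" for s i
    using pb(4)[of s i] pb(3)[of i s] that by fastforce
  have inj: "inj_on b {1..?k}"
    by (rule inj_onI) (use lt in \<open>metis less_irrefl linorder_neqE_nat\<close>)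
  have Leq: "L = {x. \<forall>c\<in>{1..?n} - b ` {1..?k}. u c \<bullet> x = 0}"
    unfolding L_def using orthonormal_family_subspace(1)[of "{1..?n}" u "b ` {1..?k}", OF u] bn by simp
  have "dim L = card (b ` {1..?k})"
    unfolding L_def by (rule dim_span_orthonormal_family) (use u bn in blast)
  then have "L \<in> grassmannian" using inj by (simp add: grassmannian_def L_def card_image)
  moreover have "dim (L \<inter> V (CARD('m) - q + p)) = p" if c: "(p, q) \<in> outer_corners ?k l" for p q
  proof -
    note cb = corner_bounds[OF y c]
    have a: "CARD('m) - q + p = b p" using cb by (simp add: b_def)
    have bp: "b p \<le> ?n" by (rule pb(1)[OF cb(1)])
    have "({1..?n} - b ` {1..?k}) \<union> {b p<..?n} = {1..?n} - b ` {1..p}"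
    proof -
      have "b ` {1..p} = b ` {1..?k} - {b p<..?n}"
      proof (intro set_eqI iffI)
        fix x assume "x \<in> b ` {1..p}"
        then obtain s where s: "s \<in> {1..p}" "x = b s" by blast
        then show "x \<in> b ` {1..?k} - {b p<..?n}" using lt[of p s] cb(1) by auto
      next
        fix x assume x: "x \<in> b ` {1..?k} - {b p<..?n}"
        then obtain s where s: "s \<in> {1..?k}" "x = b s" by blast
        then have "\<not> b p < b s" using x pb(1)[OF s(1)] by auto
        then show "x \<in> b ` {1..p}" using s lt[OF cb(1) s(1)] by auto
      qed
      then show ?thesis by auto
    qed
    then have "L \<inter> V (b p) = {x. \<forall>c\<in>{1..?n} - b ` {1..p}. u c \<bullet> x = 0}"
      unfolding Leq uV[OF bp] by blast
    moreover have "b ` {1..p} \<subseteq> {1..?n}" using bn cb(1) by auto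
    ultimately have "dim (L \<inter> V (b p)) = card (b ` {1..p})"
      using orthonormal_family_subspace(2)[of "{1..?n}" u "b ` {1..p}", OF u] by simp
    also have "\<dots> = p" using inj_on_subset[OF inj, of "{1..p}"] cb(1) by (simp add: card_image)
    finally show ?thesis unfolding a .
  qed
  ultimately have "L \<in> schubert_smooth V l" by (auto simp: schubert_smooth_def)
  then show ?thesis by blast
qed

text \<open>A box lies inside the rectangle of a corner \<open>(p, q)\<close>. If its flag space
  contains that of the corner, the intersection has dimension at least \<open>p\<close>. Otherwise
  it is smaller by at most \<open>p - i\<close> dimensions, and at most that many are lost.\<close>

lemma schubert_smooth_subset:
  fixes V :: "nat \<Rightarrow> (real ^ ('k + 'm)) set"
  assumes V: "complete_flag V" and y: "young_diagram CARD('k) CARD('m) l"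
  shows "schubert_smooth V l \<subseteq> schubert V l"
proof
  fix L assume L: "L \<in> schubert_smooth V l"
  have Lg: "L \<in> grassmannian" by (rule schubert_smooth_grassmannian[OF L])
  have L': "subspace L" using Lg by (simp add: grassmannian_def)
  have "i \<le> dim (L \<inter> V (CARD('m) - j + i))" if ij: "(i, j) \<in> boxes CARD('k) l" for i j
  proof -
    obtain p q where c: "(p, q) \<in> outer_corners CARD('k) l" and le: "i \<le> p" "j \<le> q"
      using boxes_iff_corner[OF y, of i j] ij by auto
    note cb = corner_bounds[OF y c]
    let ?a = "CARD('m) - q + p" and ?a' = "CARD('m) - j + i"
    have d: "dim (L \<inter> V ?a) = p" by (rule schubert_smooth_dim[OF L c])
    have a: "?a \<le> CARD('k + 'm)" "?a' \<le> CARD('k + 'm)" using cb(4) le cb(1) by auto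
    show ?thesis
    proof (cases "?a \<le> ?a'")
      case True
      have "dim (L \<inter> V ?a) \<le> dim (L \<inter> V ?a')" using flag_mono[OF V True a(2)] by (intro dim_subset) auto
      then show ?thesis using d le by simp
    next
      case False
      then have sub: "V ?a' \<subseteq> V ?a" by (intro flag_mono[OF V _ a(1)]) simp
      have s1: "subspace (L \<inter> V ?a)" using L' flag_subspace[OF V a(1)] by (simp add: subspace_inter)
      have "ssum (L \<inter> V ?a) (V ?a') \<subseteq> V ?a"
        using sub subspace_add[OF flag_subspace[OF V a(1)]] by (auto simp: ssum_def)
      then have "dim (ssum (L \<inter> V ?a) (V ?a')) \<le> ?a" using dim_subset flag_dim[OF V a(1)] by metis
      moreover have "L \<inter> V ?a \<inter> V ?a' = L \<inter> V ?a'" using sub by blast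
      ultimately have "p + ?a' \<le> ?a + dim (L \<inter> V ?a')"
        using dim_ssum[OF s1 flag_subspace[OF V a(2)]] d flag_dim[OF V a(2)] by simp
      then show ?thesis using le cb by auto
    qed
  qed
  then show "L \<in> schubert V l" using Lg by (auto simp: schubert_def)
qed

end

section \<open>Borel sets and volumes on the Grassmannian\<close>

lemma space_gr_borel: "space gr_borel = (grassmannian :: (real ^ ('k::finite + 'm::finite)) set set)"
  by (simp add: gr_borel_def)

lemma sets_gr_borel:
  "sets gr_borel = {gr_embed -` B \<inter> (grassmannian :: (real ^ ('k::finite + 'm::finite)) set set) | B. B \<in> sets borel}"
  unfolding gr_borel_def by (rule sets_vimage_algebra2) simp

lemma gr_embed_inj: "inj_on gr_embed (grassmannian :: (real ^ ('k::finite + 'm::finite)) set set)"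
proof (rule inj_onI)
  fix L L' :: "(real ^ ('k + 'm)) set"
  assume "L \<in> grassmannian" "L' \<in> grassmannian" "gr_embed L = gr_embed L'"
  then show "L = L'" by (intro proj_matrix_inj) (auto simp: grassmannian_def gr_embed_def)
qed

lemma gr_borelI_closed:
  fixes A :: "(real ^ ('k::finite + 'm::finite)) set set"
  assumes "A \<subseteq> grassmannian" "closed (gr_embed ` A)"
  shows "A \<in> sets gr_borel"
proof -
  have "A = gr_embed -` (gr_embed ` A) \<inter> grassmannian"
    using assms(1) inj_onD[OF gr_embed_inj] by (auto intro: rev_image_eqI)
  then show ?thesis unfolding sets_gr_borel using assms(2) borel_closed by blast
qed

context grass_frame begin

text \<open>The set is a continuous image of a compact one: of the orthogonal matrices
  \<open>g\<close> whose first \<open>i\<close> frame vectors lie in \<open>V a\<close>, under the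
  map to the scaled projection \<open>g P0 g^T\<close>.\<close>

lemma closed_frame_set:
  fixes V :: "nat \<Rightarrow> (real ^ ('k + 'm)) set"
  assumes V: "complete_flag V" and a: "a \<le> CARD('k + 'm)" and i: "i \<le> CARD('k)"
  shows "closed (gr_embed ` {L \<in> grassmannian. i \<le> dim (L \<inter> V a)})"
proof -
  let ?G = "{g. orthogonal_matrix g} \<inter> (\<Inter>s\<in>{1..i}. {g. g *v E s \<in> V a})"
  let ?f = "\<lambda>g. (1 / sqrt 2) *\<^sub>R (g ** P0 ** transpose g)"
  have cont: "continuous_on UNIV (\<lambda>g. (g :: real ^ ('k + 'm) ^ ('k + 'm)) *v x)" for x
    by (intro linear_continuous_on bounded_bilinear.bounded_linear_left[OF bounded_bilinear_matrix_vector_mult])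
  have "closed {g. g *v E s \<in> V a}" for s
    using continuous_closed_vimage[OF closed_subspace[OF flag_subspace[OF V a]], of "\<lambda>g. g *v E s"] cont[of "E s"]
    by (simp add: continuous_on_eq_continuous_at vimage_def)
  then have "compact ?G" by (intro compact_Int_closed compact_orthogonal_matrices closed_INT ballI) auto
  moreover have "continuous_on ?G ?f"
    by (intro continuous_intros bounded_bilinear.continuous_on[OF bounded_bilinear_matrix_mult]
        bounded_linear.continuous_on[OF bounded_linear_transpose])
  ultimately have "compact (?f ` ?G)" by (rule_tac compact_continuous_image)
  moreover have "gr_embed ` {L \<in> grassmannian. i \<le> dim (L \<inter> V a)} = ?f ` ?G"
  proof
    have fg: "gr_embed (act g base_point) = ?f g" if "orthogonal_matrix g" for g
      using proj_matrix_act[OF that subspace_base] by (simp add: gr_embed_def)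
    show "gr_embed ` {L \<in> grassmannian. i \<le> dim (L \<inter> V a)} \<subseteq> ?f ` ?G"
    proof
      fix M assume "M \<in> gr_embed ` {L \<in> grassmannian. i \<le> dim (L \<inter> V a)}"
      then obtain L where L: "L \<in> grassmannian" "i \<le> dim (L \<inter> V a)" "M = gr_embed L" by blast
      obtain g where g: "orthogonal_matrix g" "act g base_point = L"
        "\<And>a i. a \<le> CARD('k + 'm) \<Longrightarrow> i \<in> {1..dim (L \<inter> V a)} \<Longrightarrow> g *v E i \<in> V a"
        by (rule adapted_orthogonal[OF V L(1)]) (rule that)
      have "g \<in> ?G" using g(1) g(3)[OF a] L(2) by auto
      then show "M \<in> ?f ` ?G" using fg[OF g(1)] g(2) L(3) by blast
    qed
    show "?f ` ?G \<subseteq> gr_embed ` {L \<in> grassmannian. i \<le> dim (L \<inter> V a)}"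
    proof
      fix M assume "M \<in> ?f ` ?G"
      then obtain g where g: "orthogonal_matrix g" "\<And>s. s \<in> {1..i} \<Longrightarrow> g *v E s \<in> V a" "M = ?f g" by auto
      let ?L = "act g base_point"
      have L: "?L \<in> grassmannian" by (rule act_base_grassmannian[OF orthogonal_matrix_invertible[OF g(1)]])
      have "dim (span ((\<lambda>s. g *v E s) ` {1..i})) = card {1..i}"
        using i by (intro dim_span_orthonormal_family) (simp add: orthogonal_matrix_inner[OF g(1)] EE)
      moreover have "(\<lambda>s. g *v E s) ` {1..i} \<subseteq> ?L \<inter> V a"
        using g(2) E_base i unfolding act_def by auto
      then have "dim (span ((\<lambda>s. g *v E s) ` {1..i})) \<le> dim (?L \<inter> V a)"
        using dim_subset[of "(\<lambda>s. g *v E s) ` {1..i}" "?L \<inter> V a"] by simp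
      ultimately have "i \<le> dim (?L \<inter> V a)" by simp
      then have "?L \<in> {L \<in> grassmannian. i \<le> dim (L \<inter> V a)}" using L by simp
      moreover have "M = gr_embed ?L" using fg[OF g(1)] g(3) by simp
      ultimately show "M \<in> gr_embed ` {L \<in> grassmannian. i \<le> dim (L \<inter> V a)}" by (rule rev_image_eqI)
    qed
  qed
  ultimately show ?thesis using compact_imp_closed by simp
qed

lemma closed_gr_embed_grassmannian:
  fixes V :: "nat \<Rightarrow> (real ^ ('k + 'm)) set"
  assumes V: "complete_flag V"
  shows "closed (gr_embed ` (grassmannian :: (real ^ ('k + 'm)) set set))"
  using closed_frame_set[OF V, of 0 0] by simp

lemma dim_ge_in_gr_borel:
  fixes V :: "nat \<Rightarrow> (real ^ ('k + 'm)) set"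
  assumes V: "complete_flag V" and a: "a \<le> CARD('k + 'm)"
  shows "{L \<in> grassmannian. i \<le> dim (L \<inter> V a)} \<in> sets gr_borel"
proof (cases "i \<le> CARD('k)")
  case True
  then show ?thesis using closed_frame_set[OF V a] by (intro gr_borelI_closed) auto
next
  case False
  have e: "{L \<in> grassmannian. i \<le> dim (L \<inter> V a)} = {}"
  proof (rule equals0I)
    fix L assume "L \<in> {L \<in> grassmannian. i \<le> dim (L \<inter> V a)}"
    then have "L \<in> grassmannian" "i \<le> dim (L \<inter> V a)" by auto
    then show False using flag_dim_bounds(1)[OF V _ a, of L] False by linarith
  qed
  show ?thesis by (simp only: e sets.empty_sets)
qed

lemma grassmannian_in_gr_borel: "(grassmannian :: (real ^ ('k + 'm)) set set) \<in> sets gr_borel"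
  using sets.top[of "gr_borel :: (real ^ ('k + 'm)) set measure"] by (simp add: space_gr_borel)

lemma finite_corners: "finite (outer_corners k l)"
  by (rule finite_subset[OF _ finite_boxes[of k l]]) (auto simp: outer_corners_def)

lemma schubert_in_gr_borel:
  fixes V :: "nat \<Rightarrow> (real ^ ('k + 'm)) set"
  assumes V: "complete_flag V" and y: "young_diagram CARD('k) CARD('m) l"
  shows "schubert V l \<in> sets gr_borel" "schubert_smooth V l \<in> sets gr_borel"
proof -
  let ?G = "grassmannian :: (real ^ ('k + 'm)) set set"
  \<comment> \<open>For the empty diagram the intersection over no conditions is
    \<open>UNIV\<close>; hence the extra factor \<open>?G\<close>.\<close>
  have D: "(\<Inter>p\<in>I. S p) \<inter> ?G \<in> sets gr_borel" if "finite I" "\<And>p. p \<in> I \<Longrightarrow> S p \<in> sets gr_borel"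
    for I :: "(nat \<times> nat) set" and S
    using that
  proof (induction rule: finite_induct)
    case (insert p I)
    have "(\<Inter>p\<in>insert p I. S p) \<inter> ?G = S p \<inter> ((\<Inter>p\<in>I. S p) \<inter> ?G)" by auto
    then show ?case using insert by auto
  qed (simp add: grassmannian_in_gr_borel)
  have "schubert V l = (\<Inter>(i, j)\<in>boxes CARD('k) l. {L \<in> ?G. i \<le> dim (L \<inter> V (CARD('m) - j + i))}) \<inter> ?G"
    by (auto simp: schubert_def)
  moreover have "(\<Inter>(i, j)\<in>boxes CARD('k) l. {L \<in> ?G. i \<le> dim (L \<inter> V (CARD('m) - j + i))}) \<inter> ?G \<in> sets gr_borel"
  proof (intro D finite_boxes)
    fix c assume c: "c \<in> boxes CARD('k) l"
    then obtain i j where ij: "c = (i, j)" by (cases c)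
    then have "CARD('m) - j + i \<le> CARD('k + 'm)" using subsetD[OF boxes_subset[OF y] c] by auto
    then show "(case c of (i, j) \<Rightarrow> {L \<in> ?G. i \<le> dim (L \<inter> V (CARD('m) - j + i))}) \<in> sets gr_borel"
      using ij dim_ge_in_gr_borel[OF V] by simp
  qed
  ultimately show "schubert V l \<in> sets gr_borel" by simp
  have "schubert_smooth V l = (\<Inter>(p, q)\<in>outer_corners CARD('k) l.
      {L \<in> ?G. p \<le> dim (L \<inter> V (CARD('m) - q + p))} - {L \<in> ?G. Suc p \<le> dim (L \<inter> V (CARD('m) - q + p))}) \<inter> ?G"
    by (auto simp: schubert_smooth_def)
  moreover have "(\<Inter>(p, q)\<in>outer_corners CARD('k) l.
      {L \<in> ?G. p \<le> dim (L \<inter> V (CARD('m) - q + p))} - {L \<in> ?G. Suc p \<le> dim (L \<inter> V (CARD('m) - q + p))}) \<inter> ?G \<in> sets gr_borel"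
  proof (intro D finite_corners)
    fix c assume c: "c \<in> outer_corners CARD('k) l"
    then obtain p q where pq: "c = (p, q)" "(p, q) \<in> outer_corners CARD('k) l" by (cases c) auto
    then have "CARD('m) - q + p \<le> CARD('k + 'm)" using corner_bounds(4)[OF y] by simp
    then show "(case c of (p, q) \<Rightarrow> {L \<in> ?G. p \<le> dim (L \<inter> V (CARD('m) - q + p))} - {L \<in> ?G. Suc p \<le> dim (L \<inter> V (CARD('m) - q + p))}) \<in> sets gr_borel"
      using pq dim_ge_in_gr_borel[OF V] by (simp add: sets.Diff)
  qed
  ultimately show "schubert_smooth V l \<in> sets gr_borel" by simp
qed

text \<open>\<open>measure_of\<close> takes the prescribed values only once countable additivity is
  known. It is transferred from the Borel sets through the injective \<open>gr_embed\<close>; images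
  of measurable sets are Borel because the image of the Grassmannian is closed.\<close>

lemma gr_volume:
  fixes V :: "nat \<Rightarrow> (real ^ ('k + 'm)) set"
  assumes V: "complete_flag V"
  shows sets_gr_volume: "sets (gr_volume D) = sets (gr_borel :: (real ^ ('k + 'm)) set measure)"
    and space_gr_volume: "space (gr_volume D) = (grassmannian :: (real ^ ('k + 'm)) set set)"
    and emeasure_gr_volume: "A \<in> sets gr_borel \<Longrightarrow> emeasure (gr_volume D) A = hausdorff_outer D (gr_embed ` (A :: (real ^ ('k + 'm)) set set))"
proof -
  let ?G = "grassmannian :: (real ^ ('k + 'm)) set set"
  have sa: "sigma_algebra ?G (sets gr_borel)"
    using sets.sigma_algebra_axioms[of "gr_borel :: (real ^ ('k + 'm)) set measure"] by (simp add: space_gr_borel)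
  have sub: "sets gr_borel \<subseteq> Pow ?G" using sets.space_closed[of "gr_borel :: (real ^ ('k + 'm)) set measure"] by (simp add: space_gr_borel)
  show s: "sets (gr_volume D) = sets (gr_borel :: (real ^ ('k + 'm)) set measure)"
    unfolding gr_volume_def by (rule sigma_algebra.sets_measure_of_eq[OF sa])
  show "space (gr_volume D) = ?G"
    unfolding gr_volume_def using sub by (rule space_measure_of)
  have B: "gr_embed ` A \<in> sets borel" if hA: "A \<in> sets gr_borel" for A :: "(real ^ ('k + 'm)) set set"
  proof -
    have "\<exists>B. A = gr_embed -` B \<inter> ?G \<and> B \<in> sets borel" using hA unfolding sets_gr_borel by (rule CollectD)
    then obtain B where B: "A = gr_embed -` B \<inter> ?G" "B \<in> sets borel" by (elim exE conjE)
    have "gr_embed ` A = B \<inter> gr_embed ` ?G" unfolding B(1) by (rule set_eqI) auto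
    then show ?thesis using B(2) borel_closed[OF closed_gr_embed_grassmannian[OF V]] by (simp only: sets.Int)
  qed
  assume A: "A \<in> sets gr_borel"
  show "emeasure (gr_volume D) A = hausdorff_outer D (gr_embed ` A)"
  proof (rule emeasure_measure_of[OF gr_volume_def])
    show "sets gr_borel \<subseteq> Pow ?G" by (rule sub)
    show "positive (sets (gr_volume D)) (\<lambda>A :: (real ^ ('k + 'm)) set set. hausdorff_outer D (gr_embed ` A))"
      by (simp add: positive_def)
    show "A \<in> sets (gr_volume D)" using A s by simp
    show "countably_additive (sets (gr_volume D)) (\<lambda>A :: (real ^ ('k + 'm)) set set. hausdorff_outer D (gr_embed ` A))"
    proof (rule countably_additiveI)
      fix A :: "nat \<Rightarrow> (real ^ ('k + 'm)) set set"
      assume A: "range A \<subseteq> sets (gr_volume D)" "disjoint_family A" "(\<Union>i. A i) \<in> sets (gr_volume D)"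
      have AG: "A i \<subseteq> ?G" for i using A(1) sub unfolding s by blast
      have "range (\<lambda>i. gr_embed ` A i) \<subseteq> sets borel" using A(1) B unfolding s by blast
      moreover have "disjoint_family (\<lambda>i. gr_embed ` A i)"
        unfolding disjoint_family_on_def
      proof (intro ballI impI)
        fix i j :: nat assume "i \<noteq> j"
        then have "A i \<inter> A j = {}" using A(2) by (simp add: disjoint_family_on_def)
        then have "gr_embed ` (A i \<inter> A j) = {}" by simp
        then show "gr_embed ` A i \<inter> gr_embed ` A j = {}"
          using inj_on_image_Int[OF gr_embed_inj AG[of i] AG[of j]] by simp
      qed
      moreover have "(\<Union>i. gr_embed ` A i) \<in> sets borel" using B[of "\<Union>i. A i"] A(3) unfolding s by (simp add: image_UN)
      ultimately show "(\<Sum>i. hausdorff_outer D (gr_embed ` A i)) = hausdorff_outer D (gr_embed ` (\<Union>i. A i))"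
        unfolding image_UN
        by (rule hausdorff_outer_countably_additive[of D, unfolded countably_additive_def, rule_format])
    qed
  qed
qed

end

lemma axis_frame_exists:
  obtains E F :: "nat \<Rightarrow> real ^ ('k::finite + 'm::finite)" where "grass_frame E F"
    "grass_frame.frame_matrix E F (mat 1) ` ({1..CARD('k)} \<times> {1..CARD('m)}) \<subseteq> Basis"
proof -
  obtain a where a: "bij_betw a {1..CARD('k)} (UNIV :: 'k set)"
    using finite_same_card_bij[of "{1..CARD('k)}" "UNIV :: 'k set"] by auto
  obtain b where b: "bij_betw b {1..CARD('m)} (UNIV :: 'm set)"
    using finite_same_card_bij[of "{1..CARD('m)}" "UNIV :: 'm set"] by auto
  define E :: "nat \<Rightarrow> real ^ ('k + 'm)" where "E i = axis (Inl (a i)) 1" for i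
  define F :: "nat \<Rightarrow> real ^ ('k + 'm)" where "F j = axis (Inr (b j)) 1" for j
  have gf: "grass_frame E F"
  proof
    show "E i \<bullet> E i' = (if i = i' then 1 else 0)" if "i \<in> {1..CARD('k)}" "i' \<in> {1..CARD('k)}" for i i'
      using inj_on_eq_iff[OF bij_betw_imp_inj_on[OF a] that] by (auto simp: E_def inner_axis_axis)
    show "F j \<bullet> F j' = (if j = j' then 1 else 0)" if "j \<in> {1..CARD('m)}" "j' \<in> {1..CARD('m)}" for j j'
      using inj_on_eq_iff[OF bij_betw_imp_inj_on[OF b] that] by (auto simp: F_def inner_axis_axis)
    show "E i \<bullet> F j = 0" for i j by (simp add: E_def F_def inner_axis_axis)
    show "E i \<in> base_point" for i by (simp add: E_def base_point_def axis_def)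
  qed
  interpret grass_frame E F by (rule gf)
  have "frame_matrix (mat 1) (i, j) \<in> Basis" for i j
  proof -
    have "frame_matrix (mat 1) (i, j) = axis (Inr (b j)) (axis (Inl (a i)) 1)"
      by (simp add: frame_matrix_1 outer_def E_def F_def axis_def vec_eq_iff)
    then show ?thesis by (simp add: axis_in_Basis_iff)
  qed
  then have "frame_matrix (mat 1) ` ({1..CARD('k)} \<times> {1..CARD('m)}) \<subseteq> Basis" by auto
  then show ?thesis by (rule that[OF gf])
qed

lemma gr_volume_schubert:
  fixes V :: "nat \<Rightarrow> (real ^ ('k::finite + 'm::finite)) set"
  assumes V: "complete_flag V" and y: "young_diagram CARD('k) CARD('m) l"
  defines "D \<equiv> CARD('k) * CARD('m) - card (boxes CARD('k) l)"
  shows "0 < emeasure (gr_volume D) (schubert_smooth V l)"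
    "emeasure (gr_volume D) (schubert_smooth V l) \<le> emeasure (gr_volume D) (schubert V l)"
    "emeasure (gr_volume D) (schubert V l) < \<infinity>"
proof -
  obtain E F :: "nat \<Rightarrow> real ^ ('k::finite + 'm::finite)" where gf: "grass_frame E F" and
    B: "grass_frame.frame_matrix E F (mat 1) ` ({1..CARD('k)} \<times> {1..CARD('m)}) \<subseteq> Basis"
    by (rule axis_frame_exists) (rule that)
  interpret grass_frame E F by (rule gf)
  note sb = schubert_in_gr_borel[OF V y]
  obtain L where L: "L \<in> schubert_smooth V l" using schubert_smooth_nonempty[OF V y] by blast
  show "0 < emeasure (gr_volume D) (schubert_smooth V l)"
    unfolding emeasure_gr_volume[OF V sb(2)] D_def by (rule hausdorff_schubert_smooth_pos[OF V y L B])
  show "emeasure (gr_volume D) (schubert_smooth V l) \<le> emeasure (gr_volume D) (schubert V l)"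
    unfolding emeasure_gr_volume[OF V sb(2)] emeasure_gr_volume[OF V sb(1)]
    by (intro hausdorff_outer_mono image_mono schubert_smooth_subset[OF V y])
  show "emeasure (gr_volume D) (schubert V l) < \<infinity>"
    unfolding emeasure_gr_volume[OF V sb(1)] D_def by (rule hausdorff_schubert_finite[OF V y])
qed

lemma measure_gr_volume_schubert_pos:
  fixes V :: "nat \<Rightarrow> (real ^ ('k::finite + 'm::finite)) set"
  assumes V: "complete_flag V" and y: "young_diagram CARD('k) CARD('m) l"
  shows "0 < measure (gr_volume (CARD('k) * CARD('m) - card (boxes CARD('k) l))) (schubert V l)"
  using gr_volume_schubert[OF assms] unfolding measure_def by (simp add: enn2real_positive_iff)

lemma vol_ratio_pos:
  fixes V :: "nat \<Rightarrow> (real ^ ('k::finite + 'm::finite)) set"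
  assumes V: "complete_flag V" and y: "young_diagram CARD('k) CARD('m) l"
  shows "0 < vol_ratio V l"
proof -
  \<comment> \<open>The Grassmannian is the Schubert variety of the empty diagram, so the same
    bounds cover the denominator.\<close>
  have y0: "young_diagram CARD('k) CARD('m) (\<lambda>_. 0)" by (simp add: young_diagram_def)
  have b0: "boxes CARD('k) (\<lambda>_. 0) = {}" by (auto simp: boxes_def)
  have "schubert V (\<lambda>_. 0) = grassmannian" by (simp add: schubert_def b0)
  then have "0 < measure (gr_volume (CARD('k) * CARD('m))) (grassmannian :: (real ^ ('k + 'm)) set set)"
    using measure_gr_volume_schubert_pos[OF V y0] by (simp add: b0)
  then show ?thesis unfolding vol_ratio_def using measure_gr_volume_schubert_pos[OF V y] by simp
qed

section \<open>The stabilizer of the base point\<close>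

definition inl :: "real ^ 'k \<Rightarrow> real ^ ('k::finite + 'm::finite)" where
  "inl x = (\<chi> r. case r of Inl i \<Rightarrow> x $ i | Inr _ \<Rightarrow> 0)"

definition inr :: "real ^ 'm \<Rightarrow> real ^ ('k::finite + 'm::finite)" where
  "inr y = (\<chi> r. case r of Inl _ \<Rightarrow> 0 | Inr j \<Rightarrow> y $ j)"

lemma inl_nth [simp]: "inl x $ Inl i = x $ i" "inl x $ Inr j = 0"
  and inr_nth [simp]: "inr y $ Inl i = 0" "inr y $ Inr j = y $ j"
  by (simp_all add: inl_def inr_def)

lemma vec_sum_eq_iff:
  fixes u v :: "real ^ ('k::finite + 'm::finite)"
  shows "u = v \<longleftrightarrow> (\<forall>i. u $ Inl i = v $ Inl i) \<and> (\<forall>j. u $ Inr j = v $ Inr j)"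
  unfolding vec_eq_iff by (simp add: split_sum_all)

lemma sum_UNIV_sum: "(\<Sum>s\<in>UNIV. g s) = (\<Sum>i\<in>UNIV. g (Inl i)) + (\<Sum>j\<in>UNIV. g (Inr j))"
  for g :: "'k::finite + 'm::finite \<Rightarrow> real"
  unfolding UNIV_Plus_UNIV[symmetric] by (subst sum.Plus) simp_all

lemma inner_inl_inr:
  "inl x \<bullet> inl x' = x \<bullet> x'" "inr y \<bullet> inr y' = y \<bullet> y'" "inl x \<bullet> inr y = 0" "inr y \<bullet> inl x = 0"
  for x x' :: "real ^ 'k::finite" and y y' :: "real ^ 'm::finite"
  by (simp_all add: inner_vec_def sum_UNIV_sum)

lemma sum_vec_decomp: "\<exists>x y. z = inl x + inr y" for z :: "real ^ ('k::finite + 'm::finite)"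
  by (rule exI[of _ "\<chi> i. z $ Inl i"], rule exI[of _ "\<chi> j. z $ Inr j"]) (simp add: vec_sum_eq_iff)

lemma base_point_eq: "base_point = range (inl :: real ^ 'k \<Rightarrow> real ^ ('k::finite + 'm::finite))"
proof (rule set_eqI, rule iffI)
  fix z :: "real ^ ('k + 'm)"
  show "z \<in> base_point" if "z \<in> range inl" using that by (auto simp: base_point_def)
  assume "z \<in> base_point"
  then have "z = inl (\<chi> i. z $ Inl i)" by (simp add: vec_sum_eq_iff base_point_def)
  then show "z \<in> range inl" by (rule range_eqI)
qed

lemma orthogonal_matrixI_inner:
  fixes A :: "real ^ 'n ^ 'n"
  assumes "\<And>x y. (A *v x) \<bullet> (A *v y) = x \<bullet> y"
  shows "orthogonal_matrix A"
  using assms orthogonal_transformation_matrix[of "(*v) A"]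
  by (simp add: orthogonal_transformation_def)

lemma block_matrix_vec:
  "block_matrix h *v inl x = inl (fst h *v x)" "block_matrix h *v inr y = inr (snd h *v y)"
  by (simp_all add: vec_sum_eq_iff matrix_vector_mult_def sum_UNIV_sum block_matrix_def)

lemma block_matrix_mult: "block_matrix (stab_mult g h) = block_matrix g ** block_matrix h"
  for g h :: "(real ^ 'k::finite ^ 'k) \<times> (real ^ 'm::finite ^ 'm)"
proof -
  have "block_matrix (stab_mult g h) *v z = block_matrix g ** block_matrix h *v z" for z
  proof -
    obtain x y where z: "z = inl x + inr y" using sum_vec_decomp by blast
    show ?thesis unfolding z by (simp add: matrix_vector_right_distrib block_matrix_vec stab_mult_def flip: matrix_vector_mul_assoc)
  qed
  then show ?thesis by (simp add: matrix_eq)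
qed

definition diag_blocks :: "real ^ ('k + 'm) ^ ('k::finite + 'm::finite) \<Rightarrow> (real ^ 'k ^ 'k) \<times> (real ^ 'm ^ 'm)" where
  "diag_blocks M = ((\<chi> i j. M $ Inl i $ Inl j), (\<chi> i j. M $ Inr i $ Inr j))"

lemma diag_blocks_block_matrix [simp]: "diag_blocks (block_matrix h) = h"
  by (simp add: diag_blocks_def block_matrix_def prod_eq_iff vec_eq_iff)

lemma continuous_on_diag_blocks: "continuous_on A diag_blocks"
  unfolding diag_blocks_def by (intro continuous_intros continuous_on_vec_lambda)

lemma continuous_on_block_matrix: "continuous_on A block_matrix"
  unfolding block_matrix_def
proof (intro continuous_on_vec_lambda)
  fix r c :: "'a + 'b"
  show "continuous_on A (\<lambda>h. case (r, c) of (Inl i, Inl j) \<Rightarrow> fst h $ i $ j | (Inl i, Inr b) \<Rightarrow> 0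
    | (Inr i, Inl b) \<Rightarrow> 0 | (Inr i, Inr j) \<Rightarrow> snd h $ i $ j)"
    by (cases r; cases c) (auto intro!: continuous_intros)
qed

lemma block_matrix_stab:
  fixes h :: "(real ^ 'k::finite ^ 'k) \<times> (real ^ 'm::finite ^ 'm)"
  assumes h: "h \<in> stab"
  shows orthogonal_block_matrix: "orthogonal_matrix (block_matrix h)"
    and act_block_matrix: "act (block_matrix h) base_point = base_point"
proof -
  have o: "orthogonal_matrix (fst h)" "orthogonal_matrix (snd h)" using h by (auto simp: stab_def)
  show "orthogonal_matrix (block_matrix h)"
  proof (rule orthogonal_matrixI_inner)
    fix z z' :: "real ^ ('k + 'm)"
    obtain x y where z: "z = inl x + inr y" using sum_vec_decomp by blast
    obtain x' y' where z': "z' = inl x' + inr y'" using sum_vec_decomp by blast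
    show "(block_matrix h *v z) \<bullet> (block_matrix h *v z') = z \<bullet> z'" unfolding z z'
      by (simp add: matrix_vector_right_distrib block_matrix_vec inner_add_left inner_add_right inner_inl_inr
          orthogonal_matrix_inner[OF o(1)] orthogonal_matrix_inner[OF o(2)])
  qed
  have "fst h *v (transpose (fst h) *v x) = x" for x
    using o(1) by (simp add: matrix_vector_mul_assoc orthogonal_matrix_def)
  then have "range ((*v) (fst h)) = UNIV" by (metis surjI)
  then have "range (\<lambda>x. inl (fst h *v x) :: real ^ ('k + 'm)) = range inl" by (metis image_image)
  then show "act (block_matrix h) base_point = (base_point :: (real ^ ('k + 'm)) set)"
    unfolding act_def base_point_eq by (simp add: image_image block_matrix_vec)
qed

text \<open>An orthogonal matrix that preserves the base point also preserves its orthogonal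
  complement, so both off-diagonal blocks vanish.\<close>

lemma block_matrix_of_stabilizer:
  fixes M :: "real ^ ('k + 'm) ^ ('k::finite + 'm::finite)"
  assumes M: "orthogonal_matrix M" "act M base_point = base_point"
  shows "M = block_matrix (diag_blocks M)" "diag_blocks M \<in> stab"
proof -
  have l: "M *v inl x \<in> base_point" for x
    using M(2) unfolding act_def base_point_eq by (metis rangeI image_eqI)
  have r: "(M *v inr y) $ Inl i = 0" for y i
  proof -
    have "inl (axis i 1) \<in> act M base_point" unfolding M(2) by (simp add: base_point_eq)
    then obtain x where "inl (axis i 1) = M *v inl x" unfolding act_def base_point_eq by blast
    then have "inl (axis i 1) \<bullet> (M *v inr y) = 0" using orthogonal_matrix_inner[OF M(1)] by (simp add: inner_inl_inr)
    moreover have "inl (axis i 1) = (axis (Inl i) 1 :: real ^ ('k + 'm))" by (simp add: vec_sum_eq_iff axis_def)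
    ultimately show ?thesis by (simp add: inner_axis')
  qed
  have il: "inl (axis i 1) = (axis (Inl i) 1 :: real ^ ('k + 'm))" for i by (simp add: vec_sum_eq_iff axis_def)
  have ir: "inr (axis i 1) = (axis (Inr i) 1 :: real ^ ('k + 'm))" for i by (simp add: vec_sum_eq_iff axis_def)
  have z1: "M $ Inr j $ Inl i = 0" for i j
    using l[of "axis i 1"] unfolding il by (simp add: base_point_def matrix_vector_mul_component inner_axis)
  have z2: "M $ Inl i $ Inr j = 0" for i j
    using r[of "axis j 1" i] unfolding ir by (simp add: matrix_vector_mul_component inner_axis)
  show eq: "M = block_matrix (diag_blocks M)"
    by (simp add: vec_eq_iff split_sum_all z1 z2 block_matrix_def diag_blocks_def)
  let ?h = "diag_blocks M"
  have i: "(block_matrix ?h *v z) \<bullet> (block_matrix ?h *v z') = z \<bullet> z'" for z z'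
    using orthogonal_matrix_inner[OF M(1)] eq by metis
  have "orthogonal_matrix (fst ?h)" "orthogonal_matrix (snd ?h)"
    using i[of "inl _" "inl _"] i[of "inr _" "inr _"]
    by (auto intro!: orthogonal_matrixI_inner simp: block_matrix_vec inner_inl_inr)
  then show "?h \<in> stab" by (simp add: stab_def mem_Times_iff)
qed

lemma tensor_act_tensor: "tensor_act h (tensor x y) = tensor (fst h *v x) (snd h *v y)"
  by (simp add: vec_eq_iff tensor_act_def tensor_def matrix_vector_mult_def sum_product sum.cartesian_product
      mult_ac split_beta flip: UNIV_Times_UNIV)

lemma inner_tensor: "tensor x y \<bullet> tensor x' y' = (x \<bullet> x') * (y \<bullet> y')"
  by (simp add: tensor_def inner_vec_def sum_product sum.cartesian_product mult_ac split_beta flip: UNIV_Times_UNIV)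

lemma linear_tensor_act: "linear (tensor_act h)"
  by (rule linearI) (simp_all add: tensor_act_def vec_eq_iff distrib_left sum.distrib sum_distrib_left mult_ac)

lemma linear_hom_to_tensor: "linear hom_to_tensor"
  by (rule linearI) (simp_all add: hom_to_tensor_def vec_eq_iff)

lemma hom_to_tensor_outer: "hom_to_tensor (outer (inr y) (inl x)) = tensor x y"
  by (simp add: hom_to_tensor_def outer_def tensor_def vec_eq_iff mult.commute)

lemma set_box_list: "set (box_list k l) = boxes k l"
  by (force simp: box_list_def boxes_def simp del: upt_Suc)

lemma distinct_box_list: "distinct (box_list k l)"
proof -
  have "distinct (concat (map (\<lambda>i. map (Pair i) (g i)) xs))"
    if "distinct xs" "\<And>i. distinct (g i)" for xs :: "nat list" and g :: "nat \<Rightarrow> nat list"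
    using that by (induction xs) (auto simp: distinct_map inj_on_def)
  then show ?thesis unfolding box_list_def by simp
qed

lemma continuous_on_wedge_map:
  assumes "\<And>b. b \<in> set bs \<Longrightarrow> continuous_on A (\<lambda>x. \<phi> x b)"
  shows "continuous_on A (\<lambda>x. wedge (map (\<phi> x) bs))"
proof -
  have c: "continuous_on A (\<lambda>x. map (\<phi> x) bs ! a $ i)" if "a < length bs" for a i
  proof -
    have "continuous_on A (\<lambda>x. \<phi> x (bs ! a) $ i)" using assms that by (intro continuous_intros) simp
    then show ?thesis using that by simp
  qed
  have "continuous_on A (\<lambda>x. if card S = length (map (\<phi> x) bs) then
      \<Sum>p | p permutes {..<length (map (\<phi> x) bs)}. of_int (sign p) *
        (\<Prod>a<length (map (\<phi> x) bs). map (\<phi> x) bs ! a $ (enum_set S ! p a)) else 0)" for S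
  proof (cases "card S = length bs")
    case True
    then show ?thesis
      using c permutes_in_image by (auto intro!: continuous_on_sum continuous_on_mult continuous_on_prod simp del: nth_map)
  qed simp
  then show ?thesis unfolding wedge_def by (rule continuous_on_vec_lambda)
qed

lemma continuous_on_ext_act: "continuous_on A (\<lambda>h. ext_act h v)"
  unfolding ext_act_def ext_map_def
proof (intro continuous_on_sum continuous_on_scaleR continuous_on_const continuous_on_wedge_map)
  show "continuous_on A (\<lambda>h. tensor_act h (axis i 1))" for i
    unfolding tensor_act_def by (intro continuous_on_vec_lambda continuous_intros)
qed

lemma grass_frame_inl_inr:
  fixes e :: "nat \<Rightarrow> real ^ 'k::finite" and f :: "nat \<Rightarrow> real ^ 'm::finite"
  assumes "orthonormal_basis e" "orthonormal_basis f"
  shows "grass_frame (\<lambda>i. inl (e i) :: real ^ ('k + 'm)) (\<lambda>j. inr (f j))"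
  using assms by unfold_locales (auto simp: orthonormal_basis_def inner_inl_inr base_point_eq)

text \<open>The action turns the Schubert vector into another wedge of orthonormal tensors. Its norm
  is therefore 1, which bounds the random vector and makes it integrable.\<close>

lemma map_tensor_box_list_orthonormal:
  fixes e :: "nat \<Rightarrow> real ^ 'k::finite" and f :: "nat \<Rightarrow> real ^ 'm::finite"
  assumes e: "orthonormal_basis e" and f: "orthonormal_basis f" and y: "young_diagram CARD('k) CARD('m) l" and h: "h \<in> stab"
  defines "ws \<equiv> map (\<lambda>(i, j). tensor (fst h *v e i) (snd h *v f j)) (box_list CARD('k) l)"
  shows "\<And>a b. a < length ws \<Longrightarrow> b < length ws \<Longrightarrow> ws ! a \<bullet> ws ! b = (if a = b then 1 else 0)"
    and "ext_act h (schubert_vector e f l) = wedge ws"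
    and "norm (ext_act h (schubert_vector e f l)) = 1"
proof -
  have o: "orthogonal_matrix (fst h)" "orthogonal_matrix (snd h)" using h by (auto simp: stab_def)
  show on: "ws ! a \<bullet> ws ! b = (if a = b then 1 else 0)" if ab: "a < length ws" "b < length ws" for a b
  proof -
    let ?b = "box_list CARD('k) l"
    have ab': "a < length ?b" "b < length ?b" using ab by (simp_all add: ws_def)
    obtain i j where ij: "?b ! a = (i, j)" by (cases "?b ! a")
    obtain i' j' where ij': "?b ! b = (i', j')" by (cases "?b ! b")
    have "(i, j) \<in> boxes CARD('k) l" using nth_mem[OF ab'(1)] unfolding set_box_list ij .
    then have 1: "i \<in> {1..CARD('k)}" "j \<in> {1..CARD('m)}" using boxes_subset[OF y] by auto
    have "(i', j') \<in> boxes CARD('k) l" using nth_mem[OF ab'(2)] unfolding set_box_list ij' .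
    then have 2: "i' \<in> {1..CARD('k)}" "j' \<in> {1..CARD('m)}" using boxes_subset[OF y] by auto
    have "e i \<bullet> e i' = (if i = i' then 1 else 0)" "f j \<bullet> f j' = (if j = j' then 1 else 0)"
      using e f 1 2 by (auto simp: orthonormal_basis_def)
    then have "ws ! a \<bullet> ws ! b = (if ?b ! a = ?b ! b then 1 else 0)"
      using ab' by (simp add: ws_def ij ij' inner_tensor orthogonal_matrix_inner[OF o(1)] orthogonal_matrix_inner[OF o(2)])
    then show ?thesis using nth_eq_iff_index_eq[OF distinct_box_list ab'] by simp
  qed
  show eq: "ext_act h (schubert_vector e f l) = wedge ws"
    unfolding ext_act_def schubert_vector_def ext_map_wedge[OF linear_tensor_act] ws_def map_map
    by (intro arg_cong[where f = wedge] map_cong) (auto simp: tensor_act_tensor)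
  show "norm (ext_act h (schubert_vector e f l)) = 1" unfolding eq by (rule norm_wedge_orthonormal) (rule on)
qed

lemma unit_simple_conormal:
  fixes V :: "nat \<Rightarrow> (real ^ ('k::finite + 'm::finite)) set" and e :: "nat \<Rightarrow> real ^ 'k" and f :: "nat \<Rightarrow> real ^ 'm"
  assumes V: "complete_flag V" and y: "young_diagram CARD('k) CARD('m) l"
    and e: "orthonormal_basis e" and f: "orthonormal_basis f"
    and M: "orthogonal_matrix M" "act M L = base_point" and L: "L \<in> schubert_smooth V l"
    and g: "g \<in> grass_frame.frames (\<lambda>i. inl (e i)) (\<lambda>j. inr (f j)) V l L"
  defines "h \<equiv> diag_blocks (M ** g)"
  defines "N \<equiv> unit_simple (hom_to_tensor ` conormal_space (act M ` schubert_smooth V l) base_point)"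
  shows "M ** g = block_matrix h" "h \<in> stab"
    and "N = ext_act h (schubert_vector e f l) \<or> N = - ext_act h (schubert_vector e f l)"
proof -
  interpret grass_frame "\<lambda>i. inl (e i) :: real ^ ('k + 'm)" "\<lambda>j. inr (f j)" by (rule grass_frame_inl_inr[OF e f])
  have g': "M ** g \<in> frames (\<lambda>i. act M (V i)) l base_point" using frames_act_flag[OF g M(1)] M(2) by simp
  note st = block_matrix_of_stabilizer[OF frames_orthogonal[OF g'] frames_act[OF g']]
  show eq: "M ** g = block_matrix h" and h: "h \<in> stab" unfolding h_def by (rule st)+
  have inv: "invertible M" by (rule orthogonal_matrix_invertible[OF M(1)])
  let ?ws = "map (\<lambda>(i, j). tensor (fst h *v e i) (snd h *v f j)) (box_list CARD('k) l)"
  have fm: "hom_to_tensor (frame_matrix (M ** g) (i, j)) = tensor (fst h *v e i) (snd h *v f j)" for i j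
    unfolding eq by (simp add: frame_matrix_def block_matrix_vec hom_to_tensor_outer)
  have "act M L \<in> schubert_smooth (\<lambda>i. act M (V i)) l"
    unfolding act_schubert_smooth[OF inv, symmetric] using L by (rule imageI)
  then have b: "base_point \<in> schubert_smooth (\<lambda>i. act M (V i)) l" unfolding M(2) .
  have "conormal_space (act M ` schubert_smooth V l) base_point = span (frame_matrix (M ** g) ` boxes CARD('k) l)"
    unfolding act_schubert_smooth[OF inv] by (rule conormal_space_frame[OF complete_flag_act[OF V inv] y b g'])
  then have "hom_to_tensor ` conormal_space (act M ` schubert_smooth V l) base_point
      = span (hom_to_tensor ` frame_matrix (M ** g) ` boxes CARD('k) l)"
    by (simp add: linear_span_image[OF linear_hom_to_tensor])
  also have "hom_to_tensor ` frame_matrix (M ** g) ` boxes CARD('k) l = set ?ws"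
    unfolding set_map set_box_list image_image using fm by (intro image_cong) auto
  finally have sp: "span (set ?ws) = hom_to_tensor ` conormal_space (act M ` schubert_smooth V l) base_point" by simp
  note ws = map_tensor_box_list_orthonormal[OF e f y h]
  show "N = ext_act h (schubert_vector e f l) \<or> N = - ext_act h (schubert_vector e f l)"
    unfolding ws(2) N_def by (rule unit_simple_span[OF ws(1) sp])
qed

section \<open>Zonoids and Haar measure\<close>

text \<open>A span is determined by its orthogonal complement: the component of \<open>x\<close>
  orthogonal to the other span is then orthogonal to \<open>x\<close> as well, hence zero.\<close>

lemma span_eqI_orthogonal:
  fixes A B :: "'a::euclidean_space set"
  assumes "\<And>u. (\<forall>a\<in>A. u \<bullet> a = 0) \<longleftrightarrow> (\<forall>b\<in>B. u \<bullet> b = 0)"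
  shows "span A = span B"
proof -
  have *: "S \<subseteq> span T" if h: "\<And>u. (\<forall>b\<in>T. u \<bullet> b = 0) \<Longrightarrow> (\<forall>a\<in>S. u \<bullet> a = 0)" for S T :: "'a set"
  proof
    fix x assume x: "x \<in> S"
    obtain p z where pz: "p \<in> span T" "\<And>w. w \<in> span T \<Longrightarrow> orthogonal z w" "x = p + z"
      by (rule orthogonal_subspace_decomp_exists[of T x]) (rule that)
    have "\<forall>b\<in>T. z \<bullet> b = 0" using pz(2) by (simp add: orthogonal_def span_base)
    then have "z \<bullet> x = 0" using h x by blast
    moreover have "z \<bullet> p = 0" using pz(1,2) by (simp add: orthogonal_def)
    ultimately have "z \<bullet> z = 0" using pz(3) by (simp add: inner_add_right)
    then show "x \<in> span T" using pz(1,3) by simp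
  qed
  show ?thesis using *[of B A] *[of A B] assms by (meson span_minimal subspace_span subset_antisym)
qed

text \<open>A point outside \<open>K'\<close> is strictly separated from it by a hyperplane. The
  separation bounds \<open>K'\<close> from below in direction \<open>a\<close>, so the support
  functions are compared at \<open>-a\<close>.\<close>

lemma convex_body_subset_support:
  fixes K K' :: "'a::euclidean_space set"
  assumes K: "convex_body K" and K': "convex_body K'" and le: "\<And>u. support_fun K u \<le> support_fun K' u"
  shows "K \<subseteq> K'"
proof
  fix z assume z: "z \<in> K"
  show "z \<in> K'"
  proof (rule ccontr)
    assume "z \<notin> K'"
    then obtain a b where ab: "a \<bullet> z < b" "\<And>x. x \<in> K' \<Longrightarrow> b < a \<bullet> x"
      using separating_hyperplane_closed_point[of K' z] K' compact_imp_closed unfolding convex_body_def by blast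
    have "(-a) \<bullet> z \<le> support_fun K (-a)" unfolding support_fun_def
    proof (rule cSUP_upper[OF z])
      have "compact ((\<lambda>x. (-a) \<bullet> x) ` K)"
        using K unfolding convex_body_def by (intro compact_continuous_image continuous_intros) auto
      then show "bdd_above ((\<lambda>x. (-a) \<bullet> x) ` K)" by (intro bounded_imp_bdd_above compact_imp_bounded)
    qed
    moreover have "support_fun K' (-a) \<le> - b" unfolding support_fun_def
      using K' ab(2) unfolding convex_body_def by (intro cSUP_least) (auto intro: less_imp_le)
    ultimately show False using le[of "-a"] ab(1) by simp
  qed
qed

lemma zonoid_eqI:
  assumes "convex_body K" "\<And>u. support_fun K u = 1/2 * (\<integral>\<omega>. \<bar>u \<bullet> \<xi> \<omega>\<bar> \<partial>M)"
  shows "zonoid M \<xi> = K"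
  unfolding zonoid_def
proof (rule the_equality)
  show "K' = K" if "convex_body K' \<and> (\<forall>u. support_fun K' u = 1/2 * (\<integral>\<omega>. \<bar>u \<bullet> \<xi> \<omega>\<bar> \<partial>M))" for K'
  proof (rule subset_antisym)
    have eq: "support_fun K' u = support_fun K u" for u
      by (rule trans[OF spec[OF conjunct2[OF that]] sym[OF assms(2)]])
    show "K' \<subseteq> K" using that assms(1) eq by (intro convex_body_subset_support) auto
    show "K \<subseteq> K'" using that assms(1) eq by (intro convex_body_subset_support) auto
  qed
qed (use assms in blast)

text \<open>The zonoid consists of the integrals of \<open>s \<xi> / 2\<close> over the functions \<open>s\<close> with values in
  \<open>[-1, 1]\<close>, and its support function is attained at the sign of \<open>u \<bullet> \<xi>\<close>.\<close>

lemma zonoid_props: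
  fixes \<xi> :: "'w \<Rightarrow> 'a::euclidean_space"
  assumes "prob_space M" and m: "\<xi> \<in> borel_measurable M" and b: "\<And>\<omega>. \<omega> \<in> space M \<Longrightarrow> norm (\<xi> \<omega>) \<le> B"
  shows convex_body_zonoid: "convex_body (zonoid M \<xi>)"
    and support_fun_zonoid: "support_fun (zonoid M \<xi>) u = 1/2 * (\<integral>\<omega>. \<bar>u \<bullet> \<xi> \<omega>\<bar> \<partial>M)"
proof -
  interpret prob_space M by fact
  let ?S = "{s \<in> borel_measurable M. \<forall>\<omega>\<in>space M. \<bar>s \<omega>\<bar> \<le> (1::real)}"
  let ?I = "\<lambda>s. (1/2) *\<^sub>R (\<integral>\<omega>. s \<omega> *\<^sub>R \<xi> \<omega> \<partial>M)"
  \<comment> \<open>The closure provides compactness and does not affect suprema of linear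
    functionals.\<close>
  let ?K = "closure (?I ` ?S)"
  have sb: "norm (s \<omega> *\<^sub>R \<xi> \<omega>) \<le> B" if "s \<in> ?S" "\<omega> \<in> space M" for s \<omega>
    using mult_mono[of "\<bar>s \<omega>\<bar>" 1 "norm (\<xi> \<omega>)" B] that b by auto
  have int: "integrable M (\<lambda>\<omega>. s \<omega> *\<^sub>R \<xi> \<omega>)" if "s \<in> ?S" for s
    by (rule integrable_const_bound[of _ B]) (use that sb m in auto)
  have int1: "integrable M \<xi>" by (rule integrable_const_bound[of _ B]) (use b m in auto)
  have abs_int: "integrable M (\<lambda>\<omega>. \<bar>u \<bullet> \<xi> \<omega>\<bar>)" for u using int1 by simp
  have inner: "u \<bullet> ?I s = 1/2 * (\<integral>\<omega>. s \<omega> * (u \<bullet> \<xi> \<omega>) \<partial>M)" if "s \<in> ?S" for u s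
    using integral_inner_right[of u M "\<lambda>\<omega>. s \<omega> *\<^sub>R \<xi> \<omega>"] int[OF that] by simp
  have upper: "u \<bullet> x \<le> 1/2 * (\<integral>\<omega>. \<bar>u \<bullet> \<xi> \<omega>\<bar> \<partial>M)" if x: "x \<in> ?K" for u x
  proof -
    have "u \<bullet> ?I s \<le> 1/2 * (\<integral>\<omega>. \<bar>u \<bullet> \<xi> \<omega>\<bar> \<partial>M)" if s: "s \<in> ?S" for s
    proof -
      have "integrable M (\<lambda>\<omega>. s \<omega> * (u \<bullet> \<xi> \<omega>))" using integrable_inner_right[of u M "\<lambda>\<omega>. s \<omega> *\<^sub>R \<xi> \<omega>"] int[OF s] by simp
      then have "(\<integral>\<omega>. s \<omega> * (u \<bullet> \<xi> \<omega>) \<partial>M) \<le> (\<integral>\<omega>. \<bar>u \<bullet> \<xi> \<omega>\<bar> \<partial>M)"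
      proof (rule integral_mono[OF _ abs_int])
        fix \<omega> assume "\<omega> \<in> space M"
        then have "\<bar>s \<omega>\<bar> \<le> 1" using s by simp
        then have "\<bar>s \<omega>\<bar> * \<bar>u \<bullet> \<xi> \<omega>\<bar> \<le> 1 * \<bar>u \<bullet> \<xi> \<omega>\<bar>" by (rule mult_right_mono) simp
        then show "s \<omega> * (u \<bullet> \<xi> \<omega>) \<le> \<bar>u \<bullet> \<xi> \<omega>\<bar>" using abs_ge_self[of "s \<omega> * (u \<bullet> \<xi> \<omega>)"] by (simp add: abs_mult)
      qed
      then show ?thesis unfolding inner[OF s] by simp
    qed
    then have "?I ` ?S \<subseteq> {x. u \<bullet> x \<le> 1/2 * (\<integral>\<omega>. \<bar>u \<bullet> \<xi> \<omega>\<bar> \<partial>M)}" by blast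
    then have "?K \<subseteq> {x. u \<bullet> x \<le> 1/2 * (\<integral>\<omega>. \<bar>u \<bullet> \<xi> \<omega>\<bar> \<partial>M)}" by (rule closure_minimal) (rule closed_halfspace_le)
    then show ?thesis using x by blast
  qed
  have support: "support_fun ?K u = 1/2 * (\<integral>\<omega>. \<bar>u \<bullet> \<xi> \<omega>\<bar> \<partial>M)" for u
    unfolding support_fun_def
  proof (rule cSup_eq_maximum)
    let ?s = "\<lambda>\<omega>. sgn (u \<bullet> \<xi> \<omega>)"
    have s: "?s \<in> ?S" using m by (auto simp: abs_sgn_eq)
    have "u \<bullet> ?I ?s = 1/2 * (\<integral>\<omega>. \<bar>u \<bullet> \<xi> \<omega>\<bar> \<partial>M)" unfolding inner[OF s] by (simp add: abs_sgn mult.commute)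
    moreover have "?I ?s \<in> ?K" by (rule subsetD[OF closure_subset imageI[OF s]])
    ultimately show "1/2 * (\<integral>\<omega>. \<bar>u \<bullet> \<xi> \<omega>\<bar> \<partial>M) \<in> (\<lambda>x. u \<bullet> x) ` ?K" by (intro image_eqI[OF sym])
  qed (erule imageE, simp only: upper)
  have "convex (?I ` ?S)"
  proof (rule convexI)
    fix x y and a c :: real assume xy: "x \<in> ?I ` ?S" "y \<in> ?I ` ?S" and ac: "0 \<le> a" "0 \<le> c" "a + c = 1"
    obtain s t where st: "s \<in> ?S" "t \<in> ?S" "x = ?I s" "y = ?I t" using xy by blast
    have "\<bar>a * s \<omega> + c * t \<omega>\<bar> \<le> 1" if "\<omega> \<in> space M" for \<omega>
    proof -
      have "\<bar>a * s \<omega> + c * t \<omega>\<bar> \<le> a * \<bar>s \<omega>\<bar> + c * \<bar>t \<omega>\<bar>" using ac abs_triangle_ineq[of "a * s \<omega>" "c * t \<omega>"] by (simp add: abs_mult)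
      also have "\<dots> \<le> a * 1 + c * 1" using st(1,2) that ac by (intro add_mono mult_left_mono) auto
      finally show ?thesis using ac by simp
    qed
    then have "(\<lambda>\<omega>. a * s \<omega> + c * t \<omega>) \<in> ?S" using st(1,2) by auto
    moreover have "a *\<^sub>R x + c *\<^sub>R y = ?I (\<lambda>\<omega>. a * s \<omega> + c * t \<omega>)"
      using int[OF st(1)] int[OF st(2)] unfolding st(3,4)
      by (simp add: scaleR_add_left scaleR_add_right scaleR_left_commute[of _ "1/2"] flip: scaleR_scaleR)
    ultimately show "a *\<^sub>R x + c *\<^sub>R y \<in> ?I ` ?S" by (intro image_eqI)
  qed
  moreover have "bounded (?I ` ?S)"
  proof (rule boundedI)
    fix x assume "x \<in> ?I ` ?S"
    then obtain s where s: "s \<in> ?S" "x = ?I s" by blast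
    have "norm (\<integral>\<omega>. s \<omega> *\<^sub>R \<xi> \<omega> \<partial>M) \<le> (\<integral>\<omega>. norm (s \<omega> *\<^sub>R \<xi> \<omega>) \<partial>M)" by (rule integral_norm_bound)
    also have "\<dots> \<le> (\<integral>\<omega>. B \<partial>M)" using integrable_norm[OF int[OF s(1)]] sb[OF s(1)] by (intro integral_mono) (auto simp del: norm_scaleR)
    finally show "norm x \<le> B / 2" using s(2) by (simp add: prob_space)
  qed
  moreover have "(\<lambda>_. 0) \<in> ?S" by simp
  then have "?I ` ?S \<noteq> {}" by blast
  ultimately have K: "convex_body ?K" unfolding convex_body_def
    by (intro conjI convex_closure) (auto simp: compact_closure)
  have eq: "zonoid M \<xi> = ?K" by (rule zonoid_eqI[OF K support])
  show "convex_body (zonoid M \<xi>)" unfolding eq by (rule K)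
  show "support_fun (zonoid M \<xi>) u = 1/2 * (\<integral>\<omega>. \<bar>u \<bullet> \<xi> \<omega>\<bar> \<partial>M)" unfolding eq by (rule support)
qed

text \<open>The support function is even in \<open>u\<close>, so if it vanishes at \<open>u\<close>
  the body is confined to the hyperplane orthogonal to \<open>u\<close>.\<close>

lemma zonoid_orthogonal_iff:
  fixes \<xi> :: "'w \<Rightarrow> 'a::euclidean_space"
  assumes "prob_space M" and m: "\<xi> \<in> borel_measurable M" and b: "\<And>\<omega>. \<omega> \<in> space M \<Longrightarrow> norm (\<xi> \<omega>) \<le> B"
  shows "(\<forall>x\<in>zonoid M \<xi>. u \<bullet> x = 0) \<longleftrightarrow> (\<integral>\<omega>. \<bar>u \<bullet> \<xi> \<omega>\<bar> \<partial>M) = 0"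
proof -
  note K = convex_body_zonoid[OF assms] and s = support_fun_zonoid[OF assms]
  have ne: "zonoid M \<xi> \<noteq> {}" using K by (simp add: convex_body_def)
  have le: "v \<bullet> x \<le> support_fun (zonoid M \<xi>) v" if "x \<in> zonoid M \<xi>" for v x
    unfolding support_fun_def
  proof (rule cSUP_upper[OF that])
    have "compact ((\<lambda>x. v \<bullet> x) ` zonoid M \<xi>)"
      using K unfolding convex_body_def by (intro compact_continuous_image continuous_intros) auto
    then show "bdd_above ((\<lambda>x. v \<bullet> x) ` zonoid M \<xi>)" by (intro bounded_imp_bdd_above compact_imp_bounded)
  qed
  show ?thesis
  proof
    assume "\<forall>x\<in>zonoid M \<xi>. u \<bullet> x = 0"
    then have "support_fun (zonoid M \<xi>) u = 0" unfolding support_fun_def using ne by simp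
    then show "(\<integral>\<omega>. \<bar>u \<bullet> \<xi> \<omega>\<bar> \<partial>M) = 0" using s[of u] by linarith
  next
    assume "(\<integral>\<omega>. \<bar>u \<bullet> \<xi> \<omega>\<bar> \<partial>M) = 0"
    then have "u \<bullet> x \<le> 0" "(-u) \<bullet> x \<le> 0" if "x \<in> zonoid M \<xi>" for x
      using le[OF that, of u] le[OF that, of "-u"] s[of u] s[of "-u"] by simp_all
    then show "\<forall>x\<in>zonoid M \<xi>. u \<bullet> x = 0" by force
  qed
qed

section \<open>Haar measure of the stabilizer\<close>

lemma compact_stab: "compact (stab :: ((real ^ 'k ^ 'k) \<times> (real ^ 'm ^ 'm)) set)"
proof -
  have "stab = {A :: real ^ 'k ^ 'k. orthogonal_matrix A} \<times> {B :: real ^ 'm ^ 'm. orthogonal_matrix B}"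
    by (auto simp: stab_def)
  then show ?thesis using compact_Times[OF compact_orthogonal_matrices compact_orthogonal_matrices] by metis
qed

lemma stab_mult_in_stab: "g \<in> stab \<Longrightarrow> h \<in> stab \<Longrightarrow> stab_mult g h \<in> stab"
  by (auto simp: stab_def stab_mult_def orthogonal_matrix_mul)

lemma continuous_on_stab_mult:
  "continuous_on A (\<lambda>x. stab_mult g x)" "continuous_on A (\<lambda>x. stab_mult x g)"
  unfolding stab_mult_def
  by (intro continuous_intros bounded_bilinear.continuous_on[OF bounded_bilinear_matrix_mult])+

lemma stab_mult_measurable:
  fixes P :: "((real ^ 'k ^ 'k) \<times> (real ^ 'm ^ 'm)) measure"
  assumes s: "sets P = sets (restrict_space borel stab)" and h: "h \<in> stab"
  shows "(\<lambda>x. stab_mult h x) \<in> measurable P P" "(\<lambda>x. stab_mult x h) \<in> measurable P P"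
proof -
  have 1: "(\<lambda>x. stab_mult h x) \<in> measurable (restrict_space borel stab) (restrict_space borel stab)"
    by (intro measurable_restrict_space2 borel_measurable_continuous_on_restrict continuous_on_stab_mult)
      (simp add: space_restrict_space stab_mult_in_stab[OF h])
  have 2: "(\<lambda>x. stab_mult x h) \<in> measurable (restrict_space borel stab) (restrict_space borel stab)"
    by (intro measurable_restrict_space2 borel_measurable_continuous_on_restrict continuous_on_stab_mult)
      (simp add: space_restrict_space stab_mult_in_stab[OF _ h])
  show "(\<lambda>x. stab_mult h x) \<in> measurable P P" "(\<lambda>x. stab_mult x h) \<in> measurable P P"
    unfolding measurable_cong_sets[OF s s] by (rule 1, rule 2)
qed

lemma uniform_stab_props:
  fixes P :: "((real ^ 'k ^ 'k) \<times> (real ^ 'm ^ 'm)) measure"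
  assumes P: "uniform_stab P"
  shows uniform_stab_prob: "prob_space P" and uniform_stab_sets: "sets P = sets (restrict_space borel stab)"
    and uniform_stab_space: "space P = stab"
    and uniform_stab_borel: "continuous_on UNIV q \<Longrightarrow> (q :: _ \<Rightarrow> 'b::topological_space) \<in> borel_measurable P"
    and uniform_stab_right: "h \<in> stab \<Longrightarrow> distr P P (\<lambda>x. stab_mult x h) = P"
    and uniform_stab_left: "h \<in> stab \<Longrightarrow> distr P P (\<lambda>x. stab_mult h x) = P"
proof -
  show "prob_space P" and s: "sets P = sets (restrict_space borel stab)"
    using P by (auto simp: uniform_stab_def)
  show "space P = stab" using sets_eq_imp_space_eq[OF s] by (simp add: space_restrict_space)
  show "h \<in> stab \<Longrightarrow> distr P P (\<lambda>x. stab_mult x h) = P" "h \<in> stab \<Longrightarrow> distr P P (\<lambda>x. stab_mult h x) = P"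
    using P by (auto simp: uniform_stab_def)
  assume "continuous_on UNIV q"
  then show "q \<in> borel_measurable P"
    unfolding measurable_cong_sets[OF s refl] by (intro borel_measurable_continuous_on_restrict) (rule continuous_on_subset, auto)
qed

text \<open>Full support of the Haar measure: finitely many translates of an open set cover the group.\<close>

lemma uniform_stab_integral_zero:
  fixes P :: "((real ^ 'k ^ 'k) \<times> (real ^ 'm ^ 'm)) measure"
  assumes P: "uniform_stab P" and q: "continuous_on UNIV q" and i: "(\<integral>h. \<bar>q h\<bar> \<partial>P) = 0"
    and b: "\<And>h. h \<in> stab \<Longrightarrow> \<bar>q h\<bar> \<le> B" and h: "h \<in> stab"
  shows "q h = (0::real)"
proof (rule ccontr)
  assume nz: "q h \<noteq> 0"
  interpret prob_space P by (rule uniform_stab_prob[OF P])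
  note sp = uniform_stab_space[OF P]
  have q': "q \<in> borel_measurable P" by (rule uniform_stab_borel[OF P q])
  have "integrable P (\<lambda>h. \<bar>q h\<bar>)" using q' b sp by (intro integrable_const_bound[of _ B]) auto
  then have "AE h in P. q h = 0" using integral_nonneg_eq_0_iff_AE[of P "\<lambda>h. \<bar>q h\<bar>"] i by simp
  then have null: "emeasure P {h \<in> space P. q h \<noteq> 0} = 0" using q' by (subst (asm) AE_iff_measurable[OF _ refl]) auto
  let ?O = "\<lambda>g. {x. q (stab_mult g x) \<noteq> 0}"
  have "open (?O g)" for g
  proof -
    have "continuous_on UNIV (\<lambda>x. q (stab_mult g x))"
      by (rule continuous_on_compose2[OF q continuous_on_stab_mult(1)]) simp
    then have "open ((\<lambda>x. q (stab_mult g x)) -` (- {0}))" by (rule open_vimage[rotated]) auto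
    then show ?thesis by (simp add: vimage_def)
  qed
  moreover have "stab \<subseteq> (\<Union>g\<in>stab. ?O g)"
  proof
    fix x :: "(real ^ 'k ^ 'k) \<times> (real ^ 'm ^ 'm)" assume x: "x \<in> stab"
    \<comment> \<open>\<open>?g\<close> is \<open>h\<close> times the inverse of \<open>x\<close>,
      so translation by it moves \<open>x\<close> to the point \<open>h\<close>, where
      \<open>q\<close> does not vanish.\<close>
    let ?g = "stab_mult h (transpose (fst x), transpose (snd x))"
    have "stab_mult ?g x = h" using x
      by (auto simp: stab_def stab_mult_def orthogonal_matrix matrix_mul_assoc[symmetric] prod_eq_iff)
    moreover have "?g \<in> stab" using x h by (intro stab_mult_in_stab) (auto simp: stab_def)
    ultimately show "x \<in> (\<Union>g\<in>stab. ?O g)" using nz by (intro UN_I[of ?g]) simp_all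
  qed
  ultimately obtain C where C: "C \<subseteq> stab" "finite C" "stab \<subseteq> (\<Union>g\<in>C. ?O g)"
    using compactE_image[OF compact_stab, of stab ?O] by metis
  have "emeasure P {x \<in> space P. q (stab_mult g x) \<noteq> 0} = 0" if g: "g \<in> C" for g
  proof -
    have m: "(\<lambda>x. stab_mult g x) \<in> measurable P P"
      using stab_mult_measurable(1)[OF uniform_stab_sets[OF P]] g C(1) by blast
    have s: "{h \<in> space P. q h \<noteq> 0} \<in> sets P" using q' by measurable
    \<comment> \<open>By left invariance every translate of the null set is a null set.\<close>
    have "0 = emeasure (distr P P (\<lambda>x. stab_mult g x)) {h \<in> space P. q h \<noteq> 0}"
      using uniform_stab_left[OF P, of g] g C(1) null by auto
    also have "\<dots> = emeasure P ((\<lambda>x. stab_mult g x) -` {h \<in> space P. q h \<noteq> 0} \<inter> space P)" by (rule emeasure_distr[OF m s])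
    also have "(\<lambda>x. stab_mult g x) -` {h \<in> space P. q h \<noteq> 0} \<inter> space P = {x \<in> space P. q (stab_mult g x) \<noteq> 0}"
      using measurable_space[OF m] by auto
    finally show ?thesis by simp
  qed
  moreover have "{x \<in> space P. q (stab_mult g x) \<noteq> 0} \<in> sets P" for g
    using uniform_stab_borel[OF P continuous_on_compose2[OF q continuous_on_stab_mult(1)], of g] by measurable
  ultimately have N: "{x \<in> space P. q (stab_mult g x) \<noteq> 0} \<in> null_sets P" if "g \<in> C" for g
    using that by (intro null_setsI) simp_all
  have "(\<Union>g\<in>C. {x \<in> space P. q (stab_mult g x) \<noteq> 0}) \<in> null_sets P"
    using C(2) N by (intro null_sets.finite_UN) auto
  moreover have "(\<Union>g\<in>C. {x \<in> space P. q (stab_mult g x) \<noteq> 0}) = space P" using C(3) sp by auto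
  ultimately show False using emeasure_space_1 by (simp add: null_sets_def)
qed

section \<open>The Schubert zonoid\<close>

text \<open>Although the section \<open>g\<close> of the relation \<open>R\<close> cannot be chosen continuously, its values on a
  convergent sequence accumulate, and all accumulation points give the same value of \<open>Q\<close>.\<close>

lemma continuous_on_compact_selection:
  fixes F :: "'a::metric_space \<Rightarrow> 'c::metric_space" and C :: "'b::metric_space set"
  assumes C: "compact C" and ex: "\<And>z. z \<in> Z \<Longrightarrow> \<exists>g\<in>C. R z g"
    and cl: "\<And>z g z' g'. (\<And>n. z n \<in> Z) \<Longrightarrow> z' \<in> Z \<Longrightarrow> z \<longlonglongrightarrow> z' \<Longrightarrow> (\<And>n. R (z n) (g n)) \<Longrightarrow> g \<longlonglongrightarrow> g' \<Longrightarrow> R z' g'"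
    and F: "\<And>z g. z \<in> Z \<Longrightarrow> R z g \<Longrightarrow> F z = Q (z, g)"
    and Q: "continuous_on UNIV Q"
  shows "continuous_on Z F"
  unfolding continuous_on_sequentially
proof (intro allI ballI impI, elim conjE)
  fix z z' assume z': "z' \<in> Z" and z: "\<forall>n. z n \<in> Z" "z \<longlonglongrightarrow> z'"
  show "(F \<circ> z) \<longlonglongrightarrow> F z'"
  proof (rule ccontr)
    assume "\<not> (F \<circ> z) \<longlonglongrightarrow> F z'"
    then obtain d where d: "0 < d" "\<forall>N. \<exists>n\<ge>N. \<not> dist (F (z n)) (F z') < d" by (auto simp: lim_sequentially)
    then have "infinite {n. \<not> dist (F (z n)) (F z') < d}" unfolding infinite_nat_iff_unbounded_le by simp
    then obtain r :: "nat \<Rightarrow> nat" where r: "strict_mono r" "\<And>n. \<not> dist (F (z (r n))) (F z') < d"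
      using infinite_enumerate by blast
    have "\<forall>n. \<exists>g\<in>C. R (z (r n)) g" using ex z(1) by simp
    then obtain g where g: "\<And>n. g n \<in> C" "\<And>n. R (z (r n)) (g n)" by metis
    obtain g' s where s: "strict_mono s" "(g \<circ> s) \<longlonglongrightarrow> g'"
      using C g(1) unfolding compact_def by metis
    have lz: "(\<lambda>n. z (r (s n))) \<longlonglongrightarrow> z'"
      using LIMSEQ_subseq_LIMSEQ[OF LIMSEQ_subseq_LIMSEQ[OF z(2) r(1)] s(1)] by (simp add: o_def)
    have lg: "(\<lambda>n. g (s n)) \<longlonglongrightarrow> g'" using s(2) by (simp add: o_def)
    have R': "R z' g'" by (rule cl[OF _ z' lz g(2) lg]) (simp add: z(1))
    have "(\<lambda>n. Q (z (r (s n)), g (s n))) \<longlonglongrightarrow> Q (z', g')"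
      by (rule continuous_on_tendsto_compose[OF Q tendsto_Pair[OF lz lg]]) auto
    then have "(\<lambda>n. F (z (r (s n)))) \<longlonglongrightarrow> F z'"
      using F[OF _ g(2)] z(1) F[OF z' R'] by simp
    then obtain n where "dist (F (z (r (s n)))) (F z') < d"
      using d(1) unfolding lim_sequentially by blast
    then show False using r(2) by blast
  qed
qed

lemma act_transpose:
  assumes "orthogonal_matrix M"
  shows "act (transpose M) (act M L) = L" "act M (act (transpose M) L) = L"
  using assms by (simp_all add: act_act orthogonal_matrix_def)

text \<open>The domain consists of the orthogonal \<open>M\<close> whose moved cell passes through
  the base point. The frames at the preimage of the base point depend on \<open>M\<close> through a
  closed relation, and each of them computes the conormal vector up to the sign that the absolute
  value removes.\<close>

lemma continuous_unit_simple_conormal: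
  fixes V :: "nat \<Rightarrow> (real ^ ('k::finite + 'm::finite)) set" and e :: "nat \<Rightarrow> real ^ 'k" and f :: "nat \<Rightarrow> real ^ 'm"
  assumes V: "complete_flag V" and y: "young_diagram CARD('k) CARD('m) l"
    and e: "orthonormal_basis e" and f: "orthonormal_basis f"
  shows "continuous_on {M. orthogonal_matrix M \<and> act (transpose M) base_point \<in> schubert_smooth V l}
    (\<lambda>M. \<bar>u \<bullet> unit_simple (hom_to_tensor ` conormal_space (act M ` schubert_smooth V l) base_point)\<bar>)"
proof -
  interpret grass_frame "\<lambda>i. inl (e i) :: real ^ ('k + 'm)" "\<lambda>j. inr (f j)" by (rule grass_frame_inl_inr[OF e f])
  let ?R = "\<lambda>M g. g \<in> frames V l (act (transpose M) base_point)"
  let ?Q = "\<lambda>x. \<bar>u \<bullet> ext_act (diag_blocks (fst x ** snd x)) (schubert_vector e f l)\<bar>"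
  let ?Z = "{M. orthogonal_matrix M \<and> act (transpose M) base_point \<in> schubert_smooth V l}"
  show ?thesis
  proof (rule continuous_on_compact_selection[where R = ?R and Q = ?Q and C = "{g. orthogonal_matrix g}"])
    show "compact {g :: real ^ ('k + 'm) ^ ('k + 'm). orthogonal_matrix g}" by (rule compact_orthogonal_matrices)
    show "\<exists>g\<in>{g. orthogonal_matrix g}. ?R M g" if "M \<in> ?Z" for M
    proof -
      have "act (transpose M) base_point \<in> schubert_smooth V l" using that by simp
      then obtain g where "?R M g" by (rule frames_nonempty[OF V y])
      then show ?thesis using frames_orthogonal by blast
    qed
    show "?R M' g'" if M: "\<And>n. M n \<in> ?Z" "M' \<in> ?Z" "M \<longlonglongrightarrow> M'" and g: "\<And>n. ?R (M n) (g n)" "g \<longlonglongrightarrow> g'" for M g M' g'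
    proof (rule frames_limit[OF V y g(1) _ _ g(2)])
      show "act (transpose (M n)) base_point \<in> grassmannian" for n
        using M(1)[of n] by (auto intro: schubert_smooth_grassmannian)
      show "act (transpose M') base_point \<in> grassmannian" using M(2) by (auto intro: schubert_smooth_grassmannian)
      have p: "proj_matrix (act (transpose N) base_point) = transpose N ** P0 ** N" if "N \<in> ?Z" for N
        using proj_matrix_act[OF _ subspace_base, of "transpose N"] that by simp
      show "(\<lambda>n. proj_matrix (act (transpose (M n)) base_point)) \<longlonglongrightarrow> proj_matrix (act (transpose M') base_point)"
        unfolding p[OF M(1)] p[OF M(2)]
        by (intro bounded_bilinear.tendsto[OF bounded_bilinear_matrix_mult] tendsto_transpose M(3) tendsto_const)
    qed
    show "\<bar>u \<bullet> unit_simple (hom_to_tensor ` conormal_space (act M ` schubert_smooth V l) base_point)\<bar> = ?Q (M, g)"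
      if M: "M \<in> ?Z" and g: "?R M g" for M g
    proof -
      have M': "orthogonal_matrix M" "act (transpose M) base_point \<in> schubert_smooth V l" using M by auto
      show ?thesis
        using unit_simple_conormal(3)[OF V y e f M'(1) act_transpose(2)[OF M'(1)] M'(2) g] by auto
    qed
    show "continuous_on UNIV ?Q"
      by (intro continuous_on_rabs continuous_on_inner continuous_on_const
          continuous_on_compose2[OF continuous_on_ext_act[of UNIV]]
          continuous_on_compose2[OF continuous_on_diag_blocks[of UNIV]]
          bounded_bilinear.continuous_on[OF bounded_bilinear_matrix_mult]
          continuous_on_fst continuous_on_snd continuous_on_id subset_UNIV)
  qed
qed

text \<open>A curve in \<open>Y\<close> cannot start at \<open>L\<close>, so there are no tangent
  vectors and the orthogonality condition is vacuous. This controls the random vector at points of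
  the Grassmannian off the cell.\<close>

lemma conormal_space_outside:
  assumes "L \<notin> Y" shows "conormal_space Y L = hom_perp L"
  using assms unfolding conormal_space_def tangent_space_def by fastforce

text \<open>By the right invariance of the Haar measure, the conditional distribution of the conormal
  vector at a fixed smooth point does not depend on the point.\<close>

lemma schubert_integral:
  fixes V :: "nat \<Rightarrow> (real ^ ('k::finite + 'm::finite)) set" and e :: "nat \<Rightarrow> real ^ 'k" and f :: "nat \<Rightarrow> real ^ 'm"
    and P :: "((real ^ 'k ^ 'k) \<times> (real ^ 'm ^ 'm)) measure"
  assumes V: "complete_flag V" and yd: "young_diagram CARD('k) CARD('m) l"
    and P: "uniform_stab P" and \<tau>: "transporter \<tau>"
    and e: "orthonormal_basis e" and f: "orthonormal_basis f"
  shows "(\<integral>x. \<bar>u \<bullet> schubert_random_vector \<tau> V l x\<bar> \<partial>schubert_space P V l)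
    = (\<integral>h. \<bar>u \<bullet> ext_act h (schubert_vector e f l)\<bar> \<partial>P)"
proof -
  interpret grass_frame "\<lambda>i. inl (e i) :: real ^ ('k + 'm)" "\<lambda>j. inr (f j)" by (rule grass_frame_inl_inr[OF e f])
  let ?Y = "schubert_smooth V l" and ?v = "schubert_vector e f l"
  let ?D = "CARD('k) * CARD('m) - card (boxes CARD('k) l)"
  define U where "U = uniform_measure (gr_volume ?D) ?Y"
  define C where "C = uniform_count_measure {-1, 1 :: real}"
  define S where "S = P \<Otimes>\<^sub>M (U \<Otimes>\<^sub>M C)"
  define N where "N M = unit_simple (hom_to_tensor ` conormal_space (act M ` ?Y) base_point)" for M :: "real ^ ('k + 'm) ^ ('k + 'm)"
  define X where "X x = block_matrix (fst x) ** \<tau> (fst (snd x))"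
    for x :: "((real ^ 'k ^ 'k) \<times> (real ^ 'm ^ 'm)) \<times> (real ^ ('k + 'm)) set \<times> real"
  define G where "G x = \<bar>u \<bullet> schubert_random_vector \<tau> V l x\<bar>" for x
  \<comment> \<open>The constant value off the cell. These points form a null set, but
    \<open>G\<close> has to be measurable on the whole space.\<close>
  define c0 where "c0 = \<bar>u \<bullet> unit_simple (hom_to_tensor ` hom_perp (base_point :: (real ^ ('k + 'm)) set))\<bar>"
  have Y: "?Y \<in> sets gr_borel" by (rule schubert_in_gr_borel(2)[OF V yd])
  have sU: "sets U = sets gr_borel" by (simp add: U_def sets_gr_volume[OF V])
  have spU: "space U = grassmannian" by (simp add: U_def space_gr_volume[OF V])
  have spC: "space C = {-1, 1}" by (simp add: C_def space_uniform_count_measure)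
  note spP = uniform_stab_space[OF P]
  interpret P: prob_space P by (rule uniform_stab_prob[OF P])
  interpret U: prob_space U unfolding U_def
    using gr_volume_schubert[OF V yd] by (intro prob_space_uniform_measure) auto
  interpret C: prob_space C unfolding C_def by (rule prob_space_uniform_count_measure) auto
  interpret UC: prob_space "U \<Otimes>\<^sub>M C" by (rule prob_space_pair) unfold_locales
  interpret S: prob_space S unfolding S_def by (rule prob_space_pair) unfold_locales
  interpret A: pair_sigma_finite P "U \<Otimes>\<^sub>M C" by unfold_locales
  have spS: "fst x \<in> stab" "fst (snd x) \<in> grassmannian" "\<bar>snd (snd x)\<bar> = 1" if "x \<in> space S" for x
    using that by (auto simp: S_def space_pair_measure spP spU spC)
  have T: "orthogonal_matrix (\<tau> L)" "act (\<tau> L) L = base_point" if "L \<in> grassmannian" for L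
    using \<tau> that by (auto simp: transporter_def)
  have X: "orthogonal_matrix (X x)" "act (X x) (fst (snd x)) = base_point" if x: "x \<in> space S" for x
  proof -
    show "orthogonal_matrix (X x)" unfolding X_def
      by (intro orthogonal_matrix_mul orthogonal_block_matrix spS(1)[OF x] T(1)[OF spS(2)[OF x]])
    show "act (X x) (fst (snd x)) = base_point"
      by (simp only: X_def act_act[symmetric] T(2)[OF spS(2)[OF x]] act_block_matrix[OF spS(1)[OF x]])
  qed
  have X': "act (transpose (X x)) base_point = fst (snd x)" if x: "x \<in> space S" for x
    using act_transpose(1)[OF X(1)[OF x], of "fst (snd x)"] X(2)[OF x] by simp
  have G: "G x = \<bar>u \<bullet> N (X x)\<bar>" if x: "x \<in> space S" for x
    using spS(3)[OF x] unfolding G_def schubert_random_vector_def N_def X_def by (simp add: split_beta abs_mult)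
  have NX: "\<bar>u \<bullet> N (X x)\<bar> = c0" if x: "x \<in> space S" "fst (snd x) \<notin> ?Y" for x
  proof -
    have "base_point \<notin> act (X x) ` ?Y"
    proof
      assume "base_point \<in> act (X x) ` ?Y"
      then obtain L where L: "L \<in> ?Y" "base_point = act (X x) L" by blast
      have "fst (snd x) = L" using X'[OF x(1)] act_transpose(1)[OF X(1)[OF x(1)], of L] L(2) by simp
      then show False using L(1) x(2) by simp
    qed
    then show ?thesis unfolding N_def c0_def by (simp add: conormal_space_outside)
  qed
  \<comment> \<open>\<open>h0\<close> comes from \<open>\<tau> L\<close> times a frame at
    \<open>L\<close>; it depends on \<open>L\<close> but not on \<open>h\<close>.\<close>
  have NY: "\<exists>h0\<in>stab. \<forall>h\<in>stab. \<bar>u \<bullet> N (block_matrix h ** \<tau> L)\<bar> = \<bar>u \<bullet> ext_act (stab_mult h h0) ?v\<bar>" if L: "L \<in> ?Y" for L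
  proof -
    have Lg: "L \<in> grassmannian" by (rule schubert_smooth_grassmannian[OF L])
    obtain g where g: "g \<in> frames V l L" by (rule frames_nonempty[OF V yd L])
    note u = unit_simple_conormal[OF V yd e f T[OF Lg] L g]
    have "\<bar>u \<bullet> N (block_matrix h ** \<tau> L)\<bar> = \<bar>u \<bullet> ext_act (stab_mult h (diag_blocks (\<tau> L ** g))) ?v\<bar>" if h: "h \<in> stab" for h
    proof -
      have "block_matrix h ** \<tau> L ** g = block_matrix (stab_mult h (diag_blocks (\<tau> L ** g)))"
        unfolding block_matrix_mult u(1)[symmetric] by (rule matrix_mul_assoc[symmetric])
      then have d: "diag_blocks (block_matrix h ** \<tau> L ** g) = stab_mult h (diag_blocks (\<tau> L ** g))" by simp
      have "orthogonal_matrix (block_matrix h ** \<tau> L)" by (intro orthogonal_matrix_mul orthogonal_block_matrix h T(1)[OF Lg])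
      moreover have "act (block_matrix h ** \<tau> L) L = base_point"
        by (simp only: act_act[symmetric] T(2)[OF Lg] act_block_matrix[OF h])
      ultimately show ?thesis using unit_simple_conormal(3)[OF V yd e f _ _ L g, of "block_matrix h ** \<tau> L"]
        unfolding N_def d by auto
    qed
    then show ?thesis using u(2) by blast
  qed
  have [measurable]: "X \<in> borel_measurable S"
    unfolding X_def[abs_def]
  proof (rule borel_measurable_continuous_Pair[where H = "(**)"])
    show "(\<lambda>x. block_matrix (fst x)) \<in> borel_measurable S" unfolding S_def
      by (rule measurable_compose[OF measurable_fst uniform_stab_borel[OF P continuous_on_block_matrix]])
    have "\<tau> \<in> borel_measurable U" using \<tau> unfolding measurable_cong_sets[OF sU refl] transporter_def by simp
    then show "(\<lambda>x. \<tau> (fst (snd x))) \<in> borel_measurable S" unfolding S_def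
      by (intro measurable_compose[OF measurable_compose[OF measurable_snd measurable_fst]])
    show "continuous_on UNIV (\<lambda>x :: (real ^ ('k + 'm) ^ ('k + 'm)) \<times> (real ^ ('k + 'm) ^ ('k + 'm)). fst x ** snd x)"
      by (intro bounded_bilinear.continuous_on[OF bounded_bilinear_matrix_mult] continuous_intros)
  qed
  have YS: "{x \<in> space S. fst (snd x) \<in> ?Y} \<in> sets S"
  proof -
    have "(\<lambda>x. fst (snd x)) \<in> measurable S U" unfolding S_def
      by (rule measurable_compose[OF measurable_snd measurable_fst])
    then have "(\<lambda>x. fst (snd x)) -` ?Y \<inter> space S \<in> sets S" by (rule measurable_sets) (simp add: sU Y)
    moreover have "(\<lambda>x. fst (snd x)) -` ?Y \<inter> space S = {x \<in> space S. fst (snd x) \<in> ?Y}" by auto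
    ultimately show ?thesis by simp
  qed
  let ?Z = "{M. orthogonal_matrix M \<and> act (transpose M) base_point \<in> ?Y}"
  have mG: "G \<in> borel_measurable S"
  proof -
    \<comment> \<open>The signs in \<open>N\<close> are arbitrary choices, so measurability is
      sought only for the absolute value: it is continuous on \<open>?Z\<close> and is composed with
      the measurable \<open>X\<close>.\<close>
    have "(\<lambda>M. \<bar>u \<bullet> N M\<bar>) \<in> borel_measurable (restrict_space borel ?Z)"
      unfolding N_def by (rule borel_measurable_continuous_on_restrict[OF continuous_unit_simple_conormal[OF V yd e f]])
    moreover have "X \<in> measurable (restrict_space S {x. fst (snd x) \<in> ?Y}) (restrict_space borel ?Z)"
      using X(1) X' by (intro measurable_restrict_space2 measurable_restrict_space1) (auto simp: space_restrict_space)
    ultimately have "(\<lambda>x. \<bar>u \<bullet> N (X x)\<bar>) \<in> borel_measurable (restrict_space S {x. fst (snd x) \<in> ?Y})"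
      by (rule measurable_compose[rotated])
    then have "(\<lambda>x. if fst (snd x) \<in> ?Y then \<bar>u \<bullet> N (X x)\<bar> else c0) \<in> borel_measurable S"
      unfolding measurable_If_restrict_space_iff[OF YS] by simp
    then show ?thesis by (rule measurable_cong[THEN iffD1, rotated]) (use G NX in auto)
  qed
  have int: "integrable S G"
  proof (rule S.integrable_const_bound[OF _ mG])
    show "AE x in S. norm (G x) \<le> max (norm u) c0"
    proof (rule AE_I2)
      fix x assume x: "x \<in> space S"
      show "norm (G x) \<le> max (norm u) c0"
      proof (cases "fst (snd x) \<in> ?Y")
        case True
        then obtain h where h: "h \<in> stab" "G x = \<bar>u \<bullet> ext_act h ?v\<bar>"
          using NY[OF True] G[OF x] spS(1)[OF x] stab_mult_in_stab unfolding X_def by metis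
        have "\<bar>u \<bullet> ext_act h ?v\<bar> \<le> norm u * norm (ext_act h ?v)" by (rule Cauchy_Schwarz_ineq2)
        then show ?thesis using h map_tensor_box_list_orthonormal(3)[OF e f yd h(1)] by simp
      next
        case False
        then show ?thesis using G[OF x] NX[OF x] by (simp add: c0_def)
      qed
    qed
  qed
  define c where "c = (\<integral>h. \<bar>u \<bullet> ext_act h ?v\<bar> \<partial>P)"
  have inner: "(\<integral>h. G (h, z) \<partial>P) = c" if z: "z \<in> space (U \<Otimes>\<^sub>M C)" "fst z \<in> ?Y" for z
  proof -
    obtain h0 where h0: "h0 \<in> stab" "\<And>h. h \<in> stab \<Longrightarrow> \<bar>u \<bullet> N (block_matrix h ** \<tau> (fst z))\<bar> = \<bar>u \<bullet> ext_act (stab_mult h h0) ?v\<bar>"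
      using NY[OF z(2)] by blast
    have "G (h, z) = \<bar>u \<bullet> ext_act (stab_mult h h0) ?v\<bar>" if "h \<in> space P" for h
    proof -
      have "(h, z) \<in> space S" using that z(1) by (simp add: S_def space_pair_measure)
      then show ?thesis using G[of "(h, z)"] h0(2)[of h] that by (simp add: X_def spP)
    qed
    then have "(\<integral>h. G (h, z) \<partial>P) = (\<integral>h. \<bar>u \<bullet> ext_act (stab_mult h h0) ?v\<bar> \<partial>P)"
      by (intro Bochner_Integration.integral_cong) auto
    also have "\<dots> = (\<integral>h. \<bar>u \<bullet> ext_act h ?v\<bar> \<partial>distr P P (\<lambda>x. stab_mult x h0))"
      by (rule integral_distr[symmetric, OF stab_mult_measurable(2)[OF uniform_stab_sets[OF P] h0(1)]])
        (intro uniform_stab_borel[OF P] continuous_on_rabs continuous_on_inner continuous_on_const continuous_on_ext_act)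
    finally show ?thesis unfolding c_def uniform_stab_right[OF P h0(1)] .
  qed
  have "AE z in U \<Otimes>\<^sub>M C. fst z \<in> ?Y"
  proof -
    interpret UC': pair_sigma_finite U C by unfold_locales
    have "AE y in U. y \<in> ?Y" unfolding U_def
      by (rule AE_uniform_measureI) (auto simp: sets_gr_volume[OF V] Y)
    moreover have "{z \<in> space (U \<Otimes>\<^sub>M C). fst z \<in> ?Y} \<in> sets (U \<Otimes>\<^sub>M C)"
    proof -
      have "fst -` ?Y \<inter> space (U \<Otimes>\<^sub>M C) \<in> sets (U \<Otimes>\<^sub>M C)" by (rule measurable_sets[OF measurable_fst]) (simp add: sU Y)
      moreover have "fst -` ?Y \<inter> space (U \<Otimes>\<^sub>M C) = {z \<in> space (U \<Otimes>\<^sub>M C). fst z \<in> ?Y}" by auto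
      ultimately show ?thesis by simp
    qed
    ultimately show ?thesis by (intro UC'.AE_pair_measure) auto
  qed
  then have AE: "AE z in U \<Otimes>\<^sub>M C. (\<integral>h. G (h, z) \<partial>P) = c" by (rule AE_mp) (intro AE_I2 impI inner)
  have int': "integrable (P \<Otimes>\<^sub>M (U \<Otimes>\<^sub>M C)) (case_prod (\<lambda>h z. G (h, z)))" using int by (simp add: S_def)
  \<comment> \<open>Fubini with \<open>h\<close> as the inner variable, so that the point of the
    cell is fixed when right invariance is applied.\<close>
  have "(\<integral>x. G x \<partial>S) = (\<integral>z. (\<integral>h. G (h, z) \<partial>P) \<partial>(U \<Otimes>\<^sub>M C))"
    using A.integral_snd[OF int'] by (simp add: S_def)
  also have "\<dots> = (\<integral>z. c \<partial>(U \<Otimes>\<^sub>M C))"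
    using A.integrable_snd[OF int'] by (intro integral_cong_AE AE) auto
  also have "\<dots> = c" by (simp add: UC.prob_space)
  finally show ?thesis unfolding G_def S_def schubert_space_def U_def C_def c_def .
qed

theorem theorem8p9:
  fixes V :: "nat \<Rightarrow> (real ^ ('k::finite + 'm::finite)) set"
    and l :: "nat \<Rightarrow> nat"
    and P :: "((real ^ 'k ^ 'k) \<times> (real ^ 'm ^ 'm)) measure"
    and \<tau> :: "(real ^ ('k + 'm)) set \<Rightarrow> real ^ ('k + 'm) ^ ('k + 'm)"
    and e :: "nat \<Rightarrow> real ^ 'k"
    and f :: "nat \<Rightarrow> real ^ 'm"
  assumes "complete_flag V"
    and "young_diagram CARD('k) CARD('m) l"
    and "uniform_stab P"
    and "transporter \<tau>"
    and "orthonormal_basis e"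
    and "orthonormal_basis f"
  shows "cohomogeneous (schubert_smooth V l) \<and>
    schubert_zonoid P \<tau> V l =
      (\<lambda>x. vol_ratio V l *\<^sub>R x) ` zonoid P (\<lambda>h. ext_act h (schubert_vector e f l)) \<and>
    span (schubert_zonoid P \<tau> V l) =
      span ((\<lambda>h. ext_act h (schubert_vector e f l)) ` stab)"
proof -
  let ?\<xi> = "\<lambda>h. ext_act h (schubert_vector e f l)" and ?c = "vol_ratio V l"
  \<comment> \<open>A zonoid depends on its random vector only through the integrals of
    \<open>\<bar>u \<bullet> \<xi>\<bar>\<close>, so equal integrals give equal zonoids by
    definition, even over different probability spaces.\<close>
  have sz: "schubert_zonoid P \<tau> V l = (\<lambda>x. ?c *\<^sub>R x) ` zonoid P ?\<xi>"
    unfolding schubert_zonoid_def zonoid_def schubert_integral[OF assms] ..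
  have n: "norm (?\<xi> h) \<le> 1" if "h \<in> space P" for h
    using map_tensor_box_list_orthonormal(3)[OF assms(5,6,2)] that by (simp add: uniform_stab_space[OF assms(3)])
  have m: "?\<xi> \<in> borel_measurable P" by (rule uniform_stab_borel[OF assms(3) continuous_on_ext_act])
  have "span ((\<lambda>x. ?c *\<^sub>R x) ` zonoid P ?\<xi>) = span (?\<xi> ` stab)"
  proof (rule span_eqI_orthogonal)
    fix u
    let ?q = "\<lambda>h. u \<bullet> ?\<xi> h"
    \<comment> \<open>The volume ratio is nonzero, so scaling by it does not affect orthogonality;
      this is where the volumes must be positive and finite.\<close>
    have "(\<forall>a\<in>(\<lambda>x. ?c *\<^sub>R x) ` zonoid P ?\<xi>. u \<bullet> a = 0) \<longleftrightarrow> (\<forall>x\<in>zonoid P ?\<xi>. u \<bullet> x = 0)"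
      using vol_ratio_pos[OF assms(1,2)] by simp
    also have "\<dots> \<longleftrightarrow> (\<integral>h. \<bar>?q h\<bar> \<partial>P) = 0"
      by (rule zonoid_orthogonal_iff[OF uniform_stab_prob[OF assms(3)] m n])
    also have "\<dots> \<longleftrightarrow> (\<forall>h\<in>stab. ?q h = 0)"
    proof
      assume i: "(\<integral>h. \<bar>?q h\<bar> \<partial>P) = 0"
      have c: "continuous_on UNIV ?q" by (intro continuous_on_inner continuous_on_const continuous_on_ext_act)
      have b: "\<bar>?q h\<bar> \<le> norm u" if "h \<in> stab" for h
        using Cauchy_Schwarz_ineq2[of u "?\<xi> h"] map_tensor_box_list_orthonormal(3)[OF assms(5,6,2) that] by simp
      show "\<forall>h\<in>stab. ?q h = 0" using uniform_stab_integral_zero[OF assms(3) c i b] by blast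
    next
      assume "\<forall>h\<in>stab. ?q h = 0"
      then have "(\<integral>h. \<bar>?q h\<bar> \<partial>P) = (\<integral>h. 0 \<partial>P)"
        by (intro Bochner_Integration.integral_cong) (auto simp: uniform_stab_space[OF assms(3)])
      then show "(\<integral>h. \<bar>?q h\<bar> \<partial>P) = 0" by simp
    qed
    finally show "(\<forall>a\<in>(\<lambda>x. ?c *\<^sub>R x) ` zonoid P ?\<xi>. u \<bullet> a = 0) \<longleftrightarrow> (\<forall>b\<in>?\<xi> ` stab. u \<bullet> b = 0)" by simp
  qed
  then show ?thesis using grass_frame.cohomogeneous_schubert_smooth[OF grass_frame_inl_inr[OF assms(5,6)] assms(1,2)] sz by simp
qed

end
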